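(* Let $N\in\mathbb{N}$, $s\in(0,\min\{N/2,1\})$, $\lambda<\Lambda_{N,s}$ and $q>1$. Then there exists a radial potential $\mathscr{V}\in C^{1,\alpha}_{\mathrm{loc}}(B_1\setminus\{0\})\cap L^q(B_1)$, for some $\alpha\in(0,1)$, satisfying $$|\mathscr{V}(x)|+|x\cdot\nabla\mathscr{V}(x)|\le C_{\mathscr{V}}|x|^{-2s+\varepsilon}\quad\text{as }|x|\to0,\ \text{for some } C_{\mathscr{V}}>0,\ \varepsilon>0,$$ with $\mathscr{V}>0$ in $B_1\setminus\{0\}$, and such that the equation $$(-\Delta)^s u-\frac{\lambda}{|x|^{2s}}u=\mathscr{V}u\quad\text{in }B_1$$ admits a nontrivial radial weak solution $u\in\mathcal{D}^{s,2}_{\mathrm{rad}}(\mathbb{R}^N)$ satisfying $$\lim_{|x|\to0}|x|^{-\gamma_\lambda}u(x)=0.$$ Moreover, $u\equiv0$ in $\mathbb{R}^N\setminus B_R$ for some $R\ge1$, and $u\not\equiv0$ in $\Omega$ for every non-empty open set $\Omega\subseteq B_R$.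
   Context: $B_r=\{x\in\mathbb{R}^N:|x|<r\}$. $\mathcal{D}^{s,2}(\mathbb{R}^N)$ is the completion of $C_c^\infty(\mathbb{R}^N)$ with respect to the norm induced by the scalar product $(u,v)_{\mathcal{D}^{s,2}}=\frac{C_{N,s}}{2}\int_{\mathbb{R}^{2N}}\frac{(u(x)-u(y))(v(x)-v(y))}{|x-y|^{N+2s}}\,dx\,dy$, where $C_{N,s}=2^{2s}\pi^{-N/2}\Gamma(\frac{N+2s}{2})/|\Gamma(-s)|$; $\mathcal{D}^{s,2}_{\mathrm{rad}}(\mathbb{R}^N)$ is its subspace of radial functions. $\Lambda_{N,s}=2^{2s}\big(\Gamma(\frac{N+2s}{4})/\Gamma(\frac{N-2s}{4})\big)^2$ is the optimal fractional Hardy constant. A radial weak solution of the equation is $u\in\mathcal{D}^{s,2}_{\mathrm{rad}}(\mathbb{R}^N)$ with $(u,\varphi)_{\mathcal{D}^{s,2}}-\lambda\int_{\mathbb{R}^N}\frac{u\varphi}{|x|^{2s}}dx=\int_{\mathbb{R}^N}\mathscr{V}u\varphi\,dx$ for all $\varphi\in C_c^\infty(B_1)$. Definition of $\gamma_\lambda$: let $\mathbb{S}^N_+=\{\theta=(\theta',\theta_{N+1})\in\mathbb{S}^N:\theta_{N+1}>0\}$, $H^1(\mathbb{S}^N_+;\theta_{N+1}^{1-2s})$ the space of $v\in L^1_{\mathrm{loc}}(\mathbb{S}^N_+)$ with $\int_{\mathbb{S}^N_+}\theta_{N+1}^{1-2s}(|\nabla_{\mathbb{S}^N}v|^2+v^2)\,dS<\infty$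 (these functions have traces in $L^2(\partial\mathbb{S}^N_+)$), $\kappa_s=\frac{\Gamma(1-s)}{2^{2s-1}\Gamma(s)}$, and $$\mu_1^s(\lambda)=\min_{\phi\in H^1(\mathbb{S}^N_+;\theta_{N+1}^{1-2s})\setminus\{0\}}\frac{\int_{\mathbb{S}^N_+}\theta_{N+1}^{1-2s}|\nabla_{\mathbb{S}^N}\phi|^2dS-\kappa_s\lambda\int_{\partial\mathbb{S}^N_+}\phi^2\,d\theta'}{\int_{\mathbb{S}^N_+}\theta_{N+1}^{1-2s}\phi^2\,dS}.$$ Then $\gamma_\lambda=-\frac{N-2s}{2}+\sqrt{\left(\frac{N-2s}{2}\right)^2+\mu_1^s(\lambda)}$. *)

theory Defs
  imports "HOL-Analysis.Analysis"
begin

fun Ck :: "nat \<Rightarrow> ('a::euclidean_space \<Rightarrow> real) \<Rightarrow> bool" where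
  "Ck 0 f = continuous_on UNIV f"
| "Ck (Suc k) f = (\<exists>Df :: 'a \<Rightarrow> 'a \<Rightarrow> real.
      (\<forall>x. (f has_derivative (\<lambda>h. \<Sum>i\<in>Basis. (h \<bullet> i) * Df i x)) (at x)) \<and>
      (\<forall>i\<in>Basis. Ck k (Df i)))"

definition smooth_fun :: "('a::euclidean_space \<Rightarrow> real) \<Rightarrow> bool" where
  "smooth_fun f \<longleftrightarrow> (\<forall>k. Ck k f)"

definition test_fun :: "'a::euclidean_space set \<Rightarrow> ('a \<Rightarrow> real) \<Rightarrow> bool" where
  "test_fun U f \<longleftrightarrow> smooth_fun f \<and> compact (closure {x. f x \<noteq> 0}) \<and>
      closure {x. f x \<noteq> 0} \<subseteq> U"

definition radial :: "('a::real_normed_vector \<Rightarrow> real) \<Rightarrow> bool" where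
  "radial f \<longleftrightarrow> (\<forall>x y. norm x = norm y \<longrightarrow> f x = f y)"

definition C_Ns :: "nat \<Rightarrow> real \<Rightarrow> real" where
  "C_Ns N s = 2 powr (2 * s) * pi powr (- real N / 2) * Gamma ((real N + 2 * s)/2) / abs (Gamma (- s))"

definition Lambda_Ns :: "nat \<Rightarrow> real \<Rightarrow> real" where
  "Lambda_Ns N s = 2 powr (2 * s) * (Gamma ((real N + 2 * s)/4) / Gamma ((real N - 2 * s)/4))^2"

definition kappa_s :: "real \<Rightarrow> real" where
  "kappa_s s = Gamma (1 - s) / (2 powr (2 * s - 1) * Gamma s)"

definition gag :: "real \<Rightarrow> (real^'n \<Rightarrow> real) \<Rightarrow> ennreal" where
  "gag s u = (\<integral>\<^sup>+ z. ennreal ((u (fst z) - u (snd z))^2 /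
                   norm (fst z - snd z) powr (real CARD('n) + 2 * s)) \<partial>(lborel :: ((real^'n) \<times> (real^'n)) measure))"

text \<open>Concrete realisation of the completion of C_c^infinity w.r.t. the D^{s,2} norm:
  u is the a.e. limit of a sequence of test functions converging to u in that norm.\<close>
definition Ds2 :: "real \<Rightarrow> (real^'n \<Rightarrow> real) set" where
  "Ds2 s = {u. u \<in> borel_measurable lborel \<and>
      (\<exists>\<phi>. (\<forall>k. test_fun UNIV (\<phi> k)) \<and>
           ((\<lambda>k. gag s (\<lambda>x. u x - \<phi> k x)) \<longlonglongrightarrow> 0) \<and>
           (AE x in lborel. (\<lambda>k. \<phi> k x) \<longlonglongrightarrow> u x))}"

definition Ds2_rad :: "real \<Rightarrow> (real^'n \<Rightarrow> real) set" where
  "Ds2_rad s = {u \<in> Ds2 s. radial u}"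

definition Ds2_inner :: "real \<Rightarrow> (real^'n \<Rightarrow> real) \<Rightarrow> (real^'n \<Rightarrow> real) \<Rightarrow> real" where
  "Ds2_inner s u v = C_Ns CARD('n) s / 2 *
     (\<integral> z. (u (fst z) - u (snd z)) * (v (fst z) - v (snd z)) /
            norm (fst z - snd z) powr (real CARD('n) + 2 * s) \<partial>(lborel :: ((real^'n) \<times> (real^'n)) measure))"

definition radial_weak_solution ::
    "real \<Rightarrow> real \<Rightarrow> (real^'n \<Rightarrow> real) \<Rightarrow> (real^'n \<Rightarrow> real) \<Rightarrow> bool" where
  "radial_weak_solution s lam V u \<longleftrightarrow> u \<in> Ds2_rad s \<and>
     (\<forall>\<phi>. test_fun (ball 0 1) \<phi> \<longrightarrow>
        Ds2_inner s u \<phi> - lam * (\<integral> x. u x * \<phi> x / norm x powr (2 * s) \<partial>lborel)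
        = (\<integral> x. V x * u x * \<phi> x \<partial>lborel))"

text \<open>Integral over a subset A of the unit sphere of a Euclidean space of dimension d
  w.r.t. surface measure, via the cone formula: d times the integral over the cone
  {x : 0 < |x| < 1, x/|x| in A} of f(x/|x|).\<close>
definition sphere_integral :: "'a::euclidean_space set \<Rightarrow> ('a \<Rightarrow> real) \<Rightarrow> real" where
  "sphere_integral A f = real DIM('a) *
     (LINT x : {x. 0 < norm x \<and> norm x < 1 \<and> x /\<^sub>R norm x \<in> A} | lborel. f (x /\<^sub>R norm x))"

definition half_sphere :: "((real^'n) \<times> real) set" where
  "half_sphere = {\<theta>. norm \<theta> = 1 \<and> snd \<theta> > 0}"

text \<open>Rayleigh quotient on S^N_+ (in R^{N+1} = R^N x R) for a C^1 function Phi with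
  continuous gradient G; the spherical gradient is the tangential part of G.
  The boundary of S^N_+ is identified with the unit sphere S^{N-1} of R^N via theta' -> (theta',0).\<close>
definition rayleigh :: "real \<Rightarrow> real \<Rightarrow> ((real^'n) \<times> real \<Rightarrow> real) \<Rightarrow> ((real^'n) \<times> real \<Rightarrow> (real^'n) \<times> real) \<Rightarrow> real" where
  "rayleigh s lam \<Phi> G =
     (sphere_integral (half_sphere :: ((real^'n) \<times> real) set)
        (\<lambda>\<theta>. snd \<theta> powr (1 - 2 * s) * (norm (G \<theta> - (G \<theta> \<bullet> \<theta>) *\<^sub>R \<theta>))^2)
      - kappa_s s * lam * sphere_integral (sphere (0::real^'n) 1) (\<lambda>\<theta>'. (\<Phi> (\<theta>', 0))^2))
     / sphere_integral (half_sphere :: ((real^'n) \<times> real) set) (\<lambda>\<theta>. snd \<theta> powr (1 - 2 * s) * (\<Phi> \<theta>)^2)"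

definition mu1 :: "'n::finite itself \<Rightarrow> real \<Rightarrow> real \<Rightarrow> real" where
  "mu1 _ s lam = Inf {rayleigh s lam \<Phi> G | (\<Phi> :: (real^'n) \<times> real \<Rightarrow> real) G.
       continuous_on UNIV G \<and> (\<forall>x. (\<Phi> has_derivative (\<lambda>h. G x \<bullet> h)) (at x)) \<and>
       sphere_integral (half_sphere :: ((real^'n) \<times> real) set) (\<lambda>\<theta>. snd \<theta> powr (1 - 2 * s) * (\<Phi> \<theta>)^2) \<noteq> 0}"

definition gamma_lam :: "'n::finite itself \<Rightarrow> real \<Rightarrow> real \<Rightarrow> real" where
  "gamma_lam T s lam = - (real CARD('n) - 2 * s)/2 +
      sqrt (((real CARD('n) - 2 * s)/2)^2 + mu1 T s lam)"

definition C1alpha_loc_grad :: "real \<Rightarrow> 'a::euclidean_space set \<Rightarrow> ('a \<Rightarrow> real) \<Rightarrow> ('a \<Rightarrow> 'a) \<Rightarrow> bool" where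
  "C1alpha_loc_grad \<alpha> U V G \<longleftrightarrow>
     (\<forall>x\<in>U. (V has_derivative (\<lambda>h. G x \<bullet> h)) (at x)) \<and>
     (\<forall>K. compact K \<and> K \<subseteq> U \<longrightarrow>
        (\<exists>C. \<forall>x\<in>K. \<forall>y\<in>K. norm (G x - G y) \<le> C * norm (x - y) powr \<alpha>))"

end

theory Submission
  imports Defs
begin

text \<open>
  For \<open>2s < g < 2s + 2\<close> the renormalised fractional Laplacian of \<open>|x|^g\<close> is \<open>C a(g) |x|^(g-2s)\<close> with
  \<open>C = C_{N,s}\<close>, and \<open>a(g)\<close> takes every real value, so some \<open>g\<close> has \<open>C a(g) = \<lambda>\<close>.
  Let \<open>u\<close> be radial with compact support, \<open>u = |x|^g\<close> near the closed unit ball and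
  \<open>\<integral> u |y|^(-N-2s) dy = 0\<close>. The moment condition removes the renormalisation, and on the unit ball
  \<open>(-\<Delta>)^s u = \<lambda> |x|^(g-2s) + C f(|x|)\<close>, so that \<open>u\<close> solves the equation with \<open>V = C f(|x|) |x|^(-g)\<close>.
  Here \<open>f\<close> depends only on the modification of \<open>|x|^g\<close> far from the origin; adding bumps supported in an
  annulus one arranges the moment condition and \<open>f(r) = \<theta> r^4 + O(r^5)\<close> with \<open>\<theta> > 0\<close>, and a
  dilation makes \<open>f\<close> positive on all of \<open>(0,1)\<close>.

  Since \<open>u = |x|^g\<close> near the origin, the limit is a matter of \<open>\<gamma> < g\<close>. If \<open>\<lambda> > 0\<close>, the constant
  test function gives \<open>\<gamma> \<le> 0\<close>. If \<open>\<lambda> \<le> 0\<close>, then \<open>g \<ge> 2\<close>, and the square of the last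
  coordinate as a test function gives \<open>\<gamma> < 2\<close>.
\<close>

section \<open>Lebesgue measure and powers of the norm\<close>

text \<open>An r^2 term in f would give V the size |x|^(2-g), which for g > 2 is unbounded and fails
  to lie in L^q once q is large; it has to be cancelled. With f of order r^4, V has size |x|^(4-g),
  which is bounded since g < 4, and its sign near the origin is that of \<theta>. The coefficients
  can be prescribed because f is affine in the modification: a bump B added to u changes f by minus
  the integrated second difference of B, and moving that difference onto |y|^(-N-2s) yields Taylor
  coefficients that are positive multiples of the integrals of B |y|^(-N-2s-2k), k = 1, 2. The
  moment condition is the case k = 0. Three numbers are therefore to be hit, and bumps with three
  parameters can hit them. The expansion controls the sign of f only near 0; the dilation L^g u(x/L)
  leaves |x|^g unchanged and replaces f(r) by a multiple of f(r/L), so that (0,1) is seen through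
  (0,1/L). For \<gamma> < g, upper bounds on \<mu>_1 come from test functions; that the Rayleigh
  quotients are bounded below is a trace inequality.\<close>

definition leb_preserving :: "('a::euclidean_space \<Rightarrow> 'a) \<Rightarrow> bool" where
  "leb_preserving T \<longleftrightarrow> T \<in> borel_measurable borel \<and> distr lborel borel T = lborel"

lemma leb_preserving_nn_integral:
  fixes f :: "'a::euclidean_space \<Rightarrow> ennreal"
  assumes "leb_preserving T" "f \<in> borel_measurable borel"
  shows "(\<integral>\<^sup>+x. f (T x) \<partial>lborel) = (\<integral>\<^sup>+x. f x \<partial>lborel)"
proof -
  have "(\<integral>\<^sup>+x. f x \<partial>lborel) = (\<integral>\<^sup>+x. f x \<partial>distr lborel borel T)"
    using assms by (simp add: leb_preserving_def)
  also have "\<dots> = (\<integral>\<^sup>+x. f (T x) \<partial>lborel)"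
    using assms by (intro nn_integral_distr) (auto simp: leb_preserving_def)
  finally show ?thesis ..
qed

lemma leb_preserving_integral:
  fixes f :: "'a::euclidean_space \<Rightarrow> real"
  assumes "leb_preserving T" "f \<in> borel_measurable borel"
  shows "(\<integral>x. f (T x) \<partial>lborel) = (\<integral>x. f x \<partial>lborel)"
proof -
  have "(\<integral>x. f x \<partial>lborel) = (\<integral>x. f x \<partial>distr lborel borel T)"
    using assms by (simp add: leb_preserving_def)
  also have "\<dots> = (\<integral>x. f (T x) \<partial>lborel)"
    using assms by (intro integral_distr) (auto simp: leb_preserving_def)
  finally show ?thesis ..
qed

lemma leb_preserving_integrable:
  fixes f :: "'a::euclidean_space \<Rightarrow> real"
  assumes "leb_preserving T" "f \<in> borel_measurable borel"
  shows "integrable lborel (\<lambda>x. f (T x)) \<longleftrightarrow> integrable lborel f"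
proof -
  have "integrable lborel f \<longleftrightarrow> integrable (distr lborel borel T) f"
    using assms by (simp add: leb_preserving_def)
  also have "\<dots> \<longleftrightarrow> integrable lborel (\<lambda>x. f (T x))"
    using assms by (intro integrable_distr_eq) (auto simp: leb_preserving_def)
  finally show ?thesis ..
qed

lemma leb_preserving_plus: "leb_preserving (\<lambda>x. x + a)"
  using lborel_distr_plus[of a] by (simp add: leb_preserving_def add.commute[of _ a])

lemma leb_preserving_reflect: "leb_preserving (\<lambda>x. a - x)"
  using lborel_affine[of "-1" a, symmetric] by (simp add: leb_preserving_def density_1)

text \<open>On each fibre this is a translation, so Tonelli reduces it to
  \<open>leb_preserving_plus\<close>. It turns double integrals in (x, y) into integrals in (x, z)
  with y = x + z, where a kernel in y - x depends on one variable only.\<close>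

lemma leb_preserving_shear:
  "leb_preserving (\<lambda>w::'a::euclidean_space \<times> 'a. (fst w, fst w + snd w))"
proof -
  have meas: "(\<lambda>w::'a \<times> 'a. (fst w, fst w + snd w)) \<in> borel_measurable borel"
    by (auto intro!: borel_measurable_continuous_onI continuous_intros)
  have "distr lborel borel (\<lambda>w::'a \<times> 'a. (fst w, fst w + snd w)) = lborel"
  proof (rule measure_eqI)
    fix A assume "A \<in> sets (distr lborel borel (\<lambda>w::'a \<times> 'a. (fst w, fst w + snd w)))"
    then have A[measurable]: "A \<in> sets borel" by simp
    have A2: "A \<in> sets (borel \<Otimes>\<^sub>M borel)" by (subst borel_prod) (rule A)
    have "emeasure (distr lborel borel (\<lambda>w::'a \<times> 'a. (fst w, fst w + snd w))) A
        = (\<integral>\<^sup>+w. indicator A w \<partial>distr lborel borel (\<lambda>w::'a \<times> 'a. (fst w, fst w + snd w)))"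
      by simp
    also have "\<dots> = (\<integral>\<^sup>+w. indicator A (fst w, fst w + snd w) \<partial>lborel)"
      using meas by (subst nn_integral_distr) auto
    also have "\<dots> = (\<integral>\<^sup>+w. indicator A (fst w, fst w + snd w) \<partial>(lborel \<Otimes>\<^sub>M lborel))"
      by (simp add: lborel_prod)
    also have "\<dots> = (\<integral>\<^sup>+x. \<integral>\<^sup>+z. indicator A (x, x + z) \<partial>lborel \<partial>lborel)"
      using meas A by (subst lborel.nn_integral_fst[symmetric]) (simp_all add: lborel_prod)
    also have "\<dots> = (\<integral>\<^sup>+x. \<integral>\<^sup>+y. indicator A (x, y) \<partial>lborel \<partial>lborel)"
    proof (rule nn_integral_cong)
      fix x :: 'a
      have "(\<lambda>y. indicator A (x, y) :: ennreal) \<in> borel_measurable borel"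
        using A2 by measurable
      then show "(\<integral>\<^sup>+z. indicator A (x, x + z) \<partial>lborel) = (\<integral>\<^sup>+y. (indicator A (x, y)::ennreal) \<partial>lborel)"
        using leb_preserving_nn_integral[OF leb_preserving_plus[of x], of "\<lambda>y. indicator A (x, y)"]
        by (simp add: add.commute)
    qed
    also have "\<dots> = (\<integral>\<^sup>+w. indicator A w \<partial>(lborel \<Otimes>\<^sub>M lborel))"
      using A by (subst lborel.nn_integral_fst[symmetric]) (simp_all add: lborel_prod)
    also have "\<dots> = emeasure lborel A" by (simp add: lborel_prod)
    finally show "emeasure (distr lborel borel (\<lambda>w::'a \<times> 'a. (fst w, fst w + snd w))) A = emeasure lborel A" .
  qed simp
  then show ?thesis using meas by (simp add: leb_preserving_def)
qed

text \<open>The image measure is translation invariant, so Tonelli's theorem shows that it is proportional to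
  Lebesgue measure; balls give the constant.\<close>

lemma leb_preserving_linear_isometry:
  fixes f :: "'a::euclidean_space \<Rightarrow> 'a"
  assumes "linear f" "\<And>x. norm (f x) = norm x"
  shows "leb_preserving f"
proof -
  have bl: "bounded_linear f" using assms(1) by (rule linear_conv_bounded_linear[THEN iffD1])
  have inj: "inj f"
    using assms by (metis (no_types, lifting) injI linear_diff norm_eq_zero right_minus_eq)
  have surj: "surj f" using linear_injective_imp_surjective[OF assms(1) inj] by simp
  have mf[measurable]: "f \<in> borel_measurable borel"
    using bl by (intro borel_measurable_continuous_onI) (simp add: linear_continuous_on)
  define M where "M = distr lborel borel f"
  have sM[simp, measurable_cong]: "sets M = sets borel" by (simp add: M_def)
  have spM[simp]: "space M = UNIV" by (simp add: M_def)
  have ball: "emeasure M (ball 0 r) = emeasure lborel (ball (0::'a) r)" for r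
  proof -
    have "f -` ball 0 r = ball 0 r" using assms(2) by (auto simp: dist_norm)
    then show ?thesis by (simp add: M_def emeasure_distr)
  qed
  have sf: "sigma_finite_measure M"
  proof
    show "\<exists>A. countable A \<and> A \<subseteq> sets M \<and> \<Union> A = space M \<and> (\<forall>a\<in>A. emeasure M a \<noteq> \<infinity>)"
    proof (intro exI conjI ballI)
      show "countable (range (\<lambda>n::nat. ball (0::'a) (real n)))" by simp
      show "\<Union> (range (\<lambda>n::nat. ball (0::'a) (real n))) = space M"
        by (auto simp: dist_norm intro: reals_Archimedean2)
      fix a assume "a \<in> range (\<lambda>n::nat. ball (0::'a) (real n))"
      then show "emeasure M a \<noteq> \<infinity>"
        using ball emeasure_lborel_ball_finite[of "0::'a"] by (auto simp: less_top)
    qed auto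
  qed
  interpret M: sigma_finite_measure M by fact
  interpret P: pair_sigma_finite M lborel ..
  have transl: "(\<integral>\<^sup>+x. h (x + a) \<partial>M) = (\<integral>\<^sup>+x. h x \<partial>M)" if [measurable]: "h \<in> borel_measurable borel" for h a
  proof -
    obtain b where b: "f b = a" using surj by (metis surjD)
    have "(\<integral>\<^sup>+x. h (x + a) \<partial>M) = (\<integral>\<^sup>+x. h (f (x + b)) \<partial>lborel)"
      unfolding M_def by (subst nn_integral_distr) (auto simp: linear_add[OF assms(1)] b)
    also have "\<dots> = (\<integral>\<^sup>+x. h (f x) \<partial>lborel)"
      by (rule leb_preserving_nn_integral[OF leb_preserving_plus]) simp
    also have "\<dots> = (\<integral>\<^sup>+x. h x \<partial>M)"
      unfolding M_def by (subst nn_integral_distr) auto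
    finally show ?thesis .
  qed
  \<comment> \<open>Both sides are the double integral of 1_A(x) 1_B(x + y) over x (with M) and y
    (Lebesgue). Integrating in y first gives the left side; replacing x by x - y under M and then
    reflecting y gives the right side.\<close>
  have key: "emeasure M A * emeasure lborel B = emeasure M B * emeasure lborel A"
    if [measurable]: "A \<in> sets borel" "B \<in> sets borel" for A B :: "'a set"
  proof -
    have m1: "(\<lambda>(x, y). indicator A x * indicator B (x + y) :: ennreal) \<in> borel_measurable (M \<Otimes>\<^sub>M lborel)"
      by (subst measurable_cong_sets[of _ "borel \<Otimes>\<^sub>M borel"]) (auto intro!: sets_pair_measure_cong)
    have m2: "(\<lambda>(x, y). indicator A (x - y) * indicator B x :: ennreal) \<in> borel_measurable (M \<Otimes>\<^sub>M lborel)"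
      by (subst measurable_cong_sets[of _ "borel \<Otimes>\<^sub>M borel"]) (auto intro!: sets_pair_measure_cong)
    have "emeasure M A * emeasure lborel B = (\<integral>\<^sup>+x. indicator A x * emeasure lborel B \<partial>M)"
      by (subst nn_integral_multc) auto
    also have "\<dots> = (\<integral>\<^sup>+x. \<integral>\<^sup>+y. indicator A x * indicator B (x + y) \<partial>lborel \<partial>M)"
    proof (rule nn_integral_cong)
      fix x
      have "(\<integral>\<^sup>+y. indicator A x * indicator B (x + y) \<partial>lborel) = indicator A x * (\<integral>\<^sup>+y. indicator B (x + y) \<partial>lborel)"
        by (rule nn_integral_cmult) simp
      also have "(\<integral>\<^sup>+y. indicator B (x + y) \<partial>lborel) = (\<integral>\<^sup>+y. (indicator B y :: ennreal) \<partial>lborel)"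
        using leb_preserving_nn_integral[OF leb_preserving_plus[of x], of "indicator B"] by (simp add: add.commute)
      finally show "indicator A x * emeasure lborel B = (\<integral>\<^sup>+y. indicator A x * indicator B (x + y) \<partial>lborel)"
        by simp
    qed
    also have "\<dots> = (\<integral>\<^sup>+y. \<integral>\<^sup>+x. indicator A x * indicator B (x + y) \<partial>M \<partial>lborel)"
      using P.Fubini'[OF m1] by simp
    also have "\<dots> = (\<integral>\<^sup>+y. \<integral>\<^sup>+x. indicator A (x - y) * indicator B x \<partial>M \<partial>lborel)"
    proof (rule nn_integral_cong)
      fix y
      show "(\<integral>\<^sup>+x. indicator A x * indicator B (x + y) \<partial>M) = (\<integral>\<^sup>+x. (indicator A (x - y) * indicator B x ::ennreal) \<partial>M)"
        using transl[of "\<lambda>x. indicator A (x - y) * indicator B x" y] by simp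
    qed
    also have "\<dots> = (\<integral>\<^sup>+x. \<integral>\<^sup>+y. indicator A (x - y) * indicator B x \<partial>lborel \<partial>M)"
      using P.Fubini'[OF m2] by simp
    also have "\<dots> = (\<integral>\<^sup>+x. indicator B x * emeasure lborel A \<partial>M)"
    proof (rule nn_integral_cong)
      fix x
      have "(\<integral>\<^sup>+y. indicator A (x - y) * indicator B x \<partial>lborel) = (\<integral>\<^sup>+y. indicator A (x - y) \<partial>lborel) * indicator B x"
        by (rule nn_integral_multc) simp
      also have "(\<integral>\<^sup>+y. indicator A (x - y) \<partial>lborel) = (\<integral>\<^sup>+y. (indicator A y :: ennreal) \<partial>lborel)"
        using leb_preserving_nn_integral[OF leb_preserving_reflect[of x], of "indicator A"] by simp
      finally show "(\<integral>\<^sup>+y. indicator A (x - y) * indicator B x \<partial>lborel) = indicator B x * emeasure lborel A"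
        by (simp add: mult.commute)
    qed
    also have "\<dots> = emeasure M B * emeasure lborel A"
      by (subst nn_integral_multc) auto
    finally show ?thesis .
  qed
  have "M = lborel"
  proof (rule measure_eqI)
    fix B assume "B \<in> sets M"
    then have B: "B \<in> sets borel" by simp
    \<comment> \<open>The unit ball has the same finite, positive mass under both measures, so it
      can be cancelled from \<open>key\<close>.\<close>
    let ?v = "emeasure lborel (ball (0::'a) 1)"
    have v0: "?v \<noteq> 0" "?v \<noteq> top"
      using less_imp_neq[OF unit_ball_vol_pos[OF of_nat_0_le_iff], of "DIM('a)"] by (auto simp: emeasure_ball)
    have "?v * emeasure lborel B = ?v * emeasure M B"
      using key[of "ball 0 1" B] B ball[of 1] by (simp add: mult.commute)
    then show "emeasure M B = emeasure lborel B"
      using v0 by (simp add: ennreal_mult_cancel_left)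
  qed simp
  then show ?thesis by (simp add: leb_preserving_def M_def)
qed

section \<open>Dilations and polar coordinates\<close>

lemma lborel_scale:
  fixes c :: real
  assumes "c > 0"
  shows "(lborel :: 'a::euclidean_space measure) = density (distr lborel borel (\<lambda>x. c *\<^sub>R x)) (\<lambda>_. ennreal (c ^ DIM('a)))"
  using lborel_affine[of c "0::'a"] assms by simp

lemma nn_integral_scale:
  fixes f :: "'a::euclidean_space \<Rightarrow> ennreal"
  assumes "c > 0" and [measurable]: "f \<in> borel_measurable borel"
  shows "(\<integral>\<^sup>+x. f x \<partial>lborel) = ennreal (c ^ DIM('a)) * (\<integral>\<^sup>+x. f (c *\<^sub>R x) \<partial>lborel)"
  by (subst lborel_scale[OF assms(1)])
     (simp add: nn_integral_density nn_integral_distr nn_integral_cmult)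

lemma integral_scale:
  fixes f :: "'a::euclidean_space \<Rightarrow> real"
  assumes "c > 0" and [measurable]: "f \<in> borel_measurable borel"
  shows "(\<integral>x. f x \<partial>lborel) = c ^ DIM('a) * (\<integral>x. f (c *\<^sub>R x) \<partial>lborel)"
  using assms(1)
  by (subst lborel_scale[OF assms(1)])
     (simp add: integral_density integral_distr)

text \<open>Polar coordinates for radial integrands, without a surface measure: both measures are
  determined by the half lines {..a}, where the left one is the volume of a ball and the right one
  integrates the derivative of that volume.\<close>

lemma distr_norm_lborel:
  "distr lborel borel (norm :: 'a::euclidean_space \<Rightarrow> real) =
   density lborel (\<lambda>r. ennreal (unit_ball_vol (DIM('a)) * DIM('a) * r ^ (DIM('a) - 1)) * indicator {0..} r)"
    (is "?L = ?R")
proof (rule measure_eqI_generator_eq[where E = "range (\<lambda>a::real. {..a})" and \<Omega> = UNIV and A = "\<lambda>i::nat. {..real i}"])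
  show "Int_stable (range (\<lambda>a::real. {..a}))"
    by (auto simp: Int_stable_def)
  show "sets ?L = sigma_sets UNIV (range (\<lambda>a::real. {..a}))"
    by (subst borel_eq_atMost[unfolded, THEN arg_cong[where f=sets]] | simp)+
  show "sets ?R = sigma_sets UNIV (range (\<lambda>a::real. {..a}))"
    by (subst borel_eq_atMost[unfolded, THEN arg_cong[where f=sets]] | simp)+
  let ?w = "unit_ball_vol (real DIM('a))"
  have dist: "emeasure ?L {..a} = ennreal (?w * max 0 a ^ DIM('a))" for a
  proof -
    have "emeasure ?L {..a} = emeasure lborel (cball (0::'a) a)"
      by (subst emeasure_distr) (auto intro!: arg_cong[where f="emeasure lborel"] simp: dist_norm)
    also have "\<dots> = ennreal (?w * max 0 a ^ DIM('a))"
      by (cases "a \<ge> 0") (auto simp: emeasure_cball zero_power max_def)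
    finally show ?thesis .
  qed
  show "emeasure ?L X = emeasure ?R X" if XE: "X \<in> range (\<lambda>a::real. {..a})" for X
  proof -
    obtain a :: real where X: "X = {..a}" using XE by (elim imageE)
    have "emeasure ?R X = (\<integral>\<^sup>+r. ennreal (?w * DIM('a) * r ^ (DIM('a) - 1)) * indicator {0..max 0 a} r \<partial>lborel)"
    proof (cases "a \<ge> 0")
      case True
      then show ?thesis unfolding X
        by (subst emeasure_density) (auto intro!: nn_integral_cong simp: indicator_def)
    next
      case False
      \<comment> \<open>For a < 0 the interval {0..max 0 a} is the single point 0, so the two
        integrands agree only almost everywhere.\<close>
      have "AE r in lborel. r \<noteq> (0::real)" by (rule AE_lborel_singleton)
      then show ?thesis using False unfolding X
        by (subst emeasure_density) (auto intro!: nn_integral_cong_AE simp: indicator_def)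
    qed
    also have "\<dots> = ennreal (?w * (max 0 a) ^ DIM('a) - ?w * 0 ^ DIM('a))"
      by (rule nn_integral_FTC_Icc) (auto intro!: derivative_eq_intros mult_nonneg_nonneg)
    finally show ?thesis using dist[of a] X by simp
  qed
  show "emeasure ?L {..real i} \<noteq> \<infinity>" for i :: nat by (simp add: dist)
  show "(\<Union>i::nat. {..real i}) = UNIV" by (auto intro: real_arch_simple)
qed auto

lemma nn_integral_norm:
  assumes [measurable]: "h \<in> borel_measurable borel"
  shows "(\<integral>\<^sup>+x. h (norm (x::'a::euclidean_space)) \<partial>lborel) =
    (\<integral>\<^sup>+r. ennreal (unit_ball_vol (DIM('a)) * DIM('a) * r ^ (DIM('a) - 1)) * indicator {0..} r * h r \<partial>lborel)"
proof -
  have "(\<integral>\<^sup>+x. h (norm (x::'a)) \<partial>lborel) = (\<integral>\<^sup>+r. h r \<partial>distr lborel borel (norm :: 'a \<Rightarrow> real))"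
    by (subst nn_integral_distr) auto
  also have "\<dots> = (\<integral>\<^sup>+r. ennreal (unit_ball_vol (DIM('a)) * DIM('a) * r ^ (DIM('a) - 1)) * indicator {0..} r * h r \<partial>lborel)"
    unfolding distr_norm_lborel by (subst nn_integral_density) auto
  finally show ?thesis .
qed

lemma has_bochner_integral_norm_powr_cball:
  fixes d :: real
  assumes "d > 0"
  shows "has_bochner_integral lborel (\<lambda>z::'a::euclidean_space. indicator (cball 0 1) z * norm z powr (d - DIM('a)))
     (unit_ball_vol (DIM('a)) * DIM('a) / d)"
proof -
  let ?c = "unit_ball_vol (DIM('a)) * DIM('a)"
  have c: "?c \<ge> 0" by simp
  have "(\<integral>\<^sup>+z. ennreal (indicator (cball (0::'a) 1) z * norm z powr (d - DIM('a))) \<partial>lborel)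
     = (\<integral>\<^sup>+z. ennreal (indicator {..1} (norm (z::'a)) * norm z powr (d - DIM('a))) \<partial>lborel)"
    by (intro nn_integral_cong) (auto simp: indicator_def)
  also have "\<dots> = (\<integral>\<^sup>+r. ennreal (?c * r ^ (DIM('a) - 1)) * indicator {0..} r
        * ennreal (indicator {..1} r * r powr (d - DIM('a))) \<partial>lborel)"
    by (rule nn_integral_norm) simp
  also have "\<dots> = (\<integral>\<^sup>+r. ennreal ?c * ennreal (indicator {0..1} r * r powr (d - 1)) \<partial>lborel)"
  proof (rule nn_integral_cong)
    fix r :: real
    show "ennreal (?c * r ^ (DIM('a) - 1)) * indicator {0..} r * ennreal (indicator {..1} r * r powr (d - DIM('a)))
       = ennreal ?c * ennreal (indicator {0..1} r * r powr (d - 1))"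
    proof (cases "0 < r \<and> r \<le> 1")
      case True
      have "r ^ (DIM('a) - 1) * r powr (d - DIM('a)) = r powr (d - 1)"
        using True by (simp add: powr_realpow[symmetric] powr_add[symmetric] of_nat_diff)
      then show ?thesis using True c
        by (simp add: ennreal_mult[symmetric] mult.assoc)
    next
      case False
      then show ?thesis by (cases "r = 0") (auto simp: indicator_def)
    qed
  qed
  also have "\<dots> = ennreal ?c * (\<integral>\<^sup>+r. ennreal (indicator {0..1} r * r powr (d - 1)) \<partial>lborel)"
    by (rule nn_integral_cmult) simp
  also have "(\<integral>\<^sup>+r. ennreal (indicator {0..1} r * r powr (d - 1)) \<partial>lborel) = ennreal (1 / d)"
    using nn_integral_has_integral_lebesgue[of "{0..1}" "\<lambda>r. r powr (d - 1)" "1/d"]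
      has_integral_powr_from_0[of "d - 1" 1] assms by simp
  also have "ennreal ?c * ennreal (1 / d) = ennreal (?c / d)"
    using c assms by (simp add: ennreal_mult[symmetric])
  finally show ?thesis
    using c assms by (intro has_bochner_integral_nn_integral) (measurable, auto)
qed

lemma has_bochner_integral_norm_powr_outside:
  fixes d :: real
  assumes "d > 0"
  shows "has_bochner_integral lborel (\<lambda>z::'a::euclidean_space. indicator (- cball 0 1) z * norm z powr (- d - DIM('a)))
     (unit_ball_vol (DIM('a)) * DIM('a) / d)"
proof -
  let ?c = "unit_ball_vol (DIM('a)) * DIM('a)"
  have c: "?c \<ge> 0" by simp
  have "(\<integral>\<^sup>+z. ennreal (indicator (- cball (0::'a) 1) z * norm z powr (- d - DIM('a))) \<partial>lborel)
     = (\<integral>\<^sup>+z. ennreal (indicator {1<..} (norm (z::'a)) * norm z powr (- d - DIM('a))) \<partial>lborel)"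
    by (intro nn_integral_cong) (auto simp: indicator_def)
  also have "\<dots> = (\<integral>\<^sup>+r. ennreal (?c * r ^ (DIM('a) - 1)) * indicator {0..} r
        * ennreal (indicator {1<..} r * r powr (- d - DIM('a))) \<partial>lborel)"
    by (rule nn_integral_norm) simp
  also have "\<dots> = (\<integral>\<^sup>+r. ennreal ?c * ennreal (indicator {1..} r * r powr (- d - 1)) \<partial>lborel)"
  proof (rule nn_integral_cong_AE)
    have "AE r in lborel. r \<noteq> (1::real)" by (rule AE_lborel_singleton)
    then show "AE r in lborel. ennreal (?c * r ^ (DIM('a) - 1)) * indicator {0..} r * ennreal (indicator {1<..} r * r powr (- d - DIM('a)))
       = ennreal ?c * ennreal (indicator {1..} r * r powr (- d - 1))"
    proof (eventually_elim)
      fix r :: real assume "r \<noteq> 1"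
      show "ennreal (?c * r ^ (DIM('a) - 1)) * indicator {0..} r * ennreal (indicator {1<..} r * r powr (- d - DIM('a)))
         = ennreal ?c * ennreal (indicator {1..} r * r powr (- d - 1))"
      proof (cases "r > 1")
        case True
        have "r ^ (DIM('a) - 1) * r powr (- d - DIM('a)) = r powr (- d - 1)"
          using True by (simp add: powr_realpow[symmetric] powr_add[symmetric] of_nat_diff minus_diff_commute)
        then show ?thesis using True c
          by (simp add: ennreal_mult[symmetric] mult.assoc)
      qed (use \<open>r \<noteq> 1\<close> in auto)
    qed
  qed
  also have "\<dots> = ennreal ?c * (\<integral>\<^sup>+r. ennreal (indicator {1..} r * r powr (- d - 1)) \<partial>lborel)"
    by (rule nn_integral_cmult) simp
  also have "(\<integral>\<^sup>+r. ennreal (indicator {1..} r * r powr (- d - 1)) \<partial>lborel) = ennreal (1 / d)"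
  proof -
    have "((\<lambda>r. r powr (- d - 1)) has_integral - (1 powr (- d - 1 + 1)) / (- d - 1 + 1)) {1..}"
      using assms by (intro has_integral_powr_to_inf) auto
    moreover have "- (1 powr (- d - 1 + 1)) / (- d - 1 + 1) = 1 / d" by simp
    ultimately have "((\<lambda>r. r powr (- d - 1)) has_integral 1 / d) {1..}" by simp
    then show ?thesis using nn_integral_has_integral_lebesgue[of "{1..}" "\<lambda>r. r powr (- d - 1)" "1/d"] by simp
  qed
  also have "ennreal ?c * ennreal (1 / d) = ennreal (?c / d)"
    using c assms by (simp add: ennreal_mult[symmetric])
  finally show ?thesis
    using c assms by (intro has_bochner_integral_nn_integral) (measurable, auto)
qed

lemma integrable_kernel_dom:
  fixes \<alpha> \<beta> p :: real
  assumes "\<alpha> > p - DIM('a)" "\<beta> < p - DIM('a)"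
  shows "integrable lborel (\<lambda>z::'a::euclidean_space. (if norm z \<le> 1 then norm z powr \<alpha> else norm z powr \<beta>) * norm z powr (- p))"
proof -
  have "integrable lborel (\<lambda>z::'a. indicator (cball 0 1) z * norm z powr ((\<alpha> - p + DIM('a)) - DIM('a))
      + indicator (- cball 0 1) z * norm z powr (- (p - DIM('a) - \<beta>) - DIM('a)))"
    using has_bochner_integral_norm_powr_cball[of "\<alpha> - p + DIM('a)", where 'a='a]
      has_bochner_integral_norm_powr_outside[of "p - DIM('a) - \<beta>", where 'a='a] assms
    by (intro Bochner_Integration.integrable_add) (auto intro: integrable.intros)
  also have "(\<lambda>z::'a. indicator (cball 0 1) z * norm z powr ((\<alpha> - p + DIM('a)) - DIM('a))
      + indicator (- cball 0 1) z * norm z powr (- (p - DIM('a) - \<beta>) - DIM('a)))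
    = (\<lambda>z. (if norm z \<le> 1 then norm z powr \<alpha> else norm z powr \<beta>) * norm z powr (- p))"
    by (auto simp: indicator_def powr_add[symmetric])
  finally show ?thesis .
qed

text \<open>With p = N + 2s the two conditions read \<alpha> > 2s and \<beta> < 2s: decay faster
  than |z|^(2s) at the origin, growth slower than |z|^(2s) at infinity. The kernel integrals below
  are checked in this form.\<close>

lemma integrable_kernel:
  fixes f :: "'a::euclidean_space \<Rightarrow> real" and \<alpha> \<beta> p :: real
  assumes "f \<in> borel_measurable borel" "\<alpha> > p - DIM('a)" "\<beta> < p - DIM('a)"
    and "\<And>z. norm z \<le> 1 \<Longrightarrow> \<bar>f z\<bar> \<le> K * norm z powr \<alpha>"
    and "\<And>z. norm z > 1 \<Longrightarrow> \<bar>f z\<bar> \<le> K * norm z powr \<beta>"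
  shows "integrable lborel (\<lambda>z. f z * norm z powr (- p))"
proof (rule Bochner_Integration.integrable_bound)
  show "integrable lborel (\<lambda>z::'a. K * ((if norm z \<le> 1 then norm z powr \<alpha> else norm z powr \<beta>) * norm z powr (- p)))"
    using integrable_kernel_dom[OF assms(2,3)] by (rule integrable_mult_right)
  show "AE z in lborel. norm (f z * norm z powr - p)
     \<le> norm (K * ((if norm z \<le> 1 then norm z powr \<alpha> else norm z powr \<beta>) * norm z powr - p))"
  proof (rule AE_I2)
    fix z :: 'a
    have "\<bar>f z\<bar> \<le> K * (if norm z \<le> 1 then norm z powr \<alpha> else norm z powr \<beta>)"
      using assms(4,5)[of z] by auto
    then have "\<bar>f z\<bar> * norm z powr - p \<le> K * (if norm z \<le> 1 then norm z powr \<alpha> else norm z powr \<beta>) * norm z powr - p"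
      by (intro mult_right_mono) auto
    also have "\<dots> \<le> \<bar>K * (if norm z \<le> 1 then norm z powr \<alpha> else norm z powr \<beta>) * norm z powr - p\<bar>"
      by (rule abs_ge_self)
    finally show "norm (f z * norm z powr - p)
     \<le> norm (K * ((if norm z \<le> 1 then norm z powr \<alpha> else norm z powr \<beta>) * norm z powr - p))"
      by (simp add: abs_mult mult.assoc)
  qed
qed (use assms(1) in measurable)

lemma square_powr: "(a\<^sup>2) powr t = (a::real) powr (2 * t)" if "a \<ge> 0"
proof (cases "a = 0")
  case False
  then have "a\<^sup>2 = a powr 2" using that by simp
  then show ?thesis by (simp only: powr_powr)
qed simp

lemma powr_mult_square: "a powr t * a\<^sup>2 = (a::real) powr (t + 2)" if "a \<ge> 0"
proof (cases "a = 0")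
  case False
  then have "a\<^sup>2 = a powr 2" using that by simp
  then show ?thesis by (simp only: powr_add)
qed simp

lemma powr_divide_square: "a powr t / a\<^sup>2 = (a::real) powr (t - 2)" if "a > 0"
  using powr_mult_square[of a "t - 2"] that by (simp add: field_simps)

section \<open>The fractional Laplacian of a power\<close>

text \<open>The additional term \<open>norm z powr g\<close>, absent from the usual second difference, makes the integral of
  \<open>pbr g x z * norm z powr (- N - 2 s)\<close> over \<open>z\<close> converge at infinity. It is the source of the moment
  condition imposed on the solution.\<close>

definition pbr :: "real \<Rightarrow> 'a::real_normed_vector \<Rightarrow> 'a \<Rightarrow> real" where
  "pbr g x z = norm x powr g + norm z powr g - (norm (x + z) powr g + norm (x - z) powr g) / 2"

text \<open>The renormalising term makes the bracket symmetric. Bounds proved for |z| <= |x| thereby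
  transfer to |z| > |x|, so behaviour at infinity in z is read off from behaviour at the
  origin.\<close>

lemma pbr_commute: "pbr g x z = pbr g z x"
  unfolding pbr_def by (simp add: add.commute norm_minus_commute)

lemma norm_powr_eq: "norm x powr g = ((norm x)\<^sup>2) powr (g / 2)"
  by (simp add: square_powr)

lemma norm_pm_sq:
  fixes x z :: "'a::real_inner"
  shows "(norm (x + z))\<^sup>2 = (norm x)\<^sup>2 + (norm z)\<^sup>2 + 2 * (x \<bullet> z)"
    "(norm (x - z))\<^sup>2 = (norm x)\<^sup>2 + (norm z)\<^sup>2 - 2 * (x \<bullet> z)"
  by (simp_all add: power2_norm_eq_inner algebra_simps inner_commute)

section \<open>Symmetric averages of powers\<close>

lemma powr_avg_le_concave:
  fixes t A B :: real
  assumes "0 < t" "t \<le> 1" "0 < A" "\<bar>B\<bar> \<le> A"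
  shows "((A + B) powr t + (A - B) powr t) / 2 \<le> A powr t"
proof -
  define \<beta> where "\<beta> = B / A"
  have \<beta>: "\<bar>\<beta>\<bar> \<le> 1" using assms by (simp add: \<beta>_def abs_divide divide_le_eq)
  have \<beta>1: "0 \<le> 1 + \<beta>" "0 \<le> 1 - \<beta>" using \<beta> by (auto simp: abs_le_iff)
  have "A + B = A * (1 + \<beta>)" "A - B = A * (1 - \<beta>)" using assms by (auto simp: \<beta>_def field_simps)
  then have eq: "(A + B) powr t = A powr t * (1 + \<beta>) powr t" "(A - B) powr t = A powr t * (1 - \<beta>) powr t"
    using assms \<beta>1 by (simp_all only: powr_mult)
  \<comment> \<open>Weighted AM-GM against 1, that is, the tangent line of x^t at 1; the linear
    terms cancel when 1 + \<beta> and 1 - \<beta> are added.\<close>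
  have young: "x powr t \<le> 1 + t * (x - 1)" if "x \<ge> 0" for x :: real
  proof (cases "x = 0")
    case False
    have "x powr t * 1 powr (1 - t) \<le> t * x + (1 - t) * 1"
      using assms that False by (intro Youngs_inequality_0) auto
    then show ?thesis by (simp add: algebra_simps)
  qed (use assms in auto)
  have "(1 + \<beta>) powr t + (1 - \<beta>) powr t \<le> 2"
    using young[OF \<beta>1(1)] young[OF \<beta>1(2)] by (simp add: algebra_simps)
  then have "A powr t * ((1 + \<beta>) powr t + (1 - \<beta>) powr t) \<le> A powr t * 2"
    by (intro mult_left_mono) auto
  then show ?thesis unfolding eq \<beta>_def[symmetric] by (simp add: algebra_simps)
qed

text \<open>AM-GM on the two powers, written as squares a^2 and b^2: the half sum is at least a b =
  (1 - \<beta>^2)^(t/2), and a base in [0,1] with an exponent at most 1 only grows.\<close>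

lemma powr_avg_ge_concave:
  fixes t A B :: real
  assumes "0 < t" "t \<le> 1" "0 < A" "\<bar>B\<bar> \<le> A"
  shows "((A + B) powr t + (A - B) powr t) / 2 \<ge> A powr t * (1 - (B / A)\<^sup>2)"
proof -
  define \<beta> where "\<beta> = B / A"
  have \<beta>: "\<bar>\<beta>\<bar> \<le> 1" using assms by (simp add: \<beta>_def abs_divide divide_le_eq)
  have \<beta>1: "0 \<le> 1 + \<beta>" "0 \<le> 1 - \<beta>" using \<beta> by (auto simp: abs_le_iff)
  have "A + B = A * (1 + \<beta>)" "A - B = A * (1 - \<beta>)" using assms by (auto simp: \<beta>_def field_simps)
  then have eq: "(A + B) powr t = A powr t * (1 + \<beta>) powr t" "(A - B) powr t = A powr t * (1 - \<beta>) powr t"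
    using assms \<beta>1 by (simp_all only: powr_mult)
  define a b where "a = (1 + \<beta>) powr (t/2)" and "b = (1 - \<beta>) powr (t/2)"
  have sq: "(1 + \<beta>) powr t = a\<^sup>2" "(1 - \<beta>) powr t = b\<^sup>2"
    by (simp_all add: a_def b_def power2_eq_square powr_add[symmetric])
  have "0 \<le> (a - b)\<^sup>2" by simp
  then have "2 * (a * b) \<le> a\<^sup>2 + b\<^sup>2" by (simp add: power2_eq_square algebra_simps)
  moreover have "a * b = (1 - \<beta>\<^sup>2) powr (t/2)"
    using \<beta> by (simp add: a_def b_def powr_mult[symmetric] power2_eq_square algebra_simps)
  moreover have "(1 - \<beta>\<^sup>2) powr (t/2) \<ge> 1 - \<beta>\<^sup>2"
  proof -
    have "\<beta>\<^sup>2 \<le> 1" using \<beta> by (simp add: abs_square_le_1)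
    then have "(1 - \<beta>\<^sup>2) powr 1 \<le> (1 - \<beta>\<^sup>2) powr (t/2)"
      using assms powr_mono'[of "t/2" 1 "1 - \<beta>\<^sup>2"] by simp
    then show ?thesis using \<open>\<beta>\<^sup>2 \<le> 1\<close> by (cases "\<beta>\<^sup>2 = 1") auto
  qed
  ultimately have "(1 + \<beta>) powr t + (1 - \<beta>) powr t \<ge> 2 * (1 - \<beta>\<^sup>2)" unfolding sq by simp
  then have "A powr t * ((1 + \<beta>) powr t + (1 - \<beta>) powr t) \<ge> A powr t * (2 * (1 - \<beta>\<^sup>2))"
    by (intro mult_left_mono) auto
  then show ?thesis unfolding eq \<beta>_def[symmetric] by (simp add: algebra_simps)
qed

lemma powr_avg_ge_convex:
  fixes t A B :: real
  assumes "1 \<le> t" "0 < A" "\<bar>B\<bar> \<le> A"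
  shows "((A + B) powr t + (A - B) powr t) / 2 \<ge> A powr t"
proof -
  define \<beta> where "\<beta> = B / A"
  have \<beta>: "\<bar>\<beta>\<bar> \<le> 1" using assms by (simp add: \<beta>_def abs_divide divide_le_eq)
  have \<beta>1: "0 \<le> 1 + \<beta>" "0 \<le> 1 - \<beta>" using \<beta> by (auto simp: abs_le_iff)
  have "A + B = A * (1 + \<beta>)" "A - B = A * (1 - \<beta>)" using assms by (auto simp: \<beta>_def field_simps)
  then have eq: "(A + B) powr t = A powr t * (1 + \<beta>) powr t" "(A - B) powr t = A powr t * (1 - \<beta>) powr t"
    using assms \<beta>1 by (simp_all only: powr_mult)
  \<comment> \<open>Bernoulli's inequality, obtained from weighted AM-GM for x^t and 1 with weights
    1/t and 1 - 1/t.\<close>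
  have bern: "x powr t \<ge> 1 + t * (x - 1)" if "x \<ge> 0" for x :: real
  proof (cases "x = 0")
    case False
    have "(x powr t) powr (1/t) * 1 powr (1 - 1/t) \<le> 1/t * (x powr t) + (1 - 1/t) * 1"
      using assms that False by (intro Youngs_inequality_0) auto
    then have "x \<le> 1/t * (x powr t) + (1 - 1/t)"
      using assms that by (simp add: powr_powr)
    then have "t * x \<le> t * (1/t * (x powr t) + (1 - 1/t))" using assms by (intro mult_left_mono) auto
    then show ?thesis using assms by (simp add: algebra_simps)
  qed (use assms in auto)
  have "(1 + \<beta>) powr t + (1 - \<beta>) powr t \<ge> 2"
    using bern[OF \<beta>1(1)] bern[OF \<beta>1(2)] by (simp add: algebra_simps)
  then have "A powr t * ((1 + \<beta>) powr t + (1 - \<beta>) powr t) \<ge> A powr t * 2"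
    by (intro mult_left_mono) auto
  then show ?thesis unfolding eq \<beta>_def[symmetric] by (simp add: algebra_simps)
qed

text \<open>For 1 <= t <= 2 the power x^t = x^(2-t) (x^2)^(t-1) is a weighted geometric mean of x
  and x^2. The arithmetic mean is a quadratic polynomial, whose odd part cancels between 1 + \<beta>
  and 1 - \<beta>.\<close>

lemma powr_avg_le_convex:
  fixes t A B :: real
  assumes "1 \<le> t" "t \<le> 2" "0 < A" "\<bar>B\<bar> \<le> A"
  shows "((A + B) powr t + (A - B) powr t) / 2 \<le> A powr t * (1 + (B / A)\<^sup>2)"
proof -
  define \<beta> where "\<beta> = B / A"
  have \<beta>: "\<bar>\<beta>\<bar> \<le> 1" using assms by (simp add: \<beta>_def abs_divide divide_le_eq)
  have \<beta>1: "0 \<le> 1 + \<beta>" "0 \<le> 1 - \<beta>" using \<beta> by (auto simp: abs_le_iff)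
  have "A + B = A * (1 + \<beta>)" "A - B = A * (1 - \<beta>)" using assms by (auto simp: \<beta>_def field_simps)
  then have eq: "(A + B) powr t = A powr t * (1 + \<beta>) powr t" "(A - B) powr t = A powr t * (1 - \<beta>) powr t"
    using assms \<beta>1 by (simp_all only: powr_mult)
  have young: "x powr t \<le> (2 - t) * x + (t - 1) * x\<^sup>2" if "x \<ge> 0" for x :: real
  proof (cases "x = 0")
    case False
    have "x powr (2 - t) * (x\<^sup>2) powr (t - 1) \<le> (2 - t) * x + (t - 1) * x\<^sup>2"
      using assms that False by (intro Youngs_inequality_0) auto
    moreover have "(x\<^sup>2) powr (t - 1) = x powr (2 * (t - 1))"
      using that by (rule square_powr)
    ultimately show ?thesis by (simp add: powr_add[symmetric])
  qed (use assms in auto)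
  have "(1 + \<beta>) powr t + (1 - \<beta>) powr t \<le> (2 - t) * 2 + (t - 1) * (2 + 2 * \<beta>\<^sup>2)"
    using young[OF \<beta>1(1)] young[OF \<beta>1(2)] by (simp add: algebra_simps power2_eq_square)
  also have "\<dots> = 2 + 2 * ((t - 1) * \<beta>\<^sup>2)" by (simp add: algebra_simps)
  also have "(t - 1) * \<beta>\<^sup>2 \<le> 1 * \<beta>\<^sup>2" using assms by (intro mult_right_mono) auto
  finally have "(1 + \<beta>) powr t + (1 - \<beta>) powr t \<le> 2 * (1 + \<beta>\<^sup>2)" by simp
  then have "A powr t * ((1 + \<beta>) powr t + (1 - \<beta>) powr t) \<le> A powr t * (2 * (1 + \<beta>\<^sup>2))"
    by (intro mult_left_mono) auto
  then show ?thesis unfolding eq \<beta>_def[symmetric] by (simp add: algebra_simps)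
qed

lemma inner_le_sum_sq:
  fixes x z :: "'a::real_inner"
  shows "\<bar>2 * (x \<bullet> z)\<bar> \<le> (norm x)\<^sup>2 + (norm z)\<^sup>2"
proof -
  have "0 \<le> (norm (x + z))\<^sup>2" "0 \<le> (norm (x - z))\<^sup>2" by simp_all
  then show ?thesis unfolding norm_pm_sq by linarith
qed

lemma pbr_alt:
  fixes x z :: "'a::real_inner"
  shows "pbr g x z = norm x powr g + norm z powr g -
    (((norm x)\<^sup>2 + (norm z)\<^sup>2 + 2 * (x \<bullet> z)) powr (g/2) + ((norm x)\<^sup>2 + (norm z)\<^sup>2 - 2 * (x \<bullet> z)) powr (g/2)) / 2"
  unfolding pbr_def norm_powr_eq[of "x + z"] norm_powr_eq[of "x - z"] norm_pm_sq by simp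

lemma one_plus_powr_le:
  assumes "0 \<le> (x::real)" "0 \<le> t" "t \<le> 1"
  shows "(1 + x) powr t \<le> 1 + t * x"
proof (cases "t = 0")
  case False
  have "(1 + x) powr t * 1 powr (1 - t) \<le> t * (1 + x) + (1 - t) * 1"
    using assms False by (intro Youngs_inequality_0) auto
  then show ?thesis by (simp add: algebra_simps)
qed (use assms in auto)

lemma one_plus_powr_ge:
  assumes "0 \<le> (x::real)" "1 \<le> t"
  shows "(1 + x) powr t \<ge> 1 + t * x"
proof -
  have "((1 + x) powr t) powr (1/t) * 1 powr (1 - 1/t) \<le> 1/t * ((1 + x) powr t) + (1 - 1/t) * 1"
    using assms by (intro Youngs_inequality_0) auto
  then have "1 + x \<le> 1/t * ((1 + x) powr t) + (1 - 1/t)"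
    using assms by (simp add: powr_powr)
  then have "t * (1 + x) \<le> t * (1/t * ((1 + x) powr t) + (1 - 1/t))" using assms by (intro mult_left_mono) auto
  then show ?thesis using assms by (simp add: algebra_simps)
qed

lemma sum_sq_powr_le:
  fixes a b :: real
  assumes "0 < a" "0 \<le> b" "0 < g" "g \<le> 2"
  shows "(a\<^sup>2 + b\<^sup>2) powr (g/2) \<le> a powr g + g/2 * a powr (g - 2) * b\<^sup>2"
proof -
  have "a\<^sup>2 + b\<^sup>2 = a\<^sup>2 * (1 + b\<^sup>2/a\<^sup>2)" using assms by (simp add: field_simps)
  then have "(a\<^sup>2 + b\<^sup>2) powr (g/2) = (a\<^sup>2) powr (g/2) * (1 + b\<^sup>2/a\<^sup>2) powr (g/2)"
    by (simp add: powr_mult)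
  also have "\<dots> \<le> (a\<^sup>2) powr (g/2) * (1 + g/2 * (b\<^sup>2/a\<^sup>2))"
    using assms by (intro mult_left_mono one_plus_powr_le) auto
  also have "(a\<^sup>2) powr (g/2) = a powr g"
    using assms by (simp add: square_powr)
  also have "a powr g * (1 + g/2 * (b\<^sup>2/a\<^sup>2)) = a powr g + g/2 * (a powr g / a\<^sup>2) * b\<^sup>2"
    by (simp add: field_simps)
  also have "a powr g / a\<^sup>2 = a powr (g - 2)" using assms by (simp add: powr_divide_square)
  finally show ?thesis .
qed

lemma sum_sq_powr_ge:
  fixes a b :: real
  assumes "0 < a" "0 \<le> b" "2 \<le> g"
  shows "(a\<^sup>2 + b\<^sup>2) powr (g/2) \<ge> a powr g + g/2 * a powr (g - 2) * b\<^sup>2"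
proof -
  have "a\<^sup>2 + b\<^sup>2 = a\<^sup>2 * (1 + b\<^sup>2/a\<^sup>2)" using assms by (simp add: field_simps)
  then have "(a\<^sup>2 + b\<^sup>2) powr (g/2) = (a\<^sup>2) powr (g/2) * (1 + b\<^sup>2/a\<^sup>2) powr (g/2)"
    by (simp add: powr_mult)
  moreover have "\<dots> \<ge> (a\<^sup>2) powr (g/2) * (1 + g/2 * (b\<^sup>2/a\<^sup>2))"
    using assms by (intro mult_left_mono one_plus_powr_ge) auto
  moreover have "(a\<^sup>2) powr (g/2) = a powr g"
    using assms by (simp add: square_powr)
  moreover have "a powr g * (1 + g/2 * (b\<^sup>2/a\<^sup>2)) = a powr g + g/2 * (a powr g / a\<^sup>2) * b\<^sup>2"
    by (simp add: field_simps)
  moreover have "a powr g / a\<^sup>2 = a powr (g - 2)" using assms by (simp add: powr_divide_square)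
  ultimately show ?thesis by simp
qed

text \<open>|x+z|^2 and |x-z|^2 are A + B and A - B with A = |x|^2 + |z|^2 and B = 2 x.z, so the
  average inside \<open>pbr\<close> is one of powers g/2, concave in this range. Bounding A^(g/2)
  linearly in |z|^2 leaves an explicit expression.\<close>

lemma pbr_concave_lower:
  fixes x z :: "'a::real_inner"
  assumes "0 < g" "g \<le> 2" "x \<noteq> 0"
  shows "pbr g x z \<ge> norm z powr g - g/2 * norm x powr (g - 2) * (norm z)\<^sup>2"
proof -
  have A: "(norm x)\<^sup>2 + (norm z)\<^sup>2 > 0" using assms by (simp add: add_pos_nonneg)
  have "(((norm x)\<^sup>2 + (norm z)\<^sup>2 + 2 * (x \<bullet> z)) powr (g/2) + ((norm x)\<^sup>2 + (norm z)\<^sup>2 - 2 * (x \<bullet> z)) powr (g/2)) / 2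
     \<le> ((norm x)\<^sup>2 + (norm z)\<^sup>2) powr (g/2)"
    using assms A inner_le_sum_sq[of x z] by (intro powr_avg_le_concave) auto
  also have "\<dots> \<le> norm x powr g + g/2 * norm x powr (g - 2) * (norm z)\<^sup>2"
    using assms by (intro sum_sq_powr_le) auto
  finally show ?thesis unfolding pbr_alt by linarith
qed

lemma pbr_convex_upper:
  fixes x z :: "'a::real_inner"
  assumes "2 \<le> g" "x \<noteq> 0"
  shows "pbr g x z \<le> norm z powr g - g/2 * norm x powr (g - 2) * (norm z)\<^sup>2"
proof -
  have A: "(norm x)\<^sup>2 + (norm z)\<^sup>2 > 0" using assms by (simp add: add_pos_nonneg)
  have "(((norm x)\<^sup>2 + (norm z)\<^sup>2 + 2 * (x \<bullet> z)) powr (g/2) + ((norm x)\<^sup>2 + (norm z)\<^sup>2 - 2 * (x \<bullet> z)) powr (g/2)) / 2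
     \<ge> ((norm x)\<^sup>2 + (norm z)\<^sup>2) powr (g/2)"
    using assms A inner_le_sum_sq[of x z] by (intro powr_avg_ge_convex) auto
  moreover have "((norm x)\<^sup>2 + (norm z)\<^sup>2) powr (g/2) \<ge> norm x powr g + g/2 * norm x powr (g - 2) * (norm z)\<^sup>2"
    using assms by (intro sum_sq_powr_ge) auto
  ultimately show ?thesis unfolding pbr_alt by linarith
qed

text \<open>For |z| <= |x| the terms of size |x|^g cancel. What remains is |z|^g and a correction
  |x|^(g-2) |z|^2, itself at most |z|^g because g <= 2. The constant is 5 = 1 + 4, with 4 from (2
  x.z)^2 <= 4 |x|^2 |z|^2.\<close>

lemma pbr_bound_concave:
  fixes x z :: "'a::real_inner"
  assumes "0 < g" "g \<le> 2" "norm z \<le> norm x"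
  shows "\<bar>pbr g x z\<bar> \<le> 5 * norm z powr g"
proof (cases "z = 0")
  case True
  then show ?thesis by (simp add: pbr_def)
next
  case False
  then have z: "norm z > 0" and x: "norm x > 0" "x \<noteq> 0" using assms by auto
  define A where "A = (norm x)\<^sup>2 + (norm z)\<^sup>2"
  have A: "A > 0" unfolding A_def using x by (simp add: add_pos_nonneg)
  have s1: "norm x powr (g - 2) * (norm z)\<^sup>2 \<le> norm z powr g"
  proof -
    have "norm x powr (g - 2) * (norm z)\<^sup>2 \<le> norm z powr (g - 2) * (norm z)\<^sup>2"
      using assms z by (intro mult_right_mono powr_mono2') auto
    also have "\<dots> = norm z powr g" using z by (simp add: powr_mult_square)
    finally show ?thesis .
  qed
  have "g/2 * (norm x powr (g - 2) * (norm z)\<^sup>2) \<le> 1 * norm z powr g"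
    using assms s1 by (intro mult_mono) auto
  then have lower: "pbr g x z \<ge> 0"
    using pbr_concave_lower[OF assms(1,2) x(2), of z] by (simp add: mult.assoc)
  have "((A + 2 * (x \<bullet> z)) powr (g/2) + (A - 2 * (x \<bullet> z)) powr (g/2)) / 2 \<ge> A powr (g/2) * (1 - (2 * (x \<bullet> z) / A)\<^sup>2)"
    using assms A inner_le_sum_sq[of x z] by (intro powr_avg_ge_concave) (auto simp: A_def)
  moreover have "A powr (g/2) * (2 * (x \<bullet> z) / A)\<^sup>2 \<le> 4 * norm z powr g"
  proof -
    have "(x \<bullet> z)\<^sup>2 \<le> (norm x)\<^sup>2 * (norm z)\<^sup>2"
      using Cauchy_Schwarz_ineq[of x z] by (simp add: power2_norm_eq_inner)
    then have "(2 * (x \<bullet> z))\<^sup>2 \<le> 4 * (norm x)\<^sup>2 * (norm z)\<^sup>2" by (simp add: power_mult_distrib)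
    then have "A powr (g/2) * (2 * (x \<bullet> z) / A)\<^sup>2 \<le> A powr (g/2) * (4 * (norm x)\<^sup>2 * (norm z)\<^sup>2 / A\<^sup>2)"
      unfolding power_divide by (intro mult_left_mono divide_right_mono) auto
    also have "\<dots> = A powr (g/2 - 2) * (4 * (norm x)\<^sup>2 * (norm z)\<^sup>2)"
      using A powr_divide_square[OF A, of "g/2"] by (simp add: field_simps)
    also have "\<dots> \<le> ((norm x)\<^sup>2) powr (g/2 - 2) * (4 * (norm x)\<^sup>2 * (norm z)\<^sup>2)"
      using assms x by (intro mult_right_mono powr_mono2') (auto simp: A_def)
    also have "((norm x)\<^sup>2) powr (g/2 - 2) = norm x powr (g - 4)"
      by (simp add: square_powr algebra_simps)
    also have "norm x powr (g - 4) * (4 * (norm x)\<^sup>2 * (norm z)\<^sup>2) = 4 * (norm x powr (g - 4) * (norm x)\<^sup>2) * (norm z)\<^sup>2"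
      by (simp add: algebra_simps)
    also have "norm x powr (g - 4) * (norm x)\<^sup>2 = norm x powr (g - 2)"
      using x by (simp add: powr_mult_square)
    finally show ?thesis using s1 by (simp add: algebra_simps)
  qed
  moreover have "A powr (g/2) \<ge> norm x powr g"
    unfolding norm_powr_eq[of x] A_def using assms by (intro powr_mono2) auto
  moreover have "A powr (g/2) * (1 - (2 * (x \<bullet> z) / A)\<^sup>2) = A powr (g/2) - A powr (g/2) * (2 * (x \<bullet> z) / A)\<^sup>2"
    by (simp add: algebra_simps)
  ultimately have "pbr g x z \<le> 5 * norm z powr g"
    unfolding pbr_alt A_def[symmetric] by linarith
  with lower show ?thesis by simp
qed

text \<open>Now g - 2 >= 0, and |x|^(g-2) |z|^2 is the dominant term. Everything is expressed
  through t = |z|^2/|x|^2 in [0,1]; the bound g <= 4 enters as (1+t)^(g/2) <= (1+t)^2, and (1+t)^2 +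
  4t <= 1 + 7t.\<close>

lemma pbr_bound_convex:
  fixes x z :: "'a::real_inner"
  assumes "2 \<le> g" "g \<le> 4" "norm z \<le> norm x"
  shows "\<bar>pbr g x z\<bar> \<le> 8 * (norm z)\<^sup>2 * norm x powr (g - 2)"
proof (cases "z = 0")
  case True
  then show ?thesis using assms by (simp add: pbr_def)
next
  case False
  then have z: "norm z > 0" and x: "norm x > 0" "x \<noteq> 0" using assms by auto
  define A where "A = (norm x)\<^sup>2 + (norm z)\<^sup>2"
  have A: "A > 0" unfolding A_def using x by (simp add: add_pos_nonneg)
  have "norm z powr g \<le> norm x powr (g - 2) * (norm z)\<^sup>2"
  proof -
    have "norm z powr g = norm z powr (g - 2) * (norm z)\<^sup>2" using z by (simp add: powr_mult_square)
    also have "\<dots> \<le> norm x powr (g - 2) * (norm z)\<^sup>2"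
      using assms z by (intro mult_right_mono powr_mono2) auto
    finally show ?thesis .
  qed
  moreover have "1 * (norm x powr (g - 2) * (norm z)\<^sup>2) \<le> g/2 * (norm x powr (g - 2) * (norm z)\<^sup>2)"
    using assms by (intro mult_right_mono) auto
  ultimately have upper: "pbr g x z \<le> 0"
    using pbr_convex_upper[OF assms(1) x(2), of z] by (simp add: mult.assoc)
  define t where "t = (norm z)\<^sup>2 / (norm x)\<^sup>2"
  have t: "0 \<le> t" "t \<le> 1" using assms x by (auto simp: t_def power_mono)
  have At: "A = (norm x)\<^sup>2 * (1 + t)" using x by (simp add: A_def t_def field_simps)
  have A1: "A powr (g/2) = norm x powr g * (1 + t) powr (g/2)"
    unfolding At norm_powr_eq[of x] by (simp add: powr_mult)
  have A2: "(1 + t) powr (g/2) \<le> (1 + t) powr 2"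
    using t assms by (intro powr_mono) auto
  have A3: "(1 + t) powr 2 = 1 + 2 * t + t * t"
    using t by (simp add: power2_eq_square algebra_simps)
  have A4: "t * t \<le> t" using t mult_right_mono[of t 1 t] by simp
  have "((A + 2 * (x \<bullet> z)) powr (g/2) + (A - 2 * (x \<bullet> z)) powr (g/2)) / 2 \<le> A powr (g/2) * (1 + (2 * (x \<bullet> z) / A)\<^sup>2)"
    using assms A inner_le_sum_sq[of x z] by (intro powr_avg_le_convex) (auto simp: A_def)
  also have "A powr (g/2) * (1 + (2 * (x \<bullet> z) / A)\<^sup>2) \<le> A powr (g/2) * (1 + 4 * t / (1 + t)\<^sup>2)"
  proof (intro mult_left_mono add_left_mono)
    have "(x \<bullet> z)\<^sup>2 \<le> (norm x)\<^sup>2 * (norm z)\<^sup>2"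
      using Cauchy_Schwarz_ineq[of x z] by (simp add: power2_norm_eq_inner)
    then have "(2 * (x \<bullet> z))\<^sup>2 \<le> 4 * (norm x)\<^sup>2 * (norm z)\<^sup>2" by (simp add: power_mult_distrib)
    then have "(2 * (x \<bullet> z) / A)\<^sup>2 \<le> 4 * (norm x)\<^sup>2 * (norm z)\<^sup>2 / A\<^sup>2"
      unfolding power_divide by (intro divide_right_mono) auto
    also have "4 * (norm x)\<^sup>2 * (norm z)\<^sup>2 / A\<^sup>2 = 4 * t / (1 + t)\<^sup>2"
    proof -
      have zz: "(norm z)\<^sup>2 = t * (norm x)\<^sup>2" using x by (simp add: t_def)
      have "4 * (norm x)\<^sup>2 * (norm z)\<^sup>2 / A\<^sup>2 = (4 * t) * ((norm x)\<^sup>2 * (norm x)\<^sup>2) / ((1 + t)\<^sup>2 * ((norm x)\<^sup>2 * (norm x)\<^sup>2))"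
        unfolding At zz by (simp add: power2_eq_square algebra_simps)
      also have "\<dots> = 4 * t / (1 + t)\<^sup>2" using x by simp
      finally show ?thesis .
    qed
    finally show "(2 * (x \<bullet> z) / A)\<^sup>2 \<le> 4 * t / (1 + t)\<^sup>2" .
  qed simp
  also have "A powr (g/2) * (1 + 4 * t / (1 + t)\<^sup>2) = norm x powr g * ((1 + t) powr (g/2) * (1 + 4 * t / (1 + t)\<^sup>2))"
    unfolding A1 by (simp add: algebra_simps)
  also have "\<dots> \<le> norm x powr g * ((1 + t) powr 2 * (1 + 4 * t / (1 + t)\<^sup>2))"
    using A2 t by (intro mult_left_mono mult_right_mono) auto
  also have "(1 + t) powr 2 * (1 + 4 * t / (1 + t)\<^sup>2) = (1 + t) powr 2 + 4 * t"
    using t by (simp add: distrib_left)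
  also have "norm x powr g * ((1 + t) powr 2 + 4 * t) \<le> norm x powr g * (1 + 7 * t)"
    using A3 A4 by (intro mult_left_mono) auto
  also have "\<dots> = norm x powr g + 7 * (norm z)\<^sup>2 * (norm x powr g / (norm x)\<^sup>2)"
    by (simp add: t_def algebra_simps)
  also have "norm x powr g / (norm x)\<^sup>2 = norm x powr (g - 2)" using x by (simp add: powr_divide_square)
  finally have "pbr g x z \<ge> - (7 * (norm z)\<^sup>2 * norm x powr (g - 2))"
    unfolding pbr_alt A_def[symmetric] using powr_ge_zero[of "norm z" g] by linarith
  moreover have "0 \<le> (norm z)\<^sup>2 * norm x powr (g - 2)" by simp
  ultimately show ?thesis using upper by linarith
qed

lemma borel_measurable_pbr[measurable]: "(\<lambda>z::'a::euclidean_space. pbr g x z) \<in> borel_measurable borel"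
  unfolding pbr_def by measurable

lemma borel_measurable_pbr2[measurable]:
  assumes [measurable]: "f \<in> borel_measurable M" "h \<in> borel_measurable M"
  shows "(\<lambda>w. pbr g (f w :: 'a::euclidean_space) (h w)) \<in> borel_measurable M"
  unfolding pbr_def by measurable

text \<open>The bound depends on g only through g0, so it dominates all exponents in [g0, 2] at
  once; continuity of the coefficient in g rests on this. For |z| > |x| the arguments are exchanged
  by \<open>pbr_commute\<close>.\<close>

lemma pbr_dom_concave:
  fixes x z :: "'a::euclidean_space"
  assumes "0 < g0" "g0 \<le> g" "g \<le> 2" "norm x \<le> 1"
  shows "\<bar>pbr g x z\<bar> \<le> 8 * (if norm z \<le> 1 then norm z powr g0 else norm z powr 0)"
proof (cases "norm z \<le> norm x")
  case True
  have "\<bar>pbr g x z\<bar> \<le> 5 * norm z powr g" using assms True by (intro pbr_bound_concave) auto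
  also have "\<dots> \<le> 8 * norm z powr g0"
    using assms True by (intro mult_mono powr_mono') auto
  finally show ?thesis using True assms by simp
next
  case False
  have "\<bar>pbr g x z\<bar> \<le> 5 * norm x powr g"
    unfolding pbr_commute[of g x] using assms False by (intro pbr_bound_concave) auto
  also have "\<dots> \<le> 8 * (if norm z \<le> 1 then norm z powr g0 else norm z powr 0)"
  proof (cases "norm z \<le> 1")
    case True
    have "norm x powr g \<le> norm z powr g" using assms False by (intro powr_mono2) auto
    also have "\<dots> \<le> norm z powr g0" using assms True by (intro powr_mono') auto
    finally have "5 * norm x powr g \<le> 8 * norm z powr g0" using powr_ge_zero[of "norm z" g0] by linarith
    then show ?thesis using True by simp
  next
    case F: False
    have "norm x powr g \<le> 1" using assms by (intro powr_le1) auto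
    moreover have "norm z powr 0 = 1" using F by auto
    ultimately have "5 * norm x powr g \<le> 8 * norm z powr 0" by linarith
    then show ?thesis using F by (simp only: if_False)
  qed
  finally show ?thesis .
qed

lemma pbr_dom_convex:
  fixes x z :: "'a::euclidean_space"
  assumes "2 \<le> g" "g \<le> g1" "g1 \<le> 4" "norm x \<le> 1"
  shows "\<bar>pbr g x z\<bar> \<le> 8 * (if norm z \<le> 1 then norm z powr 2 else norm z powr (g1 - 2))"
proof (cases "norm z \<le> norm x")
  case True
  have "\<bar>pbr g x z\<bar> \<le> 8 * (norm z)\<^sup>2 * norm x powr (g - 2)" using assms True by (intro pbr_bound_convex) auto
  also have "\<dots> \<le> 8 * (norm z)\<^sup>2 * 1"
    using assms by (intro mult_left_mono powr_le1) auto
  finally show ?thesis using True assms by simp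
next
  case False
  have "\<bar>pbr g x z\<bar> \<le> 8 * (norm x)\<^sup>2 * norm z powr (g - 2)"
    unfolding pbr_commute[of g x] using assms False by (intro pbr_bound_convex) auto
  also have "\<dots> \<le> 8 * (if norm z \<le> 1 then norm z powr 2 else norm z powr (g1 - 2))"
  proof (cases "norm z \<le> 1")
    case True
    have "8 * (norm x)\<^sup>2 * norm z powr (g - 2) \<le> 8 * (norm z)\<^sup>2 * 1"
      using assms True False by (intro mult_mono powr_le1 power_mono) auto
    then show ?thesis using True by simp
  next
    case F: False
    have "8 * (norm x)\<^sup>2 * norm z powr (g - 2) \<le> 8 * 1 * norm z powr (g1 - 2)"
      using assms F by (intro mult_mono powr_mono power_le_one) auto
    then show ?thesis using F by simp
  qed
  finally show ?thesis .
qed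

lemma pbr_dom:
  fixes x z :: "'a::euclidean_space"
  assumes "0 < g" "g \<le> 4" "norm x \<le> 1"
  shows "\<bar>pbr g x z\<bar> \<le> 8 * (if norm z \<le> 1 then norm z powr (min g 2) else norm z powr (g - min g 2))"
  using pbr_dom_concave[of g g x z] pbr_dom_convex[of g g x z] assms by (cases "g \<le> 2") (auto simp: min_def)

text \<open>For a unit vector e, \<open>acoef s g e\<close> is the a(g) of the overview;
  \<open>acoef_radial\<close> shows that it does not depend on e.\<close>

definition acoef :: "real \<Rightarrow> real \<Rightarrow> 'a::euclidean_space \<Rightarrow> real" where
  "acoef s g x = (\<integral>z. pbr g x z * norm z powr (- (real DIM('a) + 2 * s)) \<partial>lborel)"

text \<open>The range of g is what \<open>integrable_kernel\<close> asks for: min g 2 > 2s near the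
  origin, and g - min g 2 < 2s at infinity, which for g >= 2 is g < 2s + 2.\<close>

lemma integrable_pbr:
  fixes x :: "'a::euclidean_space"
  assumes "0 < s" "s < 1" "2 * s < g" "g < 2 * s + 2" "norm x \<le> 1"
  shows "integrable lborel (\<lambda>z. pbr g x z * norm z powr (- (real DIM('a) + 2 * s)))"
proof (rule integrable_kernel[where \<alpha> = "min g 2" and \<beta> = "g - min g 2" and K = 8])
  have b: "\<bar>pbr g x z\<bar> \<le> 8 * (if norm z \<le> 1 then norm z powr (min g 2) else norm z powr (g - min g 2))" for z
    using assms by (intro pbr_dom) auto
  show "\<bar>pbr g x z\<bar> \<le> 8 * norm z powr min g 2" if "norm z \<le> 1" for z using b[of z] that by simp
  show "\<bar>pbr g x z\<bar> \<le> 8 * norm z powr (g - min g 2)" if "norm z > 1" for z using b[of z] that by simp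
qed (use assms in auto)

lemma pbr_scale:
  assumes "c > 0"
  shows "pbr g (c *\<^sub>R x) (c *\<^sub>R z) = c powr g * pbr g x z"
proof -
  have "norm (c *\<^sub>R x + c *\<^sub>R z) = c * norm (x + z)" "norm (c *\<^sub>R x - c *\<^sub>R z) = c * norm (x - z)"
    using assms by (simp_all add: scaleR_add_right[symmetric] scaleR_diff_right[symmetric])
  then show ?thesis using assms by (simp add: pbr_def powr_mult algebra_simps)
qed

text \<open>Substitute c z for z: the bracket scales by c^g, the kernel together with the volume
  element by c^(-2s).\<close>

lemma acoef_scale:
  assumes "c > 0"
  shows "acoef s g (c *\<^sub>R x :: 'a::euclidean_space) = c powr (g - 2 * s) * acoef s g x"
proof -
  have "acoef s g (c *\<^sub>R x) = c ^ DIM('a) * (\<integral>z. pbr g (c *\<^sub>R x) (c *\<^sub>R z) * norm (c *\<^sub>R z) powr (- (real DIM('a) + 2 * s)) \<partial>lborel)"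
    unfolding acoef_def by (rule integral_scale[OF assms]) measurable
  also have "\<dots> = c ^ DIM('a) * (\<integral>z. (c powr g * c powr (- (real DIM('a) + 2 * s))) * (pbr g x z * norm z powr (- (real DIM('a) + 2 * s))) \<partial>lborel)"
    using assms by (simp add: pbr_scale powr_mult algebra_simps)
  also have "\<dots> = (c ^ DIM('a) * (c powr g * c powr (- (real DIM('a) + 2 * s)))) * acoef s g x"
    unfolding acoef_def by simp
  also have "c ^ DIM('a) * (c powr g * c powr (- (real DIM('a) + 2 * s))) = c powr (g - 2 * s)"
    using assms by (simp add: powr_realpow[symmetric] powr_add[symmetric])
  finally show ?thesis .
qed

lemma acoef_rotate:
  fixes T :: "'a::euclidean_space \<Rightarrow> 'a"
  assumes "linear T" "\<And>x. norm (T x) = norm x"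
  shows "acoef s g (T x) = acoef s g x"
proof -
  have p: "pbr g (T x) (T z) = pbr g x z" for z
    unfolding pbr_def assms(2) linear_add[OF assms(1), symmetric] linear_diff[OF assms(1), symmetric] ..
  have "acoef s g (T x) = (\<integral>z. pbr g (T x) (T z) * norm (T z) powr (- (real DIM('a) + 2 * s)) \<partial>lborel)"
    unfolding acoef_def
    by (rule leb_preserving_integral[OF leb_preserving_linear_isometry[OF assms], symmetric]) measurable
  then show ?thesis by (simp add: p assms(2) acoef_def)
qed

lemma rotation_to:
  fixes x y :: "real^'n"
  assumes "norm x = norm y"
  obtains T :: "real^'n \<Rightarrow> real^'n" where "linear T" "\<And>z. norm (T z) = norm z" "T x = y"
  using orthogonal_transformation_exists[OF assms]
  by (metis orthogonal_transformation_linear orthogonal_transformation_norm)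

lemma acoef_radial:
  fixes x e :: "real^'n"
  assumes "norm e = 1" "x \<noteq> 0"
  shows "acoef s g x = norm x powr (g - 2 * s) * acoef s g e"
proof -
  obtain T :: "real^'n \<Rightarrow> real^'n" where T: "linear T" "\<And>z. norm (T z) = norm z" "T e = x /\<^sub>R norm x"
    by (rule rotation_to[of e "x /\<^sub>R norm x"]) (use assms in auto)
  have "acoef s g x = acoef s g (norm x *\<^sub>R T e)" using assms T by simp
  also have "\<dots> = norm x powr (g - 2 * s) * acoef s g (T e)" using assms by (intro acoef_scale) auto
  finally show ?thesis using acoef_rotate[OF T(1,2)] by simp
qed

text \<open>The parallelogram law. This zero is the anchor of the intermediate value argument:
  positive values are sought for g < 2, negative ones for g > 2.\<close>

lemma acoef_2: "acoef s 2 (x :: 'a::euclidean_space) = 0"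
proof -
  have "pbr 2 x z = 0" for z :: 'a
    by (simp add: pbr_def norm_pm_sq)
  then show ?thesis by (simp add: acoef_def)
qed

text \<open>On the unit ball the bracket is at least |z|^g - |z|^2, which produces the term 1/(g -
  2s), unbounded as g decreases to 2s. Outside the ball the bracket is nonnegative and is
  dropped.\<close>

lemma acoef_lower:
  fixes e :: "'a::euclidean_space"
  assumes "0 < s" "s < 1" "2 * s < g" "g < 2" "norm e = 1"
  shows "acoef s g e \<ge> unit_ball_vol DIM('a) * DIM('a) * (1 / (g - 2 * s) - 1 / (2 - 2 * s))"
proof -
  let ?c = "unit_ball_vol DIM('a) * DIM('a)"
  have e0: "e \<noteq> 0" using assms by auto
  have h1: "has_bochner_integral lborel (\<lambda>z::'a. indicator (cball 0 1) z * norm z powr ((g - 2 * s) - DIM('a))) (?c / (g - 2 * s))"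
    using assms by (intro has_bochner_integral_norm_powr_cball) auto
  have h2: "has_bochner_integral lborel (\<lambda>z::'a. indicator (cball 0 1) z * norm z powr ((2 - 2 * s) - DIM('a))) (?c / (2 - 2 * s))"
    using assms by (intro has_bochner_integral_norm_powr_cball) auto
  note h = has_bochner_integral_diff[OF h1 h2]
  have "?c / (g - 2 * s) - ?c / (2 - 2 * s) \<le> acoef s g e"
    unfolding acoef_def has_bochner_integral_integral_eq[OF h, symmetric]
  proof (rule integral_mono)
    show "integrable lborel (\<lambda>x::'a. indicator (cball 0 1) x * norm x powr (g - 2 * s - DIM('a)) - indicator (cball 0 1) x * norm x powr (2 - 2 * s - DIM('a)))"
      using h by (rule integrable.intros)
    show "integrable lborel (\<lambda>z. pbr g e z * norm z powr - (real DIM('a) + 2 * s))"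
      using assms by (intro integrable_pbr) auto
    fix z :: 'a
    show "indicator (cball 0 1) z * norm z powr (g - 2 * s - DIM('a)) - indicator (cball 0 1) z * norm z powr (2 - 2 * s - DIM('a))
      \<le> pbr g e z * norm z powr - (real DIM('a) + 2 * s)"
    proof (cases "norm z \<le> 1")
      case True
      have "g/2 * (norm z)\<^sup>2 \<le> 1 * (norm z)\<^sup>2" using assms by (intro mult_right_mono) auto
      then have "norm z powr g - norm z powr 2 \<le> pbr g e z"
        using pbr_concave_lower[OF _ _ e0, of g z] assms by auto
      then have "(norm z powr g - norm z powr 2) * norm z powr - (real DIM('a) + 2 * s) \<le> pbr g e z * norm z powr - (real DIM('a) + 2 * s)"
        by (intro mult_right_mono) auto
      also have "(norm z powr g - norm z powr 2) * norm z powr - (real DIM('a) + 2 * s)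
        = norm z powr (g - 2 * s - DIM('a)) - norm z powr (2 - 2 * s - DIM('a))"
        unfolding left_diff_distrib powr_add[symmetric] by (simp add: algebra_simps)
      finally show ?thesis using True by simp
    next
      case False
      have "norm z powr (g - 2) \<le> norm z powr 0"
        using assms False by (intro powr_mono) auto
      also have "\<dots> = 1" using False by auto
      finally have "g/2 * norm z powr (g - 2) \<le> 1 * 1"
        using assms by (intro mult_mono) auto
      moreover have "z \<noteq> 0" using False by auto
      ultimately have "pbr g e z \<ge> 0"
        unfolding pbr_commute[of g e] using pbr_concave_lower[of g z e] assms by auto
      then show ?thesis using False by simp
    qed
  qed
  then show ?thesis by (simp add: algebra_simps)
qed

text \<open>The mirror image: outside the unit ball the bracket is at most 1 - |z|^(g-2), whose
  integral tends to minus infinity as g increases to 2s + 2; inside the ball it is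
  nonpositive.\<close>

lemma acoef_upper:
  fixes e :: "'a::euclidean_space"
  assumes "0 < s" "s < 1" "2 \<le> g" "g < 2 * s + 2" "norm e = 1"
  shows "acoef s g e \<le> unit_ball_vol DIM('a) * DIM('a) * (1 / (2 * s) - 1 / (2 * s + 2 - g))"
proof -
  let ?c = "unit_ball_vol DIM('a) * DIM('a)"
  have e0: "e \<noteq> 0" using assms by auto
  have h1: "has_bochner_integral lborel (\<lambda>z::'a. indicator (- cball 0 1) z * norm z powr (- (2 * s) - DIM('a))) (?c / (2 * s))"
    using assms by (intro has_bochner_integral_norm_powr_outside) auto
  have h2: "has_bochner_integral lborel (\<lambda>z::'a. indicator (- cball 0 1) z * norm z powr (- (2 * s + 2 - g) - DIM('a))) (?c / (2 * s + 2 - g))"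
    using assms by (intro has_bochner_integral_norm_powr_outside) auto
  note h = has_bochner_integral_diff[OF h1 h2]
  have "acoef s g e \<le> ?c / (2 * s) - ?c / (2 * s + 2 - g)"
    unfolding acoef_def has_bochner_integral_integral_eq[OF h, symmetric]
  proof (rule integral_mono)
    show "integrable lborel (\<lambda>z::'a. indicator (- cball 0 1) z * norm z powr (- (2 * s) - DIM('a)) - indicator (- cball 0 1) z * norm z powr (- (2 * s + 2 - g) - DIM('a)))"
      using h by (rule integrable.intros)
    show "integrable lborel (\<lambda>z. pbr g e z * norm z powr - (real DIM('a) + 2 * s))"
      using assms by (intro integrable_pbr) auto
    fix z :: 'a
    show "pbr g e z * norm z powr - (real DIM('a) + 2 * s) \<le>
      indicator (- cball 0 1) z * norm z powr (- (2 * s) - DIM('a)) - indicator (- cball 0 1) z * norm z powr (- (2 * s + 2 - g) - DIM('a))"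
    proof (cases "norm z \<le> 1")
      case False
      have "1 * norm z powr (g - 2) \<le> g/2 * norm z powr (g - 2)"
        using assms by (intro mult_right_mono) auto
      moreover have "z \<noteq> 0" using False by auto
      then have "pbr g e z \<le> 1 - g/2 * norm z powr (g - 2)"
        unfolding pbr_commute[of g e] using pbr_convex_upper[of g z e] assms by simp
      ultimately have "pbr g e z \<le> 1 - norm z powr (g - 2)"
        by linarith
      then have "pbr g e z * norm z powr - (real DIM('a) + 2 * s) \<le> (1 - norm z powr (g - 2)) * norm z powr - (real DIM('a) + 2 * s)"
        by (intro mult_right_mono) auto
      also have "\<dots> = norm z powr (- (2 * s) - DIM('a)) - norm z powr (- (2 * s + 2 - g) - DIM('a))"
      proof -
        have "- (real DIM('a) + 2 * s) = - (2 * s) - DIM('a)" "g - 2 + - (real DIM('a) + 2 * s) = - (2 * s + 2 - g) - DIM('a)"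
          by simp_all
        then show ?thesis unfolding left_diff_distrib powr_add[symmetric] by (simp only: mult_1_left)
      qed
      finally show ?thesis using False by simp
    next
      case True
      have "1 * (norm z)\<^sup>2 \<le> g/2 * (norm z)\<^sup>2" using assms by (intro mult_right_mono) auto
      moreover have "norm z powr g \<le> norm z powr 2"
        using assms True by (intro powr_mono') auto
      ultimately have "pbr g e z \<le> 0"
        using pbr_convex_upper[OF _ e0, of g z] assms by auto
      then show ?thesis using True by (simp add: mult_nonpos_nonneg)
    qed
  qed
  then show ?thesis by (simp add: algebra_simps)
qed

lemma tendsto_powr_exponent:
  fixes x :: real
  assumes "X \<longlonglongrightarrow> g"
  shows "(\<lambda>n. x powr X n) \<longlonglongrightarrow> x powr g"
  by (cases "x = 0") (auto intro!: tendsto_intros assms)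

lemma acoef_tendsto:
  fixes e :: "'a::euclidean_space"
  assumes "\<alpha> > 2 * s" "\<beta> < 2 * s" "X \<longlonglongrightarrow> g"
    and "\<And>n z. \<bar>pbr (X n) e z\<bar> \<le> 8 * (if norm z \<le> 1 then norm z powr \<alpha> else norm z powr \<beta>)"
  shows "(\<lambda>n. acoef s (X n) e) \<longlonglongrightarrow> acoef s g e"
  unfolding acoef_def
proof (rule integral_dominated_convergence[where w = "\<lambda>z. 8 * ((if norm z \<le> 1 then norm z powr \<alpha> else norm z powr \<beta>) * norm z powr - (real DIM('a) + 2 * s))"])
  show "integrable lborel (\<lambda>z::'a. 8 * ((if norm z \<le> 1 then norm z powr \<alpha> else norm z powr \<beta>) * norm z powr - (real DIM('a) + 2 * s)))"
    using assms by (intro integrable_mult_right integrable_kernel_dom) auto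
  show "AE z in lborel. (\<lambda>n. pbr (X n) e z * norm z powr - (real DIM('a) + 2 * s)) \<longlonglongrightarrow> pbr g e z * norm z powr - (real DIM('a) + 2 * s)"
    unfolding pbr_def by (intro AE_I2 tendsto_intros tendsto_powr_exponent assms) auto
  show "AE z in lborel. norm (pbr (X n) e z * norm z powr - (real DIM('a) + 2 * s))
      \<le> 8 * ((if norm z \<le> 1 then norm z powr \<alpha> else norm z powr \<beta>) * norm z powr - (real DIM('a) + 2 * s))" for n
  proof (rule AE_I2)
    fix z :: 'a
    have "\<bar>pbr (X n) e z\<bar> * norm z powr - (real DIM('a) + 2 * s) \<le> 8 * (if norm z \<le> 1 then norm z powr \<alpha> else norm z powr \<beta>) * norm z powr - (real DIM('a) + 2 * s)"
      using assms(4) by (intro mult_right_mono) auto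
    then show "norm (pbr (X n) e z * norm z powr - (real DIM('a) + 2 * s))
      \<le> 8 * ((if norm z \<le> 1 then norm z powr \<alpha> else norm z powr \<beta>) * norm z powr - (real DIM('a) + 2 * s))"
      by (simp add: abs_mult mult.assoc)
  qed
qed measurable

text \<open>The intermediate value theorem on one side of g = 2: a(g) is arbitrarily large near 2s
  and arbitrarily negative near 2s + 2. The sign of \<open>lam\<close> decides the side, whence the
  last claim.\<close>

lemma exists_exponent:
  fixes e :: "'a::euclidean_space" and lam C :: real
  assumes s: "0 < s" "s < 1" and "norm e = 1" "C > 0"
  obtains g where "2 * s < g" "g < 2 * s + 2" "C * acoef s g e = lam" "lam \<le> 0 \<Longrightarrow> 2 \<le> g"
proof -
  define c where "c = unit_ball_vol DIM('a) * DIM('a)"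
  have c: "c > 0" using unit_ball_vol_pos[OF of_nat_0_le_iff, of "DIM('a)"] by (simp add: c_def)
  show ?thesis
  proof (cases "lam \<le> 0")
    case True
    \<comment> \<open>With g1 = 2s + 2 - 1/B the bound of \<open>acoef_upper\<close> becomes lam/C -
      c, just below the target. The summand 1 keeps g1 > 2 strictly, also for \<open>lam\<close> =
      0.\<close>
    define B where "B = - lam / (C * c) + 1 / (2 * s) + 1"
    have B: "B > 1 / (2 * s)" "B > 0"
    proof -
      have "- lam / (C * c) \<ge> 0" using True c assms by (simp add: divide_nonpos_pos)
      then show "B > 1 / (2 * s)" by (simp add: B_def)
      then show "B > 0" using s by (smt (verit) divide_pos_pos)
    qed
    define g1 where "g1 = 2 * s + 2 - 1 / B"
    have "1 / B < 2 * s" using B s by (simp add: field_simps)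
    then have g1: "2 < g1" "g1 < 2 * s + 2" using B by (auto simp: g1_def)
    have "acoef s g1 e \<le> c * (1 / (2 * s) - 1 / (2 * s + 2 - g1))"
      unfolding c_def using assms g1 by (intro acoef_upper) auto
    also have "\<dots> = c * (1 / (2 * s) - B)" by (simp add: g1_def)
    also have "\<dots> = lam / C - c" using c assms by (simp add: B_def field_simps)
    also have "\<dots> \<le> lam / C" using c by simp
    finally have low: "C * acoef s g1 e \<le> lam" using assms by (simp add: field_simps)
    have cont: "continuous_on {2..g1} (\<lambda>g. C * acoef s g e)"
    proof (intro continuous_on_mult_left continuous_on_sequentiallyI)
      fix X a assume X: "\<forall>n. X n \<in> {2..g1}" "a \<in> {2..g1}" "X \<longlonglongrightarrow> a"
      show "(\<lambda>n. acoef s (X n) e) \<longlonglongrightarrow> acoef s a e"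
      proof (rule acoef_tendsto[OF _ _ X(3)])
        show "\<bar>pbr (X n) e z\<bar> \<le> 8 * (if norm z \<le> 1 then norm z powr 2 else norm z powr (g1 - 2))" for n and z :: 'a
          using X(1) g1 assms by (intro pbr_dom_convex) auto
      qed (use g1 s in auto)
    qed
    have "\<exists>g\<ge>2. g \<le> g1 \<and> C * acoef s g e = lam"
      by (rule IVT2'[OF low _ _ cont]) (use True g1 acoef_2[of s e] in auto)
    then obtain g where "2 \<le> g" "g \<le> g1" "C * acoef s g e = lam" by blast
    then show ?thesis using that[of g] g1 s by auto
  next
    case False
    \<comment> \<open>With g1 = 2s + 1/B the bound of \<open>acoef_lower\<close> equals
      lam/C.\<close>
    define B where "B = lam / (C * c) + 1 / (2 - 2 * s)"
    have B: "B > 1 / (2 - 2 * s)" "B > 0"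
    proof -
      have "lam / (C * c) > 0" using False c assms by (simp add: divide_pos_pos)
      then show "B > 1 / (2 - 2 * s)" by (simp add: B_def)
      moreover have "1 / (2 - 2 * s) > 0" using s by simp
      ultimately show "B > 0" by linarith
    qed
    define g1 where "g1 = 2 * s + 1 / B"
    have "1 / B < 2 - 2 * s" using B s by (simp add: field_simps)
    then have g1: "2 * s < g1" "g1 < 2" using B by (auto simp: g1_def)
    have "lam / C = c * (B - 1 / (2 - 2 * s))" unfolding B_def using c assms by simp
    also have "\<dots> = c * (1 / (g1 - 2 * s) - 1 / (2 - 2 * s))" by (simp add: g1_def)
    also have "\<dots> \<le> acoef s g1 e"
      unfolding c_def using assms g1 by (intro acoef_lower) auto
    finally have up: "lam \<le> C * acoef s g1 e" using assms by (simp add: field_simps)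
    have cont: "continuous_on {g1..2} (\<lambda>g. C * acoef s g e)"
    proof (intro continuous_on_mult_left continuous_on_sequentiallyI)
      fix X a assume X: "\<forall>n. X n \<in> {g1..2}" "a \<in> {g1..2}" "X \<longlonglongrightarrow> a"
      show "(\<lambda>n. acoef s (X n) e) \<longlonglongrightarrow> acoef s a e"
      proof (rule acoef_tendsto[OF _ _ X(3)])
        show "\<bar>pbr (X n) e z\<bar> \<le> 8 * (if norm z \<le> 1 then norm z powr g1 else norm z powr 0)" for n and z :: 'a
          using X(1) g1 assms by (intro pbr_dom_concave) auto
      qed (use g1 s in auto)
    qed
    have "\<exists>g\<ge>g1. g \<le> 2 \<and> C * acoef s g e = lam"
      by (rule IVT2'[OF _ up _ cont]) (use False g1 acoef_2[of s e] in auto)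
    then obtain g where "g1 \<le> g" "g \<le> 2" "C * acoef s g e = lam" by blast
    then show ?thesis using that[of g] g1 s False by auto
  qed
qed

section \<open>Smooth functions\<close>

text \<open>Mirrors the recursion of \<open>Ck\<close> in one variable, so that a radial function
  inherits \<open>Ck\<close> from its profile through \<open>Ck_compose\<close>. The set S allows
  profiles that are singular at 0.\<close>

fun smooth_n :: "nat \<Rightarrow> real set \<Rightarrow> (real \<Rightarrow> real) \<Rightarrow> bool" where
  "smooth_n 0 S f = continuous_on S f"
| "smooth_n (Suc k) S f = (\<exists>f'. (\<forall>x\<in>S. (f has_real_derivative f' x) (at x)) \<and> smooth_n k S f')"

lemma smooth_n_cong:
  assumes "open S" "\<And>x. x \<in> S \<Longrightarrow> f x = h x" "smooth_n k S f"
  shows "smooth_n k S h"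
proof (cases k)
  case 0
  then show ?thesis using assms by (simp cong: continuous_on_cong)
next
  case (Suc k')
  then obtain f' where f': "\<forall>x\<in>S. (f has_real_derivative f' x) (at x)" "smooth_n k' S f'" using assms by auto
  have "(h has_real_derivative f' x) (at x)" if "x \<in> S" for x
    using has_field_derivative_transform_within_open[of f "f' x" x S h] f' that assms by auto
  then show ?thesis using Suc f' by auto
qed

lemma smooth_n_continuous: "smooth_n k S f \<Longrightarrow> continuous_on S f"
proof (cases k)
  case (Suc k')
  assume "smooth_n k S f"
  then obtain f' where "\<forall>x\<in>S. (f has_real_derivative f' x) (at x)" using Suc by auto
  then have "\<And>x. x \<in> S \<Longrightarrow> isCont f x" using DERIV_isCont by blast
  then show ?thesis by (simp add: continuous_at_imp_continuous_on)
qed simp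

lemma smooth_n_lower: "smooth_n (Suc k) S f \<Longrightarrow> smooth_n k S f"
proof (induction k arbitrary: f)
  case 0
  then show ?case using smooth_n_continuous by fastforce
next
  case (Suc k)
  then show ?case by (metis smooth_n.simps(2))
qed

lemma smooth_n_const: "smooth_n k S (\<lambda>x. c)"
proof (induction k arbitrary: c)
  case (Suc k)
  then show ?case by (auto intro!: exI[of _ "\<lambda>x. 0"])
qed simp

lemma smooth_n_affine: "smooth_n k S (\<lambda>x. c * x + d)"
proof (cases k)
  case (Suc k')
  then show ?thesis
    by (auto intro!: exI[of _ "\<lambda>x. c"] derivative_eq_intros smooth_n_const)
qed (auto intro!: continuous_intros)

lemma smooth_n_add: "smooth_n k S f \<Longrightarrow> smooth_n k S h \<Longrightarrow> smooth_n k S (\<lambda>x. f x + h x)"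
proof (induction k arbitrary: f h)
  case 0
  then show ?case by (auto intro!: continuous_intros)
next
  case (Suc k)
  then obtain f' h' where "\<forall>x\<in>S. (f has_real_derivative f' x) (at x)" "smooth_n k S f'"
    "\<forall>x\<in>S. (h has_real_derivative h' x) (at x)" "smooth_n k S h'" by auto
  then show ?case using Suc.IH[of f' h']
    by (auto intro!: exI[of _ "\<lambda>x. f' x + h' x"] derivative_eq_intros)
qed

lemma smooth_n_mult: "smooth_n k S f \<Longrightarrow> smooth_n k S h \<Longrightarrow> smooth_n k S (\<lambda>x. f x * h x)"
proof (induction k arbitrary: f h)
  case 0
  then show ?case by (auto intro!: continuous_intros)
next
  case (Suc k)
  then obtain f' h' where d: "\<forall>x\<in>S. (f has_real_derivative f' x) (at x)" "smooth_n k S f'"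
    "\<forall>x\<in>S. (h has_real_derivative h' x) (at x)" "smooth_n k S h'" by auto
  have "smooth_n k S f" "smooth_n k S h" using Suc.prems smooth_n_lower by auto
  then have "smooth_n k S (\<lambda>x. f' x * h x + f x * h' x)"
    using d by (intro smooth_n_add Suc.IH)
  then show ?case using d
    by (auto intro!: exI[of _ "\<lambda>x. f' x * h x + f x * h' x"] derivative_eq_intros)
qed

lemma smooth_n_cmult: "smooth_n k S f \<Longrightarrow> smooth_n k S (\<lambda>x. c * f x)"
  using smooth_n_mult[OF smooth_n_const] .

lemma smooth_n_diff: "smooth_n k S f \<Longrightarrow> smooth_n k S h \<Longrightarrow> smooth_n k S (\<lambda>x. f x - h x)"
  using smooth_n_add[of k S f "\<lambda>x. (-1) * h x"] smooth_n_cmult[of k S h "-1"] by simp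

lemma smooth_n_inverse: "smooth_n k S f \<Longrightarrow> (\<And>x. x \<in> S \<Longrightarrow> f x \<noteq> 0) \<Longrightarrow> smooth_n k S (\<lambda>x. inverse (f x))"
proof (induction k)
  case 0
  then show ?case by (auto intro!: continuous_intros)
next
  case (Suc k)
  then obtain f' where d: "\<forall>x\<in>S. (f has_real_derivative f' x) (at x)" "smooth_n k S f'" by auto
  have "smooth_n k S f" using Suc.prems smooth_n_lower by auto
  then have i: "smooth_n k S (\<lambda>x. inverse (f x))" using Suc by blast
  have "smooth_n k S (\<lambda>x. (- 1) * (f' x * (inverse (f x) * inverse (f x))))"
    using d by (intro smooth_n_cmult smooth_n_mult i)
  moreover have "((\<lambda>x. inverse (f x)) has_real_derivative (- 1) * (f' x * (inverse (f x) * inverse (f x)))) (at x)"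
    if "x \<in> S" for x
    using d that Suc.prems(2)[OF that]
    by (auto intro!: derivative_eq_intros simp: field_simps)
  ultimately show ?case
    by (intro smooth_n.simps(2)[THEN iffD2] exI[of _ "\<lambda>x. (- 1) * (f' x * (inverse (f x) * inverse (f x)))"]) blast
qed

lemma smooth_n_compose_affine:
  "smooth_n k S f \<Longrightarrow> (\<And>x. x \<in> T \<Longrightarrow> c * x + d \<in> S) \<Longrightarrow> smooth_n k T (\<lambda>x. f (c * x + d))"
proof (induction k arbitrary: f)
  case 0
  then show ?case
    by (auto intro!: continuous_on_compose2[of S f T] continuous_intros)
next
  case (Suc k)
  then obtain f' where d: "\<forall>x\<in>S. (f has_real_derivative f' x) (at x)" "smooth_n k S f'" by auto
  have "smooth_n k T (\<lambda>x. c * f' (c * x + d))" using d Suc by (intro smooth_n_cmult Suc.IH) auto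
  moreover have "((\<lambda>x. f (c * x + d)) has_real_derivative c * f' (c * x + d)) (at x)" if "x \<in> T" for x
  proof -
    have "((\<lambda>x. c * x + d) has_real_derivative c) (at x)" by (auto intro!: derivative_eq_intros)
    from DERIV_chain2[OF _ this, of f "f' (c * x + d)"] d Suc.prems that show ?thesis by (simp add: mult.commute)
  qed
  ultimately show ?case
    by (intro smooth_n.simps(2)[THEN iffD2] exI[of _ "\<lambda>x. c * f' (c * x + d)"]) blast
qed

lemma smooth_n_powr: "smooth_n k {0<..} (\<lambda>x. x powr a)"
proof (induction k arbitrary: a)
  case 0
  then show ?case by (auto intro!: continuous_intros)
next
  case (Suc k)
  have "smooth_n k {0<..} (\<lambda>x. a * x powr (a - 1))" by (intro smooth_n_cmult Suc.IH)
  then show ?case by (auto intro!: exI[of _ "\<lambda>x. a * x powr (a - 1)"] has_real_derivative_powr)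
qed

definition smooth_all :: "real set \<Rightarrow> (real \<Rightarrow> real) \<Rightarrow> bool" where
  "smooth_all S f \<longleftrightarrow> (\<forall>k. smooth_n k S f)"

text \<open>The existential derivative in \<open>smooth_n\<close> is identified with
  \<open>deriv\<close>, so that witnesses obtained on two open sets agree and can be glued in
  \<open>smooth_n_Un\<close>.\<close>

lemma smooth_n_deriv:
  assumes "smooth_n (Suc k) S f" "open S"
  shows "smooth_n k S (deriv f)" "x \<in> S \<Longrightarrow> (f has_real_derivative deriv f x) (at x)"
proof -
  obtain f' where f': "\<forall>x\<in>S. (f has_real_derivative f' x) (at x)" "smooth_n k S f'" using assms by auto
  have eq: "f' x = deriv f x" if "x \<in> S" for x using f'(1) that by (metis DERIV_imp_deriv)
  show "smooth_n k S (deriv f)" by (rule smooth_n_cong[OF assms(2) eq f'(2)])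
  show "(f has_real_derivative deriv f x) (at x)" if "x \<in> S" using f'(1) eq[OF that] that by auto
qed

lemma smooth_n_Un:
  assumes "open S" "open T"
  shows "smooth_n k S f \<Longrightarrow> smooth_n k T f \<Longrightarrow> smooth_n k (S \<union> T) f"
proof (induction k arbitrary: f)
  case 0
  then show ?case using assms by (simp add: continuous_on_open_Un)
next
  case (Suc k)
  have "smooth_n k (S \<union> T) (deriv f)"
    using Suc smooth_n_deriv assms by blast
  moreover have "\<forall>x\<in>S \<union> T. (f has_real_derivative deriv f x) (at x)"
    using Suc.prems smooth_n_deriv(2) assms by blast
  ultimately show ?case by auto
qed

lemma smooth_all_higher_deriv:
  assumes "smooth_all S f" "open S"
  shows "smooth_all S ((deriv ^^ i) f)"
proof (induction i)
  case (Suc i)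
  then have "smooth_n (Suc k) S ((deriv ^^ i) f)" for k unfolding smooth_all_def by blast
  then have "smooth_n k S (deriv ((deriv ^^ i) f))" for k using smooth_n_deriv(1) assms(2) by blast
  then show ?case by (simp add: smooth_all_def)
qed (use assms in simp)

lemma smooth_all_has_deriv:
  assumes "smooth_all S f" "open S" "x \<in> S"
  shows "((deriv ^^ i) f has_real_derivative (deriv ^^ Suc i) f x) (at x)"
proof -
  have "smooth_n (Suc 0) S ((deriv ^^ i) f)"
    using smooth_all_higher_deriv[OF assms(1,2), of i] unfolding smooth_all_def by blast
  from smooth_n_deriv(2)[OF this assms(2,3)] show ?thesis by simp
qed

lemma higher_deriv_cong:
  assumes "open S" "\<And>x. x \<in> S \<Longrightarrow> f x = (h x :: real)" "x \<in> S"
  shows "(deriv ^^ i) f x = (deriv ^^ i) h x"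
  using assms(3)
proof (induction i arbitrary: x)
  case (Suc i)
  have "\<forall>\<^sub>F y in nhds x. (deriv ^^ i) f y = (deriv ^^ i) h y"
    using Suc assms(1) eventually_nhds by blast
  then show ?case by (simp add: deriv_cong_ev)
qed (use assms in simp)

lemma higher_deriv_powr:
  assumes "x > 0"
  shows "(deriv ^^ i) (\<lambda>x::real. x powr a) x = (\<Prod>j<i. a - real j) * x powr (a - real i)"
  using assms
proof (induction i arbitrary: x)
  case (Suc i)
  have "(deriv ^^ Suc i) (\<lambda>x::real. x powr a) x = deriv ((deriv ^^ i) (\<lambda>x::real. x powr a)) x" by simp
  also have "\<dots> = deriv (\<lambda>x. (\<Prod>j<i. a - real j) * x powr (a - real i)) x"
  proof (rule deriv_cong_ev)
    show "\<forall>\<^sub>F y in nhds x. (deriv ^^ i) (\<lambda>x::real. x powr a) y = (\<Prod>j<i. a - real j) * y powr (a - real i)"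
      unfolding eventually_nhds using Suc by (intro exI[of _ "{0<..}"]) auto
  qed simp
  also have "\<dots> = (\<Prod>j<i. a - real j) * ((a - real i) * x powr (a - real i - 1))"
    using Suc.prems by (intro DERIV_imp_deriv DERIV_cmult has_real_derivative_powr)
  finally show ?case by (simp add: algebra_simps)
qed simp

text \<open>The classical flat function e^(-1/t) with extra powers of 1/t: the powers make the
  family closed under differentiation up to linear combinations, so one induction over all n gives
  smoothness.\<close>

definition flat_exp :: "nat \<Rightarrow> real \<Rightarrow> real" where
  "flat_exp n t = (if t > 0 then inverse t ^ n * exp (- inverse t) else 0)"

lemma flat_exp_tendsto: "(flat_exp n \<longlongrightarrow> 0) (at 0)"
proof -
  have "((\<lambda>x::real. x ^ n / exp x) \<longlongrightarrow> 0) at_top" by (rule tendsto_power_div_exp_0)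
  then have "((\<lambda>t::real. inverse t ^ n / exp (inverse t)) \<longlongrightarrow> 0) (at_right 0)"
    by (rule filterlim_compose[OF _ filterlim_inverse_at_top_right])
  then have "(flat_exp n \<longlongrightarrow> 0) (at_right 0)"
    by (rule Lim_transform_eventually)
       (auto simp: eventually_at_filter flat_exp_def exp_minus field_simps)
  moreover have "(flat_exp n \<longlongrightarrow> 0) (at_left 0)"
    by (rule Lim_transform_eventually[OF tendsto_const])
       (auto simp: eventually_at_filter flat_exp_def)
  ultimately show ?thesis by (simp add: filterlim_split_at)
qed

lemma flat_exp_deriv:
  "(flat_exp n has_real_derivative (flat_exp (n + 2) t - real n * flat_exp (n + 1) t)) (at t)"
proof -
  consider "t > 0" | "t < 0" | "t = 0" by linarith
  then show ?thesis
  proof cases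
    case 1
    have "((\<lambda>t::real. inverse t ^ n * exp (- inverse t)) has_real_derivative
        (flat_exp (n + 2) t - real n * flat_exp (n + 1) t)) (at t)"
    proof -
      have "((\<lambda>t::real. inverse t ^ n * exp (- inverse t)) has_real_derivative
         real n * inverse t ^ (n - Suc 0) * (- (inverse t * inverse t)) * exp (- inverse t)
          + inverse t ^ n * (exp (- inverse t) * (inverse t * inverse t))) (at t)"
        using 1 by (auto intro!: derivative_eq_intros simp: power2_eq_square)
      moreover have "real n * inverse t ^ (n - Suc 0) * (- (inverse t * inverse t)) * exp (- inverse t)
          + inverse t ^ n * (exp (- inverse t) * (inverse t * inverse t)) = flat_exp (n + 2) t - real n * flat_exp (n + 1) t"
        using 1 by (cases n) (auto simp: flat_exp_def algebra_simps)
      ultimately show ?thesis by simp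
    qed
    then show ?thesis
      by (rule has_field_derivative_transform_within_open[where S = "{0<..}"]) (use 1 in \<open>auto simp: flat_exp_def\<close>)
  next
    case 2
    have "((\<lambda>t::real. 0) has_real_derivative 0) (at t)" by simp
    then have "(flat_exp n has_real_derivative 0) (at t)"
      by (rule has_field_derivative_transform_within_open[where S = "{..<0}"]) (use 2 in \<open>auto simp: flat_exp_def\<close>)
    then show ?thesis using 2 by (simp add: flat_exp_def)
  next
    case 3
    \<comment> \<open>The difference quotient at 0 is \<open>flat_exp (Suc n)\<close>, since
      dividing by h adds one factor 1/h.\<close>
    have "((\<lambda>h. (flat_exp n (0 + h) - flat_exp n 0) / h) \<longlongrightarrow> 0) (at 0)"
      by (rule Lim_transform_eventually[OF flat_exp_tendsto[of "Suc n"]])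
         (auto simp: eventually_at_filter flat_exp_def field_simps)
    then show ?thesis using 3 by (simp add: DERIV_def flat_exp_def)
  qed
qed

lemma smooth_n_flat_exp: "smooth_n k UNIV (flat_exp n)"
proof (induction k arbitrary: n)
  case 0
  have "isCont (flat_exp n) x" for x using flat_exp_deriv by (rule DERIV_isCont)
  then show ?case by (simp add: continuous_at_imp_continuous_on)
next
  case (Suc k)
  have "smooth_n k UNIV (\<lambda>t. flat_exp (n + 2) t - real n * flat_exp (n + 1) t)"
    by (intro smooth_n_diff smooth_n_cmult Suc.IH)
  then show ?case
    by (intro smooth_n.simps(2)[THEN iffD2] exI[of _ "\<lambda>t. flat_exp (n + 2) t - real n * flat_exp (n + 1) t"])
       (intro conjI ballI flat_exp_deriv)
qed

lemma flat_exp_pos: "flat_exp n t > 0 \<longleftrightarrow> t > 0"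
  by (simp add: flat_exp_def)

lemma flat_exp_nonneg: "flat_exp n t \<ge> 0"
  by (simp add: flat_exp_def)

lemma flat_exp_zero: "t \<le> 0 \<Longrightarrow> flat_exp n t = 0"
  by (simp add: flat_exp_def)

section \<open>Calculus of the class \<open>Ck\<close>\<close>

lemma Ck_continuous: "Ck k f \<Longrightarrow> continuous_on UNIV f"
proof (cases k)
  case (Suc k')
  assume "Ck k f"
  then obtain Df where "\<forall>x. (f has_derivative (\<lambda>h. \<Sum>i\<in>Basis. (h \<bullet> i) * Df i x)) (at x)"
    using Suc by auto
  then show ?thesis by (intro has_derivative_continuous_on[of UNIV f]) (auto intro: has_derivative_at_withinI)
qed simp

lemma Ck_lower: "Ck (Suc k) f \<Longrightarrow> Ck k f"
proof (induction k arbitrary: f)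
  case 0
  then show ?case using Ck_continuous by fastforce
next
  case (Suc k)
  from Suc.prems obtain Df where D: "\<forall>x. (f has_derivative (\<lambda>h. \<Sum>i\<in>Basis. (h \<bullet> i) * Df i x)) (at x)"
    "\<forall>i\<in>Basis. Ck (Suc k) (Df i)" unfolding Ck.simps(2)[of "Suc k"] by blast
  then have "\<forall>i\<in>Basis. Ck k (Df i)" using Suc.IH by blast
  with D(1) show ?case unfolding Ck.simps(2)[of k] by blast
qed

lemma Ck_const: "Ck k (\<lambda>x. c)"
proof (induction k arbitrary: c)
  case (Suc k)
  then show ?case by (auto intro!: exI[of _ "\<lambda>i x. 0"])
qed simp

lemma Ck_add: "Ck k f \<Longrightarrow> Ck k h \<Longrightarrow> Ck k (\<lambda>x. f x + h x)"
proof (induction k arbitrary: f h)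
  case 0
  then show ?case by (auto intro!: continuous_intros)
next
  case (Suc k)
  then obtain Df Dh where D: "\<forall>x. (f has_derivative (\<lambda>v. \<Sum>i\<in>Basis. (v \<bullet> i) * Df i x)) (at x)"
    "\<forall>i\<in>Basis. Ck k (Df i)" "\<forall>x. (h has_derivative (\<lambda>v. \<Sum>i\<in>Basis. (v \<bullet> i) * Dh i x)) (at x)"
    "\<forall>i\<in>Basis. Ck k (Dh i)" by auto
  have "\<forall>x. ((\<lambda>x. f x + h x) has_derivative (\<lambda>v. \<Sum>i\<in>Basis. (v \<bullet> i) * (Df i x + Dh i x))) (at x)"
    using D has_derivative_add by (fastforce simp: distrib_left sum.distrib)
  then show ?case using Suc.IH D by (auto intro!: exI[of _ "\<lambda>i x. Df i x + Dh i x"])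
qed

lemma Ck_mult: "Ck k f \<Longrightarrow> Ck k h \<Longrightarrow> Ck k (\<lambda>x. f x * h x)"
proof (induction k arbitrary: f h)
  case 0
  then show ?case by (auto intro!: continuous_intros)
next
  case (Suc k)
  then obtain Df Dh where D: "\<forall>x. (f has_derivative (\<lambda>v. \<Sum>i\<in>Basis. (v \<bullet> i) * Df i x)) (at x)"
    "\<forall>i\<in>Basis. Ck k (Df i)" "\<forall>x. (h has_derivative (\<lambda>v. \<Sum>i\<in>Basis. (v \<bullet> i) * Dh i x)) (at x)"
    "\<forall>i\<in>Basis. Ck k (Dh i)" by auto
  have "((\<lambda>x. f x * h x) has_derivative (\<lambda>v. \<Sum>i\<in>Basis. (v \<bullet> i) * (f x * Dh i x + Df i x * h x))) (at x)" for x
  proof -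
    have "((\<lambda>x. f x * h x) has_derivative (\<lambda>v. f x * (\<Sum>i\<in>Basis. (v \<bullet> i) * Dh i x) + (\<Sum>i\<in>Basis. (v \<bullet> i) * Df i x) * h x)) (at x)"
      using D by (intro has_derivative_mult) auto
    moreover have "(\<lambda>v. f x * (\<Sum>i\<in>Basis. (v \<bullet> i) * Dh i x) + (\<Sum>i\<in>Basis. (v \<bullet> i) * Df i x) * h x)
       = (\<lambda>v. \<Sum>i\<in>Basis. (v \<bullet> i) * (f x * Dh i x + Df i x * h x))"
      by (simp add: sum_distrib_left sum_distrib_right sum.distrib[symmetric] algebra_simps)
    ultimately show ?thesis by simp
  qed
  moreover have "Ck k f" "Ck k h" using Suc.prems Ck_lower by auto
  then have "\<forall>i\<in>Basis. Ck k (\<lambda>x. f x * Dh i x + Df i x * h x)"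
    using D Suc.IH by (auto intro!: Ck_add)
  ultimately show ?case by (auto intro!: exI[of _ "\<lambda>i x. f x * Dh i x + Df i x * h x"])
qed

lemma Ck_linear: "Ck k (\<lambda>x. c * (x \<bullet> i))" for i :: "'a::euclidean_space"
proof (cases k)
  case 0
  then show ?thesis by (auto intro!: continuous_intros)
next
  case (Suc k')
  have "((\<lambda>x. c * (x \<bullet> i)) has_derivative (\<lambda>v. \<Sum>j\<in>Basis. (v \<bullet> j) * (c * (i \<bullet> j)))) (at x)" for x
  proof -
    have "((\<lambda>x. c * (x \<bullet> i)) has_derivative (\<lambda>v. c * (v \<bullet> i))) (at x)"
      by (auto intro!: derivative_eq_intros)
    moreover have "(\<lambda>v. c * (v \<bullet> i)) = (\<lambda>v. \<Sum>j\<in>Basis. (v \<bullet> j) * (c * (i \<bullet> j)))"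
    proof
      fix v :: 'a
      show "c * (v \<bullet> i) = (\<Sum>j\<in>Basis. (v \<bullet> j) * (c * (i \<bullet> j)))"
        unfolding euclidean_inner[of v i] by (simp add: sum_distrib_left mult.left_commute)
    qed
    ultimately show ?thesis by simp
  qed
  then show ?thesis using Suc Ck_const by (auto intro!: exI[of _ "\<lambda>j x. c * (i \<bullet> j)"])
qed

lemma Ck_sq_norm: "Ck k (\<lambda>x::'a::euclidean_space. (norm x)\<^sup>2 + c)"
proof (cases k)
  case 0
  then show ?thesis by (auto intro!: continuous_intros)
next
  case (Suc k')
  have "((\<lambda>x. (norm x)\<^sup>2 + c) has_derivative (\<lambda>v. \<Sum>j\<in>Basis. (v \<bullet> j) * (2 * (x \<bullet> j)))) (at x)" for x :: 'a
  proof -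
    have "((\<lambda>x. x \<bullet> x + c) has_derivative (\<lambda>v. 2 * (v \<bullet> x))) (at x)"
      by (auto intro!: derivative_eq_intros simp: inner_commute)
    moreover have "(\<lambda>v. 2 * (v \<bullet> x)) = (\<lambda>v. \<Sum>j\<in>Basis. (v \<bullet> j) * (2 * (x \<bullet> j)))"
    proof
      fix v :: 'a
      show "2 * (v \<bullet> x) = (\<Sum>j\<in>Basis. (v \<bullet> j) * (2 * (x \<bullet> j)))"
        unfolding euclidean_inner[of v x] by (simp add: sum_distrib_left mult.left_commute)
    qed
    ultimately show ?thesis by (simp add: power2_norm_eq_inner)
  qed
  then show ?thesis using Suc Ck_linear[of k' 2] by (auto intro!: exI[of _ "\<lambda>j x. 2 * (x \<bullet> j)"])
qed

lemma Ck_compose: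
  "smooth_n k S \<phi> \<Longrightarrow> Ck k f \<Longrightarrow> (\<And>x. f x \<in> S) \<Longrightarrow> Ck k (\<lambda>x. \<phi> (f x))"
proof (induction k arbitrary: \<phi>)
  case 0
  then show ?case by (auto intro: continuous_on_compose2)
next
  case (Suc k)
  then obtain Df \<phi>' where D: "\<forall>x. (f has_derivative (\<lambda>v. \<Sum>i\<in>Basis. (v \<bullet> i) * Df i x)) (at x)"
    "\<forall>i\<in>Basis. Ck k (Df i)" "\<forall>x\<in>S. (\<phi> has_real_derivative \<phi>' x) (at x)" "smooth_n k S \<phi>'" by auto
  have "((\<lambda>x. \<phi> (f x)) has_derivative (\<lambda>v. \<Sum>i\<in>Basis. (v \<bullet> i) * (\<phi>' (f x) * Df i x))) (at x)" for x
  proof -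
    have "((\<lambda>x. \<phi> (f x)) has_derivative (\<lambda>v. (\<Sum>i\<in>Basis. (v \<bullet> i) * Df i x) *\<^sub>R \<phi>' (f x))) (at x)"
      using D Suc.prems(3) has_derivative_compose[of f _ x UNIV \<phi> "\<lambda>t. t * \<phi>' (f x)"]
      by (simp add: has_field_derivative_def mult.commute[of _ "\<phi>' (f x)"])
    moreover have "(\<lambda>v. (\<Sum>i\<in>Basis. (v \<bullet> i) * Df i x) *\<^sub>R \<phi>' (f x)) = (\<lambda>v. \<Sum>i\<in>Basis. (v \<bullet> i) * (\<phi>' (f x) * Df i x))"
      by (simp add: sum_distrib_right mult.assoc mult.commute[of "\<phi>' (f x)"])
    ultimately show ?thesis by simp
  qed
  moreover have "Ck k f" using Suc.prems Ck_lower by auto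
  then have "Ck k (\<lambda>x. \<phi>' (f x))" using Suc.IH[OF D(4)] Suc.prems by blast
  then have "\<forall>i\<in>Basis. Ck k (\<lambda>x. \<phi>' (f x) * Df i x)" using D by (auto intro!: Ck_mult)
  ultimately show ?case by (auto intro!: exI[of _ "\<lambda>i x. \<phi>' (f x) * Df i x"])
qed

text \<open>Extracts what the weak formulation uses of a test function. The derivative is bounded on
  the closed ball of radius 2; a point beyond it has distance at least 1 from the unit ball, so
  there boundedness alone yields the Lipschitz estimate.\<close>

lemma test_fun_lipschitz:
  fixes \<phi> :: "'a::euclidean_space \<Rightarrow> real"
  assumes "test_fun (ball 0 1) \<phi>"
  obtains M where "M \<ge> 0" "\<And>x. \<bar>\<phi> x\<bar> \<le> M" "\<And>x y. \<bar>\<phi> x - \<phi> y\<bar> \<le> M * norm (x - y)"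
    "\<And>x. norm x \<ge> 1 \<Longrightarrow> \<phi> x = 0" "continuous_on UNIV \<phi>"
proof -
  let ?K = "closure {x. \<phi> x \<noteq> 0}"
  have K: "compact ?K" "?K \<subseteq> ball 0 1" and C: "Ck 1 \<phi>" "Ck 0 \<phi>"
    using assms by (auto simp: test_fun_def smooth_fun_def)
  have cont: "continuous_on UNIV \<phi>" using C by simp
  have zero: "\<phi> x = 0" if "norm x \<ge> 1" for x
    using K(2) closure_subset[of "{x. \<phi> x \<noteq> 0}"] that by (auto simp: subset_iff)
  obtain Df where D: "\<And>x. (\<phi> has_derivative (\<lambda>h. \<Sum>i\<in>Basis. (h \<bullet> i) * Df i x)) (at x)"
    "\<And>i. i \<in> Basis \<Longrightarrow> continuous_on UNIV (Df i)" using C(1) by auto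
  define L where "L x = (\<Sum>i\<in>Basis. \<bar>Df i x\<bar>)" for x
  have "continuous_on (cball 0 2) \<phi>" "continuous_on (cball 0 2) L"
    unfolding L_def by (auto intro!: continuous_intros continuous_on_subset[OF D(2)] continuous_on_subset[OF cont])
  then have "bounded (\<phi> ` cball 0 2)" "bounded (L ` cball 0 2)"
    by (auto intro!: compact_imp_bounded compact_continuous_image)
  then obtain M1 M2 where M: "\<And>x. norm x \<le> 2 \<Longrightarrow> \<bar>\<phi> x\<bar> \<le> M1" "\<And>x. norm x \<le> 2 \<Longrightarrow> \<bar>L x\<bar> \<le> M2"
    unfolding bounded_iff by (metis imageI mem_cball_0 real_norm_def)
  define M where "M = max (max M1 M2) 0"
  have M0: "M \<ge> 0" by (simp add: M_def)
  have b: "\<bar>\<phi> x\<bar> \<le> M" for x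
    using M(1)[of x] zero[of x] by (cases "norm x \<le> 2") (auto simp: M_def)
  have lip: "\<bar>\<phi> x - \<phi> y\<bar> \<le> M * norm (x - y)" if "norm x \<le> 2" "norm y \<le> 2" for x y
  proof -
    have "norm (\<phi> x - \<phi> y) \<le> M * norm (x - y)"
    proof (rule differentiable_bound[of "cball 0 2" \<phi> "\<lambda>x h. \<Sum>i\<in>Basis. (h \<bullet> i) * Df i x"])
      show "(\<phi> has_derivative (\<lambda>h. \<Sum>i\<in>Basis. (h \<bullet> i) * Df i x)) (at x within cball 0 2)" for x
        using D(1) has_derivative_at_withinI by blast
      show "onorm (\<lambda>h. \<Sum>i\<in>Basis. (h \<bullet> i) * Df i x) \<le> M" if "x \<in> cball 0 2" for x
      proof (rule onorm_le)
        fix h :: 'a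
        have "norm (\<Sum>i\<in>Basis. (h \<bullet> i) * Df i x) \<le> (\<Sum>i\<in>Basis. norm h * \<bar>Df i x\<bar>)"
          by (rule sum_norm_le) (auto simp: abs_mult intro!: mult_right_mono Basis_le_norm)
        also have "\<dots> = L x * norm h" by (simp add: L_def sum_distrib_left mult.commute)
        also have "L x \<le> M" using M(2)[of x] that by (auto simp: M_def)
        finally show "norm (\<Sum>i\<in>Basis. (h \<bullet> i) * Df i x) \<le> M * norm h" by (simp add: mult_right_mono)
      qed
    qed (use that in auto)
    then show ?thesis by simp
  qed
  have far: "\<bar>\<phi> x - \<phi> y\<bar> \<le> M * norm (x - y)" if "norm x > 2" for x y
  proof (cases "norm y \<ge> 1")
    case True
    then show ?thesis using zero[of x] zero[of y] that M0 by simp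
  next
    case False
    have "1 \<le> norm (x - y)" using that False norm_triangle_ineq2[of x y] by linarith
    then have "M * 1 \<le> M * norm (x - y)" using M0 by (rule mult_left_mono)
    then show ?thesis using b[of y] zero[of x] that by simp
  qed
  have "\<bar>\<phi> x - \<phi> y\<bar> \<le> M * norm (x - y)" for x y
    using lip[of x y] far[of x y] far[of y x] by (cases "norm x > 2"; cases "norm y > 2") (auto simp: norm_minus_commute abs_minus_commute)
  then show ?thesis using that M0 b zero cont by blast
qed

section \<open>Profiles equal to a power near the origin\<close>

lemma powr_window:
  fixes \<sigma> \<xi> a :: real
  assumes "\<sigma> > 0" "\<sigma> / 4 \<le> \<xi>" "\<xi> \<le> 9 / 4 * \<sigma>"
  shows "\<xi> powr a \<le> ((1/4) powr a + (9/4) powr a) * \<sigma> powr a"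
proof -
  define t where "t = \<xi> / \<sigma>"
  have t: "1/4 \<le> t" "t \<le> 9/4" "\<xi> = t * \<sigma>" using assms by (auto simp: t_def field_simps)
  have "t powr a \<le> (1/4) powr a + (9/4) powr a"
  proof (cases "a \<ge> 0")
    case True
    then have "t powr a \<le> (9/4) powr a" using t by (intro powr_mono2) auto
    then show ?thesis using powr_ge_zero[of "1/4" a] by linarith
  next
    case False
    then have "t powr a \<le> (1/4) powr a" using t by (intro powr_mono2') auto
    then show ?thesis using powr_ge_zero[of "9/4" a] by linarith
  qed
  then have "t powr a * \<sigma> powr a \<le> ((1/4) powr a + (9/4) powr a) * \<sigma> powr a"
    by (intro mult_right_mono) auto
  then show ?thesis using t assms by (simp add: powr_mult)
qed

text \<open>For |c| <= \<rho> the value \<rho>^2 + 2 r c + r^2 lies between (\<rho> - |r|)^2 and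
  (\<rho> + |r|)^2, and |r| <= \<rho>/2 puts these into [\<rho>^2/4, 9 \<rho>^2/4]. The cases
  \<theta> = 0 and \<theta> = 1 give both ends of the segment used in Taylor's theorem.\<close>

lemma shifted_square_window:
  fixes \<rho> c r \<theta> :: real
  assumes "2 \<le> \<rho>" "\<bar>c\<bar> \<le> \<rho>" "\<bar>r\<bar> \<le> 1" "0 \<le> \<theta>" "\<theta> \<le> 1"
  shows "\<rho>\<^sup>2 / 4 \<le> \<rho>\<^sup>2 + \<theta> * (2 * r * c + r\<^sup>2)" "\<rho>\<^sup>2 + \<theta> * (2 * r * c + r\<^sup>2) \<le> 9 / 4 * \<rho>\<^sup>2"
    "\<bar>2 * r * c + r\<^sup>2\<bar> \<le> 3 * \<bar>r\<bar> * \<rho>"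
proof -
  have rc: "\<bar>r * c\<bar> \<le> \<bar>r\<bar> * \<rho>" using assms by (simp add: abs_mult mult_left_mono)
  have r2: "r\<^sup>2 = \<bar>r\<bar> * \<bar>r\<bar>" by (simp add: power2_eq_square)
  have "\<bar>r\<bar> * \<bar>r\<bar> \<le> \<bar>r\<bar> * \<rho>" using assms by (intro mult_left_mono) auto
  moreover have e: "2 * r * c = 2 * (r * c)" by simp
  moreover have "0 \<le> \<bar>r\<bar> * \<bar>r\<bar>" by simp
  moreover have rc': "r * c \<le> \<bar>r\<bar> * \<rho>" "- (\<bar>r\<bar> * \<rho>) \<le> r * c" using rc by (auto simp: abs_le_iff)
  ultimately have "2 * r * c + r\<^sup>2 \<le> 3 * (\<bar>r\<bar> * \<rho>)" "- (3 * (\<bar>r\<bar> * \<rho>)) \<le> 2 * r * c + r\<^sup>2"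
    unfolding r2 e by linarith+
  then show "\<bar>2 * r * c + r\<^sup>2\<bar> \<le> 3 * \<bar>r\<bar> * \<rho>" by (simp add: abs_le_iff)
  have rho: "\<bar>r\<bar> \<le> \<rho> / 2" using assms by linarith
  have lo: "(\<rho> - \<bar>r\<bar>)\<^sup>2 \<ge> (\<rho>/2)\<^sup>2" using rho assms by (intro power_mono) auto
  have hi: "(\<rho> + \<bar>r\<bar>)\<^sup>2 \<le> (\<rho> + \<rho>/2)\<^sup>2" using rho assms by (intro power_mono) auto
  have b1: "2 * r * c + r\<^sup>2 \<ge> - (3/4 * \<rho>\<^sup>2)"
  proof -
    have "2 * r * c + r\<^sup>2 \<ge> - 2 * (\<bar>r\<bar> * \<rho>) + \<bar>r\<bar> * \<bar>r\<bar>" using rc' unfolding r2 e by linarith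
    moreover have "- 2 * (\<bar>r\<bar> * \<rho>) + \<bar>r\<bar> * \<bar>r\<bar> = (\<rho> - \<bar>r\<bar>)\<^sup>2 - \<rho>\<^sup>2" by (simp add: power2_eq_square algebra_simps)
    ultimately show ?thesis using lo by (simp add: power_divide)
  qed
  have b2: "2 * r * c + r\<^sup>2 \<le> 5/4 * \<rho>\<^sup>2"
  proof -
    have "2 * r * c + r\<^sup>2 \<le> 2 * (\<bar>r\<bar> * \<rho>) + \<bar>r\<bar> * \<bar>r\<bar>" using rc' unfolding r2 e by linarith
    moreover have "2 * (\<bar>r\<bar> * \<rho>) + \<bar>r\<bar> * \<bar>r\<bar> = (\<rho> + \<bar>r\<bar>)\<^sup>2 - \<rho>\<^sup>2" by (simp add: power2_eq_square algebra_simps)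
    moreover have "(\<rho> + \<rho>/2)\<^sup>2 = 9/4 * \<rho>\<^sup>2" by (simp add: power2_eq_square field_simps)
    ultimately show ?thesis using hi by simp
  qed
  have "\<theta> * (2 * r * c + r\<^sup>2) \<ge> \<theta> * (- (3/4 * \<rho>\<^sup>2))" using b1 assms by (intro mult_left_mono) auto
  moreover have "\<theta> * (3/4 * \<rho>\<^sup>2) \<le> 1 * (3/4 * \<rho>\<^sup>2)" using assms by (intro mult_right_mono) auto
  ultimately show "\<rho>\<^sup>2 / 4 \<le> \<rho>\<^sup>2 + \<theta> * (2 * r * c + r\<^sup>2)" by simp
  have "\<theta> * (2 * r * c + r\<^sup>2) \<le> \<theta> * (5/4 * \<rho>\<^sup>2)" using b2 assms by (intro mult_left_mono) auto
  moreover have "\<theta> * (5/4 * \<rho>\<^sup>2) \<le> 1 * (5/4 * \<rho>\<^sup>2)" using assms by (intro mult_right_mono) auto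
  ultimately show "\<rho>\<^sup>2 + \<theta> * (2 * r * c + r\<^sup>2) \<le> 9 / 4 * \<rho>\<^sup>2" by simp
qed

text \<open>\<open>D i\<close> stands for the i-th derivative of \<open>D 0\<close>. The Lagrange
  remainder is at most |\<open>D 5 t\<close>| |\<tau>|^5, and 243 = 3^5 comes from |\<tau>| <= 3 |r|
  \<rho>; \<open>powr_window\<close> moves the power from the intermediate point to
  \<rho>^2.\<close>

lemma taylor4_remainder:
  fixes D :: "nat \<Rightarrow> real \<Rightarrow> real" and \<rho> c r \<kappa> K :: real
  assumes D: "\<And>i \<xi>. \<rho>\<^sup>2 / 4 \<le> \<xi> \<Longrightarrow> (D i has_real_derivative D (Suc i) \<xi>) (at \<xi>)"
    and B: "\<And>\<xi>. \<rho>\<^sup>2 / 4 \<le> \<xi> \<Longrightarrow> \<bar>D 5 \<xi>\<bar> \<le> K * \<xi> powr (\<kappa> - 5)"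
    and \<rho>: "2 \<le> \<rho>" "\<bar>c\<bar> \<le> \<rho>" "\<bar>r\<bar> \<le> 1" and K: "K \<ge> 0"
  defines "\<sigma> \<equiv> \<rho>\<^sup>2" and "\<tau> \<equiv> 2 * r * c + r\<^sup>2"
  shows "\<bar>D 0 (\<sigma> + \<tau>) - D 0 \<sigma> - D 1 \<sigma> * \<tau> - D 2 \<sigma> / 2 * \<tau>^2 - D 3 \<sigma> / 6 * \<tau>^3 - D 4 \<sigma> / 24 * \<tau>^4\<bar>
    \<le> 243 * ((1/4) powr (\<kappa> - 5) + (9/4) powr (\<kappa> - 5)) * K * \<bar>r\<bar>^5 * \<rho> powr (2 * \<kappa> - 5)"
proof (cases "\<tau> = 0")
  case True
  then show ?thesis using K by simp
next
  case False
  let ?M = "(1/4) powr (\<kappa> - 5) + (9/4) powr (\<kappa> - 5) :: real"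
  have s0: "\<sigma> > 0" using \<rho> by (simp add: \<sigma>_def)
  note w = shifted_square_window[OF \<rho>, folded \<sigma>_def \<tau>_def]
  have "\<exists>t. (if \<sigma> + \<tau> < \<sigma> then \<sigma> + \<tau> < t \<and> t < \<sigma> else \<sigma> < t \<and> t < \<sigma> + \<tau>) \<and>
      D 0 (\<sigma> + \<tau>) = (\<Sum>m<5. D m \<sigma> / fact m * (\<sigma> + \<tau> - \<sigma>)^m) + D 5 t / fact 5 * (\<sigma> + \<tau> - \<sigma>)^5"
    using w[of 0] w[of 1] s0 False
    by (intro Taylor[where a = "\<sigma>/4" and b = "9/4 * \<sigma>"])
       (auto intro!: D simp: \<sigma>_def)
  then obtain t where t: "(if \<sigma> + \<tau> < \<sigma> then \<sigma> + \<tau> < t \<and> t < \<sigma> else \<sigma> < t \<and> t < \<sigma> + \<tau>)"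
      "D 0 (\<sigma> + \<tau>) = (\<Sum>m<5. D m \<sigma> / fact m * \<tau>^m) + D 5 t / fact 5 * \<tau>^5" by auto
  have tw: "\<sigma> / 4 \<le> t" "t \<le> 9 / 4 * \<sigma>" using t(1) w[of 0] w[of 1] s0 by (auto split: if_splits)
  have "(\<Sum>m<5. D m \<sigma> / fact m * \<tau>^m) = D 0 \<sigma> + D 1 \<sigma> * \<tau> + D 2 \<sigma> / 2 * \<tau>^2 + D 3 \<sigma> / 6 * \<tau>^3 + D 4 \<sigma> / 24 * \<tau>^4"
    by (simp add: eval_nat_numeral lessThan_Suc fact_numeral)
  then have "\<bar>D 0 (\<sigma> + \<tau>) - D 0 \<sigma> - D 1 \<sigma> * \<tau> - D 2 \<sigma> / 2 * \<tau>^2 - D 3 \<sigma> / 6 * \<tau>^3 - D 4 \<sigma> / 24 * \<tau>^4\<bar>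
     = \<bar>D 5 t\<bar> / 120 * \<bar>\<tau>\<bar>^5"
    using t(2) by (simp add: abs_mult power_abs fact_numeral)
  also have "\<dots> \<le> (K * (?M * \<sigma> powr (\<kappa> - 5))) * (3 * \<bar>r\<bar> * \<rho>)^5"
  proof (intro mult_mono power_mono)
    have "\<bar>D 5 t\<bar> \<le> K * t powr (\<kappa> - 5)" using B[of t] tw by (simp add: \<sigma>_def)
    also have "\<dots> \<le> K * (?M * \<sigma> powr (\<kappa> - 5))"
      using powr_window[OF s0 tw] K by (intro mult_left_mono) auto
    finally show "\<bar>D 5 t\<bar> / 120 \<le> K * (?M * \<sigma> powr (\<kappa> - 5))" by linarith
    show "\<bar>\<tau>\<bar> \<le> 3 * \<bar>r\<bar> * \<rho>" using w(3)[of 0] by simp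
  qed (use K in auto)
  also have "\<sigma> powr (\<kappa> - 5) = \<rho> powr (2 * \<kappa> - 10)"
    using \<rho> by (simp add: \<sigma>_def square_powr algebra_simps)
  also have "(K * (?M * \<rho> powr (2 * \<kappa> - 10))) * (3 * \<bar>r\<bar> * \<rho>)^5 = 243 * ?M * K * \<bar>r\<bar>^5 * (\<rho> powr (2 * \<kappa> - 10) * \<rho> ^ 5)"
    by (simp add: power_mult_distrib algebra_simps)
  also have "\<rho> powr (2 * \<kappa> - 10) * \<rho> ^ 5 = \<rho> powr (2 * \<kappa> - 5)"
  proof -
    have "\<rho> ^ 5 = \<rho> powr 5" using \<rho> by simp
    then show ?thesis by (simp only: powr_add[symmetric]) (simp add: algebra_simps)
  qed
  finally show ?thesis .
qed

lemma abs_avg_le: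
  fixes x y w Z W :: real
  assumes "\<bar>x\<bar> \<le> Z" "\<bar>y\<bar> \<le> Z" "\<bar>w\<bar> \<le> W"
  shows "\<bar>(x + y) / 2 + w\<bar> \<le> Z + W"
  using assms by (auto simp: abs_le_iff field_simps)

text \<open>With \<open>D i\<close> the i-th derivative of F, \<open>avg2\<close> and
  \<open>avg4\<close> are the coefficients of r^2 and r^4 in (F(\<sigma> + 2rc + r^2) + F(\<sigma> -
  2rc + r^2))/2 - F(\<sigma>).\<close>

definition avg2 :: "real \<Rightarrow> real \<Rightarrow> (nat \<Rightarrow> real \<Rightarrow> real) \<Rightarrow> real" where
  "avg2 \<sigma> c D = D 1 \<sigma> + 2 * D 2 \<sigma> * c\<^sup>2"

definition avg4 :: "real \<Rightarrow> real \<Rightarrow> (nat \<Rightarrow> real \<Rightarrow> real) \<Rightarrow> real" where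
  "avg4 \<sigma> c D = D 2 \<sigma> / 2 + 2 * D 3 \<sigma> * c\<^sup>2 + 2 / 3 * D 4 \<sigma> * c ^ 4"

text \<open>Averaging over c and -c cancels the odd powers of r, so that the Taylor polynomial of
  degree four contributes r^2, r^4 and higher even powers only.\<close>

lemma avg_expansion:
  fixes D :: "nat \<Rightarrow> real \<Rightarrow> real" and \<rho> c r \<kappa> K :: real
  assumes D: "\<And>i \<xi>. \<rho>\<^sup>2 / 4 \<le> \<xi> \<Longrightarrow> (D i has_real_derivative D (Suc i) \<xi>) (at \<xi>)"
    and B: "\<And>i \<xi>. i \<le> 5 \<Longrightarrow> \<rho>\<^sup>2 / 4 \<le> \<xi> \<Longrightarrow> \<bar>D i \<xi>\<bar> \<le> K * \<xi> powr (\<kappa> - real i)"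
    and \<rho>: "2 \<le> \<rho>" "\<bar>c\<bar> \<le> \<rho>" and r: "0 \<le> r" "r \<le> 1" and K: "K \<ge> 0"
  defines "\<sigma> \<equiv> \<rho>\<^sup>2"
  shows "\<bar>(D 0 (\<sigma> + 2 * r * c + r\<^sup>2) + D 0 (\<sigma> - 2 * r * c + r\<^sup>2)) / 2 - D 0 \<sigma> - r\<^sup>2 * avg2 \<sigma> c D - r^4 * avg4 \<sigma> c D\<bar>
    \<le> (243 * ((1/4) powr (\<kappa> - 5) + (9/4) powr (\<kappa> - 5)) + 3) * K * r^5 * \<rho> powr (2 * \<kappa> - 5)"
proof -
  let ?M = "(1/4) powr (\<kappa> - 5) + (9/4) powr (\<kappa> - 5) :: real"
  define \<tau>1 where "\<tau>1 = 2 * r * c + r\<^sup>2"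
  define \<tau>2 where "\<tau>2 = 2 * r * (- c) + r\<^sup>2"
  define E where "E \<tau> = D 0 (\<sigma> + \<tau>) - D 0 \<sigma> - D 1 \<sigma> * \<tau> - D 2 \<sigma> / 2 * \<tau>^2 - D 3 \<sigma> / 6 * \<tau>^3 - D 4 \<sigma> / 24 * \<tau>^4" for \<tau>
  define Y where "Y = K * r^5 * \<rho> powr (2 * \<kappa> - 5)"
  have s0: "\<sigma> > 0" using \<rho> by (simp add: \<sigma>_def)
  have sp: "\<sigma> powr t = \<rho> powr (2 * t)" for t using \<rho> by (simp add: \<sigma>_def square_powr)
  have E: "\<bar>E \<tau>1\<bar> \<le> 243 * ?M * Y" "\<bar>E \<tau>2\<bar> \<le> 243 * ?M * Y"
  proof -
    have "\<bar>E \<tau>1\<bar> \<le> 243 * ?M * K * \<bar>r\<bar>^5 * \<rho> powr (2 * \<kappa> - 5)"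
      unfolding E_def \<tau>1_def \<sigma>_def using B[of 5] r \<rho> K by (intro taylor4_remainder D) auto
    then show "\<bar>E \<tau>1\<bar> \<le> 243 * ?M * Y" using r by (simp add: Y_def mult.assoc)
    have "\<bar>E \<tau>2\<bar> \<le> 243 * ?M * K * \<bar>r\<bar>^5 * \<rho> powr (2 * \<kappa> - 5)"
      unfolding E_def \<tau>2_def \<sigma>_def using B[of 5] r \<rho> K by (intro taylor4_remainder D) auto
    then show "\<bar>E \<tau>2\<bar> \<le> 243 * ?M * Y" using r by (simp add: Y_def mult.assoc)
  qed
  \<comment> \<open>The powers r^6 and r^8 left over from the cubic and quartic Taylor terms. For r
    <= 1 they are absorbed into r^5 and account for the summand 3 of the constant.\<close>
  define Rm where "Rm = D 3 \<sigma> / 6 * r^6 + D 4 \<sigma> / 24 * (r^8 + 24 * r^6 * c\<^sup>2)"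
  have id: "(D 0 (\<sigma> + 2 * r * c + r\<^sup>2) + D 0 (\<sigma> - 2 * r * c + r\<^sup>2)) / 2 - D 0 \<sigma> - r\<^sup>2 * avg2 \<sigma> c D - r^4 * avg4 \<sigma> c D
    = (E \<tau>1 + E \<tau>2) / 2 + Rm"
  proof -
    have a: "\<sigma> + 2 * r * c + r\<^sup>2 = \<sigma> + \<tau>1" "\<sigma> - 2 * r * c + r\<^sup>2 = \<sigma> + \<tau>2" by (simp_all add: \<tau>1_def \<tau>2_def)
    have t1: "\<tau>1 + \<tau>2 = 2 * r\<^sup>2" by (simp add: \<tau>1_def \<tau>2_def)
    have t2: "\<tau>1^2 + \<tau>2^2 = 2 * (4 * r\<^sup>2 * c\<^sup>2 + r^4)"
      unfolding \<tau>1_def \<tau>2_def by algebra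
    have t3: "\<tau>1^3 + \<tau>2^3 = 2 * (r^6 + 12 * r^4 * c\<^sup>2)"
      unfolding \<tau>1_def \<tau>2_def by algebra
    have t4: "\<tau>1^4 + \<tau>2^4 = 2 * (r^8 + 24 * r^6 * c\<^sup>2 + 16 * r^4 * c^4)"
      unfolding \<tau>1_def \<tau>2_def by algebra
    have "E \<tau>1 + E \<tau>2 = D 0 (\<sigma> + \<tau>1) + D 0 (\<sigma> + \<tau>2) - 2 * D 0 \<sigma> - D 1 \<sigma> * (\<tau>1 + \<tau>2) - D 2 \<sigma> / 2 * (\<tau>1^2 + \<tau>2^2)
       - D 3 \<sigma> / 6 * (\<tau>1^3 + \<tau>2^3) - D 4 \<sigma> / 24 * (\<tau>1^4 + \<tau>2^4)"
      unfolding E_def by (simp add: algebra_simps)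
    also have "\<dots> = D 0 (\<sigma> + \<tau>1) + D 0 (\<sigma> + \<tau>2) - 2 * D 0 \<sigma> - D 1 \<sigma> * (2 * r\<^sup>2) - D 2 \<sigma> / 2 * (2 * (4 * r\<^sup>2 * c\<^sup>2 + r^4))
       - D 3 \<sigma> / 6 * (2 * (r^6 + 12 * r^4 * c\<^sup>2)) - D 4 \<sigma> / 24 * (2 * (r^8 + 24 * r^6 * c\<^sup>2 + 16 * r^4 * c^4))"
      unfolding t1 t2 t3 t4 ..
    finally have EE: "E \<tau>1 + E \<tau>2 = \<dots>" .
    show ?thesis unfolding EE a Rm_def avg2_def avg4_def by (simp add: field_simps)
  qed
  have Rm: "\<bar>Rm\<bar> \<le> 3 * Y"
  proof -
    have d3: "\<bar>D 3 \<sigma>\<bar> \<le> K * \<rho> powr (2 * \<kappa> - 6)" using B[of 3 \<sigma>] s0 sp[of "\<kappa> - 3"] by (simp add: \<sigma>_def algebra_simps)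
    have d4: "\<bar>D 4 \<sigma>\<bar> \<le> K * \<rho> powr (2 * \<kappa> - 8)" using B[of 4 \<sigma>] s0 sp[of "\<kappa> - 4"] by (simp add: \<sigma>_def algebra_simps)
    have rp: "r^6 \<le> r^5" "r^8 \<le> r^5" "0 \<le> r^5" using r by (auto intro!: power_decreasing)
    have mono: "\<rho> powr a \<le> \<rho> powr (2 * \<kappa> - 5)" if "a \<le> 2 * \<kappa> - 5" for a using that \<rho> by (intro powr_mono) auto
    have "\<bar>D 3 \<sigma> / 6 * r^6\<bar> = \<bar>D 3 \<sigma>\<bar> * (r^6 / 6)" using r by (simp add: abs_mult)
    also have "\<dots> \<le> (K * \<rho> powr (2 * \<kappa> - 5)) * r^5"
    proof (intro mult_mono order.trans[OF d3] mult_left_mono mono)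
      show "r^6 / 6 \<le> r^5" using rp by linarith
    qed (use K r in auto)
    finally have 1: "\<bar>D 3 \<sigma> / 6 * r^6\<bar> \<le> Y" by (simp add: Y_def algebra_simps)
    have c2: "c\<^sup>2 \<le> \<rho>\<^sup>2" "1 \<le> \<rho>\<^sup>2" using \<rho> by (auto simp: abs_le_square_iff[symmetric])
    have "\<bar>D 4 \<sigma> / 24 * (r^8 + 24 * r^6 * c\<^sup>2)\<bar> = \<bar>D 4 \<sigma>\<bar> * (r^8 / 24 + r^6 * c\<^sup>2)"
    proof -
      have nn: "0 \<le> r^8 + 24 * r^6 * c\<^sup>2" using r by simp
      have "\<bar>D 4 \<sigma> / 24 * (r^8 + 24 * r^6 * c\<^sup>2)\<bar> = \<bar>D 4 \<sigma>\<bar> / 24 * (r^8 + 24 * r^6 * c\<^sup>2)"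
        using abs_of_nonneg[OF nn] by (simp only: abs_mult abs_divide abs_numeral)
      then show ?thesis by (simp add: field_simps)
    qed
    also have "\<dots> \<le> (K * \<rho> powr (2 * \<kappa> - 8)) * (2 * r^5 * \<rho>\<^sup>2)"
    proof (intro mult_mono d4)
      have "r^6 * c\<^sup>2 \<le> r^5 * \<rho>\<^sup>2" using rp c2 by (intro mult_mono) auto
      moreover have "r^8 / 24 \<le> r^5 * \<rho>\<^sup>2" using rp c2 mult_left_mono[OF c2(2) rp(3)] by linarith
      ultimately show "r^8 / 24 + r^6 * c\<^sup>2 \<le> 2 * r^5 * \<rho>\<^sup>2" by linarith
    qed (use r K in auto)
    also have "\<dots> = 2 * K * r^5 * (\<rho> powr (2 * \<kappa> - 8) * \<rho>\<^sup>2)" by (simp add: algebra_simps)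
    also have "\<rho> powr (2 * \<kappa> - 8) * \<rho>\<^sup>2 = \<rho> powr (2 * \<kappa> - 6)" using \<rho> by (simp add: powr_mult_square)
    also have "2 * K * r^5 * \<rho> powr (2 * \<kappa> - 6) \<le> 2 * K * r^5 * \<rho> powr (2 * \<kappa> - 5)"
      using K r by (intro mult_left_mono mono) auto
    finally have 2: "\<bar>D 4 \<sigma> / 24 * (r^8 + 24 * r^6 * c\<^sup>2)\<bar> \<le> 2 * Y" by (simp add: Y_def algebra_simps)
    show ?thesis using 1 2 unfolding Rm_def by linarith
  qed
  have "\<bar>(E \<tau>1 + E \<tau>2) / 2 + Rm\<bar> \<le> 243 * ?M * Y + 3 * Y" by (rule abs_avg_le[OF E Rm])
  also have "\<dots> = (243 * ?M + 3) * K * r^5 * \<rho> powr (2 * \<kappa> - 5)" by (simp add: Y_def algebra_simps)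
  finally show ?thesis unfolding id .
qed

lemma integral_abs_le:
  fixes f h :: "'a \<Rightarrow> real"
  assumes "integrable M f" "integrable M h" "\<And>x. \<bar>f x\<bar> \<le> h x"
  shows "\<bar>\<integral>x. f x \<partial>M\<bar> \<le> (\<integral>x. h x \<partial>M)"
proof -
  have "\<bar>\<integral>x. f x \<partial>M\<bar> \<le> (\<integral>x. \<bar>f x\<bar> \<partial>M)" using integral_norm_bound[of M f] by simp
  also have "\<dots> \<le> (\<integral>x. h x \<partial>M)" using assms by (intro integral_mono) auto
  finally show ?thesis .
qed

text \<open>For a unit vector e and w(y) = G(|y|^2) this is (w(z + r e) + w(z - r e))/2 - w(z),
  expanded so that the dependence on r is explicit. It is not tied to a profile because it is
  applied to bumps and to the kernel as well. For the G of a profile, its integral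
  \<open>ffun\<close> is the f of the overview.\<close>

definition Gbr :: "(real \<Rightarrow> real) \<Rightarrow> 'a::euclidean_space \<Rightarrow> real \<Rightarrow> 'a \<Rightarrow> real" where
  "Gbr G e r z = (G ((norm z)\<^sup>2 + 2 * r * (e \<bullet> z) + r\<^sup>2) + G ((norm z)\<^sup>2 - 2 * r * (e \<bullet> z) + r\<^sup>2)) / 2 - G ((norm z)\<^sup>2)"

definition ffun :: "real \<Rightarrow> (real \<Rightarrow> real) \<Rightarrow> 'a::euclidean_space \<Rightarrow> real \<Rightarrow> real" where
  "ffun s G e r = (\<integral>z. Gbr G e r z * norm z powr (- (real DIM('a) + 2 * s)) \<partial>lborel)"

lemma Gbr_0 [simp]: "Gbr G e 0 z = 0" by (simp add: Gbr_def)

lemma second_order_bound: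
  fixes F F' F'' :: "real \<Rightarrow> real"
  assumes "\<And>x. x \<in> {-1..1} \<Longrightarrow> (F has_real_derivative F' x) (at x)"
    "\<And>x. x \<in> {-1..1} \<Longrightarrow> (F' has_real_derivative F'' x) (at x)"
    "\<And>x. x \<in> {-1..1} \<Longrightarrow> \<bar>F'' x\<bar> \<le> B"
    "x \<in> {-1..1}" "y \<in> {-1..1}"
  shows "\<bar>F' x - F' y\<bar> \<le> B * \<bar>x - y\<bar>" "\<bar>F y - F x - (y - x) * F' x\<bar> \<le> B * (y - x)\<^sup>2"
proof -
  have lip: "\<bar>F' x - F' y\<bar> \<le> B * \<bar>x - y\<bar>" if "x \<in> {-1..1}" "y \<in> {-1..1}" for x y
  proof -
    have "norm (F' x - F' y) \<le> B * norm (x - y)"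
      using assms(2,3) that
      by (intro field_differentiable_bound[of "{-1..1}" F' F'']) (auto intro: has_field_derivative_at_within)
    then show ?thesis by simp
  qed
  show "\<bar>F' x - F' y\<bar> \<le> B * \<bar>x - y\<bar>" using lip assms by blast
  have "norm ((F y - (y - x) * F' x) - (F x - (x - x) * F' x)) \<le> (B * \<bar>y - x\<bar>) * norm (y - x)"
  proof (rule field_differentiable_bound[of "{min x y..max x y}" "\<lambda>t. F t - (t - x) * F' x" "\<lambda>t. F' t - F' x"])
    fix t assume t: "t \<in> {min x y..max x y}"
    then have t1: "t \<in> {-1..1}" using assms by (auto simp: min_def max_def split: if_splits)
    show "((\<lambda>t. F t - (t - x) * F' x) has_field_derivative F' t - F' x) (at t within {min x y..max x y})"
      by (rule has_field_derivative_at_within) (auto intro!: derivative_eq_intros assms(1)[OF t1])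
    have "B \<ge> 0" using assms(3)[of 0] by auto
    moreover have "\<bar>t - x\<bar> \<le> \<bar>y - x\<bar>" using t by (auto simp: min_def max_def split: if_splits)
    ultimately have "B * \<bar>t - x\<bar> \<le> B * \<bar>y - x\<bar>" by (intro mult_left_mono)
    then show "norm (F' t - F' x) \<le> B * \<bar>y - x\<bar>" using lip[OF t1 assms(4)] by simp
  qed auto
  then show "\<bar>F y - F x - (y - x) * F' x\<bar> \<le> B * (y - x)\<^sup>2" by (simp add: power2_eq_square mult.assoc)
qed

text \<open>A profile is a function of \<sigma> = |x|^2, so that shifting \<sigma> regularises
  |x|^g. The radius 3, that is \<sigma> <= 9, leaves room: for |x| <= 1 and |z| < 2 the points z + x
  and z - x stay where u is the pure power. The square root of b bounds the radius of the
  support.\<close>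

locale profile =
  fixes s g b :: real and U :: "real \<Rightarrow> real"
  assumes s: "0 < s" "s < 1" and g: "2 * s < g" "g < 2 * s + 2" and b: "9 < b"
    and U_smooth: "smooth_all {0<..} U"
    and U_low: "\<And>\<sigma>. 0 \<le> \<sigma> \<Longrightarrow> \<sigma> \<le> 9 \<Longrightarrow> U \<sigma> = \<sigma> powr (g / 2)"
    and U_high: "\<And>\<sigma>. b \<le> \<sigma> \<Longrightarrow> U \<sigma> = 0"
begin

text \<open>The departure of u from the pure power. The cutoff at 9 extends it by zero to negative
  arguments, so that it is smooth on the whole line.\<close>

definition G :: "real \<Rightarrow> real" where "G \<sigma> = (if \<sigma> \<le> 9 then 0 else \<sigma> powr (g / 2) - U \<sigma>)"

definition D :: "nat \<Rightarrow> real \<Rightarrow> real" where "D i = (deriv ^^ i) G"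

lemma G_smooth: "smooth_all UNIV G"
  unfolding smooth_all_def
proof
  fix k
  have "smooth_n k {0<..} (\<lambda>\<sigma>. \<sigma> powr (g / 2) - U \<sigma>)"
    using U_smooth unfolding smooth_all_def by (intro smooth_n_diff smooth_n_powr) auto
  then have 1: "smooth_n k {0<..} G"
    by (rule smooth_n_cong[rotated 2]) (auto simp: G_def U_low)
  have 2: "smooth_n k {..<9} G"
    by (rule smooth_n_cong[OF _ _ smooth_n_const[of _ _ 0]]) (auto simp: G_def)
  have "smooth_n k ({0<..} \<union> {..<9}) G" using 1 2 by (intro smooth_n_Un) auto
  moreover have "{0<..} \<union> {..<9} = (UNIV :: real set)" by auto
  ultimately show "smooth_n k UNIV G" by simp
qed

lemma D_deriv: "(D i has_real_derivative D (Suc i) x) (at x)"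
  unfolding D_def by (rule smooth_all_has_deriv[OF G_smooth]) auto

lemma D_cont: "continuous_on S (D i)"
  by (intro continuous_at_imp_continuous_on ballI DERIV_isCont[OF D_deriv])

lemma D_0: "D 0 = G" by (simp add: D_def)

lemma D_low: "\<sigma> < 9 \<Longrightarrow> D i \<sigma> = 0"
proof -
  have z: "(deriv ^^ i) (\<lambda>x. 0 :: real) = (\<lambda>x. 0)" by (induction i) auto
  show "\<sigma> < 9 \<Longrightarrow> D i \<sigma> = 0"
    unfolding D_def using higher_deriv_cong[of "{..<9}" G "\<lambda>x. 0" \<sigma> i] z by (simp add: G_def)
qed

text \<open>Three ranges: G vanishes near 0, is smooth on a compact interval, and is the power
  \<sigma>^(g/2) itself beyond b.\<close>

lemma D_bound_single: "\<exists>K\<ge>0. \<forall>\<sigma>>0. \<bar>D i \<sigma>\<bar> \<le> K * \<sigma> powr (g / 2 - real i)"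
proof -
  let ?c = "\<bar>\<Prod>j<i. g / 2 - real j\<bar>"
  have "compact ((\<lambda>\<sigma>. D i \<sigma> * \<sigma> powr (real i - g / 2)) ` {1..b})"
    by (intro compact_continuous_image continuous_intros D_cont) auto
  then obtain K where "\<forall>y\<in>(\<lambda>\<sigma>. D i \<sigma> * \<sigma> powr (real i - g / 2)) ` {1..b}. norm y \<le> K"
    using compact_imp_bounded bounded_iff by blast
  then have K: "\<bar>D i \<sigma> * \<sigma> powr (real i - g / 2)\<bar> \<le> K" if "\<sigma> \<in> {1..b}" for \<sigma>
    using that by auto
  have K0: "K \<ge> 0" using K[of 1] b by simp
  have "\<bar>D i \<sigma>\<bar> \<le> (K + ?c) * \<sigma> powr (g / 2 - real i)" if "\<sigma> > 0" for \<sigma>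
  proof -
    consider "\<sigma> < 1" | "1 \<le> \<sigma>" "\<sigma> \<le> b" | "b < \<sigma>" by linarith
    then show ?thesis
    proof cases
      case 1
      then show ?thesis using D_low[of \<sigma> i] K0 by simp
    next
      case 2
      then have "\<bar>D i \<sigma>\<bar> * \<sigma> powr (real i - g / 2) \<le> K" using K[of \<sigma>] by (simp add: abs_mult)
      then have "\<bar>D i \<sigma>\<bar> * \<sigma> powr (real i - g / 2) * \<sigma> powr (g / 2 - real i) \<le> K * \<sigma> powr (g / 2 - real i)"
        by (intro mult_right_mono) auto
      moreover have "\<sigma> powr (real i - g / 2) * \<sigma> powr (g / 2 - real i) = 1"
        using that by (simp add: powr_add[symmetric])
      ultimately have "\<bar>D i \<sigma>\<bar> \<le> K * \<sigma> powr (g / 2 - real i)" by (simp add: mult.assoc)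
      also have "\<dots> \<le> (K + ?c) * \<sigma> powr (g / 2 - real i)" by (intro mult_right_mono) auto
      finally show ?thesis .
    next
      case 3
      have "D i \<sigma> = (deriv ^^ i) (\<lambda>x. x powr (g / 2)) \<sigma>"
        unfolding D_def by (rule higher_deriv_cong[of "{b<..}"]) (use 3 b in \<open>auto simp: G_def U_high\<close>)
      also have "\<dots> = (\<Prod>j<i. g / 2 - real j) * \<sigma> powr (g / 2 - real i)"
        using that by (rule higher_deriv_powr)
      finally have "\<bar>D i \<sigma>\<bar> = ?c * \<sigma> powr (g / 2 - real i)" by (simp add: abs_mult)
      also have "\<dots> \<le> (K + ?c) * \<sigma> powr (g / 2 - real i)" using K0 by (intro mult_right_mono) auto
      finally show ?thesis .
    qed
  qed
  then show ?thesis using K0 by (intro exI[of _ "K + ?c"]) auto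
qed

lemma D_bound: obtains K where "K \<ge> 0" "\<And>i \<sigma>. i \<le> 5 \<Longrightarrow> \<sigma> > 0 \<Longrightarrow> \<bar>D i \<sigma>\<bar> \<le> K * \<sigma> powr (g / 2 - real i)"
proof -
  obtain Ki where Ki: "\<And>i. Ki i \<ge> 0" "\<And>i \<sigma>. \<sigma> > 0 \<Longrightarrow> \<bar>D i \<sigma>\<bar> \<le> Ki i * \<sigma> powr (g / 2 - real i)"
    using D_bound_single by metis
  show ?thesis
  proof (rule that[of "\<Sum>i\<le>5. Ki i"])
    show "0 \<le> (\<Sum>i\<le>5. Ki i)" using Ki by (intro sum_nonneg)
    fix i :: nat and \<sigma> :: real assume i: "i \<le> 5" "\<sigma> > 0"
    have "Ki i \<le> (\<Sum>i\<le>5. Ki i)" using i Ki by (intro member_le_sum) auto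
    then show "\<bar>D i \<sigma>\<bar> \<le> (\<Sum>i\<le>5. Ki i) * \<sigma> powr (g / 2 - real i)"
      using Ki(2)[OF i(2)] by (meson mult_right_mono order_trans powr_ge_zero)
  qed
qed

text \<open>\<open>H1\<close> and \<open>H2\<close> are the first and second derivatives of
  \<open>Gbr G e r z\<close> in r.\<close>

definition H1 :: "'a::euclidean_space \<Rightarrow> real \<Rightarrow> 'a \<Rightarrow> real" where
  "H1 e r z = (D 1 ((norm z)\<^sup>2 + 2 * r * (e \<bullet> z) + r\<^sup>2) * (2 * (e \<bullet> z) + 2 * r)
     + D 1 ((norm z)\<^sup>2 - 2 * r * (e \<bullet> z) + r\<^sup>2) * (- 2 * (e \<bullet> z) + 2 * r)) / 2"

definition H2 :: "'a::euclidean_space \<Rightarrow> real \<Rightarrow> 'a \<Rightarrow> real" where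
  "H2 e r z = (D 2 ((norm z)\<^sup>2 + 2 * r * (e \<bullet> z) + r\<^sup>2) * (2 * (e \<bullet> z) + 2 * r)\<^sup>2 + 2 * D 1 ((norm z)\<^sup>2 + 2 * r * (e \<bullet> z) + r\<^sup>2)
     + (D 2 ((norm z)\<^sup>2 - 2 * r * (e \<bullet> z) + r\<^sup>2) * (- 2 * (e \<bullet> z) + 2 * r)\<^sup>2 + 2 * D 1 ((norm z)\<^sup>2 - 2 * r * (e \<bullet> z) + r\<^sup>2))) / 2"

lemma H1_0[simp]: "H1 e 0 z = 0" by (simp add: H1_def)

lemma Gbr_deriv: "((\<lambda>r. Gbr G e r z) has_real_derivative H1 e r z) (at r)"
proof -
  have d: "((\<lambda>r. G ((norm z)\<^sup>2 + 2 * r * c + r\<^sup>2)) has_real_derivative D 1 ((norm z)\<^sup>2 + 2 * r * c + r\<^sup>2) * (2 * c + 2 * r)) (at r)" for c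
    using D_deriv[of 0] unfolding D_0 by (intro DERIV_chain2[where f = G]) (auto intro!: derivative_eq_intros)
  show ?thesis
    using DERIV_add[OF d[of "e \<bullet> z"] d[of "- (e \<bullet> z)"], THEN DERIV_cdivide, of 2]
    unfolding Gbr_def[abs_def] H1_def
    by (intro DERIV_cong[OF DERIV_diff[OF _ DERIV_const]]) auto
qed

lemma H1_deriv: "((\<lambda>r. H1 e r z) has_real_derivative H2 e r z) (at r)"
proof -
  have d: "((\<lambda>r. D 1 ((norm z)\<^sup>2 + 2 * r * c + r\<^sup>2) * (2 * c + 2 * r)) has_real_derivative
     D 2 ((norm z)\<^sup>2 + 2 * r * c + r\<^sup>2) * (2 * c + 2 * r)\<^sup>2 + 2 * D 1 ((norm z)\<^sup>2 + 2 * r * c + r\<^sup>2)) (at r)" for c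
  proof -
    have "((\<lambda>r. D 1 ((norm z)\<^sup>2 + 2 * r * c + r\<^sup>2)) has_real_derivative D 2 ((norm z)\<^sup>2 + 2 * r * c + r\<^sup>2) * (2 * c + 2 * r)) (at r)"
      using D_deriv[of 1] by (intro DERIV_chain2[where f = "D 1"]) (auto intro!: derivative_eq_intros simp: numeral_2_eq_2)
    moreover have "((\<lambda>r. 2 * c + 2 * r) has_real_derivative 2) (at r)" by (auto intro!: derivative_eq_intros)
    ultimately show ?thesis by (rule DERIV_cong[OF DERIV_mult]) (simp add: power2_eq_square algebra_simps)
  qed
  show ?thesis
    using DERIV_add[OF d[of "e \<bullet> z"] d[of "- (e \<bullet> z)"], THEN DERIV_cdivide, of 2]
    unfolding H1_def[abs_def] H2_def by simp
qed

text \<open>For |z| < 2 all arguments of D are below 9, where D vanishes. Beyond, two derivatives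
  lower the growth |z|^g to |z|^(g-2), and g - 2 < 2s is what the kernel tolerates at
  infinity.\<close>

lemma H2_bound: obtains K where "K \<ge> 0"
  "\<And>(e :: 'a::euclidean_space) r z. norm e = 1 \<Longrightarrow> \<bar>r\<bar> \<le> 1 \<Longrightarrow> \<bar>H2 e r z\<bar> \<le> K * (indicator {2..} (norm z) * norm z powr (g - 2))"
proof -
  obtain K where K: "K \<ge> 0" "\<And>i \<sigma>. i \<le> 5 \<Longrightarrow> \<sigma> > 0 \<Longrightarrow> \<bar>D i \<sigma>\<bar> \<le> K * \<sigma> powr (g / 2 - real i)"
    by (rule D_bound) blast
  let ?M = "\<lambda>a. (1/4) powr a + (9/4) powr a :: real"
  define C where "C = K * (?M (g/2 - 2) * 16 + 2 * ?M (g/2 - 1))"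
  have Mpos: "?M a \<ge> 0" for a by (simp add: add_nonneg_nonneg)
  have C0: "C \<ge> 0" unfolding C_def using K Mpos by (intro mult_nonneg_nonneg add_nonneg_nonneg) auto
  show ?thesis
  proof (rule that[OF C0])
    fix e z :: 'a and r :: real assume e: "norm e = 1" and r: "\<bar>r\<bar> \<le> 1"
    define \<rho> where "\<rho> = norm z"
    have \<rho>0: "\<rho> \<ge> 0" by (simp add: \<rho>_def)
    have cz: "\<bar>e \<bullet> z\<bar> \<le> \<rho>" using Cauchy_Schwarz_ineq2[of e z] e by (simp add: \<rho>_def)
    have half: "\<bar>D 2 (\<rho>\<^sup>2 + 2 * r * c + r\<^sup>2) * (2 * c + 2 * r)\<^sup>2 + 2 * D 1 (\<rho>\<^sup>2 + 2 * r * c + r\<^sup>2)\<bar>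
      \<le> C * (indicator {2..} \<rho> * \<rho> powr (g - 2))" if c: "\<bar>c\<bar> \<le> \<rho>" for c
    proof (cases "\<rho> \<ge> 2")
      case False
      have "\<bar>r * c\<bar> \<le> 1 * \<rho>" unfolding abs_mult using r c \<rho>0 by (intro mult_mono) auto
      moreover have "r\<^sup>2 \<le> 1" using r by (simp add: abs_square_le_1)
      moreover have "\<rho>\<^sup>2 < 2\<^sup>2" using False \<rho>0 by (intro power_strict_mono) auto
      ultimately have "\<rho>\<^sup>2 + 2 * r * c + r\<^sup>2 < 9" using False by (auto simp: abs_le_iff)
      then show ?thesis using D_low C0 False by simp
    next
      case True
      define \<xi> where "\<xi> = \<rho>\<^sup>2 + 2 * r * c + r\<^sup>2"
      have w: "\<rho>\<^sup>2 / 4 \<le> \<xi>" "\<xi> \<le> 9/4 * \<rho>\<^sup>2"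
        using shifted_square_window(1,2)[OF True c r, of 1] by (auto simp: \<xi>_def)
      have r2: "\<rho>\<^sup>2 > 0" using True by simp
      then have \<xi>0: "\<xi> > 0" using w by linarith
      have p: "\<xi> powr a \<le> ?M a * \<rho> powr (2 * a)" for a
        using powr_window[OF r2 w, of a] True by (simp add: square_powr)
      have "\<bar>D 2 \<xi>\<bar> \<le> K * \<xi> powr (g/2 - 2)" using K(2)[of 2 \<xi>] \<xi>0 by simp
      also have "\<dots> \<le> K * (?M (g/2 - 2) * \<rho> powr (2 * (g/2 - 2)))" by (rule mult_left_mono[OF p K(1)])
      finally have d2: "\<bar>D 2 \<xi>\<bar> \<le> K * ?M (g/2 - 2) * \<rho> powr (g - 4)" by (simp add: mult.assoc)
      have "\<bar>D 1 \<xi>\<bar> \<le> K * \<xi> powr (g/2 - 1)" using K(2)[of 1 \<xi>] \<xi>0 by simp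
      also have "\<dots> \<le> K * (?M (g/2 - 1) * \<rho> powr (2 * (g/2 - 1)))" by (rule mult_left_mono[OF p K(1)])
      finally have d1: "\<bar>D 1 \<xi>\<bar> \<le> K * ?M (g/2 - 1) * \<rho> powr (g - 2)" by (simp add: mult.assoc)
      have "(2 * c + 2 * r)\<^sup>2 \<le> (4 * \<rho>)\<^sup>2"
        using c r True by (intro abs_le_square_iff[THEN iffD1]) auto
      then have "\<bar>D 2 \<xi>\<bar> * (2 * c + 2 * r)\<^sup>2 \<le> (K * ?M (g/2 - 2) * \<rho> powr (g - 4)) * (16 * \<rho>\<^sup>2)"
        using K Mpos by (intro mult_mono d2 mult_nonneg_nonneg) (auto simp: power_mult_distrib)
      also have "\<dots> = K * ?M (g/2 - 2) * 16 * (\<rho> powr (g - 4) * \<rho>\<^sup>2)" by (simp add: algebra_simps)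
      also have "\<rho> powr (g - 4) * \<rho>\<^sup>2 = \<rho> powr (g - 2)" using True by (simp add: powr_mult_square)
      finally have "\<bar>D 2 \<xi> * (2 * c + 2 * r)\<^sup>2\<bar> \<le> K * ?M (g/2 - 2) * 16 * \<rho> powr (g - 2)" by (simp add: abs_mult)
      then have "\<bar>D 2 \<xi> * (2 * c + 2 * r)\<^sup>2 + 2 * D 1 \<xi>\<bar> \<le> K * ?M (g/2 - 2) * 16 * \<rho> powr (g - 2) + 2 * (K * ?M (g/2 - 1) * \<rho> powr (g - 2))"
        using d1 by (simp add: abs_le_iff)
      also have "\<dots> = C * \<rho> powr (g - 2)" by (simp add: C_def algebra_simps)
      finally show ?thesis using True by (simp add: \<xi>_def)
    qed
    show "\<bar>H2 e r z\<bar> \<le> C * (indicator {2..} (norm z) * norm z powr (g - 2))"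
      using half[OF cz] half[of "- (e \<bullet> z)"] cz unfolding H2_def \<rho>_def by (simp add: abs_le_iff)
  qed
qed

lemma borel_measurable_D[measurable]: "D i \<in> borel_measurable borel"
  using D_cont[of UNIV] by (rule borel_measurable_continuous_onI)

lemma borel_measurable_G[measurable]: "G \<in> borel_measurable borel"
  using borel_measurable_D[of 0] by (simp add: D_0)

lemma borel_measurable_Gbr[measurable]: "Gbr G e r \<in> borel_measurable borel"
  unfolding Gbr_def[abs_def] by measurable

lemma borel_measurable_H1[measurable]: "H1 e r \<in> borel_measurable borel"
  unfolding H1_def[abs_def] by measurable

definition wt :: "'a::euclidean_space \<Rightarrow> real" where
  "wt z = indicator {2..} (norm z) * norm z powr (g - 2)"

lemma wt_nonneg: "wt z \<ge> 0" by (simp add: wt_def)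

lemma borel_measurable_wt[measurable]: "wt \<in> borel_measurable borel"
  unfolding wt_def[abs_def] by measurable

lemma integrable_wt_bound:
  fixes F :: "'a::euclidean_space \<Rightarrow> real"
  assumes "F \<in> borel_measurable borel" "\<And>z. \<bar>F z\<bar> \<le> K * wt z"
  shows "integrable lborel (\<lambda>z. F z * norm z powr (- (real DIM('a) + 2 * s)))"
\<comment> \<open>F vanishes on the unit ball, so any exponent above 2s serves near the
  origin.\<close>
proof (rule integrable_kernel[where \<alpha> = "2 * s + 1" and \<beta> = "g - 2" and K = "\<bar>K\<bar>"])
  show "\<bar>F z\<bar> \<le> \<bar>K\<bar> * norm z powr (2 * s + 1)" if "norm z \<le> 1" for z
    using assms(2)[of z] that by (simp add: wt_def)
  show "\<bar>F z\<bar> \<le> \<bar>K\<bar> * norm z powr (g - 2)" if "norm z > 1" for z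
  proof -
    have "\<bar>F z\<bar> \<le> \<bar>K\<bar> * wt z" using assms(2)[of z] mult_right_mono[OF abs_ge_self wt_nonneg, of K z] by linarith
    also have "\<dots> \<le> \<bar>K\<bar> * norm z powr (g - 2)" by (intro mult_left_mono) (auto simp: wt_def indicator_def)
    finally show ?thesis .
  qed
qed (use assms g in auto)

text \<open>Fixing one constant for all e, r and z makes it a term, so that it can occur in
  \<open>Lc\<close> and in later statements.\<close>

definition kbound :: "'a::euclidean_space itself \<Rightarrow> real" where
  "kbound _ = (SOME K. K \<ge> 0 \<and> (\<forall>(e :: 'a) r z. norm e = 1 \<longrightarrow> \<bar>r\<bar> \<le> 1 \<longrightarrow> \<bar>H2 e r z\<bar> \<le> K * wt z))"

lemma kbound: "kbound TYPE('a) \<ge> 0"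
  "norm e = 1 \<Longrightarrow> \<bar>r\<bar> \<le> 1 \<Longrightarrow> \<bar>H2 (e::'a::euclidean_space) r z\<bar> \<le> kbound TYPE('a) * wt z"
proof -
  have "\<exists>K. K \<ge> 0 \<and> (\<forall>(e :: 'a) r z. norm e = 1 \<longrightarrow> \<bar>r\<bar> \<le> 1 \<longrightarrow> \<bar>H2 e r z\<bar> \<le> K * wt z)"
    unfolding wt_def by (rule H2_bound) blast
  then have "kbound TYPE('a) \<ge> 0 \<and> (\<forall>(e :: 'a) r z. norm e = 1 \<longrightarrow> \<bar>r\<bar> \<le> 1 \<longrightarrow> \<bar>H2 e r z\<bar> \<le> kbound TYPE('a) * wt z)"
    unfolding kbound_def by (rule someI_ex)
  then show "kbound TYPE('a) \<ge> 0" "norm e = 1 \<Longrightarrow> \<bar>r\<bar> \<le> 1 \<Longrightarrow> \<bar>H2 e r z\<bar> \<le> kbound TYPE('a) * wt z" by auto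
qed

lemma second_order:
  fixes e z :: "'a::euclidean_space"
  assumes "norm e = 1" "\<bar>x\<bar> \<le> 1" "\<bar>y\<bar> \<le> 1"
  shows "\<bar>H1 e x z - H1 e y z\<bar> \<le> kbound TYPE('a) * wt z * \<bar>x - y\<bar>"
    "\<bar>Gbr G e y z - Gbr G e x z - (y - x) * H1 e x z\<bar> \<le> kbound TYPE('a) * wt z * (y - x)\<^sup>2"
proof -
  have xy: "x \<in> {-1..1}" "y \<in> {-1..1}" using assms by auto
  have b: "\<bar>H2 e x z\<bar> \<le> kbound TYPE('a) * wt z" if "x \<in> {-1..1}" for x
    using that by (intro kbound assms) auto
  show "\<bar>H1 e x z - H1 e y z\<bar> \<le> kbound TYPE('a) * wt z * \<bar>x - y\<bar>"
    by (rule second_order_bound(1)[OF Gbr_deriv H1_deriv b xy])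
  show "\<bar>Gbr G e y z - Gbr G e x z - (y - x) * H1 e x z\<bar> \<le> kbound TYPE('a) * wt z * (y - x)\<^sup>2"
    by (rule second_order_bound(2)[OF Gbr_deriv H1_deriv b xy])
qed

lemma Gbr_bound:
  fixes e z :: "'a::euclidean_space"
  assumes "norm e = 1" "\<bar>r\<bar> \<le> 1"
  shows "\<bar>Gbr G e r z\<bar> \<le> kbound TYPE('a) * wt z * r\<^sup>2"
  using second_order(2)[OF assms(1), of 0 r z] assms by simp

lemma integrable_Gbr:
  fixes e :: "'a::euclidean_space"
  assumes "norm e = 1" "\<bar>r\<bar> \<le> 1"
  shows "integrable lborel (\<lambda>z. Gbr G e r z * norm z powr (- (real DIM('a) + 2 * s)))"
  using Gbr_bound[OF assms] by (intro integrable_wt_bound[where K = "kbound TYPE('a) * r\<^sup>2"]) (auto simp: algebra_simps)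

lemma integrable_H1:
  fixes e :: "'a::euclidean_space"
  assumes "norm e = 1" "\<bar>r\<bar> \<le> 1"
  shows "integrable lborel (\<lambda>z. H1 e r z * norm z powr (- (real DIM('a) + 2 * s)))"
  using second_order(1)[OF assms(1), of r 0] assms
  by (intro integrable_wt_bound[where K = "kbound TYPE('a) * \<bar>r\<bar>"]) (auto simp: algebra_simps)

text \<open>The derivative of \<open>ffun\<close> in r, by \<open>ffun_deriv\<close>; the constant
  \<open>Lc\<close> is a Lipschitz constant of it.\<close>

definition f1 :: "'a::euclidean_space \<Rightarrow> real \<Rightarrow> real" where
  "f1 e r = (\<integral>z. H1 e r z * norm z powr (- (real DIM('a) + 2 * s)) \<partial>lborel)"

definition Lc :: "'a::euclidean_space itself \<Rightarrow> real" where
  "Lc _ = kbound TYPE('a) * (\<integral>z. wt (z::'a) * norm z powr (- (real DIM('a) + 2 * s)) \<partial>lborel)"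

lemma integral_wt_bound:
  fixes F :: "'a::euclidean_space \<Rightarrow> real"
  assumes "F \<in> borel_measurable borel" "\<And>z. \<bar>F z\<bar> \<le> kbound TYPE('a) * wt z * C"
  shows "\<bar>\<integral>z. F z * norm z powr (- (real DIM('a) + 2 * s)) \<partial>lborel\<bar> \<le> Lc TYPE('a) * C"
proof -
  have "\<bar>\<integral>z. F z * norm z powr (- (real DIM('a) + 2 * s)) \<partial>lborel\<bar>
     \<le> (\<integral>z. kbound TYPE('a) * C * (wt (z::'a) * norm z powr (- (real DIM('a) + 2 * s))) \<partial>lborel)"
  proof (rule integral_abs_le)
    show "integrable lborel (\<lambda>z. F z * norm z powr (- (real DIM('a) + 2 * s)))"
      using assms by (intro integrable_wt_bound[where K = "kbound TYPE('a) * C"]) (auto simp: algebra_simps)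
    have "integrable lborel (\<lambda>z::'a. wt z * norm z powr (- (real DIM('a) + 2 * s)))"
      by (intro integrable_wt_bound[where K = 1]) (auto simp: wt_nonneg)
    then show "integrable lborel (\<lambda>z::'a. kbound TYPE('a) * C * (wt z * norm z powr (- (real DIM('a) + 2 * s))))"
      by (rule integrable_mult_right)
    fix z
    have "\<bar>F z\<bar> * norm z powr (- (real DIM('a) + 2 * s)) \<le> kbound TYPE('a) * wt z * C * norm z powr (- (real DIM('a) + 2 * s))"
      using assms by (intro mult_right_mono) auto
    then show "\<bar>F z * norm z powr (- (real DIM('a) + 2 * s))\<bar> \<le> kbound TYPE('a) * C * (wt z * norm z powr (- (real DIM('a) + 2 * s)))"
      by (simp add: abs_mult algebra_simps)
  qed
  also have "\<dots> = kbound TYPE('a) * C * (\<integral>z. wt (z::'a) * norm z powr (- (real DIM('a) + 2 * s)) \<partial>lborel)"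
    by (rule integral_mult_right_zero)
  finally show ?thesis by (simp only: Lc_def mult.assoc mult.commute mult.left_commute)
qed

lemma Lc_nonneg: "Lc TYPE('a::euclidean_space) \<ge> 0"
  unfolding Lc_def by (intro mult_nonneg_nonneg kbound integral_nonneg_AE AE_I2) (auto simp: wt_nonneg)

lemma f1_lipschitz:
  fixes e :: "'a::euclidean_space"
  assumes "norm e = 1" "\<bar>x\<bar> \<le> 1" "\<bar>y\<bar> \<le> 1"
  shows "\<bar>f1 e x - f1 e y\<bar> \<le> Lc TYPE('a) * \<bar>x - y\<bar>"
proof -
  have "f1 e x - f1 e y = (\<integral>z. (H1 e x z - H1 e y z) * norm z powr (- (real DIM('a) + 2 * s)) \<partial>lborel)"
    unfolding f1_def left_diff_distrib by (rule Bochner_Integration.integral_diff[symmetric]) (use integrable_H1 assms in auto)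
  also have "\<bar>\<dots>\<bar> \<le> Lc TYPE('a) * \<bar>x - y\<bar>"
    using second_order(1)[OF assms] by (intro integral_wt_bound) auto
  finally show ?thesis .
qed

lemma f1_0[simp]: "f1 e 0 = 0" by (simp add: f1_def)

lemma ffun_0[simp]: "ffun s G e 0 = 0" by (simp add: ffun_def)

text \<open>Integrating the pointwise second-order estimate against the kernel gives
  differentiability of f without a separate theorem on parameter integrals. The Lipschitz bound on
  its derivative is what later gives the Hoelder continuity of the gradient of V.\<close>

lemma ffun_second_order:
  fixes e :: "'a::euclidean_space"
  assumes "norm e = 1" "\<bar>x\<bar> \<le> 1" "\<bar>y\<bar> \<le> 1"
  shows "\<bar>ffun s G e y - ffun s G e x - (y - x) * f1 e x\<bar> \<le> Lc TYPE('a) * (y - x)\<^sup>2"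
proof -
  let ?k = "\<lambda>z::'a. norm z powr (- (real DIM('a) + 2 * s))"
  have "(\<integral>z. (Gbr G e y z - Gbr G e x z - (y - x) * H1 e x z) * ?k z \<partial>lborel)
      = (\<integral>z. Gbr G e y z * ?k z - Gbr G e x z * ?k z - (y - x) * (H1 e x z * ?k z) \<partial>lborel)"
    by (simp add: algebra_simps)
  also have "\<dots> = ffun s G e y - ffun s G e x - (y - x) * f1 e x"
    unfolding f1_def ffun_def
    using integrable_Gbr[OF assms(1,2)] integrable_Gbr[OF assms(1,3)] integrable_H1[OF assms(1,2)] by simp
  finally have "ffun s G e y - ffun s G e x - (y - x) * f1 e x = (\<integral>z. (Gbr G e y z - Gbr G e x z - (y - x) * H1 e x z) * ?k z \<partial>lborel)" ..
  also have "\<bar>\<dots>\<bar> \<le> Lc TYPE('a) * (y - x)\<^sup>2"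
    using second_order(2)[OF assms] by (intro integral_wt_bound) auto
  finally show ?thesis .
qed

lemma ffun_deriv:
  fixes e :: "'a::euclidean_space"
  assumes "norm e = 1" "\<bar>x\<bar> < 1"
  shows "(ffun s G e has_real_derivative f1 e x) (at x)"
  unfolding has_field_derivative_iff
proof (rule Lim_null[THEN iffD2], rule Lim_null_comparison)
  have "((\<lambda>y. Lc TYPE('a) * \<bar>y - x\<bar>) \<longlongrightarrow> Lc TYPE('a) * \<bar>x - x\<bar>) (at x)"
    by (intro tendsto_intros)
  then show "((\<lambda>y. Lc TYPE('a) * \<bar>y - x\<bar>) \<longlongrightarrow> 0) (at x)" by simp
  have "\<forall>\<^sub>F y in at x. y \<in> {-1<..<1}"
    using assms by (intro eventually_at_in_open') auto
  moreover have "\<forall>\<^sub>F y in at x. y \<noteq> x" by (simp add: eventually_at_filter)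
  ultimately show "\<forall>\<^sub>F y in at x. norm ((ffun s G e y - ffun s G e x) / (y - x) - f1 e x) \<le> Lc TYPE('a) * \<bar>y - x\<bar>"
  proof eventually_elim
    fix y :: real assume y: "y \<in> {-1<..<1}" "y \<noteq> x"
    have ub: "\<bar>ffun s G e y - ffun s G e x - (y - x) * f1 e x\<bar> \<le> Lc TYPE('a) * \<bar>y - x\<bar> * \<bar>y - x\<bar>"
      using ffun_second_order[of e x y] assms y abs_le_iff[of y 1] by (simp add: power2_eq_square mult.assoc)
    have "(ffun s G e y - ffun s G e x) / (y - x) - f1 e x = (ffun s G e y - ffun s G e x - (y - x) * f1 e x) / (y - x)"
      using y by (simp add: diff_divide_distrib)
    then have "norm ((ffun s G e y - ffun s G e x) / (y - x) - f1 e x) = \<bar>ffun s G e y - ffun s G e x - (y - x) * f1 e x\<bar> / \<bar>y - x\<bar>"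
      by (simp only: real_norm_def abs_divide)
    also have "\<dots> \<le> (Lc TYPE('a) * \<bar>y - x\<bar> * \<bar>y - x\<bar>) / \<bar>y - x\<bar>"
      using ub by (rule divide_right_mono) simp
    finally show "norm ((ffun s G e y - ffun s G e x) / (y - x) - f1 e x) \<le> Lc TYPE('a) * \<bar>y - x\<bar>" using y by simp
  qed
qed

text \<open>The pointwise expansion \<open>avg_expansion\<close>, with coefficients and remainder
  dominated by multiples of \<open>wt\<close>, is integrated against the kernel. The values m2 and
  m4 are left undetermined; the bumps cancel them whatever they are.\<close>

lemma ffun_expansion:
  fixes e :: "'a::euclidean_space"
  assumes e: "norm e = 1"
  obtains m2 m4 K where "\<And>r. 0 \<le> r \<Longrightarrow> r \<le> 1 \<Longrightarrow> \<bar>ffun s G e r - r\<^sup>2 * m2 - r^4 * m4\<bar> \<le> K * r^5"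
proof -
  obtain K where K: "K \<ge> 0" "\<And>i \<sigma>. i \<le> 5 \<Longrightarrow> \<sigma> > 0 \<Longrightarrow> \<bar>D i \<sigma>\<bar> \<le> K * \<sigma> powr (g / 2 - real i)"
    by (rule D_bound) blast
  let ?k = "\<lambda>z::'a. norm z powr (- (real DIM('a) + 2 * s))"
  let ?a2 = "\<lambda>z. avg2 ((norm z)\<^sup>2) (e \<bullet> z) D" and ?a4 = "\<lambda>z. avg4 ((norm z)\<^sup>2) (e \<bullet> z) D"
  have cz: "\<bar>e \<bullet> z\<bar> \<le> norm z" for z using Cauchy_Schwarz_ineq2[of e z] e by simp
  have small: "D i ((norm z)\<^sup>2) = 0" if "norm z < 2" for i and z :: 'a
    using power_strict_mono[OF that, of 2] by (intro D_low) auto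
  have Dk: "\<bar>D i ((norm z)\<^sup>2)\<bar> \<le> K * norm z powr (g - 2 * real i)" if "i \<le> 5" "norm z \<ge> 2" for i and z :: 'a
  proof -
    have "z \<noteq> 0" using that by auto
    then show ?thesis using K(2)[OF that(1), of "(norm z)\<^sup>2"] that by (simp add: square_powr algebra_simps)
  qed
  have c2: "(e \<bullet> z)\<^sup>2 \<le> (norm z)\<^sup>2" "(e \<bullet> z)^4 \<le> (norm z)^4" for z
    using cz[of z] power_mono[of "\<bar>e \<bullet> z\<bar>" "norm z" 4] by (auto simp: abs_le_square_iff[symmetric])
  have pw: "norm z powr a * (norm z)^n = norm z powr (a + real n)" if "norm z \<ge> 2" for z :: 'a and a n
  proof -
    have "norm z > 0" using that by linarith
    then show ?thesis by (simp add: powr_add powr_realpow)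
  qed
  have b2: "\<bar>?a2 z\<bar> \<le> 3 * K * wt z" for z
  proof (cases "norm z < 2")
    case True then show ?thesis using small[OF True] K wt_nonneg[of z] by (simp add: avg2_def)
  next
    case False
    then have z: "norm z \<ge> 2" by simp
    have "\<bar>D 2 ((norm z)\<^sup>2) * (e \<bullet> z)\<^sup>2\<bar> \<le> K * norm z powr (g - 2 * real 2) * (norm z)\<^sup>2"
      unfolding abs_mult using Dk[of 2 z] c2[of z] z K by (intro mult_mono) auto
    also have "\<dots> = K * norm z powr (g - 2)" using pw[OF z, of "g - 4" 2] by (simp add: mult.assoc)
    finally show ?thesis using Dk[of 1 z] z unfolding avg2_def wt_def by simp
  qed
  have b4: "\<bar>?a4 z\<bar> \<le> 4 * K * wt z" for z
  proof (cases "norm z < 2")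
    case True then show ?thesis using small[OF True] K wt_nonneg[of z] by (simp add: avg4_def)
  next
    case False
    then have z: "norm z \<ge> 2" by simp
    have "\<bar>D 3 ((norm z)\<^sup>2) * (e \<bullet> z)\<^sup>2\<bar> \<le> K * norm z powr (g - 2 * real 3) * (norm z)\<^sup>2"
      unfolding abs_mult using Dk[of 3 z] c2[of z] z K by (intro mult_mono) auto
    also have "\<dots> = K * norm z powr (g - 4)" using pw[OF z, of "g - 6" 2] by (simp add: mult.assoc)
    finally have 3: "\<bar>D 3 ((norm z)\<^sup>2) * (e \<bullet> z)\<^sup>2\<bar> \<le> K * norm z powr (g - 4)" .
    have "\<bar>D 4 ((norm z)\<^sup>2) * (e \<bullet> z)^4\<bar> \<le> K * norm z powr (g - 2 * real 4) * (norm z)^4"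
      unfolding abs_mult using Dk[of 4 z] c2[of z] z K by (intro mult_mono) auto
    also have "\<dots> = K * norm z powr (g - 4)" using pw[OF z, of "g - 8" 4] by (simp add: mult.assoc)
    finally have 4: "\<bar>D 4 ((norm z)\<^sup>2) * (e \<bullet> z)^4\<bar> \<le> K * norm z powr (g - 4)" .
    have 2: "\<bar>D 2 ((norm z)\<^sup>2)\<bar> \<le> K * norm z powr (g - 4)" using Dk[of 2 z] z by simp
    have "\<bar>?a4 z\<bar> \<le> 4 * (K * norm z powr (g - 4))" using 2 3 4 unfolding avg4_def by linarith
    also have "K * norm z powr (g - 4) \<le> K * norm z powr (g - 2)" using z K by (intro mult_left_mono powr_mono) auto
    finally show ?thesis using z unfolding wt_def by simp
  qed
  have m2: "(\<lambda>z. ?a2 z) \<in> borel_measurable borel" "(\<lambda>z. ?a4 z) \<in> borel_measurable borel"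
    unfolding avg2_def avg4_def by measurable
  have i2: "integrable lborel (\<lambda>z. ?a2 z * ?k z)" by (rule integrable_wt_bound[OF m2(1) b2])
  have i4: "integrable lborel (\<lambda>z. ?a4 z * ?k z)" by (rule integrable_wt_bound[OF m2(2) b4])
  define C where "C = (243 * ((1/4) powr (g/2 - 5) + (9/4) powr (g/2 - 5)) + 3) * K"
  have C0: "C \<ge> 0" unfolding C_def using K by (intro mult_nonneg_nonneg add_nonneg_nonneg) auto
  have rem: "\<bar>Gbr G e r z - r\<^sup>2 * ?a2 z - r^4 * ?a4 z\<bar> \<le> C * r^5 * wt z" if r: "0 \<le> r" "r \<le> 1" for r z
  proof (cases "norm z < 2")
    case True
    have "Gbr G e r z = 0" using Gbr_bound[OF e, of r z] True r by (simp add: wt_def)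
    then show ?thesis using small[OF True] r C0 wt_nonneg[of z] by (simp add: avg2_def avg4_def)
  next
    case False
    then have z: "norm z \<ge> 2" "(norm z)\<^sup>2 > 0" by auto
    have "\<bar>(D 0 ((norm z)\<^sup>2 + 2 * r * (e \<bullet> z) + r\<^sup>2) + D 0 ((norm z)\<^sup>2 - 2 * r * (e \<bullet> z) + r\<^sup>2)) / 2 - D 0 ((norm z)\<^sup>2)
        - r\<^sup>2 * ?a2 z - r^4 * ?a4 z\<bar> \<le> (243 * ((1/4) powr (g/2 - 5) + (9/4) powr (g/2 - 5)) + 3) * K * r^5 * norm z powr (2 * (g/2) - 5)"
    proof (intro avg_expansion D_deriv r cz z(1) K(1))
      show "\<bar>D i \<xi>\<bar> \<le> K * \<xi> powr (g / 2 - real i)" if "i \<le> 5" "(norm z)\<^sup>2 / 4 \<le> \<xi>" for i \<xi>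
        using K(2)[OF that(1), of \<xi>] that(2) z(2) by linarith
    qed
    also have "\<dots> \<le> C * r^5 * norm z powr (g - 2)"
      unfolding C_def[symmetric] using z C0 r by (intro mult_left_mono powr_mono) auto
    finally show ?thesis using z by (simp add: Gbr_def D_0 wt_def)
  qed
  define W where "W = (\<integral>z. wt (z::'a) * ?k z \<partial>lborel)"
  have iw: "integrable lborel (\<lambda>z::'a. wt z * ?k z)"
    by (intro integrable_wt_bound[where K = 1]) (auto simp: wt_nonneg)
  show ?thesis
  proof (rule that[of "\<integral>z. ?a2 z * ?k z \<partial>lborel" "\<integral>z. ?a4 z * ?k z \<partial>lborel" "C * W"])
    fix r :: real assume r: "0 \<le> r" "r \<le> 1"
    have ig: "integrable lborel (\<lambda>z. Gbr G e r z * ?k z)" using integrable_Gbr[OF e, of r] r by simp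
    have eq1: "ffun s G e r - r\<^sup>2 * (\<integral>z. ?a2 z * ?k z \<partial>lborel) - r^4 * (\<integral>z. ?a4 z * ?k z \<partial>lborel)
      = (\<integral>z. Gbr G e r z * ?k z - r\<^sup>2 * (?a2 z * ?k z) - r^4 * (?a4 z * ?k z) \<partial>lborel)"
      unfolding ffun_def using ig i2 i4 by simp
    have eq2: "\<bar>\<integral>z. Gbr G e r z * ?k z - r\<^sup>2 * (?a2 z * ?k z) - r^4 * (?a4 z * ?k z) \<partial>lborel\<bar> \<le> (\<integral>z. (C * r^5) * (wt z * ?k z) \<partial>lborel)"
    proof (rule integral_abs_le)
      show "integrable lborel (\<lambda>z. Gbr G e r z * ?k z - r\<^sup>2 * (?a2 z * ?k z) - r^4 * (?a4 z * ?k z))"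
        using ig i2 i4 by simp
      show "integrable lborel (\<lambda>z::'a. (C * r^5) * (wt z * ?k z))" using iw by simp
      fix z :: 'a
      have "Gbr G e r z * ?k z - r\<^sup>2 * (?a2 z * ?k z) - r^4 * (?a4 z * ?k z) = (Gbr G e r z - r\<^sup>2 * ?a2 z - r^4 * ?a4 z) * ?k z"
        by (simp add: algebra_simps)
      then have "\<bar>Gbr G e r z * ?k z - r\<^sup>2 * (?a2 z * ?k z) - r^4 * (?a4 z * ?k z)\<bar> = \<bar>Gbr G e r z - r\<^sup>2 * ?a2 z - r^4 * ?a4 z\<bar> * ?k z"
        by (simp add: abs_mult)
      also have "\<dots> \<le> C * r^5 * wt z * ?k z" using rem[OF r, of z] by (intro mult_right_mono) auto
      finally show "\<bar>Gbr G e r z * ?k z - r\<^sup>2 * (?a2 z * ?k z) - r^4 * (?a4 z * ?k z)\<bar> \<le> (C * r^5) * (wt z * ?k z)"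
        by (simp add: mult.assoc)
    qed
    have eq3: "(\<integral>z. (C * r^5) * (wt (z::'a) * ?k z) \<partial>lborel) = (C * r^5) * W" unfolding W_def by simp
    show "\<bar>ffun s G e r - r\<^sup>2 * (\<integral>z. ?a2 z * ?k z \<partial>lborel) - r^4 * (\<integral>z. ?a4 z * ?k z \<partial>lborel)\<bar> \<le> C * W * r^5"
      using eq2 unfolding eq1 eq3 by (simp only: mult.assoc mult.commute[of "r^5"])
  qed
qed

end

section \<open>Bumps supported in an annulus\<close>

lemma open_AE_empty:
  fixes W :: "'a::euclidean_space set"
  assumes "open W" "AE x in lborel. x \<notin> W"
  shows "W = {}"
proof (rule ccontr)
  assume "W \<noteq> {}"
  then have "\<not> negligible W" using assms(1) open_not_negligible by blast
  moreover have "W \<in> null_sets lborel"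
    using assms by (subst AE_iff_null_sets) auto
  then have "negligible W" by (simp add: negligible_iff_null_sets null_sets_completionI)
  ultimately show False by simp
qed

text \<open>Read at \<sigma> = |y|^2, these are weights on the annulus 3 <= |y| <= 4. There a power
  of |y - r e| with |r| <= 1 is bounded whatever its exponent.\<close>

definition bsupp :: "(real \<Rightarrow> real) \<Rightarrow> bool" where
  "bsupp W \<longleftrightarrow> W \<in> borel_measurable borel \<and> (\<exists>C. \<forall>\<sigma>. \<bar>W \<sigma>\<bar> \<le> C) \<and> (\<forall>\<sigma>. \<sigma> \<le> 9 \<or> 16 \<le> \<sigma> \<longrightarrow> W \<sigma> = 0)"

lemma bsupp_measurable: "bsupp W \<Longrightarrow> W \<in> borel_measurable borel"
  unfolding bsupp_def by blast

lemma bsupp_zero: "bsupp W \<Longrightarrow> \<sigma> \<le> 9 \<or> 16 \<le> \<sigma> \<Longrightarrow> W \<sigma> = 0"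
  unfolding bsupp_def by blast

lemma bsupp_bounded: "bsupp W \<Longrightarrow> \<exists>C. \<forall>\<sigma>. \<bar>W \<sigma>\<bar> \<le> C"
  unfolding bsupp_def by blast

lemma bsupp_powr:
  assumes "bsupp W"
  shows "bsupp (\<lambda>\<sigma>. W \<sigma> * \<sigma> powr a)"
proof -
  obtain C where C: "\<And>\<sigma>. \<bar>W \<sigma>\<bar> \<le> C" using bsupp_bounded[OF assms] by blast
  have C0: "C \<ge> 0" using C[of 0] by linarith
  have "\<bar>W \<sigma> * \<sigma> powr a\<bar> \<le> C * (9 powr a + 16 powr a)" for \<sigma>
  proof (cases "9 < \<sigma> \<and> \<sigma> < 16")
    case True
    have "\<sigma> powr a \<le> 9 powr a + 16 powr a"
    proof (cases "a \<ge> 0")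
      case T: True
      then have "\<sigma> powr a \<le> 16 powr a" using True by (intro powr_mono2) auto
      then show ?thesis using powr_ge_zero[of 9 a] by linarith
    next
      case F: False
      then have "\<sigma> powr a \<le> 9 powr a" using True by (intro powr_mono2') auto
      then show ?thesis using powr_ge_zero[of 16 a] by linarith
    qed
    then show ?thesis unfolding abs_mult using C C0 by (intro mult_mono) auto
  next
    case False
    then have "W \<sigma> = 0" using bsupp_zero[OF assms, of \<sigma>] by linarith
    then show ?thesis using C0 by simp
  qed
  moreover have "(\<lambda>\<sigma>. W \<sigma> * \<sigma> powr a) \<in> borel_measurable borel"
    using bsupp_measurable[OF assms] by measurable
  ultimately show ?thesis using bsupp_zero[OF assms] unfolding bsupp_def by (metis mult_zero_left)
qed

lemma bsupp_integrable:
  fixes h :: "'a::euclidean_space \<Rightarrow> real"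
  assumes "bsupp W" and [measurable]: "h \<in> borel_measurable borel"
    and h: "\<And>y. 3 \<le> norm y \<Longrightarrow> norm y \<le> 4 \<Longrightarrow> \<bar>h y\<bar> \<le> C"
  shows "integrable lborel (\<lambda>y. W ((norm y)\<^sup>2) * h y)"
proof -
  obtain K where K: "\<And>\<sigma>. \<bar>W \<sigma>\<bar> \<le> K" using bsupp_bounded[OF assms(1)] by blast
  have [measurable]: "W \<in> borel_measurable borel" using assms(1) by (rule bsupp_measurable)
  show ?thesis
  proof (rule Bochner_Integration.integrable_bound)
    show "integrable lborel (\<lambda>y::'a. indicator (cball 0 4) y * (K * \<bar>C\<bar>))"
      using emeasure_lborel_cball_finite[of "0::'a" 4]
      by (intro integrable_mult_left integrable_real_indicator) auto
    show "AE y in lborel. norm (W ((norm y)\<^sup>2) * h y) \<le> norm (indicator (cball (0::'a) 4) y * (K * \<bar>C\<bar>))"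
    proof (rule AE_I2)
      fix y :: 'a
      show "norm (W ((norm y)\<^sup>2) * h y) \<le> norm (indicator (cball (0::'a) 4) y * (K * \<bar>C\<bar>))"
      proof (cases "3 \<le> norm y \<and> norm y \<le> 4")
        case True
        have "\<bar>W ((norm y)\<^sup>2)\<bar> * \<bar>h y\<bar> \<le> K * \<bar>C\<bar>"
          using K[of "(norm y)\<^sup>2"] h[of y] True by (intro mult_mono) auto
        also have "\<dots> \<le> \<bar>K * \<bar>C\<bar>\<bar>" by (rule abs_ge_self)
        finally show ?thesis using True by (simp add: abs_mult)
      next
        case False
        have "(norm y)\<^sup>2 \<le> 9 \<or> 16 \<le> (norm y)\<^sup>2"
          using False power_mono[of "norm y" 3 2] power_mono[of 4 "norm y" 2] by auto
        then have "W ((norm y)\<^sup>2) = 0" by (rule bsupp_zero[OF assms(1)])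
        then show ?thesis by simp
      qed
    qed
  qed measurable
qed

lemma bsupp_integrable_radial:
  assumes "bsupp W"
  shows "integrable lborel (\<lambda>y::'a::euclidean_space. W ((norm y)\<^sup>2))"
  using bsupp_integrable[OF assms, of "\<lambda>_::'a. 1" 1] by simp

section \<open>Second and fourth moments of radial weights\<close>

context
  fixes W :: "real \<Rightarrow> real"
  assumes W: "bsupp W"
begin

definition moment :: "nat \<Rightarrow> real^'n \<Rightarrow> real" where
  "moment k x = (\<integral>y. W ((norm y)\<^sup>2) * (x \<bullet> y) ^ k \<partial>lborel)"

lemma W_meas: "W \<in> borel_measurable borel" using W by (rule bsupp_measurable)

lemma moment_integrable: "integrable lborel (\<lambda>y::real^'n. W ((norm y)\<^sup>2) * ((x \<bullet> y) ^ k * (z \<bullet> y) ^ l))"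
proof (rule bsupp_integrable[OF W])
  fix y :: "real^'n" assume y: "norm y \<le> 4"
  have "\<bar>x \<bullet> y\<bar> \<le> norm x * 4" "\<bar>z \<bullet> y\<bar> \<le> norm z * 4"
    using Cauchy_Schwarz_ineq2[of x y] Cauchy_Schwarz_ineq2[of z y] y mult_left_mono[OF y norm_ge_zero[of x]]
      mult_left_mono[OF y norm_ge_zero[of z]] by linarith+
  then show "\<bar>(x \<bullet> y) ^ k * (z \<bullet> y) ^ l\<bar> \<le> (norm x * 4) ^ k * (norm z * 4) ^ l"
    unfolding abs_mult power_abs by (intro mult_mono power_mono) auto
qed measurable

lemma moment_rotate:
  fixes x x' :: "real^'n"
  assumes "norm x = norm x'"
  shows "moment k x = moment k x'"
proof -
  obtain f :: "real^'n \<Rightarrow> real^'n" where f: "orthogonal_transformation f" "f x = x'"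
    using orthogonal_transformation_exists[OF assms] by blast
  have inner: "f a \<bullet> f b = a \<bullet> b" for a b using f(1) by (simp add: orthogonal_transformation_def)
  have iso: "norm (f a) = norm a" for a using f(1) by (rule orthogonal_transformation_norm)
  have lin: "linear f" using f(1) by (rule orthogonal_transformation_linear)
  note W_meas[measurable]
  have "moment k x' = (\<integral>y. W ((norm (f y))\<^sup>2) * (f x \<bullet> f y) ^ k \<partial>lborel)"
    unfolding moment_def f(2)
    by (rule leb_preserving_integral[OF leb_preserving_linear_isometry[OF lin iso], symmetric]) measurable
  then show ?thesis by (simp add: inner iso moment_def)
qed

lemma moment_scale: "moment k (c *\<^sub>R x) = c ^ k * moment k x"
  unfolding moment_def by (simp add: power_mult_distrib mult.left_commute)

text \<open>By rotation invariance all N coordinates have the same second moment, and these add up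
  to the integral with |y|^2.\<close>

lemma second_moment:
  fixes e :: "real^'n"
  assumes "norm e = 1"
  shows "(\<integral>y. W ((norm y)\<^sup>2) * (norm (y::real^'n))\<^sup>2 \<partial>lborel) = real CARD('n) * moment 2 e"
proof -
  have sq: "(norm y)\<^sup>2 = (\<Sum>i\<in>Basis. (i \<bullet> y)\<^sup>2)" for y :: "real^'n"
    unfolding power2_norm_eq_inner by (subst euclidean_inner) (simp add: power2_eq_square inner_commute)
  have i: "integrable lborel (\<lambda>y::real^'n. W ((norm y)\<^sup>2) * (i \<bullet> y)\<^sup>2)" for i
    using moment_integrable[of i 2 0 0] by simp
  have "(\<integral>y. W ((norm y)\<^sup>2) * (norm (y::real^'n))\<^sup>2 \<partial>lborel) = (\<integral>y. (\<Sum>i\<in>Basis. W ((norm (y::real^'n))\<^sup>2) * (i \<bullet> y)\<^sup>2) \<partial>lborel)"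
    by (intro Bochner_Integration.integral_cong refl) (simp only: sq[symmetric] sum_distrib_left[symmetric])
  also have "\<dots> = (\<Sum>i\<in>Basis. moment 2 (i::real^'n))"
    unfolding moment_def by (rule Bochner_Integration.integral_sum) (rule i)
  also have "\<dots> = (\<Sum>i\<in>(Basis::(real^'n) set). moment 2 e)"
    using assms by (intro sum.cong moment_rotate) auto
  finally show ?thesis by simp
qed

text \<open>|y|^4 is the sum of the products of squares of coordinates. The N diagonal terms are J
  each by rotation invariance, the mixed ones J/3, and N + N(N-1)/3 = N(N+2)/3.\<close>

lemma fourth_moment:
  fixes e :: "real^'n"
  assumes e: "norm e = 1"
  shows "(\<integral>y. W ((norm y)\<^sup>2) * (norm (y::real^'n)) ^ 4 \<partial>lborel) = real CARD('n) * (real CARD('n) + 2) / 3 * moment 4 e"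
proof -
  let ?J = "moment 4 e"
  let ?B = "Basis :: (real^'n) set"
  define X where "X i j = (\<integral>y. W ((norm (y::real^'n))\<^sup>2) * ((i \<bullet> y)\<^sup>2 * (j \<bullet> y)\<^sup>2) \<partial>lborel)" for i j
  have i22: "integrable lborel (\<lambda>y::real^'n. W ((norm y)\<^sup>2) * ((i \<bullet> y)\<^sup>2 * (j \<bullet> y)\<^sup>2))" for i j
    by (rule moment_integrable)
  have i4: "integrable lborel (\<lambda>y::real^'n. W ((norm y)\<^sup>2) * (i \<bullet> y) ^ 4)" for i
    using moment_integrable[of i 4 0 0] by simp
  have diag: "X i i = ?J" if "i \<in> ?B" for i
  proof -
    have "X i i = moment 4 i" unfolding X_def moment_def by (simp add: power2_eq_square eval_nat_numeral mult.assoc)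
    also have "\<dots> = ?J" using that e by (intro moment_rotate) simp
    finally show ?thesis .
  qed
  \<comment> \<open>The vectors i + j and i - j have length sqrt 2, so their fourth moments are 4 J
    each. Expanding (u+v)^4 + (u-v)^4 gives 8 J = 4 J + 12 \<open>X i j\<close>.\<close>
  have off: "X i j = ?J / 3" if ij: "i \<in> ?B" "j \<in> ?B" "i \<noteq> j" for i j
  proof -
    have n: "(norm (i + j))\<^sup>2 = 2" "(norm (i - j))\<^sup>2 = 2"
      using ij by (simp_all add: norm_pm_sq inner_Basis)
    then have n': "norm (i + j) = sqrt 2" "norm (i - j) = sqrt 2"
      using real_sqrt_unique[of "norm (i + j)" 2] real_sqrt_unique[of "norm (i - j)" 2] by auto
    have s4: "(sqrt 2 :: real) ^ 4 = 4"
    proof -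
      have "(sqrt 2 :: real) ^ 4 = ((sqrt 2)\<^sup>2)\<^sup>2" by (simp only: power_mult[symmetric]) simp
      then show ?thesis by simp
    qed
    have "moment 4 (i + j) = moment 4 (sqrt 2 *\<^sub>R e)" "moment 4 (i - j) = moment 4 (sqrt 2 *\<^sub>R e)"
      using n' e by (auto intro!: moment_rotate)
    then have m: "moment 4 (i + j) + moment 4 (i - j) = 8 * ?J" by (simp add: moment_scale s4)
    have id: "(u + v) ^ 4 + (u - v) ^ 4 = 2 * u ^ 4 + 2 * v ^ 4 + 12 * (u\<^sup>2 * v\<^sup>2)" for u v :: real by algebra
    have "moment 4 (i + j) + moment 4 (i - j) =
       (\<integral>y. W ((norm (y::real^'n))\<^sup>2) * ((i + j) \<bullet> y) ^ 4 + W ((norm y)\<^sup>2) * ((i - j) \<bullet> y) ^ 4 \<partial>lborel)"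
      unfolding moment_def using i4 by (intro Bochner_Integration.integral_add[symmetric])
    also have "\<dots> = (\<integral>y. 2 * (W ((norm (y::real^'n))\<^sup>2) * (i \<bullet> y) ^ 4) + 2 * (W ((norm y)\<^sup>2) * (j \<bullet> y) ^ 4)
        + 12 * (W ((norm y)\<^sup>2) * ((i \<bullet> y)\<^sup>2 * (j \<bullet> y)\<^sup>2)) \<partial>lborel)"
      by (intro Bochner_Integration.integral_cong refl)
         (simp only: inner_add_left inner_diff_left distrib_left[symmetric] id mult.left_commute[of _ "W _"])
    also have "\<dots> = 2 * moment 4 i + 2 * moment 4 j + 12 * X i j"
      unfolding moment_def X_def using i4 i22 by simp
    also have "moment 4 i = ?J" using ij e by (intro moment_rotate) simp
    also have "moment 4 j = ?J" using ij e by (intro moment_rotate) simp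
    finally show ?thesis using m by simp
  qed
  have sq: "(norm y) ^ 4 = (\<Sum>i\<in>?B. \<Sum>j\<in>?B. (i \<bullet> y)\<^sup>2 * (j \<bullet> y)\<^sup>2)" for y :: "real^'n"
  proof -
    have "(norm y)\<^sup>2 = (\<Sum>i\<in>?B. (i \<bullet> y)\<^sup>2)"
      unfolding power2_norm_eq_inner by (subst euclidean_inner) (simp add: power2_eq_square inner_commute)
    moreover have "(norm y) ^ 4 = (norm y)\<^sup>2 * (norm y)\<^sup>2" by (simp add: power2_eq_square eval_nat_numeral mult.assoc)
    ultimately show ?thesis by (simp add: sum_product)
  qed
  have "(\<integral>y. W ((norm y)\<^sup>2) * (norm (y::real^'n)) ^ 4 \<partial>lborel)
    = (\<integral>y. (\<Sum>i\<in>?B. \<Sum>j\<in>?B. W ((norm (y::real^'n))\<^sup>2) * ((i \<bullet> y)\<^sup>2 * (j \<bullet> y)\<^sup>2)) \<partial>lborel)"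
    unfolding sq by (simp add: sum_distrib_left)
  also have "\<dots> = (\<Sum>i\<in>?B. \<Sum>j\<in>?B. X i j)"
    unfolding X_def using i22 by (simp add: Bochner_Integration.integral_sum)
  also have "\<dots> = (\<Sum>i\<in>?B. \<Sum>j\<in>?B. (if j = i then 2 * ?J / 3 else 0) + ?J / 3)"
    by (intro sum.cong refl) (use diag off in auto)
  also have "\<dots> = (\<Sum>i\<in>?B. 2 * ?J / 3 + real CARD('n) * ?J / 3)"
    by (intro sum.cong refl) (simp add: sum.distrib sum.delta)
  also have "\<dots> = real CARD('n) * (real CARD('n) + 2) / 3 * ?J"
    by (simp add: field_simps)
  finally show ?thesis .
qed

end

section \<open>The contribution of a bump to the expansion of f\<close>

definition Dk :: "real \<Rightarrow> nat \<Rightarrow> real \<Rightarrow> real" where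
  "Dk a i \<xi> = (\<Prod>j<i. a - real j) * \<xi> powr (a - real i)"

lemma Dk_deriv: "\<xi> > 0 \<Longrightarrow> (Dk a i has_real_derivative Dk a (Suc i) \<xi>) (at \<xi>)"
  unfolding Dk_def[abs_def]
  by (rule DERIV_cong[OF DERIV_cmult[OF has_real_derivative_powr]]) (auto simp: algebra_simps)

lemma kernel_expansion:
  fixes e y :: "'a::euclidean_space" and a :: real
  assumes "norm e = 1"
  obtains K where "K \<ge> 0" "\<And>r y. 0 \<le> r \<Longrightarrow> r \<le> 1 \<Longrightarrow> 3 \<le> norm y \<Longrightarrow> norm (y::'a) \<le> 4 \<Longrightarrow>
    \<bar>Gbr (\<lambda>\<sigma>. \<sigma> powr a) e r y - r\<^sup>2 * avg2 ((norm y)\<^sup>2) (e \<bullet> y) (Dk a) - r^4 * avg4 ((norm y)\<^sup>2) (e \<bullet> y) (Dk a)\<bar> \<le> K * r^5"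
proof -
  define K0 where "K0 = (\<Sum>i\<le>5::nat. \<bar>\<Prod>j<i. a - real j\<bar>)"
  have K0: "K0 \<ge> 0" by (simp add: K0_def sum_nonneg)
  define C where "C = (243 * ((1/4) powr (a - 5) + (9/4) powr (a - 5)) + 3) * K0"
  have C0: "C \<ge> 0" unfolding C_def using K0 by (intro mult_nonneg_nonneg add_nonneg_nonneg) auto
  define M where "M = 3 powr (2 * a - 5) + 4 powr (2 * a - 5 :: real)"
  show ?thesis
  proof (rule that[of "C * M"])
    show "C * M \<ge> 0" using C0 by (simp add: M_def add_nonneg_nonneg)
    fix r :: real and y :: 'a assume r: "0 \<le> r" "r \<le> 1" and y: "3 \<le> norm y" "norm y \<le> 4"
    have cy: "\<bar>e \<bullet> y\<bar> \<le> norm y" using Cauchy_Schwarz_ineq2[of e y] assms by simp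
    have y2: "(norm y)\<^sup>2 / 4 > 0" using y by auto
    have "\<bar>(Dk a 0 ((norm y)\<^sup>2 + 2 * r * (e \<bullet> y) + r\<^sup>2) + Dk a 0 ((norm y)\<^sup>2 - 2 * r * (e \<bullet> y) + r\<^sup>2)) / 2 - Dk a 0 ((norm y)\<^sup>2)
        - r\<^sup>2 * avg2 ((norm y)\<^sup>2) (e \<bullet> y) (Dk a) - r^4 * avg4 ((norm y)\<^sup>2) (e \<bullet> y) (Dk a)\<bar>
        \<le> (243 * ((1/4) powr (a - 5) + (9/4) powr (a - 5)) + 3) * K0 * r^5 * norm y powr (2 * a - 5)"
    proof (rule avg_expansion)
      show "(Dk a i has_real_derivative Dk a (Suc i) \<xi>) (at \<xi>)" if "(norm y)\<^sup>2 / 4 \<le> \<xi>" for i \<xi>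
        using that y2 by (intro Dk_deriv) linarith
      show "\<bar>Dk a i \<xi>\<bar> \<le> K0 * \<xi> powr (a - real i)" if "i \<le> 5" for i \<xi>
      proof -
        have "\<bar>\<Prod>j<i. a - real j\<bar> \<le> K0" unfolding K0_def using that by (intro member_le_sum[of i "{..5}" "\<lambda>i. \<bar>\<Prod>j<i. a - real j\<bar>"]) auto
        then show ?thesis unfolding Dk_def abs_mult by (simp add: mult_right_mono)
      qed
    qed (use y r cy K0 in auto)
    also have "\<dots> = C * r^5 * norm y powr (2 * a - 5)" by (simp add: C_def)
    also have "\<dots> \<le> C * r^5 * M"
    proof (intro mult_left_mono)
      show "norm y powr (2 * a - 5) \<le> M"
      proof (cases "2 * a - 5 \<ge> 0")
        case True
        then have "norm y powr (2 * a - 5) \<le> 4 powr (2 * a - 5)" using y by (intro powr_mono2) auto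
        then show ?thesis using powr_ge_zero[of 3 "2 * a - 5"] unfolding M_def by linarith
      next
        case False
        then have "norm y powr (2 * a - 5) \<le> 3 powr (2 * a - 5)" using y by (intro powr_mono2') auto
        then show ?thesis using powr_ge_zero[of 4 "2 * a - 5"] unfolding M_def by linarith
      qed
    qed (use C0 r in auto)
    also have "\<dots> = C * M * r^5" by simp
    finally show "\<bar>Gbr (\<lambda>\<sigma>. \<sigma> powr a) e r y - r\<^sup>2 * avg2 ((norm y)\<^sup>2) (e \<bullet> y) (Dk a) - r^4 * avg4 ((norm y)\<^sup>2) (e \<bullet> y) (Dk a)\<bar> \<le> C * M * r^5"
      by (simp add: Gbr_def Dk_def)
  qed
qed

lemma bsupp_shift_kernel:
  fixes e :: "'a::euclidean_space" and p r :: real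
  assumes B: "bsupp B" and e: "norm e = 1" and r: "\<bar>r\<bar> \<le> 1"
  shows "integrable lborel (\<lambda>y. B ((norm y)\<^sup>2) * norm (y - r *\<^sub>R e) powr (- p))"
    "integrable lborel (\<lambda>z. B ((norm (z + r *\<^sub>R e))\<^sup>2) * norm z powr (- p))"
    "(\<integral>z. B ((norm (z + r *\<^sub>R e))\<^sup>2) * norm z powr (- p) \<partial>lborel) = (\<integral>y. B ((norm y)\<^sup>2) * norm (y - r *\<^sub>R e) powr (- p) \<partial>lborel)"
proof -
  have [measurable]: "B \<in> borel_measurable borel" using B by (rule bsupp_measurable)
  define h where "h y = B ((norm y)\<^sup>2) * norm (y - r *\<^sub>R e) powr (- p)" for y
  have hm: "h \<in> borel_measurable borel" unfolding h_def[abs_def] by measurable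
  have re: "norm (r *\<^sub>R e) \<le> 1" using e r by simp
  show ih: "integrable lborel (\<lambda>y. B ((norm y)\<^sup>2) * norm (y - r *\<^sub>R e) powr (- p))"
  proof (rule bsupp_integrable[OF B])
    fix y :: 'a assume y: "3 \<le> norm y" "norm y \<le> 4"
    have n: "2 \<le> norm (y - r *\<^sub>R e)" "norm (y - r *\<^sub>R e) \<le> 5"
      using norm_triangle_ineq2[of y "r *\<^sub>R e"] norm_triangle_ineq4[of y "r *\<^sub>R e"] y re by linarith+
    show "\<bar>norm (y - r *\<^sub>R e) powr - p\<bar> \<le> 2 powr (- p) + 5 powr (- p)"
    proof (cases "p \<ge> 0")
      case True
      then have "norm (y - r *\<^sub>R e) powr - p \<le> 2 powr - p" using n by (intro powr_mono2') auto
      then show ?thesis using powr_ge_zero[of 5 "-p"] abs_of_nonneg[OF powr_ge_zero, of "norm (y - r *\<^sub>R e)" "-p"] by linarith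
    next
      case False
      then have "norm (y - r *\<^sub>R e) powr - p \<le> 5 powr - p" using n by (intro powr_mono2) auto
      then show ?thesis using powr_ge_zero[of 2 "-p"] abs_of_nonneg[OF powr_ge_zero, of "norm (y - r *\<^sub>R e)" "-p"] by linarith
    qed
  qed measurable
  have eq: "(\<lambda>z. B ((norm (z + r *\<^sub>R e))\<^sup>2) * norm z powr (- p)) = (\<lambda>z. h (z + r *\<^sub>R e))"
    by (simp add: h_def)
  show "integrable lborel (\<lambda>z. B ((norm (z + r *\<^sub>R e))\<^sup>2) * norm z powr (- p))"
    unfolding eq leb_preserving_integrable[OF leb_preserving_plus hm] using ih by (simp add: h_def[abs_def])
  show "(\<integral>z. B ((norm (z + r *\<^sub>R e))\<^sup>2) * norm z powr (- p) \<partial>lborel) = (\<integral>y. B ((norm y)\<^sup>2) * norm (y - r *\<^sub>R e) powr (- p) \<partial>lborel)"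
    unfolding eq leb_preserving_integral[OF leb_preserving_plus hm] by (simp add: h_def[abs_def])
qed

lemma norm_shift_sq:
  fixes e z :: "'a::real_inner"
  assumes "norm e = 1"
  shows "(norm (z + r *\<^sub>R e))\<^sup>2 = (norm z)\<^sup>2 + 2 * r * (e \<bullet> z) + r\<^sup>2"
    "(norm (z - r *\<^sub>R e))\<^sup>2 = (norm z)\<^sup>2 - 2 * r * (e \<bullet> z) + r\<^sup>2"
  using assms by (simp_all add: norm_pm_sq inner_commute power_mult_distrib algebra_simps)

text \<open>A discrete integration by parts: translating each of the three integrals moves the
  second difference from B to the kernel, whose expansion on the annulus is explicit. As |y|^(-p) is
  the power -p/2 of |y|^2, \<open>Gbr\<close> describes the difference of the kernel too.\<close>

lemma bump_Gbr:
  fixes e :: "'a::euclidean_space" and s r :: real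
  assumes B: "bsupp B" and e: "norm e = 1" and r: "\<bar>r\<bar> \<le> 1"
  shows "integrable lborel (\<lambda>z. Gbr B e r z * norm z powr (- (real DIM('a) + 2 * s)))"
    "ffun s B e r = (\<integral>y. B ((norm y)\<^sup>2) * Gbr (\<lambda>\<sigma>. \<sigma> powr (- ((real DIM('a) + 2 * s) / 2))) e r y \<partial>lborel)"
    "integrable lborel (\<lambda>y. B ((norm y)\<^sup>2) * Gbr (\<lambda>\<sigma>. \<sigma> powr (- ((real DIM('a) + 2 * s) / 2))) e r y)"
proof -
  let ?p = "real DIM('a) + 2 * s"
  let ?k = "\<lambda>z::'a. norm z powr (- ?p)"
  let ?b = "\<lambda>z::'a. B ((norm z)\<^sup>2)"
  have r': "\<bar>- r\<bar> \<le> 1" using r by simp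
  note i1 = bsupp_shift_kernel[OF B e r, of ?p]
  note i2 = bsupp_shift_kernel[OF B e r', of ?p, simplified]
  note i0 = bsupp_shift_kernel[OF B e, of 0 ?p, simplified]
  have G: "Gbr B e r z * ?k z = (?b (z + r *\<^sub>R e) * ?k z + ?b (z - r *\<^sub>R e) * ?k z) / 2 - ?b z * ?k z" for z
    by (simp add: Gbr_def norm_shift_sq[OF e] algebra_simps add_divide_distrib)
  show "integrable lborel (\<lambda>z. Gbr B e r z * ?k z)"
    unfolding G using i1(2) i2(2) i0 by simp
  have K: "?b y * Gbr (\<lambda>\<sigma>. \<sigma> powr (- (?p / 2))) e r y
     = (?b y * ?k (y - r *\<^sub>R e) + ?b y * ?k (y + r *\<^sub>R e)) / 2 - ?b y * ?k y" for y
  proof -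
    have ex: "2 * - (q / 2) = - q" for q :: real by simp
    show ?thesis
      unfolding Gbr_def norm_shift_sq[OF e, symmetric] square_powr[OF norm_ge_zero] ex
      by (simp add: algebra_simps add_divide_distrib)
  qed
  show "integrable lborel (\<lambda>y. ?b y * Gbr (\<lambda>\<sigma>. \<sigma> powr (- (?p / 2))) e r y)"
    unfolding K using i1(1) i2(1) i0 by simp
  show "ffun s B e r = (\<integral>y. ?b y * Gbr (\<lambda>\<sigma>. \<sigma> powr (- (?p / 2))) e r y \<partial>lborel)"
    unfolding ffun_def G K using i1 i2 i0 by simp
qed

text \<open>For k = 0 this is the contribution of B to the moment condition; k = 1 and k = 2 carry
  its r^2 and r^4 coefficients, by \<open>bump_expansion\<close>.\<close>

definition wint :: "real \<Rightarrow> (real \<Rightarrow> real) \<Rightarrow> (real^'n) itself \<Rightarrow> nat \<Rightarrow> real" where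
  "wint s B _ k = (\<integral>y. B ((norm (y::real^'n))\<^sup>2) * norm y powr (- (real CARD('n) + 2 * s) - 2 * real k) \<partial>lborel)"

text \<open>The coefficients of Pizzetti's formula for spherical means. With p = N + 2s,
  \<open>kap2\<close> and \<open>kap4\<close> are the factors of |y|^(-p-2) in Lap |y|^(-p) / (2N)
  and of |y|^(-p-4) in Lap^2 |y|^(-p) / (8N(N+2)), where Lap is the Laplacian. Both are positive, so
  they can be divided by.\<close>

definition kap2 :: "nat \<Rightarrow> real \<Rightarrow> real" where
  "kap2 N s = (real N + 2 * s) / 2 * (2 * s + 2) / real N"

definition kap4 :: "nat \<Rightarrow> real \<Rightarrow> real" where
  "kap4 N s = (real N + 2 * s) / 2 * ((real N + 2 * s) / 2 + 1) * (2 * s + 4) * (2 * s + 2) / (2 * real N * (real N + 2))"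

text \<open>After \<open>bump_Gbr\<close> the Taylor coefficients of the kernel are integrated
  against a radial weight. \<open>second_moment\<close> and \<open>fourth_moment\<close> then
  replace (e.y)^2 by |y|^2/N and (e.y)^4 by 3|y|^4/(N(N+2)).\<close>

lemma bump_expansion:
  fixes e :: "real^'n" and s :: real
  assumes B: "bsupp B" and e: "norm e = 1"
  obtains K where "\<And>r. 0 \<le> r \<Longrightarrow> r \<le> 1 \<Longrightarrow>
    \<bar>ffun s B e r - r\<^sup>2 * (kap2 CARD('n) s * wint s B TYPE(real^'n) 1) - r^4 * (kap4 CARD('n) s * wint s B TYPE(real^'n) 2)\<bar> \<le> K * r^5"
proof -
  let ?N = "real CARD('n)"
  let ?p = "?N + 2 * s"
  define a where "a = - (?p / 2)"
  define \<beta> where "\<beta> = ?p / 2"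
  have a: "a = - \<beta>" by (simp add: a_def \<beta>_def)
  have N: "?N > 0" by simp
  let ?b = "\<lambda>y::real^'n. B ((norm y)\<^sup>2)"
  have [measurable]: "B \<in> borel_measurable borel" using B by (rule bsupp_measurable)
  \<comment> \<open>\<open>Dk a k\<close> contributes the power a - k of |y|^2; \<open>Wk k\<close>
    merges it with B into one radial weight.\<close>
  define Wk where "Wk k \<sigma> = B \<sigma> * \<sigma> powr (a - real k)" for k \<sigma>
  have Wk: "bsupp (Wk k)" for k unfolding Wk_def by (rule bsupp_powr[OF B])
  have Wz: "Wk k \<sigma> = 0" if "\<sigma> \<le> 9" for k \<sigma> using bsupp_zero[OF Wk] that by blast
  have wint_eq: "(\<integral>y. Wk (k + j) ((norm (y::real^'n))\<^sup>2) * (norm y)^(2 * j) \<partial>lborel) = wint s B TYPE(real^'n) k" for k j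
    unfolding wint_def
  proof (intro Bochner_Integration.integral_cong refl)
    fix y :: "real^'n"
    show "Wk (k + j) ((norm y)\<^sup>2) * (norm y)^(2 * j) = B ((norm y)\<^sup>2) * norm y powr (- ?p - 2 * real k)"
    proof (cases "norm y = 0")
      case False
      then have "(norm y)^(2 * j) = norm y powr (2 * real j)" by (simp add: powr_realpow[symmetric])
      moreover have "2 * (a - real (k + j)) + 2 * real j = - ?p - 2 * real k" by (simp add: a_def field_simps)
      ultimately show ?thesis
        unfolding Wk_def square_powr[OF norm_ge_zero] by (simp only: mult.assoc powr_add[symmetric])
    qed (use bsupp_zero[OF B, of 0] in \<open>simp add: Wk_def\<close>)
  qed
  have m2: "moment (Wk (k + 1)) 2 e = wint s B TYPE(real^'n) k / ?N" for k
  proof -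
    have "?N * moment (Wk (k + 1)) 2 e = wint s B TYPE(real^'n) k"
      using second_moment[OF Wk[of "k + 1"] e] wint_eq[of k 1, unfolded mult_1_right] by (simp only:)
    then show ?thesis using N by (simp add: eq_divide_eq mult.commute)
  qed
  have m4: "moment (Wk (k + 2)) 4 e = wint s B TYPE(real^'n) k * 3 / (?N * (?N + 2))" for k
  proof -
    have e4: "2 * 2 = (4::nat)" by simp
    have "?N * (?N + 2) / 3 * moment (Wk (k + 2)) 4 e = wint s B TYPE(real^'n) k"
      using fourth_moment[OF Wk[of "k + 2"] e] wint_eq[of k 2, unfolded e4] by (simp only:)
    moreover have "?N * (?N + 2) \<noteq> 0" using N by (auto simp: add_eq_0_iff)
    ultimately show ?thesis by (simp add: eq_divide_eq mult.commute mult.left_commute)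
  qed
  have im: "integrable lborel (\<lambda>y::real^'n. Wk k ((norm y)\<^sup>2) * (e \<bullet> y) ^ l)" for k l
    using moment_integrable[OF Wk[of k], of e l 0 0] by simp
  have im0: "integrable lborel (\<lambda>y::real^'n. Wk k ((norm y)\<^sup>2))" for k
    using im[of k 0] by simp
  let ?A2 = "\<lambda>y. avg2 ((norm y)\<^sup>2) (e \<bullet> y) (Dk a)" and ?A4 = "\<lambda>y. avg4 ((norm y)\<^sup>2) (e \<bullet> y) (Dk a)"
  have D: "Dk a 1 \<sigma> = - \<beta> * \<sigma> powr (a - real 1)" "Dk a 2 \<sigma> = \<beta> * (\<beta> + 1) * \<sigma> powr (a - real 2)"
    "Dk a 3 \<sigma> = - (\<beta> * (\<beta> + 1) * (\<beta> + 2)) * \<sigma> powr (a - real 3)"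
    "Dk a 4 \<sigma> = \<beta> * (\<beta> + 1) * (\<beta> + 2) * (\<beta> + 3) * \<sigma> powr (a - real 4)" for \<sigma>
    by (simp_all add: Dk_def eval_nat_numeral lessThan_Suc a algebra_simps)
  have A2: "?b y * ?A2 y = - \<beta> * Wk 1 ((norm y)\<^sup>2) + 2 * (\<beta> * (\<beta> + 1)) * (Wk 2 ((norm y)\<^sup>2) * (e \<bullet> y)\<^sup>2)" for y
    unfolding avg2_def D Wk_def by (simp only: algebra_simps)
  have A4: "?b y * ?A4 y = \<beta> * (\<beta> + 1) / 2 * Wk 2 ((norm y)\<^sup>2) - 2 * (\<beta> * (\<beta> + 1) * (\<beta> + 2)) * (Wk 3 ((norm y)\<^sup>2) * (e \<bullet> y)\<^sup>2)
     + 2 / 3 * (\<beta> * (\<beta> + 1) * (\<beta> + 2) * (\<beta> + 3)) * (Wk 4 ((norm y)\<^sup>2) * (e \<bullet> y)^4)" for y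
    unfolding avg4_def D Wk_def by (simp add: algebra_simps)
  have i2: "integrable lborel (\<lambda>y. ?b y * ?A2 y)"
    unfolding A2 using im im0 by simp
  have i4: "integrable lborel (\<lambda>y. ?b y * ?A4 y)"
    unfolding A4 using im im0 by simp
  have w1: "(\<integral>y. Wk 1 ((norm (y::real^'n))\<^sup>2) \<partial>lborel) = wint s B TYPE(real^'n) 1" using wint_eq[of 1 0] by simp
  have w2: "(\<integral>y. Wk 2 ((norm (y::real^'n))\<^sup>2) \<partial>lborel) = wint s B TYPE(real^'n) 2" using wint_eq[of 2 0] by simp
  have I2: "(\<integral>y. ?b y * ?A2 y \<partial>lborel) = kap2 CARD('n) s * wint s B TYPE(real^'n) 1"
  proof -
    have "(\<integral>y. ?b y * ?A2 y \<partial>lborel) = - \<beta> * wint s B TYPE(real^'n) 1 + 2 * (\<beta> * (\<beta> + 1)) * moment (Wk 2) 2 e"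
      unfolding A2 moment_def[OF Wk] using im[of 2 2] im0[of 1] w1 by simp
    also have "moment (Wk 2) 2 e = wint s B TYPE(real^'n) 1 / ?N" using m2[of 1] by (simp only: one_add_one)
    also have "- \<beta> * wint s B TYPE(real^'n) 1 + 2 * (\<beta> * (\<beta> + 1)) * (wint s B TYPE(real^'n) 1 / ?N)
      = kap2 CARD('n) s * wint s B TYPE(real^'n) 1"
      using N by (simp add: kap2_def \<beta>_def field_simps)
    finally show ?thesis .
  qed
  have I4: "(\<integral>y. ?b y * ?A4 y \<partial>lborel) = kap4 CARD('n) s * wint s B TYPE(real^'n) 2"
  proof -
    let ?w = "wint s B TYPE(real^'n) 2"
    have n3: "2 + 1 = (3::nat)" "2 + 2 = (4::nat)" by simp_all
    have "(\<integral>y. ?b y * ?A4 y \<partial>lborel) = \<beta> * (\<beta> + 1) / 2 * ?w - 2 * (\<beta> * (\<beta> + 1) * (\<beta> + 2)) * moment (Wk 3) 2 e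
       + 2 / 3 * (\<beta> * (\<beta> + 1) * (\<beta> + 2) * (\<beta> + 3)) * moment (Wk 4) 4 e"
      unfolding A4 moment_def[OF Wk] using im[of 3 2] im[of 4 4] im0[of 2] w2 by simp
    also have "moment (Wk 3) 2 e = ?w / ?N" using m2[of 2] by (simp only: n3)
    also have "moment (Wk 4) 4 e = ?w * 3 / (?N * (?N + 2))" using m4[of 2] by (simp only: n3)
    also have "\<beta> * (\<beta> + 1) / 2 * ?w - 2 * (\<beta> * (\<beta> + 1) * (\<beta> + 2)) * (?w / ?N)
       + 2 / 3 * (\<beta> * (\<beta> + 1) * (\<beta> + 2) * (\<beta> + 3)) * (?w * 3 / (?N * (?N + 2)))
      = \<beta> * (\<beta> + 1) * ?w * ((?N * (?N + 2) - 4 * (\<beta> + 2) * (?N + 2) + 4 * (\<beta> + 2) * (\<beta> + 3)) / (2 * ?N * (?N + 2)))"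
      using N by (simp add: divide_simps) (simp add: algebra_simps)
    \<comment> \<open>Written with 2s = 2\<beta> - N, the quadratic factorises, which exhibits the
      sign of \<open>kap4\<close>.\<close>
    also have "?N * (?N + 2) - 4 * (\<beta> + 2) * (?N + 2) + 4 * (\<beta> + 2) * (\<beta> + 3) = (2 * s + 4) * (2 * s + 2)"
    proof -
      have s2: "2 * s = 2 * \<beta> - ?N" by (simp add: \<beta>_def field_simps)
      show ?thesis unfolding s2 by (simp add: algebra_simps)
    qed
    also have "\<beta> * (\<beta> + 1) * ?w * ((2 * s + 4) * (2 * s + 2) / (2 * ?N * (?N + 2))) = kap4 CARD('n) s * ?w"
      by (simp add: kap4_def \<beta>_def)
    finally show ?thesis .
  qed
  obtain K where K: "K \<ge> 0" "\<And>r y. 0 \<le> r \<Longrightarrow> r \<le> 1 \<Longrightarrow> 3 \<le> norm y \<Longrightarrow> norm (y::real^'n) \<le> 4 \<Longrightarrow>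
    \<bar>Gbr (\<lambda>\<sigma>. \<sigma> powr a) e r y - r\<^sup>2 * ?A2 y - r^4 * ?A4 y\<bar> \<le> K * r^5"
    by (rule kernel_expansion[OF e, of a]) blast
  have iabs: "integrable lborel (\<lambda>y. \<bar>?b y\<bar>)"
    using bsupp_integrable_radial[OF B] by (rule integrable_abs)
  show ?thesis
  proof (rule that[of "K * (\<integral>y. \<bar>?b y\<bar> \<partial>lborel)"])
    fix r :: real assume r: "0 \<le> r" "r \<le> 1"
    then have r': "\<bar>r\<bar> \<le> 1" by simp
    have a2: "a = - ((?N + 2 * s) / 2)" by (simp add: a_def)
    have bG: "ffun s B e r = (\<integral>y. ?b y * Gbr (\<lambda>\<sigma>. \<sigma> powr a) e r y \<partial>lborel)"
      "integrable lborel (\<lambda>y. ?b y * Gbr (\<lambda>\<sigma>. \<sigma> powr a) e r y)"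
      unfolding a2 using bump_Gbr(2,3)[OF B e r', of s] by (simp_all only: DIM_cart DIM_real mult_1_right)
    have eq1: "ffun s B e r - r\<^sup>2 * (kap2 CARD('n) s * wint s B TYPE(real^'n) 1) - r^4 * (kap4 CARD('n) s * wint s B TYPE(real^'n) 2)
      = (\<integral>y. ?b y * Gbr (\<lambda>\<sigma>. \<sigma> powr a) e r y - r\<^sup>2 * (?b y * ?A2 y) - r^4 * (?b y * ?A4 y) \<partial>lborel)"
      unfolding bG(1) I2[symmetric] I4[symmetric] using bG(2) i2 i4 by simp
    have eq2: "\<bar>\<integral>y. ?b y * Gbr (\<lambda>\<sigma>. \<sigma> powr a) e r y - r\<^sup>2 * (?b y * ?A2 y) - r^4 * (?b y * ?A4 y) \<partial>lborel\<bar>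
       \<le> (\<integral>y. K * r^5 * \<bar>?b y\<bar> \<partial>lborel)"
    proof (rule integral_abs_le)
      show "integrable lborel (\<lambda>y. ?b y * Gbr (\<lambda>\<sigma>. \<sigma> powr a) e r y - r\<^sup>2 * (?b y * ?A2 y) - r^4 * (?b y * ?A4 y))"
        using bG(2) i2 i4 by simp
      show "integrable lborel (\<lambda>y. K * r^5 * \<bar>?b y\<bar>)" using iabs by (rule integrable_mult_right)
      fix y :: "real^'n"
      show "\<bar>?b y * Gbr (\<lambda>\<sigma>. \<sigma> powr a) e r y - r\<^sup>2 * (?b y * ?A2 y) - r^4 * (?b y * ?A4 y)\<bar> \<le> K * r^5 * \<bar>?b y\<bar>"
      proof (cases "3 \<le> norm y \<and> norm y \<le> 4")
        case True
        have "?b y * Gbr (\<lambda>\<sigma>. \<sigma> powr a) e r y - r\<^sup>2 * (?b y * ?A2 y) - r^4 * (?b y * ?A4 y)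
          = ?b y * (Gbr (\<lambda>\<sigma>. \<sigma> powr a) e r y - r\<^sup>2 * ?A2 y - r^4 * ?A4 y)"
          by (simp add: algebra_simps)
        then have "\<bar>?b y * Gbr (\<lambda>\<sigma>. \<sigma> powr a) e r y - r\<^sup>2 * (?b y * ?A2 y) - r^4 * (?b y * ?A4 y)\<bar>
          = \<bar>?b y\<bar> * \<bar>Gbr (\<lambda>\<sigma>. \<sigma> powr a) e r y - r\<^sup>2 * ?A2 y - r^4 * ?A4 y\<bar>" by (simp only: abs_mult)
        also have "\<dots> \<le> \<bar>?b y\<bar> * (K * r^5)" using K(2)[OF r] True by (intro mult_left_mono) auto
        finally show ?thesis by (simp only: mult.commute)
      next
        case False
        have "(norm y)\<^sup>2 \<le> 9 \<or> 16 \<le> (norm y)\<^sup>2"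
          using False power_mono[of "norm y" 3 2] power_mono[of 4 "norm y" 2] by auto
        then have "?b y = 0" by (rule bsupp_zero[OF B])
        then show ?thesis by simp
      qed
    qed
    have eq3: "(\<integral>y. K * r^5 * \<bar>?b y\<bar> \<partial>lborel) = K * r^5 * (\<integral>y. \<bar>?b y\<bar> \<partial>lborel)" by simp
    show "\<bar>ffun s B e r - r\<^sup>2 * (kap2 CARD('n) s * wint s B TYPE(real^'n) 1) - r^4 * (kap4 CARD('n) s * wint s B TYPE(real^'n) 2)\<bar>
      \<le> K * (\<integral>y. \<bar>?b y\<bar> \<partial>lborel) * r^5"
      using eq2 unfolding eq1 eq3 by (simp only: mult.assoc mult.commute[of "r^5"])
  qed
qed

section \<open>Boundedness and integrability of a profile\<close>

context profile
begin

lemma U_eq: "0 \<le> \<sigma> \<Longrightarrow> U \<sigma> = \<sigma> powr (g / 2) - G \<sigma>"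
  using U_low by (auto simp: G_def)

lemma borel_measurable_U_norm[measurable]: "(\<lambda>y::'a::euclidean_space. U ((norm y)\<^sup>2)) \<in> borel_measurable borel"
proof -
  have "(\<lambda>y::'a. U ((norm y)\<^sup>2)) = (\<lambda>y. ((norm y)\<^sup>2) powr (g / 2) - G ((norm y)\<^sup>2))"
    by (simp add: U_eq)
  then show ?thesis by simp
qed

lemma U_bounded: obtains K where "K \<ge> 0" "\<And>\<sigma>. 0 \<le> \<sigma> \<Longrightarrow> \<bar>U \<sigma>\<bar> \<le> K"
proof -
  have "continuous_on {1..b} (\<lambda>\<sigma>. \<sigma> powr (g / 2) - D 0 \<sigma>)"
    by (intro continuous_intros D_cont) auto
  then have "compact ((\<lambda>\<sigma>. \<sigma> powr (g / 2) - D 0 \<sigma>) ` {1..b})"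
    by (intro compact_continuous_image) auto
  then obtain K where "\<forall>y\<in>(\<lambda>\<sigma>. \<sigma> powr (g / 2) - D 0 \<sigma>) ` {1..b}. norm y \<le> K"
    using compact_imp_bounded bounded_iff by blast
  then have K: "\<bar>U \<sigma>\<bar> \<le> K" if "\<sigma> \<in> {1..b}" for \<sigma>
    using that by (auto simp: U_eq D_0)
  show ?thesis
  proof (rule that[of "max K 1"])
    fix \<sigma> :: real assume \<sigma>: "0 \<le> \<sigma>"
    consider "\<sigma> \<le> 1" | "1 \<le> \<sigma>" "\<sigma> \<le> b" | "b \<le> \<sigma>" by linarith
    then show "\<bar>U \<sigma>\<bar> \<le> max K 1"
    proof cases
      case 1
      then have "\<sigma> powr (g / 2) \<le> 1" using \<sigma> g s by (intro powr_le1) auto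
      then show ?thesis using 1 \<sigma> by (simp add: U_low)
    next
      case 2 then show ?thesis using K[of \<sigma>] by auto
    next
      case 3 then show ?thesis by (simp add: U_high)
    qed
  qed simp
qed

lemma integrable_U: "integrable lborel (\<lambda>y::'a::euclidean_space. U ((norm y)\<^sup>2) * norm y powr (- (real DIM('a) + 2 * s)))"
proof -
  obtain K where K: "K \<ge> 0" "\<And>\<sigma>. 0 \<le> \<sigma> \<Longrightarrow> \<bar>U \<sigma>\<bar> \<le> K" by (rule U_bounded) blast
  show ?thesis
  proof (rule integrable_kernel[where \<alpha> = g and \<beta> = 0 and K = "max K 1"])
    fix y :: 'a assume y: "norm y \<le> 1"
    then have "(norm y)\<^sup>2 \<le> 9" using power_mono[OF y, of 2] by simp
    then have "\<bar>U ((norm y)\<^sup>2)\<bar> = norm y powr g" by (simp add: U_low square_powr)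
    moreover have "1 * norm y powr g \<le> max K 1 * norm y powr g" by (intro mult_right_mono) auto
    ultimately show "\<bar>U ((norm y)\<^sup>2)\<bar> \<le> max K 1 * norm y powr g" by simp
  next
    fix y :: 'a assume y: "norm y > 1"
    then have "norm y powr 0 = 1" by auto
    then show "\<bar>U ((norm y)\<^sup>2)\<bar> \<le> max K 1 * norm y powr 0"
      using K(2)[of "(norm y)\<^sup>2"] by (simp only: mult_1_right) simp
  qed (use g s in auto)
qed

end

section \<open>A three-parameter family of profiles\<close>

definition bet :: "real \<Rightarrow> real" where
  "bet \<sigma> = flat_exp 0 (\<sigma> - 9) * flat_exp 0 (16 - \<sigma>)"

text \<open>Multiplication by 1/\<sigma> raises the index of \<open>wint\<close> by one, so by
  \<open>wint_Bq\<close> the integrals of \<open>Bq q\<close> involve only those of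
  \<open>bet\<close>. The coefficients form a triple because triples are a Euclidean space, on which
  injective linear maps are surjective.\<close>

definition quad :: "real \<times> real \<times> real \<Rightarrow> real \<Rightarrow> real" where
  "quad q \<sigma> = fst q + fst (snd q) * inverse \<sigma> + snd (snd q) * (inverse \<sigma> * inverse \<sigma>)"

definition Bq :: "real \<times> real \<times> real \<Rightarrow> real \<Rightarrow> real" where
  "Bq q \<sigma> = bet \<sigma> * quad q \<sigma>"

text \<open>A smooth cutoff, 1 up to 9 and 0 from 16 on. The denominator is positive since 16 -
  \<sigma> and \<sigma> - 9 are never both nonpositive.\<close>

definition eta :: "real \<Rightarrow> real" where
  "eta \<sigma> = flat_exp 0 (16 - \<sigma>) * inverse (flat_exp 0 (16 - \<sigma>) + flat_exp 0 (\<sigma> - 9))"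

definition Uq :: "real \<Rightarrow> real \<times> real \<times> real \<Rightarrow> real \<Rightarrow> real" where
  "Uq g q \<sigma> = \<sigma> powr (g / 2) * eta \<sigma> + Bq q \<sigma>"

lemma smooth_flat1: "smooth_n k S (\<lambda>\<sigma>. flat_exp 0 (\<sigma> - 9))"
  using smooth_n_compose_affine[OF smooth_n_flat_exp, of S 1 "-9" k 0] by simp

lemma smooth_flat2: "smooth_n k S (\<lambda>\<sigma>. flat_exp 0 (16 - \<sigma>))"
  using smooth_n_compose_affine[OF smooth_n_flat_exp, of S "-1" 16 k 0] by (simp add: add.commute)

lemma smooth_quad: "smooth_n k {0<..} (quad q)"
proof -
  have "smooth_n k {0<..} (\<lambda>\<sigma>::real. inverse \<sigma>)"
    using smooth_n_inverse[of k "{0<..}" "\<lambda>x. 1 * x + 0"] smooth_n_affine[of k "{0<..}" 1 0] by simp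
  then show ?thesis unfolding quad_def[abs_def]
    by (intro smooth_n_add smooth_n_mult smooth_n_const)
qed

lemma smooth_Bq: "smooth_n k {0<..} (Bq q)"
  unfolding Bq_def[abs_def] bet_def by (intro smooth_n_mult smooth_flat1 smooth_flat2 smooth_quad)

lemma eta_denom: "flat_exp 0 (16 - \<sigma>) + flat_exp 0 (\<sigma> - 9) > 0"
  using flat_exp_pos[of 0 "16 - \<sigma>"] flat_exp_pos[of 0 "\<sigma> - 9"] flat_exp_nonneg[of 0 "16 - \<sigma>"] flat_exp_nonneg[of 0 "\<sigma> - 9"]
  by (cases "\<sigma> < 16") auto

lemma smooth_eta: "smooth_n k {0<..} eta"
  unfolding eta_def[abs_def] using eta_denom
  by (intro smooth_n_mult smooth_n_inverse smooth_n_add smooth_flat1 smooth_flat2) (simp add: less_imp_neq[symmetric])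

lemma bet_zero: "\<sigma> \<le> 9 \<or> 16 \<le> \<sigma> \<Longrightarrow> bet \<sigma> = 0"
  by (auto simp: bet_def flat_exp_zero)

lemma bet_pos: "9 < \<sigma> \<Longrightarrow> \<sigma> < 16 \<Longrightarrow> bet \<sigma> > 0"
  by (simp add: bet_def flat_exp_pos)

lemma bet_nonneg: "bet \<sigma> \<ge> 0"
  by (simp add: bet_def flat_exp_nonneg)

lemma flat_exp0_le1: "flat_exp 0 t \<le> 1"
  by (simp add: flat_exp_def)

lemma bet_le1: "bet \<sigma> \<le> 1"
  unfolding bet_def using mult_mono[OF flat_exp0_le1 flat_exp0_le1 _ flat_exp_nonneg] by simp

lemma continuous_flat_exp: "continuous_on UNIV (flat_exp n)"
  using smooth_n_flat_exp[of 0 n] by simp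

lemma borel_measurable_flat_exp[measurable]: "flat_exp n \<in> borel_measurable borel"
  by (rule borel_measurable_continuous_onI[OF continuous_flat_exp])

lemma borel_measurable_bet[measurable]: "bet \<in> borel_measurable borel"
  unfolding bet_def[abs_def] by measurable

lemma borel_measurable_quad[measurable]: "quad q \<in> borel_measurable borel"
  unfolding quad_def[abs_def] by measurable

lemma borel_measurable_Bq[measurable]: "Bq q \<in> borel_measurable borel"
  unfolding Bq_def[abs_def] by measurable

lemma bsupp_Bq: "bsupp (Bq q)"
proof -
  define C where "C = \<bar>fst q\<bar> + \<bar>fst (snd q)\<bar> + \<bar>snd (snd q)\<bar>"
  have "\<bar>Bq q \<sigma>\<bar> \<le> C" for \<sigma>
  proof (cases "9 < \<sigma>")
    case True
    have i: "0 \<le> inverse \<sigma>" "inverse \<sigma> \<le> 1" using True by (auto simp: inverse_le_1_iff)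
    have ii: "inverse \<sigma> * inverse \<sigma> \<le> 1" using mult_mono[OF i(2) i(2)] i by simp
    have "\<bar>fst (snd q) * inverse \<sigma>\<bar> \<le> \<bar>fst (snd q)\<bar> * 1" unfolding abs_mult using i by (intro mult_left_mono) auto
    moreover have "\<bar>snd (snd q) * (inverse \<sigma> * inverse \<sigma>)\<bar> \<le> \<bar>snd (snd q)\<bar> * 1"
      unfolding abs_mult using ii i by (intro mult_left_mono) (auto simp: abs_mult)
    ultimately have "\<bar>quad q \<sigma>\<bar> \<le> C" unfolding quad_def C_def by linarith
    then have "\<bar>bet \<sigma>\<bar> * \<bar>quad q \<sigma>\<bar> \<le> 1 * C" using bet_nonneg[of \<sigma>] bet_le1[of \<sigma>] by (intro mult_mono) auto
    then show ?thesis by (simp add: Bq_def abs_mult)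
  next
    case False
    then show ?thesis by (simp add: Bq_def bet_zero C_def)
  qed
  then show ?thesis unfolding bsupp_def using bet_zero by (auto simp: Bq_def)
qed

lemma bsupp_bet: "bsupp bet"
  using bsupp_Bq[of "(1, 0, 0)"] by (simp add: Bq_def[abs_def] quad_def)

lemma bsupp_powr_integrable:
  assumes "bsupp B"
  shows "integrable lborel (\<lambda>y::'a::euclidean_space. B ((norm y)\<^sup>2) * norm y powr c)"
proof -
  have eq: "(\<lambda>y::'a. B ((norm y)\<^sup>2) * norm y powr c) = (\<lambda>y. B ((norm y)\<^sup>2) * ((norm y)\<^sup>2) powr (c / 2))"
    by (simp add: square_powr)
  show ?thesis unfolding eq using bsupp_integrable_radial[OF bsupp_powr[OF assms, of "c / 2"]] by simp
qed

lemma bet_shift: "bet ((norm y)\<^sup>2) * norm (y::'a::euclidean_space) powr c * inverse ((norm y)\<^sup>2) = bet ((norm y)\<^sup>2) * norm y powr (c - 2)"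
proof (cases "y = 0")
  case False
  then show ?thesis using powr_divide_square[of "norm y" c] by (simp add: divide_inverse mult.assoc)
qed (simp add: bet_zero)

lemma quad_powr: "bet ((norm y)\<^sup>2) * norm (y::'a::euclidean_space) powr c * quad q ((norm y)\<^sup>2) =
  fst q * (bet ((norm y)\<^sup>2) * norm y powr c) + fst (snd q) * (bet ((norm y)\<^sup>2) * norm y powr (c - 2))
   + snd (snd q) * (bet ((norm y)\<^sup>2) * norm y powr (c - 4))"
proof -
  have "c - 4 = (c - 2) - 2" by simp
  then have 4: "bet ((norm y)\<^sup>2) * norm y powr (c - 4) = bet ((norm y)\<^sup>2) * norm y powr c * inverse ((norm y)\<^sup>2) * inverse ((norm y)\<^sup>2)"
    by (simp only: bet_shift)
  show ?thesis unfolding 4 bet_shift[of y c, symmetric] quad_def by (simp add: algebra_simps)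
qed

lemma wint_Bq:
  "wint s (Bq q) TYPE(real^'n) j = fst q * wint s bet TYPE(real^'n) j + fst (snd q) * wint s bet TYPE(real^'n) (j + 1)
     + snd (snd q) * wint s bet TYPE(real^'n) (j + 2)"
proof -
  let ?c = "\<lambda>k. - (real CARD('n) + 2 * s) - 2 * real k"
  have e: "?c (j + 1) = ?c j - 2" "?c (j + 2) = ?c j - 4" by simp_all
  have i: "integrable lborel (\<lambda>y::real^'n. bet ((norm y)\<^sup>2) * norm y powr c)" for c
    by (rule bsupp_powr_integrable[OF bsupp_bet])
  have "wint s (Bq q) TYPE(real^'n) j = (\<integral>y. bet ((norm (y::real^'n))\<^sup>2) * norm y powr (?c j) * quad q ((norm y)\<^sup>2) \<partial>lborel)"
    unfolding wint_def Bq_def by (simp add: mult.assoc mult.commute[of "quad q _"])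
  then show ?thesis unfolding quad_powr wint_def e using i by simp
qed

lemma quad_three_roots:
  assumes "quad q x = 0" "quad q y = 0" "quad q z = 0" "0 < x" "x < y" "y < z"
  shows "q = 0"
proof -
  obtain a b c where q: "q = (a, b, c)" by (cases q)
  have pol: "a * t\<^sup>2 + b * t + c = 0" if "quad q t = 0" "0 < t" for t
  proof -
    have "a * t\<^sup>2 + b * t + c = t\<^sup>2 * quad q t" using that(2) by (simp add: q quad_def power2_eq_square field_simps)
    then show ?thesis using that by simp
  qed
  have p: "a * x\<^sup>2 + b * x + c = 0" "a * y\<^sup>2 + b * y + c = 0" "a * z\<^sup>2 + b * z + c = 0"
    using pol assms by auto
  have "(x - y) * (a * (x + y) + b) = 0" "(x - z) * (a * (x + z) + b) = 0"
    using p by (simp_all add: power2_eq_square algebra_simps)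
  then have l: "a * (x + y) + b = 0" "a * (x + z) + b = 0" using assms by auto
  then have "a * (y - z) = 0" unfolding distrib_left right_diff_distrib by linarith
  then have "a = 0" using assms by auto
  moreover from this l have "b = 0" by simp
  ultimately show ?thesis using p by (simp add: q zero_prod_def)
qed

text \<open>The matrix of the linear system is the Gram matrix of \<open>1\<close>, \<open>1/\<sigma>\<close>, \<open>1/\<sigma>\<^sup>2\<close> for a nonnegative weight.\<close>

lemma gram_surj:
  fixes t :: "real \<times> real \<times> real" and s :: real
  obtains q where "wint s (Bq q) TYPE(real^'n) 0 = fst t" "wint s (Bq q) TYPE(real^'n) 1 = fst (snd t)"
    "wint s (Bq q) TYPE(real^'n) 2 = snd (snd t)"
proof -
  let ?w = "\<lambda>q. wint s (Bq q) TYPE(real^'n)"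
  let ?p = "real CARD('n) + 2 * s"
  define T where "T q = (?w q 0, ?w q 1, ?w q 2)" for q
  have lin: "linear T"
    by (rule linearI) (simp_all add: T_def wint_Bq algebra_simps)
  have inj: "inj T"
    unfolding linear_injective_0[OF lin]
  proof (intro allI impI)
    fix q assume "T q = 0"
    then have w: "?w q 0 = 0" "?w q 1 = 0" "?w q 2 = 0" by (auto simp: T_def zero_prod_def)
    \<comment> \<open>Its integral is the inner product of q with T q, so it is 0 here; since h is
      nonnegative, it vanishes almost everywhere.\<close>
    define h where "h y = bet ((norm y)\<^sup>2) * norm y powr (- ?p) * (quad q ((norm y)\<^sup>2))\<^sup>2" for y :: "real^'n"
    have i: "integrable lborel (\<lambda>y::real^'n. Bq q ((norm y)\<^sup>2) * norm y powr c)" for c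
      by (rule bsupp_powr_integrable[OF bsupp_Bq])
    have heq: "h y = fst q * (Bq q ((norm y)\<^sup>2) * norm y powr (- ?p)) + fst (snd q) * (Bq q ((norm y)\<^sup>2) * norm y powr (- ?p - 2))
       + snd (snd q) * (Bq q ((norm y)\<^sup>2) * norm y powr (- ?p - 4))" for y
    proof -
      have "h y = (bet ((norm y)\<^sup>2) * norm y powr (- ?p) * quad q ((norm y)\<^sup>2)) * quad q ((norm y)\<^sup>2)"
        by (simp add: h_def power2_eq_square)
      then show ?thesis unfolding quad_powr Bq_def by (simp add: algebra_simps)
    qed
    have ih: "integrable lborel h" unfolding heq[abs_def] using i by simp
    have "(\<integral>y. h y \<partial>lborel) = fst q * ?w q 0 + fst (snd q) * ?w q 1 + snd (snd q) * ?w q 2"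
      unfolding heq wint_def using i by simp
    then have "(\<integral>y. h y \<partial>lborel) = 0" using w by simp
    moreover have "\<And>y. 0 \<le> h y" unfolding h_def by (intro mult_nonneg_nonneg bet_nonneg) auto
    ultimately have "AE y in lborel. h y = 0" using integral_nonneg_eq_0_iff_AE[OF ih] by simp
    \<comment> \<open>By continuity of \<open>quad q\<close>, vanishing almost everywhere becomes
      vanishing on the whole open annulus, hence at the three values 10, 11, 12 of \<sigma>.\<close>
    define W where "W = {y::real^'n. 9 < (norm y)\<^sup>2 \<and> (norm y)\<^sup>2 < 16 \<and> quad q ((norm y)\<^sup>2) \<noteq> 0}"
    have cq: "continuous_on {y::real^'n. 9 < (norm y)\<^sup>2} (\<lambda>y. quad q ((norm y)\<^sup>2))"
      unfolding quad_def by (intro continuous_intros) auto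
    have "open {y::real^'n. 9 < (norm y)\<^sup>2}" by (intro open_Collect_less continuous_intros)
    then have "open ({y::real^'n. 9 < (norm y)\<^sup>2} \<inter> (\<lambda>y. quad q ((norm y)\<^sup>2)) -` (- {0}))"
      by (intro continuous_open_preimage[OF cq]) auto
    moreover have "open {y::real^'n. (norm y)\<^sup>2 < 16}" by (intro open_Collect_less continuous_intros)
    moreover have "W = ({y::real^'n. 9 < (norm y)\<^sup>2} \<inter> (\<lambda>y. quad q ((norm y)\<^sup>2)) -` (- {0})) \<inter> {y. (norm y)\<^sup>2 < 16}"
      by (auto simp: W_def)
    ultimately have "open W" by auto
    moreover have "AE y in lborel. y \<notin> W"
      using \<open>AE y in lborel. h y = 0\<close>
    proof eventually_elim
      fix y :: "real^'n" assume "h y = 0"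
      then show "y \<notin> W" using bet_pos[of "(norm y)\<^sup>2"] by (auto simp: W_def h_def)
    qed
    ultimately have "W = {}" by (rule open_AE_empty)
    have z: "quad q \<sigma> = 0" if "9 < \<sigma>" "\<sigma> < 16" for \<sigma>
    proof -
      obtain e :: "real^'n" where e: "norm e = 1" using vector_choose_size[of 1] by auto
      have "(norm (sqrt \<sigma> *\<^sub>R e))\<^sup>2 = \<sigma>" using that e by simp
      then show ?thesis using \<open>W = {}\<close> that unfolding W_def by (metis (mono_tags, lifting) empty_Collect_eq)
    qed
    show "q = 0" using quad_three_roots[of q 10 11 12] z[of 10] z[of 11] z[of 12] by simp
  qed
  have "surj T" using linear_injective_imp_surjective[OF lin inj] by simp
  then obtain q where "T q = t" by (metis surjD)
  then show ?thesis using that[of q] by (auto simp: T_def)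
qed

lemma profile_Uq:
  assumes "0 < s" "s < 1" "2 * s < g" "g < 2 * s + 2"
  shows "profile s g 16 (Uq g q)"
proof
  show "smooth_all {0<..} (Uq g q)" unfolding smooth_all_def Uq_def[abs_def]
    by (intro allI smooth_n_add smooth_n_mult smooth_n_powr smooth_eta smooth_Bq)
  show "Uq g q \<sigma> = \<sigma> powr (g / 2)" if "0 \<le> \<sigma>" "\<sigma> \<le> 9" for \<sigma>
  proof -
    have "eta \<sigma> = 1" using that flat_exp_pos[of 0 "16 - \<sigma>"] by (simp add: eta_def flat_exp_zero)
    then show ?thesis using that by (simp add: Uq_def Bq_def bet_zero)
  qed
  show "Uq g q \<sigma> = 0" if "16 \<le> \<sigma>" for \<sigma>
    using that by (simp add: Uq_def eta_def Bq_def bet_zero flat_exp_zero)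
qed (use assms in auto)

lemma Bq_add: "Bq (x + y) \<sigma> = Bq x \<sigma> + Bq y \<sigma>"
  by (simp add: Bq_def quad_def algebra_simps)

lemma Bq_scale: "Bq (c *\<^sub>R x) \<sigma> = c * Bq x \<sigma>"
  by (simp add: Bq_def quad_def algebra_simps)

text \<open>The three integrals of the bump \<open>Bq q\<close> are used to cancel the moment, to cancel the coefficient of \<open>r\<^sup>2\<close>,
  and to set the coefficient \<open>\<theta>\<close> of \<open>r^4\<close>. Avoiding countably many values of \<open>\<theta>\<close> makes \<open>U\<close> nonzero
  at every rational point where \<open>Bq v\<close> is nonzero, hence somewhere in every interval.\<close>

theorem exists_profile:
  fixes e :: "real^'n" and s g :: real
  assumes s: "0 < s" "s < 1" and g: "2 * s < g" "g < 2 * s + 2" and e: "norm e = 1"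
  obtains U \<theta> K where "profile s g 16 U"
    "(\<integral>y. U ((norm (y::real^'n))\<^sup>2) * norm y powr (- (real CARD('n) + 2 * s)) \<partial>lborel) = 0"
    "\<theta> > 0" "\<And>r. 0 \<le> r \<Longrightarrow> r \<le> 1 \<Longrightarrow> \<bar>ffun s (profile.G g U) e r - \<theta> * r^4\<bar> \<le> K * r^5"
    "\<And>c d. 0 \<le> c \<Longrightarrow> c < d \<Longrightarrow> d \<le> 16 \<Longrightarrow> \<exists>\<sigma>. c < \<sigma> \<and> \<sigma> < d \<and> U \<sigma> \<noteq> 0"
proof -
  let ?p = "real CARD('n) + 2 * s"
  let ?w = "\<lambda>q. wint s (Bq q) TYPE(real^'n)"
  have pr: "profile s g 16 (Uq g q)" for q using s g by (rule profile_Uq)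
  interpret P0: profile s g 16 "Uq g 0" by (rule pr)
  obtain m2 m4 K0 where K0: "\<And>r. 0 \<le> r \<Longrightarrow> r \<le> 1 \<Longrightarrow> \<bar>ffun s P0.G e r - r\<^sup>2 * m2 - r^4 * m4\<bar> \<le> K0 * r^5"
    using P0.ffun_expansion[OF e] by blast
  define \<mu> where "\<mu> = (\<integral>y. Uq g 0 ((norm (y::real^'n))\<^sup>2) * norm y powr (- ?p) \<partial>lborel)"
  define k2 where "k2 = kap2 CARD('n) s"
  define k4 where "k4 = kap4 CARD('n) s"
  have k: "k2 > 0" "k4 > 0" using s unfolding k2_def k4_def kap2_def kap4_def
    by (auto intro!: mult_pos_pos divide_pos_pos add_pos_pos)
  \<comment> \<open>G loses \<open>Bq q\<close> when U gains it, so these targets bring the moment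
    and the coefficients of r^2 and r^4 to zero. The direction v changes the r^4 coefficient alone,
    and its target -1/k4 turns into + \<theta> for the same reason.\<close>
  obtain qs where qs: "?w qs 0 = - \<mu>" "?w qs 1 = m2 / k2" "?w qs 2 = m4 / k4"
    by (rule gram_surj[of s "(- \<mu>, m2 / k2, m4 / k4)", where 'n='n]) auto
  obtain v where v: "?w v 0 = 0" "?w v 1 = 0" "?w v 2 = - 1 / k4"
    by (rule gram_surj[of s "(0, 0, - 1 / k4)", where 'n='n]) auto
  have v0: "v \<noteq> 0"
  proof
    assume "v = 0"
    then have "?w v 2 = 0" by (simp add: wint_Bq)
    then show False using v k by simp
  qed
  let ?bad = "(\<lambda>\<sigma>. - Uq g qs \<sigma> / Bq v \<sigma>) ` \<rat>"
  have "countable ?bad" using countable_rat by (rule countable_image)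
  moreover have "uncountable {0<..<1::real}" by (simp add: uncountable_open_interval)
  ultimately obtain \<theta> where \<theta>: "\<theta> \<in> {0<..<1}" "\<theta> \<notin> ?bad"
    by (meson countable_subset subsetI)
  define q where "q = qs + \<theta> *\<^sub>R v"
  have wq: "?w q 0 = - \<mu>" "?w q 1 = m2 / k2" "?w q 2 = m4 / k4 - \<theta> / k4"
  proof -
    have "?w q j = ?w qs j + \<theta> * ?w v j" for j by (simp add: q_def wint_Bq algebra_simps)
    then show "?w q 0 = - \<mu>" "?w q 1 = m2 / k2" "?w q 2 = m4 / k4 - \<theta> / k4" using qs v by simp_all
  qed
  have Uq_split: "Uq g x \<sigma> = Uq g 0 \<sigma> + Bq x \<sigma>" for x \<sigma> by (simp add: Uq_def Bq_def quad_def)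
  interpret P: profile s g 16 "Uq g q" by (rule pr)
  have Gsplit: "P.G = (\<lambda>\<sigma>. P0.G \<sigma> - Bq q \<sigma>)"
  proof
    fix \<sigma> show "P.G \<sigma> = P0.G \<sigma> - Bq q \<sigma>"
      by (simp add: P.G_def P0.G_def Uq_split[of q] Bq_def bet_zero)
  qed
  obtain K1 where K1: "\<And>r. 0 \<le> r \<Longrightarrow> r \<le> 1 \<Longrightarrow> \<bar>ffun s (Bq q) e r - r\<^sup>2 * (k2 * ?w q 1) - r^4 * (k4 * ?w q 2)\<bar> \<le> K1 * r^5"
    unfolding k2_def k4_def using bump_expansion[OF bsupp_Bq e] by blast
  show ?thesis
  proof (rule that[of "Uq g q" \<theta> "K0 + K1"])
    show "profile s g 16 (Uq g q)" by (rule pr)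
    show "0 < \<theta>" using \<theta> by simp
    show "(\<integral>y. Uq g q ((norm (y::real^'n))\<^sup>2) * norm y powr (- ?p) \<partial>lborel) = 0"
    proof -
      have i0: "integrable lborel (\<lambda>y::real^'n. Uq g 0 ((norm y)\<^sup>2) * norm y powr (- ?p))"
        using P0.integrable_U[where 'a="real^'n"] by (simp only: DIM_cart DIM_real mult_1_right)
      have i1: "integrable lborel (\<lambda>y::real^'n. Bq q ((norm y)\<^sup>2) * norm y powr (- ?p))"
        by (rule bsupp_powr_integrable[OF bsupp_Bq])
      have "(\<integral>y. Uq g q ((norm (y::real^'n))\<^sup>2) * norm y powr (- ?p) \<partial>lborel)
        = (\<integral>y. Uq g 0 ((norm (y::real^'n))\<^sup>2) * norm y powr (- ?p) + Bq q ((norm y)\<^sup>2) * norm y powr (- ?p) \<partial>lborel)"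
        unfolding Uq_split[of q] distrib_right ..
      also have "\<dots> = \<mu> + ?w q 0"
        unfolding \<mu>_def wint_def using i0 i1 by simp
      finally show ?thesis using wq by simp
    qed
    show "\<bar>ffun s P.G e r - \<theta> * r^4\<bar> \<le> (K0 + K1) * r^5" if r: "0 \<le> r" "r \<le> 1" for r
    proof -
      have r': "\<bar>r\<bar> \<le> 1" using r by simp
      have "Gbr P.G e r z = Gbr P0.G e r z - Gbr (Bq q) e r z" for z
        unfolding Gsplit Gbr_def by (simp add: field_simps)
      then have "ffun s P.G e r = (\<integral>z. Gbr P0.G e r z * norm z powr (- (real DIM(real^'n) + 2 * s)) - Gbr (Bq q) e r z * norm z powr (- (real DIM(real^'n) + 2 * s)) \<partial>lborel)"
        unfolding ffun_def by (simp only: left_diff_distrib)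
      also have "\<dots> = ffun s P0.G e r - ffun s (Bq q) e r"
        unfolding ffun_def using P0.integrable_Gbr[OF e r'] bump_Gbr(1)[OF bsupp_Bq e r', of q s] by (rule Bochner_Integration.integral_diff)
      finally have f: "ffun s P.G e r = ffun s P0.G e r - ffun s (Bq q) e r" .
      have k1: "k2 * ?w q 1 = m2" "k4 * ?w q 2 = m4 - \<theta>" using k wq by (simp_all add: field_simps)
      have "ffun s P.G e r - \<theta> * r^4 = (ffun s P0.G e r - r\<^sup>2 * m2 - r^4 * m4) - (ffun s (Bq q) e r - r\<^sup>2 * (k2 * ?w q 1) - r^4 * (k4 * ?w q 2))"
        unfolding f k1 by (simp add: algebra_simps)
      also have "\<bar>\<dots>\<bar> \<le> K0 * r^5 + K1 * r^5"
        using K0[OF r] K1[OF r] by linarith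
      finally show ?thesis by (simp add: algebra_simps)
    qed
    show "\<exists>\<sigma>. c < \<sigma> \<and> \<sigma> < d \<and> Uq g q \<sigma> \<noteq> 0" if cd: "0 \<le> c" "c < d" "d \<le> 16" for c d
    proof (cases "c < 9")
      case True
      define \<sigma> where "\<sigma> = (c + min d 9) / 2"
      have \<sigma>: "c < \<sigma>" "\<sigma> < d" "\<sigma> < 9" using cd True by (auto simp: \<sigma>_def min_def field_simps)
      then have "Uq g q \<sigma> = \<sigma> powr (g / 2)" using cd by (intro P.U_low) auto
      then show ?thesis using \<sigma> cd by (intro exI[of _ \<sigma>]) auto
    next
      case False
      \<comment> \<open>Three points are taken because \<open>quad v\<close> with v nonzero has at
        most two positive zeros.\<close>
      obtain x where x: "x \<in> \<rat>" "c < x" "x < d" using Rats_dense_in_real cd by blast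
      obtain y where y: "y \<in> \<rat>" "x < y" "y < d" using Rats_dense_in_real x by blast
      obtain z where z: "z \<in> \<rat>" "y < z" "z < d" using Rats_dense_in_real y by blast
      have "\<exists>\<sigma>\<in>{x, y, z}. quad v \<sigma> \<noteq> 0"
        using quad_three_roots[of v x y z] v0 x y z False by auto
      then obtain \<sigma> where \<sigma>: "\<sigma> \<in> \<rat>" "c < \<sigma>" "\<sigma> < d" "quad v \<sigma> \<noteq> 0"
        using x y z by fastforce
      have "bet \<sigma> > 0" using \<sigma> False cd by (intro bet_pos) auto
      then have B: "Bq v \<sigma> \<noteq> 0" using \<sigma> by (simp add: Bq_def)
      have "Uq g q \<sigma> = Uq g qs \<sigma> + \<theta> * Bq v \<sigma>"
        unfolding Uq_split[of q] Uq_split[of qs] by (simp add: q_def Bq_add Bq_scale)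
      moreover have "\<theta> \<noteq> - Uq g qs \<sigma> / Bq v \<sigma>" using \<theta> \<sigma> by blast
      ultimately have "Uq g q \<sigma> \<noteq> 0" using B by (auto simp: field_simps)
      then show ?thesis using \<sigma> by blast
    qed
  qed
qed

section \<open>Membership in the energy space\<close>

text \<open>The shape of a bound for differences of bounded Hoelder functions: a power of the
  distance for close points, a constant for distant ones.\<close>

definition capk :: "real \<Rightarrow> 'a::euclidean_space \<Rightarrow> real" where
  "capk \<beta> z = (if norm z \<le> 1 then norm z powr \<beta> else norm z powr 0)"

lemma capk_nonneg: "capk \<beta> z \<ge> 0" by (simp add: capk_def)

lemma borel_measurable_capk[measurable]: "capk \<beta> \<in> borel_measurable borel"
  unfolding capk_def[abs_def] by measurable

text \<open>At least 1 as soon as one of the points lies in the ball. A sum replaces the indicator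
  of the union because each summand integrates to the volume of a ball.\<close>

definition balls :: "real \<Rightarrow> 'a::euclidean_space \<Rightarrow> 'a \<Rightarrow> real" where
  "balls R x y = (if norm x < R then 1 else 0) + (if norm y < R then 1 else 0)"


lemma balls_nonneg: "balls R x y \<ge> 0" by (simp add: balls_def)

lemma borel_measurable_balls[measurable]:
  assumes [measurable]: "f \<in> borel_measurable M" "h \<in> borel_measurable M"
  shows "(\<lambda>w. balls R (f w :: 'a::euclidean_space) (h w)) \<in> borel_measurable M"
  unfolding balls_def by measurable

text \<open>Tonelli in the sheared variables: for fixed z the x-integral of \<open>balls\<close> is
  twice the volume of the ball, whatever z is.\<close>

lemma integrable_kernel_shear:
  fixes k :: "'a::euclidean_space \<Rightarrow> real"
  assumes k: "integrable lborel k" "\<And>z. 0 \<le> k z" "k \<in> borel_measurable borel"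
  shows "integrable lborel (\<lambda>w::'a \<times> 'a. balls R (fst w) (fst w + snd w) * k (snd w))"
proof (rule integrableI_nonneg)
  have [measurable]: "k \<in> borel_measurable borel" by (rule k)
  let ?f = "\<lambda>w::'a \<times> 'a. balls R (fst w) (fst w + snd w) * k (snd w)"
  have m: "?f \<in> borel_measurable (borel \<Otimes>\<^sub>M borel)" by measurable
  then show mb: "?f \<in> borel_measurable lborel" by (simp add: borel_prod)
  have "(\<integral>\<^sup>+ w. ennreal (?f w) \<partial>lborel) = (\<integral>\<^sup>+ w. ennreal (?f w) \<partial>(lborel \<Otimes>\<^sub>M lborel))"
    by (simp add: lborel_prod)
  also have "\<dots> = (\<integral>\<^sup>+ z. \<integral>\<^sup>+ x. ennreal (?f (x, z)) \<partial>lborel \<partial>lborel)"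
    by (rule lborel_pair.nn_integral_snd[symmetric]) measurable
  also have "\<dots> = (\<integral>\<^sup>+ z. ennreal (k z) * (2 * emeasure lborel (ball (0::'a) R)) \<partial>lborel)"
  proof (rule nn_integral_cong)
    fix z :: 'a
    define iB where "iB x = (if norm x < R then 1 else 0 :: ennreal)" for x :: 'a
    have [measurable]: "iB \<in> borel_measurable borel" unfolding iB_def[abs_def] by measurable
    have iB_int: "(\<integral>\<^sup>+ x. iB x \<partial>lborel) = emeasure lborel (ball (0::'a) R)"
    proof -
      have "(\<integral>\<^sup>+ x. iB x \<partial>lborel) = (\<integral>\<^sup>+ x. indicator (ball (0::'a) R) x \<partial>lborel)"
        by (intro nn_integral_cong) (simp add: iB_def)
      then show ?thesis by simp
    qed
    have "(\<integral>\<^sup>+ x. ennreal (?f (x, z)) \<partial>lborel) = (\<integral>\<^sup>+ x. ennreal (k z) * (iB x + iB (x + z)) \<partial>lborel)"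
      using k(2)[of z] by (intro nn_integral_cong) (auto simp: balls_def iB_def ennreal_mult'' mult_2 mult.commute ennreal_plus[symmetric] simp del: ennreal_plus)
    also have "\<dots> = ennreal (k z) * (\<integral>\<^sup>+ x. (iB x + iB (x + z)) \<partial>lborel)"
      by (rule nn_integral_cmult) measurable
    also have "(\<integral>\<^sup>+ x. (iB x + iB (x + z)) \<partial>lborel) = (\<integral>\<^sup>+ x. iB x \<partial>lborel) + (\<integral>\<^sup>+ x. iB (x + z) \<partial>lborel)"
      by (rule nn_integral_add) measurable
    also have "(\<integral>\<^sup>+ x. iB (x + z) \<partial>lborel) = (\<integral>\<^sup>+ x. iB x \<partial>lborel)"
      by (rule leb_preserving_nn_integral[OF leb_preserving_plus]) measurable
    finally show "(\<integral>\<^sup>+ x. ennreal (?f (x, z)) \<partial>lborel) = ennreal (k z) * (2 * emeasure lborel (ball (0::'a) R))"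
      by (simp add: mult_2 iB_int)
  qed
  also have "\<dots> = (\<integral>\<^sup>+ z. ennreal (k z) \<partial>lborel) * (2 * emeasure lborel (ball (0::'a) R))"
    by (rule nn_integral_multc) measurable
  also have "\<dots> < \<infinity>"
  proof -
    have "(\<integral>\<^sup>+ z. ennreal (k z) \<partial>lborel) < top"
      using k(1,2) by (simp add: nn_integral_eq_integral)
    moreover have "2 * emeasure lborel (ball (0::'a) R) < top"
      using emeasure_lborel_ball_finite[of "0::'a" R] by (simp add: ennreal_mult_less_top)
    ultimately show ?thesis by (simp add: ennreal_mult_less_top)
  qed
  finally show "(\<integral>\<^sup>+ w. ennreal (?f w) \<partial>lborel) < \<infinity>" .
  show "AE w in lborel. 0 \<le> ?f w" using k(2) by (auto simp: balls_def)
qed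

lemma integrable_capk_shear:
  assumes "\<beta> > 2 * s" "0 < s"
  shows "integrable lborel (\<lambda>w::'a::euclidean_space \<times> 'a. balls R (fst w) (fst w + snd w) * (capk \<beta> (snd w) * norm (snd w) powr (- (real DIM('a) + 2 * s))))"
proof (rule integrable_kernel_shear)
  show "integrable lborel (\<lambda>z::'a. capk \<beta> z * norm z powr (- (real DIM('a) + 2 * s)))"
    unfolding capk_def using assms by (intro integrable_kernel_dom) auto
qed (auto simp: capk_nonneg)

lemma integrable_capk_pair:
  assumes "\<beta> > 2 * s" "0 < s"
  shows "integrable lborel (\<lambda>w::'a::euclidean_space \<times> 'a. balls R (fst w) (snd w) * (capk \<beta> (fst w - snd w) * norm (fst w - snd w) powr (- (real DIM('a) + 2 * s))))"
proof -
  let ?h = "\<lambda>w::'a \<times> 'a. balls R (fst w) (snd w) * (capk \<beta> (fst w - snd w) * norm (fst w - snd w) powr (- (real DIM('a) + 2 * s)))"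
  have "?h \<in> borel_measurable (borel \<Otimes>\<^sub>M borel)" by measurable
  then have m: "?h \<in> borel_measurable borel" by (simp add: borel_prod)
  have c: "capk \<beta> (- z) = capk \<beta> z" for z :: 'a by (simp add: capk_def)
  show ?thesis
    using leb_preserving_integrable[OF leb_preserving_shear m] integrable_capk_shear[OF assms, of R, where 'a='a] by (simp add: c)
qed

section \<open>Hoelder regularity and smooth approximation of the solution\<close>

lemma powr_subadditive:
  fixes a b \<alpha> :: real
  assumes "0 \<le> a" "0 \<le> b" "0 < \<alpha>" "\<alpha> \<le> 1"
  shows "(a + b) powr \<alpha> \<le> a powr \<alpha> + b powr \<alpha>"
proof (cases "a + b = 0")
  case False
  then have ab: "a + b > 0" using assms by simp
  have *: "x / (a + b) \<le> (x / (a + b)) powr \<alpha>" if "0 \<le> x" "x \<le> a + b" for x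
    using powr_mono'[of \<alpha> 1 "x / (a + b)"] assms that ab by auto
  have "1 = a / (a + b) + b / (a + b)" using ab by (simp add: add_divide_distrib[symmetric])
  also have "\<dots> \<le> (a / (a + b)) powr \<alpha> + (b / (a + b)) powr \<alpha>" using assms by (intro add_mono *) auto
  finally have "(a + b) powr \<alpha> * 1 \<le> (a + b) powr \<alpha> * ((a / (a + b)) powr \<alpha> + (b / (a + b)) powr \<alpha>)"
    by (intro mult_left_mono) auto
  also have "\<dots> = a powr \<alpha> + b powr \<alpha>"
    using assms ab by (simp add: distrib_left powr_divide)
  finally show ?thesis by simp
qed (use assms in auto)

context profile
begin

text \<open>Near the origin r -> U(r^2) is r^g, which limits the exponent: its derivative is
  O(r^(\<alpha>-1)) on bounded intervals because \<alpha> <= g. Integrating this bound and using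
  subadditivity of powers gives the claim.\<close>

lemma U_holder:
  assumes \<alpha>: "0 < \<alpha>" "\<alpha> \<le> 1" "\<alpha> \<le> g"
  obtains K where "K \<ge> 0" "\<And>r t. 0 \<le> r \<Longrightarrow> 0 \<le> t \<Longrightarrow> \<bar>U (r\<^sup>2) - U (t\<^sup>2)\<bar> \<le> K * \<bar>r - t\<bar> powr \<alpha>"
proof -
  define m where "m r = r powr g - G (r\<^sup>2)" for r
  have Um: "U (r\<^sup>2) = m r" if "0 \<le> r" for r using that by (simp add: U_eq m_def square_powr)
  obtain K where K: "K \<ge> 0" "\<And>i \<sigma>. i \<le> 5 \<Longrightarrow> \<sigma> > 0 \<Longrightarrow> \<bar>D i \<sigma>\<bar> \<le> K * \<sigma> powr (g / 2 - real i)"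
    by (rule D_bound) blast
  define R0 where "R0 = sqrt b"
  have R0: "R0 > 0" using b by (simp add: R0_def)
  define C where "C = (g + 2 * K) * R0 powr (g - \<alpha>)"
  have C0: "C \<ge> 0" unfolding C_def using K g s by (intro mult_nonneg_nonneg) auto
  define m' where "m' r = g * r powr (g - 1) - D 1 (r\<^sup>2) * (2 * r)" for r
  have der: "(m has_real_derivative m' r) (at r)" if "r > 0" for r
  proof -
    have "((\<lambda>r. G (r\<^sup>2)) has_real_derivative D 1 (r\<^sup>2) * (2 * r)) (at r)"
      using D_deriv[of 0] unfolding D_0 by (intro DERIV_chain2[where f = G]) (auto intro!: derivative_eq_intros)
    then show ?thesis unfolding m_def[abs_def] m'_def using that by (intro DERIV_diff has_real_derivative_powr)
  qed
  have bound: "\<bar>m' r\<bar> \<le> C * r powr (\<alpha> - 1)" if r: "0 < r" "r \<le> R0" for r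
  proof -
    have "\<bar>D 1 (r\<^sup>2)\<bar> \<le> K * r powr (g - 2)" using K(2)[of 1 "r\<^sup>2"] r by (simp add: square_powr algebra_simps)
    then have "\<bar>D 1 (r\<^sup>2)\<bar> * (2 * r) \<le> K * r powr (g - 2) * (2 * r)" using r by (intro mult_right_mono) auto
    also have "\<dots> = 2 * K * (r powr (g - 2) * r powr 1)" using r by simp
    also have "\<dots> = 2 * K * r powr (g - 1)" by (simp only: powr_add[symmetric]) simp
    finally have "\<bar>D 1 (r\<^sup>2) * (2 * r)\<bar> \<le> 2 * K * r powr (g - 1)" using r by (simp add: abs_mult)
    moreover have "\<bar>g * r powr (g - 1)\<bar> = g * r powr (g - 1)" using g s by simp
    ultimately have "\<bar>m' r\<bar> \<le> g * r powr (g - 1) + 2 * K * r powr (g - 1)" unfolding m'_def by linarith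
    also have "\<dots> = (g + 2 * K) * (r powr (g - \<alpha>) * r powr (\<alpha> - 1))" by (simp add: powr_add[symmetric] algebra_simps)
    also have "\<dots> \<le> (g + 2 * K) * (R0 powr (g - \<alpha>) * r powr (\<alpha> - 1))"
      using r K g s \<alpha> by (intro mult_left_mono mult_right_mono powr_mono2) auto
    finally show ?thesis by (simp add: C_def mult.assoc)
  qed
  have cont: "continuous_on {x..y} m" if "0 \<le> x" for x y
  proof -
    have "continuous_on {x..y} (\<lambda>r. D 0 (r\<^sup>2))"
      by (rule continuous_on_compose2[OF D_cont[of UNIV 0]]) (auto intro!: continuous_intros)
    moreover have "continuous_on {x..y} (\<lambda>r. r powr g)"
      using that g s by (intro continuous_on_powr' continuous_intros) auto
    ultimately show ?thesis unfolding m_def[abs_def] D_0 by (intro continuous_on_diff)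
  qed
  have inc: "\<bar>m t - m r\<bar> \<le> C / \<alpha> * (t - r) powr \<alpha>" if rt: "0 \<le> r" "r \<le> t" "t \<le> R0" for r t
  proof -
    \<comment> \<open>Adding or subtracting m leaves (C/\<alpha>) r^\<alpha> increasing, since its
      derivative C r^(\<alpha>-1) dominates that of m. The two signs together bound the increment of
      m.\<close>
    have one: "C / \<alpha> * r powr \<alpha> + \<epsilon> * m r \<le> C / \<alpha> * t powr \<alpha> + \<epsilon> * m t" if \<epsilon>: "\<epsilon> = 1 \<or> \<epsilon> = -1" for \<epsilon>
    proof (rule DERIV_nonneg_imp_increasing_open[OF rt(2)])
      fix x assume x: "r < x" "x < t"
      have "((\<lambda>x. C / \<alpha> * x powr \<alpha> + \<epsilon> * m x) has_real_derivative C / \<alpha> * (\<alpha> * x powr (\<alpha> - 1)) + \<epsilon> * m' x) (at x)"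
        using x rt by (intro DERIV_add DERIV_cmult has_real_derivative_powr der) auto
      moreover have "C / \<alpha> * (\<alpha> * x powr (\<alpha> - 1)) + \<epsilon> * m' x \<ge> 0"
        using bound[of x] x rt \<epsilon> \<alpha> by auto
      ultimately show "\<exists>y. ((\<lambda>x. C / \<alpha> * x powr \<alpha> + \<epsilon> * m x) has_real_derivative y) (at x) \<and> 0 \<le> y" by blast
    next
      have "continuous_on {r..t} (\<lambda>x. x powr \<alpha>)"
        using rt \<alpha> by (intro continuous_on_powr' continuous_intros) auto
      then show "continuous_on {r..t} (\<lambda>x. C / \<alpha> * x powr \<alpha> + \<epsilon> * m x)"
        using cont[OF rt(1)] by (intro continuous_on_add continuous_on_mult continuous_on_const)
    qed
    have "\<bar>m t - m r\<bar> \<le> C / \<alpha> * (t powr \<alpha> - r powr \<alpha>)"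
      using one[of 1] one[of "-1"] by (simp add: algebra_simps abs_le_iff)
    also have "\<dots> \<le> C / \<alpha> * (t - r) powr \<alpha>"
      using powr_subadditive[of r "t - r" \<alpha>] rt \<alpha> C0 by (intro mult_left_mono) auto
    finally show ?thesis .
  qed
  have far: "m r = 0" if "r \<ge> R0" for r
  proof -
    have "b \<le> r\<^sup>2" using power_mono[OF that, of 2] R0 b by (simp add: R0_def)
    then show ?thesis using Um[of r] U_high that R0 by simp
  qed
  have main: "\<bar>m t - m r\<bar> \<le> C / \<alpha> * (t - r) powr \<alpha>" if rt: "0 \<le> r" "r \<le> t" for r t
  proof -
    consider "t \<le> R0" | "r \<le> R0" "R0 < t" | "R0 < r" by linarith
    then show ?thesis
    proof cases
      case 1 then show ?thesis using inc rt by simp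
    next
      case 2
      have "\<bar>m t - m r\<bar> = \<bar>m R0 - m r\<bar>" using far[of t] far[of R0] 2 by simp
      also have "\<dots> \<le> C / \<alpha> * (R0 - r) powr \<alpha>" using 2 rt by (intro inc) auto
      also have "\<dots> \<le> C / \<alpha> * (t - r) powr \<alpha>" using 2 rt \<alpha> C0 by (intro mult_left_mono powr_mono2) auto
      finally show ?thesis .
    next
      case 3 then show ?thesis using far[of r] far[of t] rt \<alpha> C0 by simp
    qed
  qed
  show ?thesis
  proof (rule that[of "C / \<alpha>"])
    show "0 \<le> C / \<alpha>" using C0 \<alpha> by simp
    fix r t :: real assume "0 \<le> r" "0 \<le> t"
    then show "\<bar>U (r\<^sup>2) - U (t\<^sup>2)\<bar> \<le> C / \<alpha> * \<bar>r - t\<bar> powr \<alpha>"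
      using main[of r t] main[of t r] Um by (cases "r \<le> t") (auto simp: abs_minus_commute)
  qed
qed

text \<open>The reverse triangle inequality in the plane for the vectors (a, sqrt \<epsilon>) and
  (c, sqrt \<epsilon>).\<close>

lemma sqrt_shift_lipschitz:
  fixes a c \<epsilon> :: real
  assumes "0 \<le> a" "0 \<le> c" "0 \<le> \<epsilon>"
  shows "\<bar>sqrt (a\<^sup>2 + \<epsilon>) - sqrt (c\<^sup>2 + \<epsilon>)\<bar> \<le> \<bar>a - c\<bar>"
proof -
  have "\<bar>norm (a, sqrt \<epsilon>) - norm (c, sqrt \<epsilon>)\<bar> \<le> norm ((a, sqrt \<epsilon>) - (c, sqrt \<epsilon>))"
    by (rule norm_triangle_ineq3)
  then show ?thesis using assms by (simp add: norm_Pair)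
qed

text \<open>The constant does not depend on \<epsilon>, so that one integrable bound serves all
  approximants at once.\<close>

lemma U_shift_holder:
  assumes \<alpha>: "0 < \<alpha>" "\<alpha> \<le> 1" "\<alpha> \<le> g"
  obtains K where "K \<ge> 0" "\<And>\<epsilon> x y. 0 \<le> \<epsilon> \<Longrightarrow> \<bar>U ((norm (x::'a::euclidean_space))\<^sup>2 + \<epsilon>) - U ((norm y)\<^sup>2 + \<epsilon>)\<bar> \<le> K * norm (x - y) powr \<alpha>"
proof -
  obtain K where K: "K \<ge> 0" "\<And>r t. 0 \<le> r \<Longrightarrow> 0 \<le> t \<Longrightarrow> \<bar>U (r\<^sup>2) - U (t\<^sup>2)\<bar> \<le> K * \<bar>r - t\<bar> powr \<alpha>"
    by (rule U_holder[OF \<alpha>]) blast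
  show ?thesis
  proof (rule that[OF K(1)])
    fix \<epsilon> :: real and x y :: 'a assume \<epsilon>: "0 \<le> \<epsilon>"
    have "\<bar>U ((sqrt ((norm x)\<^sup>2 + \<epsilon>))\<^sup>2) - U ((sqrt ((norm y)\<^sup>2 + \<epsilon>))\<^sup>2)\<bar>
      \<le> K * \<bar>sqrt ((norm x)\<^sup>2 + \<epsilon>) - sqrt ((norm y)\<^sup>2 + \<epsilon>)\<bar> powr \<alpha>"
      using \<epsilon> by (intro K(2)) auto
    also have "\<dots> \<le> K * norm (x - y) powr \<alpha>"
    proof (intro mult_left_mono powr_mono2)
      show "\<bar>sqrt ((norm x)\<^sup>2 + \<epsilon>) - sqrt ((norm y)\<^sup>2 + \<epsilon>)\<bar> \<le> norm (x - y)"
        using sqrt_shift_lipschitz[of "norm x" "norm y" \<epsilon>] norm_triangle_ineq3[of x y] \<epsilon> by simp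
    qed (use K \<alpha> in auto)
    finally show "\<bar>U ((norm x)\<^sup>2 + \<epsilon>) - U ((norm y)\<^sup>2 + \<epsilon>)\<bar> \<le> K * norm (x - y) powr \<alpha>"
      using \<epsilon> by simp
  qed
qed

text \<open>The exponent serves two integrability conditions: s < \<open>hexp\<close> gives u finite
  energy, and 2s < \<open>hexp\<close> + 1 handles the product of its differences with those of a
  Lipschitz function.\<close>

definition hexp :: real where "hexp = min g 1"

lemma hexp: "0 < hexp" "hexp \<le> 1" "hexp \<le> g" "s < hexp" "2 * s < hexp + 1"
  using s g by (auto simp: hexp_def)

definition approx :: "nat \<Rightarrow> 'a::euclidean_space \<Rightarrow> real" where
  "approx k x = U ((norm x)\<^sup>2 + inverse (real (Suc k)))"

lemma approx_test_fun: "test_fun UNIV (approx k :: 'a::euclidean_space \<Rightarrow> real)"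
  unfolding test_fun_def smooth_fun_def
proof (intro conjI allI)
  have pos: "(norm x)\<^sup>2 + inverse (real (Suc k)) \<in> {0<..}" for x :: 'a
    by (simp add: add_nonneg_pos)
  show "Ck j (approx k :: 'a \<Rightarrow> real)" for j
    unfolding approx_def[abs_def]
    by (rule Ck_compose[OF _ Ck_sq_norm pos]) (use U_smooth in \<open>simp add: smooth_all_def\<close>)
  have "{x::'a. approx k x \<noteq> 0} \<subseteq> cball 0 (sqrt b)"
  proof
    fix x :: 'a assume "x \<in> {x. approx k x \<noteq> 0}"
    then have "(norm x)\<^sup>2 + inverse (real (Suc k)) < b" using U_high by (force simp: approx_def not_le[symmetric])
    moreover have "inverse (real (Suc k)) > 0" by simp
    ultimately have "(norm x)\<^sup>2 \<le> b" by linarith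
    then show "x \<in> cball 0 (sqrt b)" using real_le_rsqrt by simp
  qed
  then have "bounded {x::'a. approx k x \<noteq> 0}" using bounded_cball bounded_subset by blast
  then show "compact (closure {x::'a. approx k x \<noteq> 0})" by simp
qed simp

lemma approx_tendsto: "(\<lambda>k. approx k x) \<longlonglongrightarrow> U ((norm x)\<^sup>2)"
proof (cases "x = 0")
  case False
  have "smooth_n 0 {0<..} U" using U_smooth by (simp add: smooth_all_def del: smooth_n.simps)
  then have "isCont U ((norm x)\<^sup>2)"
    using False by (simp add: continuous_on_eq_continuous_at)
  moreover have "(\<lambda>k. (norm x)\<^sup>2 + inverse (real (Suc k))) \<longlonglongrightarrow> (norm x)\<^sup>2 + 0"
    by (intro tendsto_intros LIMSEQ_inverse_real_of_nat)
  ultimately show ?thesis unfolding approx_def using isCont_tendsto_compose by fastforce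
next
  case True
  have "(\<lambda>k. inverse (real (Suc k)) powr (g / 2)) \<longlonglongrightarrow> 0"
    using g s by (intro tendsto_zero_powrI[OF LIMSEQ_inverse_real_of_nat tendsto_const]) auto
  moreover have "approx k x = inverse (real (Suc k)) powr (g / 2)" for k
    unfolding approx_def True using inverse_le_1_iff[of "real (Suc k)"] by (subst U_low) auto
  ultimately show ?thesis using U_low[of 0] True by simp
qed

text \<open>Dominated convergence for the energy of u - \<open>approx k\<close>: the differences
  converge pointwise, satisfy a Hoelder bound uniform in k, and are supported in one ball.\<close>

theorem U_in_Ds2:
  "(\<lambda>x::real^'n. U ((norm x)\<^sup>2)) \<in> Ds2 s"
  unfolding Ds2_def
proof (intro CollectI conjI exI[of _ approx] allI)
  show "(\<lambda>x::real^'n. U ((norm x)\<^sup>2)) \<in> borel_measurable lborel" by simp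
  show "test_fun UNIV (approx k :: real^'n \<Rightarrow> real)" for k by (rule approx_test_fun)
  show "AE x in lborel. (\<lambda>k. approx k (x::real^'n)) \<longlonglongrightarrow> U ((norm x)\<^sup>2)" by (intro AE_I2 approx_tendsto)
  let ?p = "real CARD('n) + 2 * s"
  let ?u = "\<lambda>x::real^'n. U ((norm x)\<^sup>2)"
  define d where "d k x = ?u x - approx k x" for k and x :: "real^'n"
  obtain K where K: "K \<ge> 0" "\<And>\<epsilon> x y. 0 \<le> \<epsilon> \<Longrightarrow> \<bar>U ((norm (x::real^'n))\<^sup>2 + \<epsilon>) - U ((norm y)\<^sup>2 + \<epsilon>)\<bar> \<le> K * norm (x - y) powr hexp"
    by (rule U_shift_holder[OF hexp(1-3), where 'a="real^'n"]) blast
  obtain B where B: "B \<ge> 0" "\<And>\<sigma>. 0 \<le> \<sigma> \<Longrightarrow> \<bar>U \<sigma>\<bar> \<le> B" by (rule U_bounded) blast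
  define L where "L = 2 * K + 4 * B"
  have cm: "continuous_on UNIV (approx k :: real^'n \<Rightarrow> real)" for k
    using approx_test_fun[of k, where 'a="real^'n"] unfolding test_fun_def smooth_fun_def using Ck_continuous by blast
  have dm[measurable]: "d k \<in> borel_measurable borel" for k
    unfolding d_def[abs_def] using borel_measurable_continuous_onI[OF cm] by measurable
  have hol: "\<bar>d k x - d k y\<bar> \<le> L * capk hexp (x - y)" for k x y
  proof -
    have 1: "\<bar>d k x - d k y\<bar> \<le> 2 * K * norm (x - y) powr hexp"
      using K(2)[of 0 x y] K(2)[of "inverse (real (Suc k))" x y] unfolding d_def approx_def by simp
    have b4: "\<bar>?u x\<bar> \<le> B" "\<bar>?u y\<bar> \<le> B" "\<bar>approx k x\<bar> \<le> B" "\<bar>approx k y\<bar> \<le> B"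
      unfolding approx_def by (auto intro!: B)
    then have 2: "\<bar>d k x - d k y\<bar> \<le> 4 * B" unfolding d_def by linarith
    show ?thesis
    proof (cases "norm (x - y) \<le> 1")
      case True
      have "2 * K * norm (x - y) powr hexp \<le> L * norm (x - y) powr hexp" using B by (intro mult_right_mono) (auto simp: L_def)
      then show ?thesis using 1 True by (simp add: capk_def)
    next
      case False
      then have "x \<noteq> y" by auto
      then show ?thesis using 2 False K by (simp add: capk_def L_def)
    qed
  qed
  have zero: "d k x = 0" if "x \<notin> ball 0 (sqrt b)" for k x
  proof -
    have "b \<le> (norm x)\<^sup>2" using that real_sqrt_le_iff[of b "(norm x)\<^sup>2"] by simp
    moreover from this have "b \<le> (norm x)\<^sup>2 + inverse (real (Suc k))" by (simp add: add_increasing2)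
    ultimately show ?thesis by (simp add: d_def approx_def U_high)
  qed
  define F where "F k w = ennreal ((d k (fst w) - d k (snd w))\<^sup>2 / norm (fst w - snd w) powr ?p)" for k and w :: "(real^'n) \<times> (real^'n)"
  define W where "W w = L\<^sup>2 * (balls (sqrt b) (fst w) (snd w) * (capk (2 * hexp) (fst w - snd w) * norm (fst w - snd w) powr (- ?p)))" for w :: "(real^'n) \<times> (real^'n)"
  have FW: "F k w \<le> ennreal (W w)" for k w
    unfolding F_def
  proof (rule ennreal_leI)
    let ?x = "fst w" and ?y = "snd w"
    have c2: "(capk hexp (?x - ?y))\<^sup>2 = capk (2 * hexp) (?x - ?y)"
      by (auto simp: capk_def power2_eq_square powr_add[symmetric])
    have "(d k ?x - d k ?y)\<^sup>2 \<le> L\<^sup>2 * (balls (sqrt b) ?x ?y * capk (2 * hexp) (?x - ?y))"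
    proof (cases "?x \<in> ball 0 (sqrt b) \<or> ?y \<in> ball 0 (sqrt b)")
      case True
      have "(d k ?x - d k ?y)\<^sup>2 = \<bar>d k ?x - d k ?y\<bar>\<^sup>2" by simp
      also have "\<dots> \<le> (L * capk hexp (?x - ?y))\<^sup>2" by (rule power_mono[OF hol]) simp
      also have "\<dots> = L\<^sup>2 * (1 * capk (2 * hexp) (?x - ?y))" by (simp add: power_mult_distrib c2)
      also have "\<dots> \<le> L\<^sup>2 * (balls (sqrt b) ?x ?y * capk (2 * hexp) (?x - ?y))"
        using True by (intro mult_left_mono mult_right_mono) (auto simp: balls_def capk_nonneg)
      finally show ?thesis .
    next
      case False
      then show ?thesis using zero by (simp add: balls_def)
    qed
    then have "(d k ?x - d k ?y)\<^sup>2 * norm (?x - ?y) powr (- ?p) \<le> L\<^sup>2 * (balls (sqrt b) ?x ?y * capk (2 * hexp) (?x - ?y)) * norm (?x - ?y) powr (- ?p)"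
      by (rule mult_right_mono) simp
    then show "(d k ?x - d k ?y)\<^sup>2 / norm (?x - ?y) powr ?p \<le> W w"
      unfolding W_def by (simp only: powr_minus divide_inverse mult.assoc)
  qed
  have "(\<lambda>k. \<integral>\<^sup>+ w. F k w \<partial>lborel) \<longlonglongrightarrow> (\<integral>\<^sup>+ w. 0 \<partial>(lborel :: ((real^'n) \<times> (real^'n)) measure))"
  proof (rule nn_integral_dominated_convergence[where w = "\<lambda>w. ennreal (W w)"])
    have "F k \<in> borel_measurable (borel \<Otimes>\<^sub>M borel)" for k unfolding F_def[abs_def] by measurable
    then show "F k \<in> borel_measurable lborel" for k by (simp add: borel_prod)
    have Wm: "W \<in> borel_measurable (borel \<Otimes>\<^sub>M borel)" unfolding W_def[abs_def] by measurable
    then show "(\<lambda>w. ennreal (W w)) \<in> borel_measurable lborel" by (simp add: borel_prod)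
    have "integrable lborel W" unfolding W_def[abs_def]
      using integrable_capk_pair[of s "2 * hexp" "sqrt b", where 'a="real^'n"] hexp s
      by (intro integrable_mult_right) simp
    moreover have "0 \<le> W w" for w unfolding W_def by (simp add: balls_nonneg capk_nonneg)
    ultimately show "(\<integral>\<^sup>+ w. ennreal (W w) \<partial>lborel) < \<infinity>"
      by (simp add: nn_integral_eq_integral)
    show "AE w in lborel. F k w \<le> ennreal (W w)" for k using FW by simp
    show "AE w in lborel. (\<lambda>k. F k w) \<longlonglongrightarrow> 0"
    proof (rule AE_I2)
      fix w :: "(real^'n) \<times> (real^'n)"
      have t: "(\<lambda>k. d k x) \<longlonglongrightarrow> ?u x - ?u x" for x
        unfolding d_def by (intro tendsto_intros approx_tendsto)
      have "(\<lambda>k. (d k (fst w) - d k (snd w))\<^sup>2 * inverse (norm (fst w - snd w) powr ?p))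
        \<longlonglongrightarrow> ((?u (fst w) - ?u (fst w)) - (?u (snd w) - ?u (snd w)))\<^sup>2 * inverse (norm (fst w - snd w) powr ?p)"
        by (intro tendsto_mult tendsto_const tendsto_power tendsto_diff t)
      then have "(\<lambda>k. (d k (fst w) - d k (snd w))\<^sup>2 / norm (fst w - snd w) powr ?p) \<longlonglongrightarrow> 0"
        by (simp add: divide_inverse)
      then show "(\<lambda>k. F k w) \<longlonglongrightarrow> 0" unfolding F_def using tendsto_ennrealI by fastforce
    qed
  qed auto
  then show "(\<lambda>k. gag s (\<lambda>x. ?u x - approx k x)) \<longlonglongrightarrow> 0"
    unfolding gag_def F_def d_def by simp
qed

end

section \<open>The weak form of the equation\<close>

lemma Gbr_rotate:
  assumes "linear T" "\<And>z. norm (T z) = norm z" "\<And>x y. T x \<bullet> T y = x \<bullet> (y::'a::euclidean_space)"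
  shows "Gbr G (T e) r (T z) = Gbr G e r z"
  using assms by (simp add: Gbr_def)

lemma ffun_rotate:
  fixes e e' :: "real^'n"
  assumes e: "norm e = 1" "norm e' = 1" and G[measurable]: "G \<in> borel_measurable borel"
  shows "ffun s G e' r = ffun s G e r"
proof -
  have "norm e = norm e'" using e by simp
  then obtain f :: "real^'n \<Rightarrow> real^'n" where f: "orthogonal_transformation f" "f e = e'"
    using orthogonal_transformation_exists by blast
  have inner: "f a \<bullet> f b = a \<bullet> b" for a b using f(1) by (simp add: orthogonal_transformation_def)
  have iso: "norm (f a) = norm a" for a using f(1) by (rule orthogonal_transformation_norm)
  have lin: "linear f" using f(1) by (rule orthogonal_transformation_linear)
  have "ffun s G e' r = (\<integral>z. Gbr G (f e) r (f z) * norm (f z) powr (- (real DIM(real^'n) + 2 * s)) \<partial>lborel)"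
    unfolding ffun_def f(2)
    by (rule leb_preserving_integral[OF leb_preserving_linear_isometry[OF lin iso], symmetric])
       (simp add: Gbr_def)
  also have "\<dots> = ffun s G e r"
    unfolding ffun_def Gbr_rotate[OF lin iso inner] iso ..
  finally show ?thesis .
qed

lemma integrable_lborel_prod_cmult:
  fixes f k :: "'a::euclidean_space \<Rightarrow> real"
  assumes f: "integrable lborel f" and k: "integrable lborel k"
  shows "integrable (lborel \<Otimes>\<^sub>M lborel) (\<lambda>w. f (fst w) * k (snd w))"
proof -
  have "integrable (lborel \<Otimes>\<^sub>M lborel) (\<lambda>(x, z). f x * k z)"
  proof (rule lborel_pair.Fubini_integrable)
    have [measurable]: "f \<in> borel_measurable borel" "k \<in> borel_measurable borel"
      using f k by (auto dest: borel_measurable_integrable)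
    show "(\<lambda>(x, z). f x * k z) \<in> borel_measurable (lborel \<Otimes>\<^sub>M lborel)" by measurable
    have "integrable lborel (\<lambda>x. \<bar>f x\<bar> * (\<integral>z. \<bar>k z\<bar> \<partial>lborel))"
      using f by (intro integrable_mult_left integrable_abs)
    then show "integrable lborel (\<lambda>x. \<integral>y. norm ((case (x, y) of (x, z) \<Rightarrow> f x * k z)) \<partial>lborel)"
      by (simp add: abs_mult)
    show "AE x in lborel. integrable lborel (\<lambda>y. case (x, y) of (x, z) \<Rightarrow> f x * k z)"
      using k by simp
  qed
  then show ?thesis by (simp add: case_prod_beta')
qed

context profile
begin

definition uf :: "'a::euclidean_space \<Rightarrow> real" where "uf y = U ((norm y)\<^sup>2)"

text \<open>The second difference of u with the renormalising term of \<open>pbr\<close>. Against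
  the kernel the added u(z) integrates to the moment, so for the solution it changes
  nothing.\<close>

definition Ebr :: "'a::euclidean_space \<Rightarrow> 'a \<Rightarrow> real" where
  "Ebr x z = uf x + uf z - (uf (x + z) + uf (x - z)) / 2"

lemma borel_measurable_uf[measurable]: "uf \<in> borel_measurable borel"
  unfolding uf_def[abs_def] by measurable

lemma uf_eq: "uf y = norm y powr g - G ((norm y)\<^sup>2)"
  unfolding uf_def by (simp add: U_eq square_powr)

text \<open>u is the pure power minus G, and G vanishes at |x|^2 because |x| < 1. In what is left, x
  + z and x - z are read as shifts of z by |x| along the unit vector of x and its opposite.\<close>

lemma Ebr_eq:
  fixes x z :: "'a::euclidean_space"
  assumes "x \<noteq> 0" "norm x < 1"
  shows "Ebr x z = pbr g x z + Gbr G (x /\<^sub>R norm x) (norm x) z"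
proof -
  have "(norm x)\<^sup>2 < 1" using power_strict_mono[of "norm x" 1 2] assms by simp
  then have Gx: "G ((norm x)\<^sup>2) = 0" by (simp add: G_def)
  have "norm x *\<^sub>R (x /\<^sub>R norm x) = x" using assms by simp
  then have n: "(norm x) * ((x /\<^sub>R norm x) \<bullet> z) = x \<bullet> z" using assms by simp
  have p: "(norm (x + z))\<^sup>2 = (norm z)\<^sup>2 + 2 * norm x * ((x /\<^sub>R norm x) \<bullet> z) + (norm x)\<^sup>2"
    "(norm (x - z))\<^sup>2 = (norm z)\<^sup>2 - 2 * norm x * ((x /\<^sub>R norm x) \<bullet> z) + (norm x)\<^sup>2"
    unfolding norm_pm_sq using n by simp_all
  show ?thesis
    unfolding Ebr_def uf_eq pbr_def Gbr_def p[symmetric] Gx by (simp add: field_simps)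
qed

text \<open>A bound that does not involve x and is integrable against the kernel, as Fubini requires
  in \<open>weak_identity\<close>.\<close>

lemma Ebr_bound:
  fixes x z :: "'a::euclidean_space"
  assumes "norm x < 1"
  shows "\<bar>Ebr x z\<bar> \<le> (8 + kbound TYPE('a)) * (if norm z \<le> 1 then norm z powr (min g 2) else norm z powr (g - min g 2))"
    (is "_ \<le> _ * ?Q")
proof -
  have Q0: "?Q \<ge> 0" by simp
  have K0: "kbound TYPE('a) \<ge> 0" by (rule kbound)
  show ?thesis
  proof (cases "x = 0")
    case True
    have "uf (0::'a) = 0" using U_low[of 0] by (simp add: uf_def)
    then have "Ebr x z = 0" using True by (simp add: Ebr_def uf_def)
    then show ?thesis using Q0 K0 by simp
  next
    case False
    have 1: "\<bar>pbr g x z\<bar> \<le> 8 * ?Q" using g s assms by (intro pbr_dom) auto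
    have "\<bar>Gbr G (x /\<^sub>R norm x) (norm x) z\<bar> \<le> kbound TYPE('a) * wt z * (norm x)\<^sup>2"
      using False assms by (intro Gbr_bound) auto
    also have "\<dots> \<le> kbound TYPE('a) * wt z * 1"
      using assms K0 by (intro mult_left_mono power_le_one mult_nonneg_nonneg) (auto simp: wt_nonneg)
    also have "\<dots> \<le> kbound TYPE('a) * ?Q"
    proof -
      have "wt z \<le> ?Q"
      proof (cases "norm z \<ge> 2")
        case True
        then have "norm z powr (g - 2) \<le> norm z powr (g - min g 2)" by (intro powr_mono) auto
        then show ?thesis using True by (simp add: wt_def)
      next
        case False
        then have "wt z = 0" by (simp add: wt_def)
        then show ?thesis using Q0 by simp
      qed
      then show ?thesis using K0 by (simp add: mult_left_mono)
    qed
    finally have 2: "\<bar>Gbr G (x /\<^sub>R norm x) (norm x) z\<bar> \<le> kbound TYPE('a) * ?Q" .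
    have "\<bar>Ebr x z\<bar> \<le> 8 * ?Q + kbound TYPE('a) * ?Q"
      unfolding Ebr_eq[OF False assms] using 1 2 by linarith
    then show ?thesis by (simp only: distrib_right)
  qed
qed

lemma integral_Ebr:
  fixes x e :: "real^'n"
  assumes x: "x \<noteq> 0" "norm x < 1" and e: "norm e = 1"
  shows "(\<integral>z. Ebr x z * norm z powr (- (real CARD('n) + 2 * s)) \<partial>lborel) = norm x powr (g - 2 * s) * acoef s g e + ffun s G e (norm x)"
proof -
  have e': "norm (x /\<^sub>R norm x) = 1" using x by simp
  have i1: "integrable lborel (\<lambda>z. pbr g x z * norm z powr (- (real DIM(real^'n) + 2 * s)))"
    using s g x by (intro integrable_pbr) auto
  have i2: "integrable lborel (\<lambda>z. Gbr G (x /\<^sub>R norm x) (norm x) z * norm z powr (- (real DIM(real^'n) + 2 * s)))"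
    using x by (intro integrable_Gbr e') auto
  have "(\<integral>z. Ebr x z * norm z powr (- (real DIM(real^'n) + 2 * s)) \<partial>lborel) = acoef s g x + ffun s G (x /\<^sub>R norm x) (norm x)"
    unfolding Ebr_eq[OF x] distrib_right acoef_def ffun_def by (rule Bochner_Integration.integral_add[OF i1 i2])
  also have "acoef s g x = norm x powr (g - 2 * s) * acoef s g e" by (rule acoef_radial[OF e x(1)])
  also have "ffun s G (x /\<^sub>R norm x) (norm x) = ffun s G e (norm x)" by (rule ffun_rotate[OF e e']) measurable
  finally show ?thesis by simp
qed

text \<open>For fixed z, translations in x turn the product of differences of u and \<phi> into
  twice \<phi> times the second difference of u, which cancels the factor 1/2 of the inner product.
  Adding and subtracting u(z) gives \<open>Ebr\<close>, to which Fubini applies, and leaves a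
  multiple of the moment.\<close>

theorem weak_identity:
  fixes \<phi> :: "real^'n \<Rightarrow> real" and e :: "real^'n"
  assumes m0: "(\<integral>y. uf (y::real^'n) * norm y powr (- (real CARD('n) + 2 * s)) \<partial>lborel) = 0"
    and e: "norm e = 1" and \<phi>m[measurable]: "\<phi> \<in> borel_measurable borel"
    and \<phi>: "M \<ge> 0" "\<And>x. \<bar>\<phi> x\<bar> \<le> M" "\<And>x y. \<bar>\<phi> x - \<phi> y\<bar> \<le> M * norm (x - y)" "\<And>x. norm x \<ge> 1 \<Longrightarrow> \<phi> x = 0"
  shows "Ds2_inner s uf \<phi> = C_Ns CARD('n) s * (\<integral>x. \<phi> x * (norm x powr (g - 2 * s) * acoef s g e + ffun s G e (norm x)) \<partial>lborel)"
proof -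
  let ?p = "real CARD('n) + 2 * s"
  let ?k = "\<lambda>z::real^'n. norm z powr (- ?p)"
  let ?u = "uf :: real^'n \<Rightarrow> real"
  obtain K where K: "K \<ge> 0" "\<And>\<epsilon> x y. 0 \<le> \<epsilon> \<Longrightarrow> \<bar>U ((norm (x::real^'n))\<^sup>2 + \<epsilon>) - U ((norm y)\<^sup>2 + \<epsilon>)\<bar> \<le> K * norm (x - y) powr hexp"
    by (rule U_shift_holder[OF hexp(1-3), where 'a="real^'n"]) blast
  obtain B where B: "B \<ge> 0" "\<And>\<sigma>. 0 \<le> \<sigma> \<Longrightarrow> \<bar>U \<sigma>\<bar> \<le> B" by (rule U_bounded) blast
  have uB: "\<bar>?u x\<bar> \<le> B" for x unfolding uf_def by (rule B(2)) simp
  have uH: "\<bar>?u x - ?u y\<bar> \<le> K * norm (x - y) powr hexp" for x y using K(2)[of 0 x y] by (simp add: uf_def)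
  define I where "I w = (?u (fst w) - ?u (snd w)) * (\<phi> (fst w) - \<phi> (snd w)) / norm (fst w - snd w) powr ?p" for w :: "(real^'n) \<times> (real^'n)"
  have Im: "I \<in> borel_measurable (borel \<Otimes>\<^sub>M borel)" unfolding I_def[abs_def] by measurable
  define L where "L = K * M + 4 * B * M"
  \<comment> \<open>Close points contribute a Hoelder factor of u times a Lipschitz factor of
    \<phi>, hence the power \<open>hexp\<close> + 1; distant points are bounded by 2B times
    2M.\<close>
  have II: "integrable lborel I"
  proof (rule Bochner_Integration.integrable_bound)
    show "integrable lborel (\<lambda>w::(real^'n) \<times> (real^'n). L * (balls 1 (fst w) (snd w) * (capk (hexp + 1) (fst w - snd w) * ?k (fst w - snd w))))"
      using integrable_capk_pair[of s "hexp + 1" 1, where 'a="real^'n"] hexp s by (intro integrable_mult_right) simp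
    show "I \<in> borel_measurable lborel" using Im by (simp add: borel_prod)
    show "AE w in lborel. norm (I w) \<le> norm (L * (balls 1 (fst w) (snd w) * (capk (hexp + 1) (fst w - snd w) * ?k (fst w - snd w))))"
    proof (rule AE_I2)
      fix w :: "(real^'n) \<times> (real^'n)"
      let ?x = "fst w" and ?y = "snd w"
      have "\<bar>?u ?x - ?u ?y\<bar> * \<bar>\<phi> ?x - \<phi> ?y\<bar> \<le> L * (balls 1 ?x ?y * capk (hexp + 1) (?x - ?y))"
      proof (cases "norm ?x < 1 \<or> norm ?y < 1")
        case True
        then have b1: "1 \<le> balls 1 ?x ?y" by (auto simp: balls_def)
        have "\<bar>?u ?x - ?u ?y\<bar> * \<bar>\<phi> ?x - \<phi> ?y\<bar> \<le> L * capk (hexp + 1) (?x - ?y)"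
        proof (cases "norm (?x - ?y) \<le> 1")
          case T: True
          have "\<bar>?u ?x - ?u ?y\<bar> * \<bar>\<phi> ?x - \<phi> ?y\<bar> \<le> (K * norm (?x - ?y) powr hexp) * (M * norm (?x - ?y))"
            using K \<phi>(1) by (intro mult_mono uH \<phi>(3)) auto
          also have "\<dots> = K * M * norm (?x - ?y) powr (hexp + 1)" by (simp add: powr_add)
          also have "\<dots> \<le> L * norm (?x - ?y) powr (hexp + 1)"
            using B \<phi>(1) by (intro mult_right_mono) (auto simp: L_def)
          finally show ?thesis using T by (simp add: capk_def)
        next
          case F: False
          have "\<bar>?u ?x - ?u ?y\<bar> \<le> 2 * B" using uB[of ?x] uB[of ?y] by linarith
          moreover have "\<bar>\<phi> ?x - \<phi> ?y\<bar> \<le> 2 * M" using \<phi>(2)[of ?x] \<phi>(2)[of ?y] by linarith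
          ultimately have "\<bar>?u ?x - ?u ?y\<bar> * \<bar>\<phi> ?x - \<phi> ?y\<bar> \<le> (2 * B) * (2 * M)"
            using B by (intro mult_mono) auto
          also have "\<dots> \<le> L" using K \<phi>(1) by (simp add: L_def)
          finally show ?thesis using F by (auto simp: capk_def)
        qed
        also have "\<dots> \<le> L * (balls 1 ?x ?y * capk (hexp + 1) (?x - ?y))"
          using b1 K B \<phi>(1) mult_right_mono[OF b1 capk_nonneg, of "hexp + 1" "?x - ?y"]
          by (intro mult_left_mono) (auto simp: L_def)
        finally show ?thesis .
      next
        case False
        then show ?thesis using \<phi>(4)[of ?x] \<phi>(4)[of ?y] by (simp add: balls_def)
      qed
      then have "\<bar>?u ?x - ?u ?y\<bar> * \<bar>\<phi> ?x - \<phi> ?y\<bar> * ?k (?x - ?y) \<le> L * (balls 1 ?x ?y * capk (hexp + 1) (?x - ?y)) * ?k (?x - ?y)"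
        by (rule mult_right_mono) simp
      moreover have "norm (I w) = \<bar>?u ?x - ?u ?y\<bar> * \<bar>\<phi> ?x - \<phi> ?y\<bar> * ?k (?x - ?y)"
        unfolding I_def powr_minus divide_inverse by (simp add: abs_mult)
      ultimately have "norm (I w) \<le> L * (balls 1 ?x ?y * (capk (hexp + 1) (?x - ?y) * ?k (?x - ?y)))"
        by (simp only: mult.assoc)
      also have "\<dots> \<le> norm (L * (balls 1 ?x ?y * (capk (hexp + 1) (?x - ?y) * ?k (?x - ?y))))"
        unfolding real_norm_def by (rule abs_ge_self)
      finally show "norm (I w) \<le> norm (L * (balls 1 ?x ?y * (capk (hexp + 1) (?x - ?y) * ?k (?x - ?y))))" .
    qed
  qed
  define J where "J x z = (?u x - ?u (x + z)) * (\<phi> x - \<phi> (x + z)) * ?k z" for x z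
  have IJ: "I (fst w, fst w + snd w) = J (fst w) (snd w)" for w
    unfolding I_def J_def powr_minus divide_inverse by simp
  have Imb: "I \<in> borel_measurable borel" using Im by (simp add: borel_prod)
  have Jint: "integrable (lborel \<Otimes>\<^sub>M lborel) (\<lambda>(x, z). J x z)"
    using leb_preserving_integrable[OF leb_preserving_shear Imb] II
    by (simp add: IJ lborel_prod case_prod_beta')
  have "(\<integral>w. I w \<partial>lborel) = (\<integral>w. J (fst w) (snd w) \<partial>lborel)"
    using leb_preserving_integral[OF leb_preserving_shear Imb] by (simp add: IJ)
  also have "\<dots> = (\<integral>z. \<integral>x. J x z \<partial>lborel \<partial>lborel)"
    using lborel_pair.integral_snd[OF Jint] by (simp add: lborel_prod case_prod_beta')
  finally have S1: "(\<integral>w. I w \<partial>lborel) = (\<integral>z. \<integral>x. J x z \<partial>lborel \<partial>lborel)" .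
  have S1i: "integrable lborel (\<lambda>z. \<integral>x. J x z \<partial>lborel)" by (rule lborel_pair.integrable_snd[OF Jint])
  have \<phi>i: "integrable lborel (\<lambda>x. \<phi> x * h x)" if [measurable]: "h \<in> borel_measurable borel" and h: "\<And>x. norm x < 1 \<Longrightarrow> \<bar>h x\<bar> \<le> C" for h :: "real^'n \<Rightarrow> real" and C
  proof (rule Bochner_Integration.integrable_bound)
    show "integrable lborel (\<lambda>x::real^'n. indicator (ball 0 1) x * (M * \<bar>C\<bar>))"
      using emeasure_lborel_ball_finite[of "0::real^'n" 1]
      by (intro integrable_mult_left integrable_real_indicator) auto
    show "AE x in lborel. norm (\<phi> x * h x) \<le> norm (indicator (ball (0::real^'n) 1) x * (M * \<bar>C\<bar>))"
    proof (rule AE_I2)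
      fix x :: "real^'n"
      show "norm (\<phi> x * h x) \<le> norm (indicator (ball (0::real^'n) 1) x * (M * \<bar>C\<bar>))"
      proof (cases "norm x < 1")
        case True
        have "\<bar>\<phi> x\<bar> * \<bar>h x\<bar> \<le> M * \<bar>C\<bar>" using \<phi>(1,2) h[OF True] by (intro mult_mono) auto
        then show ?thesis using True \<phi>(1) by (simp add: abs_mult)
      qed (use \<phi>(4) in simp)
    qed
  qed measurable
  have \<phi>i0: "integrable lborel \<phi>" using \<phi>i[of "\<lambda>_. 1" 1] by simp
  define m where "m = (\<integral>x. \<phi> x \<partial>lborel)"
  have S2: "(\<integral>x. J x z \<partial>lborel) = 2 * (\<integral>x. \<phi> x * Ebr x z * ?k z \<partial>lborel) - 2 * m * (?u z * ?k z)" for z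
  proof -
    let ?a = "\<lambda>x. \<phi> x * ?u x" and ?b = "\<lambda>x. \<phi> x * ?u (x + z)" and ?c = "\<lambda>x. \<phi> x * ?u (x - z)"
    have ia: "integrable lborel ?a" by (rule \<phi>i[OF _ uB]) measurable
    have ib: "integrable lborel ?b" by (rule \<phi>i[OF _ uB]) measurable
    have ic: "integrable lborel ?c" by (rule \<phi>i[OF _ uB]) measurable
    have am: "?a \<in> borel_measurable borel" and cm: "?c \<in> borel_measurable borel" by measurable
    have ia': "integrable lborel (\<lambda>x. ?a (x + z))" "(\<integral>x. ?a (x + z) \<partial>lborel) = (\<integral>x. ?a x \<partial>lborel)"
      using leb_preserving_integrable[OF leb_preserving_plus am] ia leb_preserving_integral[OF leb_preserving_plus am] by auto
    have ic': "integrable lborel (\<lambda>x. ?c (x + z))" "(\<integral>x. ?c (x + z) \<partial>lborel) = (\<integral>x. ?c x \<partial>lborel)"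
      using leb_preserving_integrable[OF leb_preserving_plus cm, of z] ic leb_preserving_integral[OF leb_preserving_plus cm, of z] by auto
    have "(\<integral>x. (?u x - ?u (x + z)) * (\<phi> x - \<phi> (x + z)) \<partial>lborel) = (\<integral>x. ?a x - ?b x - ?c (x + z) + ?a (x + z) \<partial>lborel)"
      by (intro Bochner_Integration.integral_cong refl) (simp add: algebra_simps)
    also have "\<dots> = (\<integral>x. ?a x \<partial>lborel) - (\<integral>x. ?b x \<partial>lborel) - (\<integral>x. ?c x \<partial>lborel) + (\<integral>x. ?a x \<partial>lborel)"
      using ia ib ic ia' ic' by simp
    finally have 1: "(\<integral>x. (?u x - ?u (x + z)) * (\<phi> x - \<phi> (x + z)) \<partial>lborel) = 2 * (\<integral>x. ?a x \<partial>lborel) - (\<integral>x. ?b x \<partial>lborel) - (\<integral>x. ?c x \<partial>lborel)"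
      by simp
    have "(\<integral>x. \<phi> x * Ebr x z \<partial>lborel) = (\<integral>x. ?a x + ?u z * \<phi> x - ?b x / 2 - ?c x / 2 \<partial>lborel)"
      by (intro Bochner_Integration.integral_cong refl) (simp add: Ebr_def algebra_simps add_divide_distrib)
    also have "\<dots> = (\<integral>x. ?a x \<partial>lborel) + ?u z * m - (\<integral>x. ?b x \<partial>lborel) / 2 - (\<integral>x. ?c x \<partial>lborel) / 2"
      unfolding m_def using ia ib ic \<phi>i0 by simp
    finally have 2: "(\<integral>x. (?u x - ?u (x + z)) * (\<phi> x - \<phi> (x + z)) \<partial>lborel) = 2 * (\<integral>x. \<phi> x * Ebr x z \<partial>lborel) - 2 * m * ?u z"
      using 1 by simp
    have "(\<integral>x. J x z \<partial>lborel) = (\<integral>x. (?u x - ?u (x + z)) * (\<phi> x - \<phi> (x + z)) \<partial>lborel) * ?k z"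
      unfolding J_def by (rule integral_mult_left_zero)
    moreover have "(\<integral>x. \<phi> x * Ebr x z * ?k z \<partial>lborel) = (\<integral>x. \<phi> x * Ebr x z \<partial>lborel) * ?k z"
      by (rule integral_mult_left_zero)
    ultimately show ?thesis using 2 by (simp only: left_diff_distrib mult.assoc)
  qed
  have ui: "integrable lborel (\<lambda>z. ?u z * ?k z)"
    using integrable_U[where 'a="real^'n"] by (simp add: uf_def)
  have Eint: "integrable (lborel \<Otimes>\<^sub>M lborel) (\<lambda>(x, z). \<phi> x * Ebr x z * ?k z)"
  proof (rule Bochner_Integration.integrable_bound)
    let ?Q = "\<lambda>z::real^'n. (if norm z \<le> 1 then norm z powr (min g 2) else norm z powr (g - min g 2)) * ?k z"
    have iQ: "integrable lborel ?Q"
      using integrable_kernel_dom[of ?p "min g 2" "g - min g 2", where 'a="real^'n"] g s by (simp add: min_def)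
    show "integrable (lborel \<Otimes>\<^sub>M lborel) (\<lambda>w. (\<bar>\<phi> (fst w)\<bar> * (8 + kbound TYPE(real^'n))) * ?Q (snd w))"
      using \<phi>i0 by (intro integrable_lborel_prod_cmult iQ integrable_mult_left integrable_abs)
    show "(\<lambda>(x, z). \<phi> x * Ebr x z * ?k z) \<in> borel_measurable (lborel \<Otimes>\<^sub>M lborel)"
      unfolding Ebr_def by measurable
    show "AE w in lborel \<Otimes>\<^sub>M lborel. norm (case w of (x, z) \<Rightarrow> \<phi> x * Ebr x z * ?k z) \<le> norm ((\<bar>\<phi> (fst w)\<bar> * (8 + kbound TYPE(real^'n))) * ?Q (snd w))"
    proof (rule AE_I2)
      fix w :: "(real^'n) \<times> (real^'n)"
      obtain x z where w: "w = (x, z)" by (cases w)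
      define Qz where "Qz = (if norm z \<le> 1 then norm z powr (min g 2) else norm z powr (g - min g 2))"
      have Q0: "Qz \<ge> 0" by (simp add: Qz_def)
      have "\<bar>\<phi> x\<bar> * \<bar>Ebr x z\<bar> \<le> \<bar>\<phi> x\<bar> * ((8 + kbound TYPE(real^'n)) * Qz)"
      proof (cases "norm x < 1")
        case True then show ?thesis unfolding Qz_def by (intro mult_left_mono Ebr_bound) auto
      qed (use \<phi>(4) in simp)
      then have "\<bar>\<phi> x\<bar> * \<bar>Ebr x z\<bar> * ?k z \<le> \<bar>\<phi> x\<bar> * ((8 + kbound TYPE(real^'n)) * Qz) * ?k z"
        by (rule mult_right_mono) simp
      moreover have "0 \<le> 8 + kbound TYPE(real^'n)" using kbound(1)[where 'a="real^'n"] by simp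
      ultimately show "norm (case w of (x, z) \<Rightarrow> \<phi> x * Ebr x z * ?k z) \<le> norm ((\<bar>\<phi> (fst w)\<bar> * (8 + kbound TYPE(real^'n))) * ?Q (snd w))"
        unfolding w fst_conv snd_conv Qz_def[symmetric] prod.case real_norm_def abs_mult using Q0
        by (simp add: mult.assoc)
    qed
  qed
  have Ei: "integrable lborel (\<lambda>z. \<integral>x. \<phi> x * Ebr x z * ?k z \<partial>lborel)" by (rule lborel_pair.integrable_snd[OF Eint])
  \<comment> \<open>Here the vanishing moment \<open>m0\<close> removes the term with u(z).\<close>
  have S3: "(\<integral>z. \<integral>x. J x z \<partial>lborel \<partial>lborel) = 2 * (\<integral>z. \<integral>x. \<phi> x * Ebr x z * ?k z \<partial>lborel \<partial>lborel)"
    unfolding S2 using Ei ui m0 by simp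
  have S4: "(\<integral>z. \<integral>x. \<phi> x * Ebr x z * ?k z \<partial>lborel \<partial>lborel) = (\<integral>x. \<integral>z. \<phi> x * Ebr x z * ?k z \<partial>lborel \<partial>lborel)"
    by (rule lborel_pair.Fubini_integral[OF Eint])
  have S5: "(\<integral>x. \<integral>z. \<phi> x * Ebr x z * ?k z \<partial>lborel \<partial>lborel) = (\<integral>x. \<phi> x * (norm x powr (g - 2 * s) * acoef s g e + ffun s G e (norm x)) \<partial>lborel)"
  proof (rule integral_cong_AE)
    show "(\<lambda>x. \<integral>z. \<phi> x * Ebr x z * ?k z \<partial>lborel) \<in> borel_measurable lborel"
      using lborel_pair.integrable_fst[OF Eint] by (rule borel_measurable_integrable)
    show "(\<lambda>x. \<phi> x * (norm x powr (g - 2 * s) * acoef s g e + ffun s G e (norm x))) \<in> borel_measurable lborel"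
    proof -
      have "(\<lambda>x::real^'n. ffun s G e (norm x)) \<in> borel_measurable borel"
        unfolding ffun_def Gbr_def by measurable
      then show ?thesis by measurable
    qed
    have "AE x in lborel. x \<noteq> (0::real^'n)" by (rule AE_lborel_singleton)
    then show "AE x in lborel. (\<integral>z. \<phi> x * Ebr x z * ?k z \<partial>lborel) = \<phi> x * (norm x powr (g - 2 * s) * acoef s g e + ffun s G e (norm x))"
    proof eventually_elim
      fix x :: "real^'n" assume x: "x \<noteq> 0"
      have "(\<integral>z. \<phi> x * Ebr x z * ?k z \<partial>lborel) = \<phi> x * (\<integral>z. Ebr x z * ?k z \<partial>lborel)"
        unfolding mult.assoc by (rule integral_mult_right_zero)
      then show "(\<integral>z. \<phi> x * Ebr x z * ?k z \<partial>lborel) = \<phi> x * (norm x powr (g - 2 * s) * acoef s g e + ffun s G e (norm x))"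
        using integral_Ebr[OF x _ e] \<phi>(4)[of x] by (cases "norm x < 1") auto
    qed
  qed
  have "Ds2_inner s uf \<phi> = C_Ns CARD('n) s / 2 * (\<integral>w. I w \<partial>lborel)"
    unfolding Ds2_inner_def I_def ..
  then show ?thesis unfolding S1 S3 S4 S5 by simp
qed

end

section \<open>Rayleigh quotients on the half sphere\<close>

definition hball :: "((real^'n) \<times> real) set" where
  "hball = {X. norm X < 1 \<and> 0 < snd X}"

lemma hball_measurable[measurable]: "hball \<in> sets borel"
proof -
  have "open (hball :: ((real^'n) \<times> real) set)" unfolding hball_def
    by (intro open_Collect_conj open_Collect_less continuous_intros)
  then show ?thesis by (rule borel_open)
qed

lemma borel_measurable_snd_compose:
  assumes "f \<in> borel_measurable M"
  shows "(\<lambda>x. snd (f x :: 'a::euclidean_space \<times> 'b::euclidean_space)) \<in> borel_measurable M"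
  using borel_measurable_continuous_on[OF continuous_on_snd[OF continuous_on_id] assms] by simp

lemma borel_measurable_snd_id: "(snd :: 'a::euclidean_space \<times> 'b::euclidean_space \<Rightarrow> 'b) \<in> borel_measurable borel"
  by (rule borel_measurable_continuous_onI) (rule continuous_on_snd[OF continuous_on_id])

lemma abs_snd_le: "\<bar>snd X\<bar> \<le> norm X" for X :: "'a::real_normed_vector \<times> real"
  using norm_snd_le[where x = "fst X" and y = "snd X"] by simp

lemma snd_pos_norm: "0 < snd X \<Longrightarrow> norm X > 0" for X :: "'a::real_normed_vector \<times> real"
  by (metis less_irrefl snd_zero zero_less_norm_iff)

lemma sphere_integral_half:
  "sphere_integral (half_sphere :: ((real^'n) \<times> real) set) f = (real CARD('n) + 1) * (\<integral>X. indicator hball X * f (X /\<^sub>R norm X) \<partial>lborel)"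
proof -
  have "{X::(real^'n) \<times> real. 0 < norm X \<and> norm X < 1 \<and> X /\<^sub>R norm X \<in> half_sphere} = hball"
  proof (intro set_eqI iffI)
    fix X :: "(real^'n) \<times> real"
    assume "X \<in> {X. 0 < norm X \<and> norm X < 1 \<and> X /\<^sub>R norm X \<in> half_sphere}"
    then show "X \<in> hball" by (auto simp: half_sphere_def hball_def zero_less_mult_iff)
  next
    fix X :: "(real^'n) \<times> real" assume X: "X \<in> hball"
    then have "0 < norm X" by (intro snd_pos_norm) (simp add: hball_def)
    then show "X \<in> {X. 0 < norm X \<and> norm X < 1 \<and> X /\<^sub>R norm X \<in> half_sphere}"
      using X by (simp add: half_sphere_def hball_def)
  qed
  then show ?thesis by (simp add: sphere_integral_def set_lebesgue_integral_def)
qed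

lemma sphere_integral_bd:
  "sphere_integral (sphere (0::real^'n) 1) f = real CARD('n) * (\<integral>x. indicator (ball 0 1 - {0}) x * f (x /\<^sub>R norm x) \<partial>lborel)"
proof -
  have "{x::real^'n. 0 < norm x \<and> norm x < 1 \<and> x /\<^sub>R norm x \<in> sphere 0 1} = ball 0 1 - {0}"
    by auto
  then show ?thesis by (simp add: sphere_integral_def set_lebesgue_integral_def)
qed

section \<open>Powers of the last coordinate on the half sphere\<close>

lemma nn_integral_homogeneous_scale:
  fixes f :: "'a::euclidean_space \<Rightarrow> ennreal" and A :: "'a set"
  assumes [measurable]: "f \<in> borel_measurable borel" and c: "0 < c"
    and f: "\<And>x. f (c *\<^sub>R x) = f x" and A: "\<And>x. c *\<^sub>R x \<in> A \<longleftrightarrow> x \<in> A" and [measurable]: "A \<in> sets borel"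
  shows "(\<integral>\<^sup>+x. indicator A x * f x * indicator {x. norm x < c} x \<partial>lborel)
    = ennreal (c ^ DIM('a)) * (\<integral>\<^sup>+x. indicator A x * f x * indicator {x. norm x < 1} x \<partial>lborel)"
proof -
  have "(\<integral>\<^sup>+x. indicator A x * f x * indicator {x. norm x < c} x \<partial>lborel)
    = ennreal (c ^ DIM('a)) * (\<integral>\<^sup>+x. indicator A (c *\<^sub>R x) * f (c *\<^sub>R x) * indicator {x. norm x < c} (c *\<^sub>R x) \<partial>lborel)"
    using c by (intro nn_integral_scale) measurable
  also have "(\<lambda>x. indicator A (c *\<^sub>R x) * f (c *\<^sub>R x) * indicator {x. norm x < c} (c *\<^sub>R x) :: ennreal) = (\<lambda>x. indicator A x * f x * indicator {x. norm x < 1} x)"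
    using c by (intro ext) (simp add: f A indicator_def)
  finally show ?thesis .
qed

text \<open>Half the Beta function at (\<alpha>+1)/2 and N/2 + 1. It arises when the half ball is
  sliced at height y into balls of radius sqrt(1 - y^2).\<close>

definition cc :: "nat \<Rightarrow> real \<Rightarrow> real" where
  "cc N \<alpha> = integral {0..1} (\<lambda>y. y powr \<alpha> * (1 - y\<^sup>2) powr (real N / 2))"

lemma cc_has_integral:
  assumes "0 < \<alpha>" "N > 0"
  shows "((\<lambda>y. y powr \<alpha> * (1 - y\<^sup>2) powr (real N / 2)) has_integral cc N \<alpha>) {0..1}"
  unfolding cc_def
  by (rule integrable_integral, rule integrable_continuous_real, intro continuous_on_mult continuous_on_powr' continuous_intros)
     (use assms in \<open>auto simp: power_le_one\<close>)

text \<open>The function y^(\<alpha>+1) (1-y^2)^(N/2+1) vanishes at 0 and at 1, and its derivative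
  is the corresponding combination of the two integrands.\<close>

lemma cc_rec:
  assumes "0 < \<alpha>" "N > 0"
  shows "(\<alpha> + real N + 3) * cc N (\<alpha> + 2) = (\<alpha> + 1) * cc N \<alpha>"
proof -
  let ?h = "\<lambda>y. (1 - y\<^sup>2) powr (real N / 2) :: real"
  let ?F = "\<lambda>y. y powr (\<alpha> + 1) * (1 - y\<^sup>2) powr (real N / 2 + 1) :: real"
  have 1: "((\<lambda>y. (\<alpha> + 1) * (y powr \<alpha> * ?h y) - (\<alpha> + real N + 3) * (y powr (\<alpha> + 2) * ?h y)) has_integral
     ((\<alpha> + 1) * cc N \<alpha> - (\<alpha> + real N + 3) * cc N (\<alpha> + 2))) {0..1}"
    using assms by (intro has_integral_diff has_integral_mult_right cc_has_integral) auto
  have 2: "((\<lambda>y. (\<alpha> + 1) * (y powr \<alpha> * ?h y) - (\<alpha> + real N + 3) * (y powr (\<alpha> + 2) * ?h y)) has_integral (?F 1 - ?F 0)) {0..1}"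
  proof (rule fundamental_theorem_of_calculus_interior)
    show "continuous_on {0..1} ?F"
      by (intro continuous_on_mult continuous_on_powr' continuous_intros) (use assms in \<open>auto simp: power_le_one\<close>)
    fix y :: real assume y: "y \<in> {0<..<1}"
    then have y2: "1 - y\<^sup>2 > 0" by (simp add: abs_square_less_1)
    have "(?F has_real_derivative ((\<alpha> + 1) * y powr (\<alpha> + 1 - 1)) * (1 - y\<^sup>2) powr (real N / 2 + 1)
       + ((real N / 2 + 1) * (1 - y\<^sup>2) powr (real N / 2 + 1 - 1) * (- (2 * y))) * y powr (\<alpha> + 1)) (at y)"
    proof (intro DERIV_mult has_real_derivative_powr)
      have "((\<lambda>y::real. 1 - y\<^sup>2) has_real_derivative - (2 * y)) (at y)" by (auto intro!: derivative_eq_intros)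
      then show "((\<lambda>y. (1 - y\<^sup>2) powr (real N / 2 + 1)) has_real_derivative (real N / 2 + 1) * (1 - y\<^sup>2) powr (real N / 2 + 1 - 1) * (- (2 * y))) (at y)"
        using y2 by (intro DERIV_chain2[where f="\<lambda>x. x powr (real N / 2 + 1)"] has_real_derivative_powr)
    qed (use y in auto)
    moreover have "((\<alpha> + 1) * y powr (\<alpha> + 1 - 1)) * (1 - y\<^sup>2) powr (real N / 2 + 1)
       + ((real N / 2 + 1) * (1 - y\<^sup>2) powr (real N / 2 + 1 - 1) * (- (2 * y))) * y powr (\<alpha> + 1)
       = (\<alpha> + 1) * (y powr \<alpha> * ?h y) - (\<alpha> + real N + 3) * (y powr (\<alpha> + 2) * ?h y)"
    proof -
      have e1: "(1 - y\<^sup>2) powr (real N / 2 + 1) = ?h y * (1 - y\<^sup>2)" using y2 by (simp add: powr_add)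
      have e2: "y powr (\<alpha> + 1) = y powr \<alpha> * y" using y by (simp add: powr_add)
      have e3: "y powr (\<alpha> + 2) = y powr \<alpha> * y\<^sup>2" using y powr_mult_square[of y \<alpha>] by simp
      show ?thesis unfolding e1 e2 e3 by (simp add: algebra_simps power2_eq_square)
    qed
    ultimately show "(?F has_vector_derivative (\<alpha> + 1) * (y powr \<alpha> * ?h y) - (\<alpha> + real N + 3) * (y powr (\<alpha> + 2) * ?h y)) (at y)"
      by (simp add: has_real_derivative_iff_has_vector_derivative)
  qed simp
  show ?thesis using has_integral_unique[OF 1 2] by simp
qed

lemma hball_integral_cc:
  assumes "0 < \<alpha>"
  shows "(\<integral>\<^sup>+X. indicator hball (X::(real^'n) \<times> real) * ennreal (snd X powr \<alpha>) \<partial>lborel) = ennreal (unit_ball_vol (real CARD('n)) * cc CARD('n) \<alpha>)"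
proof -
  let ?V = "unit_ball_vol (real CARD('n))"
  have [measurable]: "(snd :: (real^'n) \<times> real \<Rightarrow> real) \<in> borel_measurable borel" by (rule borel_measurable_snd_id)
  have m: "(\<lambda>X. indicator hball (X::(real^'n) \<times> real) * ennreal (snd X powr \<alpha>)) \<in> borel_measurable borel" by measurable
  have "(\<integral>\<^sup>+X. indicator hball (X::(real^'n) \<times> real) * ennreal (snd X powr \<alpha>) \<partial>lborel)
     = (\<integral>\<^sup>+X. indicator hball (X::(real^'n) \<times> real) * ennreal (snd X powr \<alpha>) \<partial>(lborel \<Otimes>\<^sub>M lborel))"
    by (simp add: lborel_prod)
  also have "\<dots> = (\<integral>\<^sup>+y. \<integral>\<^sup>+x. indicator hball ((x::real^'n), y) * ennreal (y powr \<alpha>) \<partial>lborel \<partial>lborel)"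
    using m by (subst lborel_pair.nn_integral_snd[symmetric]) (simp_all add: lborel_prod)
  also have "\<dots> = (\<integral>\<^sup>+y. ennreal (?V) * ennreal (indicator {0..1} y * (y powr \<alpha> * (1 - y\<^sup>2) powr (real CARD('n) / 2))) \<partial>lborel)"
  proof (rule nn_integral_cong)
    fix y :: real
    show "(\<integral>\<^sup>+x. indicator hball ((x::real^'n), y) * ennreal (y powr \<alpha>) \<partial>lborel) = ennreal (?V) * ennreal (indicator {0..1} y * (y powr \<alpha> * (1 - y\<^sup>2) powr (real CARD('n) / 2)))"
    proof (cases "0 < y \<and> y < 1")
      case True
      then have y2: "1 - y\<^sup>2 > 0" by (simp add: abs_square_less_1)
      have eq: "indicator hball ((x::real^'n), y) * ennreal (y powr \<alpha>) = ennreal (y powr \<alpha>) * indicator (ball 0 (sqrt (1 - y\<^sup>2))) x" for x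
      proof -
        have "norm (x, y) < 1 \<longleftrightarrow> (norm x)\<^sup>2 + y\<^sup>2 < 1"
          by (simp add: norm_Pair)
        also have "\<dots> \<longleftrightarrow> norm x < sqrt (1 - y\<^sup>2)"
          using real_sqrt_less_iff[of "(norm x)\<^sup>2" "1 - y\<^sup>2"] by auto
        finally show ?thesis using True by (auto simp: hball_def indicator_def)
      qed
      have "(\<integral>\<^sup>+x. indicator hball ((x::real^'n), y) * ennreal (y powr \<alpha>) \<partial>lborel) = ennreal (y powr \<alpha>) * emeasure lborel (ball (0::real^'n) (sqrt (1 - y\<^sup>2)))"
        unfolding eq by (rule nn_integral_cmult_indicator) simp
      also have "emeasure lborel (ball (0::real^'n) (sqrt (1 - y\<^sup>2))) = ennreal (?V * sqrt (1 - y\<^sup>2) ^ CARD('n))"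
        using y2 by (subst emeasure_ball) auto
      also have "sqrt (1 - y\<^sup>2) ^ CARD('n) = (1 - y\<^sup>2) powr (real CARD('n) / 2)"
        using y2 by (simp add: powr_half_sqrt[symmetric] powr_realpow[symmetric] powr_powr)
      finally show ?thesis using True by (simp add: ennreal_mult[symmetric] mult.left_commute)
    next
      case False
      have "indicator hball ((x::real^'n), y) = (0::ennreal)" for x
      proof -
        have "\<bar>y\<bar> \<le> norm (x, y)" using abs_snd_le[of "(x, y)"] by simp
        then show ?thesis using False by (auto simp: hball_def indicator_def)
      qed
      moreover have "indicator {0..1} y * (y powr \<alpha> * (1 - y\<^sup>2) powr (real CARD('n) / 2)) = 0"
        using False by (cases "y = 0 \<or> y = 1") (auto simp: indicator_def)
      ultimately show ?thesis by simp
    qed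
  qed
  also have "\<dots> = ennreal ?V * (\<integral>\<^sup>+y. ennreal (indicator {0..1} y * (y powr \<alpha> * (1 - y\<^sup>2) powr (real CARD('n) / 2))) \<partial>lborel)"
    by (rule nn_integral_cmult) measurable
  also have "(\<integral>\<^sup>+y. ennreal (indicator {0..1} y * (y powr \<alpha> * (1 - y\<^sup>2) powr (real CARD('n) / 2))) \<partial>lborel) = ennreal (cc CARD('n) \<alpha>)"
    using nn_integral_has_integral_lebesgue[OF _ cc_has_integral[OF assms, of "CARD('n)"]] by simp
  finally show ?thesis by (simp add: ennreal_mult')
qed

text \<open>Up to the factor N + 1, the surface integral of the power \<alpha> of the last
  coordinate over the half sphere.\<close>

definition hsph :: "((real^'n) itself) \<Rightarrow> real \<Rightarrow> real" where
  "hsph _ \<alpha> = (\<integral>X. indicator hball (X::(real^'n) \<times> real) * (snd (X /\<^sub>R norm X)) powr \<alpha> \<partial>lborel)"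

text \<open>The power of the height is |X|^\<alpha> times a function of the direction. Writing
  |X|^\<alpha> as the integral of \<alpha> \<tau>^(\<alpha>-1) up to |X| and exchanging the
  integrals leaves shells of a function homogeneous of degree zero, known by scaling. The factor is
  the radial integral of (N+1) r^(N+\<alpha>).\<close>

lemma hball_radial:
  assumes "1 < \<alpha>"
  shows "(\<integral>\<^sup>+X. indicator hball (X::(real^'n) \<times> real) * ennreal (snd X powr \<alpha>) \<partial>lborel)
    = ennreal ((real CARD('n) + 1) / (real CARD('n) + 1 + \<alpha>) * hsph TYPE(real^'n) \<alpha>)"
    "integrable lborel (\<lambda>X. indicator hball (X::(real^'n) \<times> real) * (snd (X /\<^sub>R norm X)) powr \<alpha>)"
proof -
  let ?n = "CARD('n) + 1"
  let ?T = "\<lambda>X::(real^'n) \<times> real. (snd (X /\<^sub>R norm X)) powr \<alpha>"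
  define A :: "((real^'n) \<times> real) set" where "A = {X. 0 < snd X}"
  have "open A" unfolding A_def by (intro open_Collect_less continuous_intros)
  then have Am[measurable]: "A \<in> sets borel" by (rule borel_open)
  have "(\<lambda>X::(real^'n) \<times> real. snd (X /\<^sub>R norm X)) \<in> borel_measurable borel"
    by (rule borel_measurable_snd_compose) measurable
  then have Tm[measurable]: "?T \<in> borel_measurable borel" by measurable
  have T1: "?T X \<le> 1" if "X \<in> A" for X
  proof -
    have "\<bar>snd X\<bar> \<le> norm X" by (rule abs_snd_le)
    moreover have "snd X > 0" using that by (simp add: A_def)
    moreover from this have "norm X > 0" by (rule snd_pos_norm)
    ultimately have "snd (X /\<^sub>R norm X) \<le> 1" "0 \<le> snd (X /\<^sub>R norm X)" by (auto simp: field_simps)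
    then show ?thesis using assms by (intro powr_le1) auto
  qed
  have hb: "hball = A \<inter> {X. norm X < 1}" by (auto simp: hball_def A_def)
  show I: "integrable lborel (\<lambda>X. indicator hball X * ?T X)"
  proof (rule Bochner_Integration.integrable_bound)
    show "integrable lborel (indicator (ball (0::(real^'n) \<times> real) 1) :: _ \<Rightarrow> real)"
      using emeasure_lborel_ball_finite[of "0::(real^'n) \<times> real" 1] by (intro integrable_real_indicator) auto
    show "AE X in lborel. norm (indicator hball X * ?T X) \<le> norm (indicator (ball (0::(real^'n) \<times> real) 1) X :: real)"
      using T1 by (intro AE_I2) (auto simp: hb indicator_def)
  qed measurable
  define h where "h = hsph TYPE(real^'n) \<alpha>"
  have h0: "h \<ge> 0" unfolding h_def hsph_def by (intro integral_nonneg_AE) auto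
  define f where "f X = ennreal (?T X)" for X
  have fm[measurable]: "f \<in> borel_measurable borel" unfolding f_def using Tm by measurable
  define J where "J \<tau> = (\<integral>\<^sup>+X. indicator A X * f X * indicator {X. norm X < \<tau>} X \<partial>lborel)" for \<tau> :: real
  have J1: "J 1 = ennreal h"
  proof -
    have "J 1 = (\<integral>\<^sup>+X. ennreal (indicator hball X * ?T X) \<partial>lborel)"
      unfolding J_def by (intro nn_integral_cong) (auto simp: hb f_def indicator_def)
    also have "\<dots> = ennreal (\<integral>X. indicator hball X * ?T X \<partial>lborel)"
      by (rule nn_integral_eq_integral[OF I]) auto
    finally show ?thesis by (simp add: h_def hsph_def)
  qed
  have J: "J \<tau> = ennreal (\<tau> ^ ?n * h)" if "0 < \<tau>" for \<tau>
  proof -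
    have "J \<tau> = ennreal (\<tau> ^ DIM((real^'n) \<times> real)) * J 1"
      unfolding J_def
    proof (rule nn_integral_homogeneous_scale[OF fm that _ _ Am])
      show "f (\<tau> *\<^sub>R X) = f X" for X
      proof -
        have "(\<tau> *\<^sub>R X) /\<^sub>R norm (\<tau> *\<^sub>R X) = X /\<^sub>R norm X" using that by simp
        then show ?thesis unfolding f_def by (simp only:)
      qed
      show "\<tau> *\<^sub>R X \<in> A \<longleftrightarrow> X \<in> A" for X using that by (simp add: A_def zero_less_mult_iff)
    qed
    then show ?thesis using that h0 by (simp add: J1 ennreal_mult)
  qed
  \<comment> \<open>The shell is the difference of two dilated half balls; both masses are finite,
    so the subtraction in \<open>ennreal\<close> is meaningful.\<close>
  have shell: "(\<integral>\<^sup>+X. indicator A X * f X * indicator {X. \<tau> \<le> norm X \<and> norm X < 1} X \<partial>lborel) = ennreal ((1 - \<tau> ^ ?n) * h)" if t: "0 < \<tau>" "\<tau> \<le> 1" for \<tau>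
  proof -
    let ?S = "\<integral>\<^sup>+X. indicator A X * f X * indicator {X. \<tau> \<le> norm X \<and> norm X < 1} X \<partial>lborel"
    have "J 1 = (\<integral>\<^sup>+X. indicator A X * f X * indicator {X. norm X < \<tau>} X + indicator A X * f X * indicator {X. \<tau> \<le> norm X \<and> norm X < 1} X \<partial>lborel)"
      unfolding J_def using t by (intro nn_integral_cong) (auto simp: indicator_def)
    also have "\<dots> = J \<tau> + ?S" unfolding J_def by (rule nn_integral_add) measurable
    finally have e: "ennreal h = ennreal (\<tau> ^ ?n * h) + ?S" using J[OF t(1)] J1 by simp
    then have "?S = ennreal h - ennreal (\<tau> ^ ?n * h)" by (simp add: ennreal_minus_eq_top)
    also have "\<dots> = ennreal (h - \<tau> ^ ?n * h)" using t h0 by (intro ennreal_minus) auto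
    finally show ?thesis by (simp add: algebra_simps)
  qed
  have layer: "ennreal (r powr \<alpha>) = (\<integral>\<^sup>+\<tau>. ennreal (indicator {0..1} \<tau> * (\<alpha> * \<tau> powr (\<alpha> - 1))) * indicator {..r} \<tau> \<partial>lborel)" if r: "0 \<le> r" "r \<le> 1" for r
  proof -
    have "((\<lambda>\<tau>. \<alpha> * \<tau> powr (\<alpha> - 1)) has_integral \<alpha> * (r powr (\<alpha> - 1 + 1) / (\<alpha> - 1 + 1))) {0..r}"
      using assms r by (intro has_integral_mult_right has_integral_powr_from_0) auto
    then have "((\<lambda>\<tau>. \<alpha> * \<tau> powr (\<alpha> - 1)) has_integral r powr \<alpha>) {0..r}" using assms by simp
    then have "(\<integral>\<^sup>+\<tau>. ennreal (indicator {0..r} \<tau> * (\<alpha> * \<tau> powr (\<alpha> - 1))) \<partial>lborel) = ennreal (r powr \<alpha>)"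
      using assms by (intro nn_integral_has_integral_lebesgue) auto
    then show ?thesis using r by (subst (asm) nn_integral_cong[where v="\<lambda>\<tau>. ennreal (indicator {0..1} \<tau> * (\<alpha> * \<tau> powr (\<alpha> - 1))) * indicator {..r} \<tau>"]) (auto simp: indicator_def)
  qed
  define k where "k \<tau> = ennreal (indicator {0..1} \<tau> * (\<alpha> * \<tau> powr (\<alpha> - 1)))" for \<tau> :: real
  have [measurable]: "k \<in> borel_measurable borel" unfolding k_def by measurable
  have "(\<integral>\<^sup>+X. indicator hball (X::(real^'n) \<times> real) * ennreal (snd X powr \<alpha>) \<partial>lborel)
     = (\<integral>\<^sup>+X. \<integral>\<^sup>+\<tau>. indicator hball X * f X * (k \<tau> * indicator {..norm X} \<tau>) \<partial>lborel \<partial>lborel)"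
  proof (rule nn_integral_cong)
    fix X :: "(real^'n) \<times> real"
    show "indicator hball X * ennreal (snd X powr \<alpha>) = (\<integral>\<^sup>+\<tau>. indicator hball X * f X * (k \<tau> * indicator {..norm X} \<tau>) \<partial>lborel)"
    proof (cases "X \<in> hball")
      case True
      then have X: "norm X \<noteq> 0" "norm X \<le> 1" "0 < snd X" by (auto simp: hball_def)
      have "(\<integral>\<^sup>+\<tau>. indicator hball X * f X * (k \<tau> * indicator {..norm X} \<tau>) \<partial>lborel) = indicator hball X * f X * (\<integral>\<^sup>+\<tau>. k \<tau> * indicator {..norm X} \<tau> \<partial>lborel)"
        by (rule nn_integral_cmult) measurable
      also have "(\<integral>\<^sup>+\<tau>. k \<tau> * indicator {..norm X} \<tau> \<partial>lborel) = ennreal (norm X powr \<alpha>)"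
        using layer[of "norm X"] X unfolding k_def by simp
      also have "indicator hball X * f X * ennreal (norm X powr \<alpha>) = ennreal (?T X * norm X powr \<alpha>)"
        using True by (simp add: f_def ennreal_mult)
      also have "?T X * norm X powr \<alpha> = snd X powr \<alpha>"
        using X by (simp add: powr_mult[symmetric] field_simps)
      finally show ?thesis using True by simp
    qed simp
  qed
  also have "\<dots> = (\<integral>\<^sup>+\<tau>. \<integral>\<^sup>+X. indicator hball X * f X * (k \<tau> * indicator {..norm X} \<tau>) \<partial>lborel \<partial>lborel)"
  proof -
    have "(\<lambda>(X, \<tau>). indicator hball X * f X * (k \<tau> * indicator {..norm X} \<tau>)) = (\<lambda>w. indicator hball (fst w) * f (fst w) * (k (snd w) * (if snd w \<le> norm (fst w) then 1 else 0)))"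
      by (auto simp: indicator_def)
    moreover have "\<dots> \<in> borel_measurable (lborel \<Otimes>\<^sub>M lborel)" by measurable
    ultimately show ?thesis using lborel_pair.Fubini'[of "\<lambda>X \<tau>. indicator hball X * f X * (k \<tau> * indicator {..norm X} \<tau>)"] by simp
  qed
  also have "\<dots> = (\<integral>\<^sup>+\<tau>. ennreal (indicator {0..1} \<tau> * (\<alpha> * (\<tau> powr (\<alpha> - 1) - \<tau> powr (\<alpha> + CARD('n))) * h)) \<partial>lborel)"
  proof (rule nn_integral_cong)
    fix \<tau> :: real
    show "(\<integral>\<^sup>+X. indicator hball X * f X * (k \<tau> * indicator {..norm X} \<tau>) \<partial>lborel) = ennreal (indicator {0..1} \<tau> * (\<alpha> * (\<tau> powr (\<alpha> - 1) - \<tau> powr (\<alpha> + CARD('n))) * h))"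
    proof (cases "0 < \<tau> \<and> \<tau> \<le> 1")
      case True
      have "(\<integral>\<^sup>+X. indicator hball X * f X * (k \<tau> * indicator {..norm X} \<tau>) \<partial>lborel) = (\<integral>\<^sup>+X. k \<tau> * (indicator A X * f X * indicator {X. \<tau> \<le> norm X \<and> norm X < 1} X) \<partial>lborel)"
        by (intro nn_integral_cong) (auto simp: hb indicator_def mult.commute)
      also have "\<dots> = k \<tau> * ennreal ((1 - \<tau> ^ ?n) * h)"
        using shell True by (subst nn_integral_cmult) auto
      also have "\<dots> = ennreal ((\<alpha> * \<tau> powr (\<alpha> - 1)) * ((1 - \<tau> ^ ?n) * h))"
        using True assms h0 power_le_one[of \<tau> ?n] unfolding k_def by (simp add: ennreal_mult)
      also have "(\<alpha> * \<tau> powr (\<alpha> - 1)) * ((1 - \<tau> ^ ?n) * h) = \<alpha> * (\<tau> powr (\<alpha> - 1) - \<tau> powr (\<alpha> - 1) * \<tau> ^ ?n) * h"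
        by (simp add: algebra_simps)
      also have "\<tau> powr (\<alpha> - 1) * \<tau> ^ ?n = \<tau> powr (\<alpha> + CARD('n))"
        using True by (simp add: powr_realpow[symmetric] powr_add[symmetric] del: power_Suc)
      finally show ?thesis using True by simp
    next
      case False
      then show ?thesis by (cases "\<tau> = 0") (auto simp: k_def indicator_def)
    qed
  qed
  also have "\<dots> = ennreal ((real CARD('n) + 1) / (real CARD('n) + 1 + \<alpha>) * h)"
  proof (rule nn_integral_has_integral_lebesgue)
    have "((\<lambda>\<tau>. \<alpha> * (\<tau> powr (\<alpha> - 1) - \<tau> powr (\<alpha> + CARD('n))) * h) has_integral
       \<alpha> * (1 powr (\<alpha> - 1 + 1) / (\<alpha> - 1 + 1) - 1 powr (\<alpha> + CARD('n) + 1) / (\<alpha> + CARD('n) + 1)) * h) {0..1}"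
      using assms by (intro has_integral_mult_left has_integral_mult_right has_integral_diff has_integral_powr_from_0) auto
    moreover have "\<alpha> * (1 powr (\<alpha> - 1 + 1) / (\<alpha> - 1 + 1) - 1 powr (\<alpha> + CARD('n) + 1) / (\<alpha> + CARD('n) + 1)) = (real CARD('n) + 1) / (real CARD('n) + 1 + \<alpha>)"
    proof -
      have nz: "\<alpha> \<noteq> 0" "\<alpha> + CARD('n) + 1 \<noteq> 0" using assms by auto
      have "\<alpha> * (1 / \<alpha> - 1 / (\<alpha> + CARD('n) + 1)) = 1 - \<alpha> / (\<alpha> + CARD('n) + 1)"
        using nz by (simp add: right_diff_distrib)
      also have "\<dots> = (real CARD('n) + 1) / (real CARD('n) + 1 + \<alpha>)"
        using nz by (simp add: field_simps)
      finally show ?thesis by simp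
    qed
    ultimately show "((\<lambda>\<tau>. \<alpha> * (\<tau> powr (\<alpha> - 1) - \<tau> powr (\<alpha> + CARD('n))) * h) has_integral (real CARD('n) + 1) / (real CARD('n) + 1 + \<alpha>) * h) {0..1}"
      by simp
    fix \<tau> :: real assume "\<tau> \<in> {0..1}"
    then have "\<tau> powr (\<alpha> + CARD('n)) \<le> \<tau> powr (\<alpha> - 1)" using assms by (intro powr_mono') auto
    then show "0 \<le> \<alpha> * (\<tau> powr (\<alpha> - 1) - \<tau> powr (\<alpha> + CARD('n))) * h" using assms h0 by simp
  qed
  finally show "(\<integral>\<^sup>+X. indicator hball (X::(real^'n) \<times> real) * ennreal (snd X powr \<alpha>) \<partial>lborel)
    = ennreal ((real CARD('n) + 1) / (real CARD('n) + 1 + \<alpha>) * hsph TYPE(real^'n) \<alpha>)" unfolding h_def .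
qed

text \<open>The solid integral of the power is known in two ways, by horizontal slices and by rays;
  comparing them carries \<open>cc_rec\<close> over to the sphere.\<close>

lemma hsph_rec:
  assumes "1 < \<alpha>"
  shows "(real CARD('n) + 1 + \<alpha>) * hsph TYPE(real^'n) (\<alpha> + 2) = (\<alpha> + 1) * hsph TYPE(real^'n) \<alpha>"
proof -
  let ?N = "real CARD('n)" and ?h = "hsph TYPE(real^'n)"
  have h: "(?N + 1) / (?N + 1 + a) * ?h a = unit_ball_vol ?N * cc CARD('n) a" if "1 < a" for a
  proof -
    have "?h a \<ge> 0" unfolding hsph_def by (intro integral_nonneg_AE) auto
    moreover have "cc CARD('n) a \<ge> 0"
      using that by (intro has_integral_nonneg[OF cc_has_integral[of a "CARD('n)"]]) auto
    moreover have "ennreal ((?N + 1) / (?N + 1 + a) * ?h a) = ennreal (unit_ball_vol ?N * cc CARD('n) a)"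
      using hball_radial(1)[OF that, where 'n='n] hball_integral_cc[of a, where 'n='n] that by simp
    ultimately show ?thesis using that by (subst (asm) ennreal_inj) auto
  qed
  have c: "(\<alpha> + ?N + 3) * cc CARD('n) (\<alpha> + 2) = (\<alpha> + 1) * cc CARD('n) \<alpha>" using assms by (intro cc_rec) auto
  have nz: "?N + 1 + \<alpha> \<noteq> 0" "?N + 1 + (\<alpha> + 2) \<noteq> 0" "?N + 1 \<noteq> 0" using assms by auto
  have "(?N + 1) * ?h (\<alpha> + 2) = (?N + 1 + (\<alpha> + 2)) * (unit_ball_vol ?N * cc CARD('n) (\<alpha> + 2))"
    using h[of "\<alpha> + 2"] assms nz by (simp add: nonzero_divide_eq_eq mult.commute)
  also have "\<dots> = unit_ball_vol ?N * ((\<alpha> + ?N + 3) * cc CARD('n) (\<alpha> + 2))" by (simp add: algebra_simps)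
  also have "\<dots> = (\<alpha> + 1) * (unit_ball_vol ?N * cc CARD('n) \<alpha>)" unfolding c by simp
  also have "\<dots> = (\<alpha> + 1) * ((?N + 1) / (?N + 1 + \<alpha>) * ?h \<alpha>)" using h[OF assms] by simp
  finally have "(?N + 1) * ((?N + 1 + \<alpha>) * ?h (\<alpha> + 2)) = (?N + 1) * ((\<alpha> + 1) * ?h \<alpha>)"
    using nz by (simp add: field_simps)
  then show ?thesis using nz by (simp only: mult_cancel_left) simp
qed

lemma hball_integral_pos:
  fixes f :: "(real^'n) \<times> real \<Rightarrow> real"
  assumes i: "integrable lborel (\<lambda>X. indicator hball X * f X)" and f: "\<And>X. X \<in> hball \<Longrightarrow> f X > 0"
  shows "(\<integral>X. indicator hball X * f X \<partial>lborel) > 0"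
proof -
  have nn: "0 \<le> indicator hball X * f X" for X using f[of X] by (auto simp: indicator_def less_imp_le)
  have "(\<integral>X. indicator hball X * f X \<partial>lborel) \<noteq> 0"
  proof
    assume "(\<integral>X. indicator hball X * f X \<partial>lborel) = 0"
    then have "AE X in lborel. indicator hball X * f X = 0"
      using integral_nonneg_eq_0_iff_AE[OF i] nn by simp
    then have "AE X in lborel. X \<notin> (hball :: ((real^'n) \<times> real) set)"
    proof eventually_elim
      fix X assume "indicator hball X * f X = 0"
      then show "X \<notin> hball" using f[of X] by (auto simp: indicator_def)
    qed
    moreover have "open (hball :: ((real^'n) \<times> real) set)" unfolding hball_def
      by (intro open_Collect_conj open_Collect_less continuous_intros)
    ultimately have "(hball :: ((real^'n) \<times> real) set) = {}" by (intro open_AE_empty)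
    moreover have "(0, 1/2) \<in> (hball :: ((real^'n) \<times> real) set)" by (simp add: hball_def norm_Pair)
    ultimately show False by blast
  qed
  moreover have "(\<integral>X. indicator hball X * f X \<partial>lborel) \<ge> 0" using nn by (intro integral_nonneg_AE) auto
  ultimately show ?thesis by linarith
qed

lemma snd_normalized_pos: "X \<in> hball \<Longrightarrow> snd (X /\<^sub>R norm X) > 0"
  using snd_pos_norm[of X] by (simp add: hball_def zero_less_mult_iff)

lemma hsph_pos: "1 < \<alpha> \<Longrightarrow> hsph TYPE(real^'n) \<alpha> > 0"
  unfolding hsph_def using snd_normalized_pos
  by (intro hball_integral_pos hball_radial(2)) (auto simp: less_le)

text \<open>The function y^2, with y the last coordinate, vanishes on the boundary of the half
  sphere, so the term with \<open>lam\<close> drops out. Its tangential gradient has squared norm 4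
  y^2 - 4 y^4, and \<open>hsph_rec\<close> at \<alpha> = 3 - 2s evaluates the quotient.\<close>

lemma rayleigh_sq:
  assumes s: "0 < s" "s < 1"
  shows "rayleigh s lam (\<lambda>X::(real^'n) \<times> real. (snd X)\<^sup>2) (\<lambda>X. (0, 2 * snd X)) = 4 * real CARD('n) / (4 - 2 * s)"
    "sphere_integral (half_sphere :: ((real^'n) \<times> real) set) (\<lambda>\<theta>. snd \<theta> powr (1 - 2 * s) * ((snd \<theta>)\<^sup>2)\<^sup>2) \<noteq> 0"
proof -
  let ?N = "real CARD('n)" and ?h = "hsph TYPE(real^'n)"
  define T where "T X = snd (X /\<^sub>R norm X)" for X :: "(real^'n) \<times> real"
  have Tp: "T X > 0" if "X \<in> hball" for X using snd_normalized_pos[OF that] by (simp add: T_def)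
  have p4: "y powr (1 - 2 * s) * (y\<^sup>2)\<^sup>2 = y powr (5 - 2 * s)" if "y > 0" for y :: real
  proof -
    have "y powr (1 - 2 * s) * (y\<^sup>2)\<^sup>2 = y powr (1 - 2 * s) * y\<^sup>2 * y\<^sup>2" by (simp add: power2_eq_square)
    also have "\<dots> = y powr (1 - 2 * s + 2 + 2)" using that powr_mult_square[of y] by (simp only: less_imp_le)
    finally show ?thesis by (simp add: algebra_simps)
  qed
  have p2: "y powr (1 - 2 * s) * y\<^sup>2 = y powr (3 - 2 * s)" if "y > 0" for y :: real
    using that powr_mult_square[of y "1 - 2 * s"] by (simp add: algebra_simps)
  have den: "sphere_integral (half_sphere :: ((real^'n) \<times> real) set) (\<lambda>\<theta>. snd \<theta> powr (1 - 2 * s) * ((snd \<theta>)\<^sup>2)\<^sup>2) = (?N + 1) * ?h (5 - 2 * s)"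
    unfolding sphere_integral_half hsph_def T_def[symmetric]
  proof (intro arg_cong[where f="\<lambda>x. (?N + 1) * x"] Bochner_Integration.integral_cong refl)
    fix X :: "(real^'n) \<times> real"
    show "indicator hball X * (T X powr (1 - 2 * s) * ((T X)\<^sup>2)\<^sup>2) = indicator hball X * T X powr (5 - 2 * s)"
      by (cases "X \<in> hball") (simp_all only: p4[OF Tp] indicator_simps mult_zero_left not_False_eq_True)
  qed
  have pos: "?h (5 - 2 * s) > 0" using s by (intro hsph_pos) auto
  show "sphere_integral (half_sphere :: ((real^'n) \<times> real) set) (\<lambda>\<theta>. snd \<theta> powr (1 - 2 * s) * ((snd \<theta>)\<^sup>2)\<^sup>2) \<noteq> 0"
    unfolding den using pos by (simp add: add_eq_0_iff)
  have tang: "(norm ((0, 2 * snd \<theta>) - ((0, 2 * snd \<theta>) \<bullet> \<theta>) *\<^sub>R \<theta>))\<^sup>2 = 4 * (snd \<theta>)\<^sup>2 - 4 * ((snd \<theta>)\<^sup>2)\<^sup>2"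
    if "norm \<theta> = 1" for \<theta> :: "(real^'n) \<times> real"
  proof -
    let ?g = "(0, 2 * snd \<theta>) :: (real^'n) \<times> real"
    have t1: "\<theta> \<bullet> \<theta> = 1" using that by (simp add: power2_norm_eq_inner[symmetric])
    have "(norm (?g - (?g \<bullet> \<theta>) *\<^sub>R \<theta>))\<^sup>2 = ?g \<bullet> ?g - (?g \<bullet> \<theta>)\<^sup>2"
      unfolding power2_norm_eq_inner using t1
      by (simp add: inner_diff_left inner_diff_right inner_commute power2_eq_square algebra_simps)
    moreover have "?g \<bullet> ?g = 4 * (snd \<theta>)\<^sup>2" "?g \<bullet> \<theta> = 2 * (snd \<theta>)\<^sup>2"
      by (simp_all add: inner_prod_def power2_eq_square)
    ultimately show ?thesis by (simp add: power2_eq_square)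
  qed
  have num: "sphere_integral (half_sphere :: ((real^'n) \<times> real) set)
      (\<lambda>\<theta>. snd \<theta> powr (1 - 2 * s) * (norm ((0, 2 * snd \<theta>) - ((0, 2 * snd \<theta>) \<bullet> \<theta>) *\<^sub>R \<theta>))\<^sup>2)
     = (?N + 1) * (4 * ?h (3 - 2 * s) - 4 * ?h (5 - 2 * s))"
  proof -
    have i: "integrable lborel (\<lambda>X::(real^'n) \<times> real. indicator hball X * T X powr (3 - 2 * s))"
      "integrable lborel (\<lambda>X::(real^'n) \<times> real. indicator hball X * T X powr (5 - 2 * s))"
      unfolding T_def using hball_radial(2)[of "3 - 2 * s", where 'n='n] hball_radial(2)[of "5 - 2 * s", where 'n='n] s by simp_all
    have "(\<integral>X. indicator hball (X::(real^'n) \<times> real) * (snd (X /\<^sub>R norm X) powr (1 - 2 * s) *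
       (norm ((0, 2 * snd (X /\<^sub>R norm X)) - ((0, 2 * snd (X /\<^sub>R norm X)) \<bullet> (X /\<^sub>R norm X)) *\<^sub>R (X /\<^sub>R norm X)))\<^sup>2) \<partial>lborel)
      = (\<integral>X. 4 * (indicator hball X * T X powr (3 - 2 * s)) - 4 * (indicator hball X * T X powr (5 - 2 * s)) \<partial>lborel)"
    proof (intro Bochner_Integration.integral_cong refl)
      fix X :: "(real^'n) \<times> real"
      show "indicator hball X * (snd (X /\<^sub>R norm X) powr (1 - 2 * s) *
       (norm ((0, 2 * snd (X /\<^sub>R norm X)) - ((0, 2 * snd (X /\<^sub>R norm X)) \<bullet> (X /\<^sub>R norm X)) *\<^sub>R (X /\<^sub>R norm X)))\<^sup>2)
       = 4 * (indicator hball X * T X powr (3 - 2 * s)) - 4 * (indicator hball X * T X powr (5 - 2 * s))"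
      proof (cases "X \<in> hball")
        case True
        then have "norm X > 0" by (intro snd_pos_norm) (simp add: hball_def)
        then have n1: "norm (X /\<^sub>R norm X) = 1" by simp
        show ?thesis
          unfolding tang[OF n1] unfolding T_def[symmetric] p2[OF Tp[OF True], symmetric] p4[OF Tp[OF True], symmetric]
          by (simp add: algebra_simps)
      qed simp
    qed
    also have "\<dots> = 4 * ?h (3 - 2 * s) - 4 * ?h (5 - 2 * s)"
      using i unfolding hsph_def T_def by simp
    finally show ?thesis unfolding sphere_integral_half by simp
  qed
  have rec: "(?N + 1 + (3 - 2 * s)) * ?h (5 - 2 * s) = (4 - 2 * s) * ?h (3 - 2 * s)"
  proof -
    have e: "3 - 2 * s + 2 = 5 - 2 * s" "3 - 2 * s + 1 = 4 - 2 * s" by simp_all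
    show ?thesis using hsph_rec[of "3 - 2 * s", where 'n='n] s unfolding e by simp
  qed
  have bd: "sphere_integral (sphere (0::real^'n) 1) (\<lambda>\<theta>'. ((snd (\<theta>', 0::real))\<^sup>2)\<^sup>2) = 0"
    by (simp add: sphere_integral_bd)
  have "rayleigh s lam (\<lambda>X::(real^'n) \<times> real. (snd X)\<^sup>2) (\<lambda>X. (0, 2 * snd X))
     = ((?N + 1) * (4 * ?h (3 - 2 * s) - 4 * ?h (5 - 2 * s))) / ((?N + 1) * ?h (5 - 2 * s))"
    unfolding rayleigh_def num den bd by simp
  also have "\<dots> = 4 * ?N / (4 - 2 * s)"
  proof -
    have "?h (3 - 2 * s) = (?N + 4 - 2 * s) * ?h (5 - 2 * s) / (4 - 2 * s)" using rec s by (simp add: field_simps)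
    then have "4 * ?h (3 - 2 * s) - 4 * ?h (5 - 2 * s) = 4 * ?N / (4 - 2 * s) * ?h (5 - 2 * s)" using s by (simp add: field_simps)
    then show ?thesis using pos by (simp add: add_eq_0_iff)
  qed
  finally show "rayleigh s lam (\<lambda>X::(real^'n) \<times> real. (snd X)\<^sup>2) (\<lambda>X. (0, 2 * snd X)) = 4 * ?N / (4 - 2 * s)" .
qed

section \<open>A weighted trace inequality\<close>

lemma nn_integral_powr_Ioo:
  fixes a \<delta> :: real
  assumes "-1 < a" "0 < \<delta>"
  shows "(\<integral>\<^sup>+t. indicator {0<..<\<delta>} t * ennreal (t powr a) \<partial>lborel) = ennreal (\<delta> powr (a + 1) / (a + 1))"
proof -
  have "AE t in lborel. t \<noteq> (0::real) \<and> t \<noteq> \<delta>"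
    using AE_lborel_singleton[of 0] AE_lborel_singleton[of \<delta>] by eventually_elim auto
  then have "AE t in lborel. indicator {0<..<\<delta>} t * ennreal (t powr a) = ennreal (indicator {0..\<delta>} t * t powr a)"
    by eventually_elim (auto simp: indicator_def)
  then have "(\<integral>\<^sup>+t. indicator {0<..<\<delta>} t * ennreal (t powr a) \<partial>lborel) = (\<integral>\<^sup>+t. ennreal (indicator {0..\<delta>} t * t powr a) \<partial>lborel)"
    by (rule nn_integral_cong_AE)
  also have "\<dots> = ennreal (\<delta> powr (a + 1) / (a + 1))"
    using assms by (intro nn_integral_has_integral_lebesgue has_integral_powr_from_0) auto
  finally show ?thesis .
qed

text \<open>The choice \<eta> = d/B suffices. This recovers Cauchy-Schwarz from its AM-GM form,
  which can be integrated termwise in \<open>ennreal\<close>.\<close>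

lemma square_le_of_amgm:
  fixes d E B :: real
  assumes "0 \<le> d" "0 \<le> E" "0 < B" and h: "\<And>\<eta>. 0 < \<eta> \<Longrightarrow> d \<le> E / (2 * \<eta>) + \<eta> * B / 2"
  shows "d\<^sup>2 \<le> E * B"
proof (cases "d = 0")
  case False
  then have d: "d > 0" using assms by simp
  have "d \<le> E / (2 * (d / B)) + (d / B) * B / 2" using d assms by (intro h) auto
  then have "d \<le> E * B / (2 * d) + d / 2" using assms by simp
  then have "d * (2 * d) \<le> (E * B / (2 * d) + d / 2) * (2 * d)" using d by (intro mult_right_mono) auto
  also have "\<dots> = E * B + d * d" using d by (simp add: field_simps)
  finally show ?thesis by (simp add: power2_eq_square)
qed (use assms in auto)

text \<open>Cauchy-Schwarz with the weights t^(1-2s) and t^(2s-1) bounds (\<psi>(0) - \<psi>(t))^2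
  by the energy times t^(2s)/(2s); then (\<psi>(0))^2 <= 2 (\<psi>(t))^2 + 2 (\<psi>(0) -
  \<psi>(t))^2 is integrated against t^(1-2s). The gradient carries \<delta>^2 against
  \<delta>^(2-2s) on the left, so its share is small for small \<delta>.\<close>

lemma trace_1d:
  fixes \<psi> \<psi>' :: "real \<Rightarrow> real" and s \<delta> :: real
  assumes s: "0 < s" "s < 1" and \<delta>: "0 < \<delta>"
    and der: "\<And>t. t \<in> {0..\<delta>} \<Longrightarrow> (\<psi> has_real_derivative \<psi>' t) (at t within {0..\<delta>})"
    and cont: "continuous_on {0..\<delta>} \<psi>'"
    and meas[measurable]: "\<psi> \<in> borel_measurable borel" "\<psi>' \<in> borel_measurable borel"
  shows "ennreal ((\<psi> 0)\<^sup>2 * (\<delta> powr (2 - 2 * s) / (2 - 2 * s)))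
    \<le> (\<integral>\<^sup>+t. indicator {0<..<\<delta>} t * ennreal (t powr (1 - 2 * s) * (2 * (\<psi> t)\<^sup>2 + \<delta>\<^sup>2 / (2 * s) * (\<psi>' t)\<^sup>2)) \<partial>lborel)"
proof -
  define E where "E = (\<integral>\<^sup>+t. indicator {0<..<\<delta>} t * ennreal (t powr (1 - 2 * s) * (\<psi>' t)\<^sup>2) \<partial>lborel)"
  define A where "A = (\<integral>\<^sup>+t. indicator {0<..<\<delta>} t * ennreal (t powr (1 - 2 * s) * (\<psi> t)\<^sup>2) \<partial>lborel)"
  have "bounded (\<psi>' ` {0..\<delta>})" by (intro compact_imp_bounded compact_continuous_image cont) auto
  then obtain M where "\<forall>y\<in>\<psi>' ` {0..\<delta>}. norm y \<le> M" using bounded_iff by blast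
  then have M: "\<bar>\<psi>' t\<bar> \<le> M" if "t \<in> {0..\<delta>}" for t using that by auto
  have "E \<le> (\<integral>\<^sup>+t. ennreal (M\<^sup>2) * (indicator {0<..<\<delta>} t * ennreal (t powr (1 - 2 * s))) \<partial>lborel)"
    unfolding E_def
  proof (rule nn_integral_mono)
    fix t :: real
    show "indicator {0<..<\<delta>} t * ennreal (t powr (1 - 2 * s) * (\<psi>' t)\<^sup>2) \<le> ennreal (M\<^sup>2) * (indicator {0<..<\<delta>} t * ennreal (t powr (1 - 2 * s)))"
    proof (cases "t \<in> {0<..<\<delta>}")
      case True
      have "(\<psi>' t)\<^sup>2 \<le> M\<^sup>2" using M[of t] True power_mono[of "\<bar>\<psi>' t\<bar>" M 2] by simp
      then have "t powr (1 - 2 * s) * (\<psi>' t)\<^sup>2 \<le> M\<^sup>2 * t powr (1 - 2 * s)" by (simp add: mult.commute mult_right_mono)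
      then show ?thesis using True by (simp add: ennreal_mult[symmetric])
    qed simp
  qed
  also have "\<dots> = ennreal (M\<^sup>2) * ennreal (\<delta> powr (1 - 2 * s + 1) / (1 - 2 * s + 1))"
    using s \<delta> by (subst nn_integral_cmult) (auto simp: nn_integral_powr_Ioo)
  also have "\<dots> < top" by (simp add: ennreal_mult_less_top)
  finally obtain E' where E': "E = ennreal E'" "E' \<ge> 0" by (cases E) auto
  have pt: "(\<psi> 0)\<^sup>2 \<le> 2 * (\<psi> t)\<^sup>2 + E' * t powr (2 * s) / s" if t: "0 < t" "t < \<delta>" for t
  proof -
    have ct: "continuous_on {0..t} \<psi>'" using cont by (rule continuous_on_subset) (use t in auto)
    have "(\<psi>' has_integral (\<psi> t - \<psi> 0)) {0..t}"
      using t by (intro fundamental_theorem_of_calculus)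
        (auto simp: has_real_derivative_iff_has_vector_derivative[symmetric] intro!: DERIV_subset[OF der])
    then have "norm (\<psi> t - \<psi> 0) \<le> integral {0..t} (\<lambda>y. \<bar>\<psi>' y\<bar>)"
      using integral_norm_bound_integral[of \<psi>' "{0..t}" "\<lambda>y. \<bar>\<psi>' y\<bar>"] ct
      by (auto simp: integral_unique intro!: integrable_continuous_real continuous_intros)
    then have d: "\<bar>\<psi> 0 - \<psi> t\<bar> \<le> integral {0..t} (\<lambda>y. \<bar>\<psi>' y\<bar>)" by (simp add: abs_minus_commute)
    have nnq: "(\<integral>\<^sup>+y. ennreal (indicator {0..t} y * \<bar>\<psi>' y\<bar>) \<partial>lborel) = ennreal (integral {0..t} (\<lambda>y. \<bar>\<psi>' y\<bar>))"
      using ct by (intro nn_integral_has_integral_lebesgue integrable_integral integrable_continuous_real continuous_intros) auto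
    have "(\<psi> 0 - \<psi> t)\<^sup>2 \<le> E' * (t powr (2 * s) / (2 * s))"
    proof -
      have "\<bar>\<psi> 0 - \<psi> t\<bar>\<^sup>2 \<le> E' * (t powr (2 * s) / (2 * s))"
      proof (rule square_le_of_amgm)
        fix \<eta> :: real assume \<eta>: "\<eta> > 0"
        have "ennreal \<bar>\<psi> 0 - \<psi> t\<bar> \<le> (\<integral>\<^sup>+y. ennreal (indicator {0..t} y * \<bar>\<psi>' y\<bar>) \<partial>lborel)"
          unfolding nnq using d by (rule ennreal_leI)
        also have "\<dots> \<le> (\<integral>\<^sup>+y. ennreal (1 / (2 * \<eta>)) * (indicator {0<..<\<delta>} y * ennreal (y powr (1 - 2 * s) * (\<psi>' y)\<^sup>2))
           + ennreal (\<eta> / 2) * (indicator {0<..<t} y * ennreal (y powr (2 * s - 1))) \<partial>lborel)"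
        proof (rule nn_integral_mono_AE)
          have "AE y in lborel. y \<noteq> (0::real) \<and> y \<noteq> t"
            using AE_lborel_singleton[of 0] AE_lborel_singleton[of t] by eventually_elim auto
          then show "AE y in lborel. ennreal (indicator {0..t} y * \<bar>\<psi>' y\<bar>) \<le> ennreal (1 / (2 * \<eta>)) * (indicator {0<..<\<delta>} y * ennreal (y powr (1 - 2 * s) * (\<psi>' y)\<^sup>2))
           + ennreal (\<eta> / 2) * (indicator {0<..<t} y * ennreal (y powr (2 * s - 1)))"
          proof eventually_elim
            fix y :: real assume y: "y \<noteq> 0 \<and> y \<noteq> t"
            show "ennreal (indicator {0..t} y * \<bar>\<psi>' y\<bar>) \<le> ennreal (1 / (2 * \<eta>)) * (indicator {0<..<\<delta>} y * ennreal (y powr (1 - 2 * s) * (\<psi>' y)\<^sup>2))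
               + ennreal (\<eta> / 2) * (indicator {0<..<t} y * ennreal (y powr (2 * s - 1)))"
            proof (cases "y \<in> {0..t}")
              case True
              then have y0: "0 < y" "y < t" "y < \<delta>" using y t by auto
              define p where "p = y powr (1 - 2 * s)"
              have p0: "p > 0" using y0 by (simp add: p_def)
              have pi: "y powr (2 * s - 1) = 1 / p" using y0 powr_minus_divide[of y "1 - 2 * s"] by (simp add: p_def)
              \<comment> \<open>AM-GM for the factorisation of |\<psi>'| into p^(1/2) |\<psi>'| and
                p^(-1/2), where p is the weight at y.\<close>
              have "0 \<le> (p * \<bar>\<psi>' y\<bar> - \<eta>)\<^sup>2" by simp
              then have "2 * \<eta> * (p * \<bar>\<psi>' y\<bar>) \<le> p\<^sup>2 * (\<psi>' y)\<^sup>2 + \<eta>\<^sup>2" by (simp add: power2_diff power_mult_distrib algebra_simps)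
              then have "2 * \<eta> * (p * \<bar>\<psi>' y\<bar>) / (2 * \<eta> * p) \<le> (p\<^sup>2 * (\<psi>' y)\<^sup>2 + \<eta>\<^sup>2) / (2 * \<eta> * p)"
                using \<eta> p0 by (intro divide_right_mono) auto
              also have "\<dots> = 1 / (2 * \<eta>) * (p * (\<psi>' y)\<^sup>2) + \<eta> / 2 * (1 / p)"
                using \<eta> p0 by (simp add: add_divide_distrib power2_eq_square)
              finally have "\<bar>\<psi>' y\<bar> \<le> 1 / (2 * \<eta>) * (p * (\<psi>' y)\<^sup>2) + \<eta> / 2 * (1 / p)" using \<eta> p0 by simp
              then have "ennreal \<bar>\<psi>' y\<bar> \<le> ennreal (1 / (2 * \<eta>) * (p * (\<psi>' y)\<^sup>2) + \<eta> / 2 * (1 / p))" by (rule ennreal_leI)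
              also have "\<dots> = ennreal (1 / (2 * \<eta>)) * ennreal (p * (\<psi>' y)\<^sup>2) + ennreal (\<eta> / 2) * ennreal (1 / p)"
                using \<eta> p0 by (simp add: ennreal_mult[symmetric] ennreal_plus[symmetric] del: ennreal_plus)
              finally show ?thesis using y0 by (simp add: pi p_def[symmetric])
            qed simp
          qed
        qed
        also have "\<dots> = ennreal (1 / (2 * \<eta>)) * E + ennreal (\<eta> / 2) * ennreal (t powr (2 * s - 1 + 1) / (2 * s - 1 + 1))"
          unfolding E_def using s t by (simp add: nn_integral_add nn_integral_cmult nn_integral_powr_Ioo)
        also have "\<dots> = ennreal (E' / (2 * \<eta>) + \<eta> * (t powr (2 * s) / (2 * s)) / 2)"
          unfolding E' using \<eta> E' s by (simp add: ennreal_mult[symmetric] ennreal_plus[symmetric] del: ennreal_plus)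
        finally show "\<bar>\<psi> 0 - \<psi> t\<bar> \<le> E' / (2 * \<eta>) + \<eta> * (t powr (2 * s) / (2 * s)) / 2"
          using \<eta> E' s by (subst (asm) ennreal_le_iff) auto
      qed (use E' s t in auto)
      then show ?thesis by simp
    qed
    moreover have "(\<psi> 0)\<^sup>2 \<le> 2 * (\<psi> t)\<^sup>2 + 2 * (\<psi> 0 - \<psi> t)\<^sup>2"
    proof -
      have "0 \<le> (\<psi> 0 - 2 * \<psi> t)\<^sup>2" by simp
      then show ?thesis by (simp add: power2_eq_square algebra_simps)
    qed
    ultimately show ?thesis by (simp add: field_simps)
  qed
  have "ennreal ((\<psi> 0)\<^sup>2 * (\<delta> powr (2 - 2 * s) / (2 - 2 * s))) = ennreal ((\<psi> 0)\<^sup>2) * (\<integral>\<^sup>+t. indicator {0<..<\<delta>} t * ennreal (t powr (1 - 2 * s)) \<partial>lborel)"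
    using s \<delta> nn_integral_powr_Ioo[of "1 - 2 * s" \<delta>] by (simp add: ennreal_mult[symmetric])
  also have "\<dots> = (\<integral>\<^sup>+t. ennreal ((\<psi> 0)\<^sup>2) * (indicator {0<..<\<delta>} t * ennreal (t powr (1 - 2 * s))) \<partial>lborel)"
    by (rule nn_integral_cmult[symmetric]) measurable
  also have "\<dots> \<le> (\<integral>\<^sup>+t. 2 * (indicator {0<..<\<delta>} t * ennreal (t powr (1 - 2 * s) * (\<psi> t)\<^sup>2)) + ennreal (E' / s) * (indicator {0<..<\<delta>} t * ennreal (t powr 1)) \<partial>lborel)"
  proof (rule nn_integral_mono)
    fix t :: real
    show "ennreal ((\<psi> 0)\<^sup>2) * (indicator {0<..<\<delta>} t * ennreal (t powr (1 - 2 * s)))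
      \<le> 2 * (indicator {0<..<\<delta>} t * ennreal (t powr (1 - 2 * s) * (\<psi> t)\<^sup>2)) + ennreal (E' / s) * (indicator {0<..<\<delta>} t * ennreal (t powr 1))"
    proof (cases "t \<in> {0<..<\<delta>}")
      case True
      then have t: "0 < t" "t < \<delta>" by auto
      have "(\<psi> 0)\<^sup>2 * t powr (1 - 2 * s) \<le> (2 * (\<psi> t)\<^sup>2 + E' * t powr (2 * s) / s) * t powr (1 - 2 * s)"
        by (rule mult_right_mono[OF pt[OF t]]) simp
      also have "\<dots> = 2 * (t powr (1 - 2 * s) * (\<psi> t)\<^sup>2) + E' / s * (t powr (2 * s) * t powr (1 - 2 * s))"
        by (simp add: algebra_simps)
      also have "t powr (2 * s) * t powr (1 - 2 * s) = t powr 1" by (simp only: powr_add[symmetric]) simp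
      finally have "ennreal ((\<psi> 0)\<^sup>2 * t powr (1 - 2 * s)) \<le> ennreal (2 * (t powr (1 - 2 * s) * (\<psi> t)\<^sup>2) + E' / s * t powr 1)" by (rule ennreal_leI)
      also have "\<dots> = ennreal 2 * ennreal (t powr (1 - 2 * s) * (\<psi> t)\<^sup>2) + ennreal (E' / s) * ennreal (t powr 1)"
        using E' s by (simp add: ennreal_mult[symmetric] ennreal_plus[symmetric] del: ennreal_plus ennreal_numeral)
      finally show ?thesis using True by (simp add: ennreal_mult)
    qed simp
  qed
  also have "\<dots> = 2 * A + ennreal (E' / s) * ennreal (\<delta> powr (1 + 1) / (1 + 1))"
  proof -
    have "(\<integral>\<^sup>+t. ennreal (E' / s) * (indicator {0<..<\<delta>} t * ennreal (t powr 1)) \<partial>lborel) = ennreal (E' / s) * ennreal (\<delta> powr (1 + 1) / (1 + 1))"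
      using nn_integral_powr_Ioo[of 1 \<delta>] \<delta> by (subst nn_integral_cmult) simp_all
    moreover have "(\<integral>\<^sup>+t. 2 * (indicator {0<..<\<delta>} t * ennreal (t powr (1 - 2 * s) * (\<psi> t)\<^sup>2)) \<partial>lborel) = 2 * A"
      unfolding A_def by (rule nn_integral_cmult) measurable
    ultimately show ?thesis by (subst nn_integral_add) auto
  qed
  also have "ennreal (E' / s) * ennreal (\<delta> powr (1 + 1) / (1 + 1)) = ennreal (\<delta>\<^sup>2 / (2 * s)) * E"
    unfolding E' using E' s \<delta> by (simp add: ennreal_mult[symmetric] mult.commute)
  also have "2 * A + ennreal (\<delta>\<^sup>2 / (2 * s)) * E = (\<integral>\<^sup>+t. 2 * (indicator {0<..<\<delta>} t * ennreal (t powr (1 - 2 * s) * (\<psi> t)\<^sup>2))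
     + ennreal (\<delta>\<^sup>2 / (2 * s)) * (indicator {0<..<\<delta>} t * ennreal (t powr (1 - 2 * s) * (\<psi>' t)\<^sup>2)) \<partial>lborel)"
    unfolding A_def E_def by (simp add: nn_integral_add nn_integral_cmult)
  also have "\<dots> = (\<integral>\<^sup>+t. indicator {0<..<\<delta>} t * ennreal (t powr (1 - 2 * s) * (2 * (\<psi> t)\<^sup>2 + \<delta>\<^sup>2 / (2 * s) * (\<psi>' t)\<^sup>2)) \<partial>lborel)"
  proof (rule nn_integral_cong)
    fix t :: real
    have "2 * ennreal (t powr (1 - 2 * s) * (\<psi> t)\<^sup>2) + ennreal (\<delta>\<^sup>2 / (2 * s)) * ennreal (t powr (1 - 2 * s) * (\<psi>' t)\<^sup>2)
      = ennreal (t powr (1 - 2 * s) * (2 * (\<psi> t)\<^sup>2 + \<delta>\<^sup>2 / (2 * s) * (\<psi>' t)\<^sup>2))"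
    proof -
      have e: "ennreal (2 * a + d * b) = 2 * ennreal a + ennreal d * ennreal b" if "0 \<le> a" "0 \<le> b" "0 \<le> d" for a b d
      proof -
        have "ennreal (2 * a + d * b) = ennreal 2 * ennreal a + ennreal d * ennreal b"
          using that by (simp add: ennreal_plus ennreal_mult del: ennreal_numeral)
        then show ?thesis by simp
      qed
      have r: "t powr (1 - 2 * s) * (2 * (\<psi> t)\<^sup>2 + \<delta>\<^sup>2 / (2 * s) * (\<psi>' t)\<^sup>2)
        = 2 * (t powr (1 - 2 * s) * (\<psi> t)\<^sup>2) + \<delta>\<^sup>2 / (2 * s) * (t powr (1 - 2 * s) * (\<psi>' t)\<^sup>2)"
        by (simp add: algebra_simps)
      show ?thesis unfolding r using s by (intro e[symmetric]) auto
    qed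
    then show "2 * (indicator {0<..<\<delta>} t * ennreal (t powr (1 - 2 * s) * (\<psi> t)\<^sup>2))
     + ennreal (\<delta>\<^sup>2 / (2 * s)) * (indicator {0<..<\<delta>} t * ennreal (t powr (1 - 2 * s) * (\<psi>' t)\<^sup>2))
     = indicator {0<..<\<delta>} t * ennreal (t powr (1 - 2 * s) * (2 * (\<psi> t)\<^sup>2 + \<delta>\<^sup>2 / (2 * s) * (\<psi>' t)\<^sup>2))"
      by (cases "t \<in> {0<..<\<delta>}") auto
  qed
  finally show ?thesis .
qed


text \<open>Along the vertical line the normalised point moves on the sphere. Its velocity is P
  times the projection of (0, 1) to the tangent space, so only the tangential part of G
  enters.\<close>

lemma vertical_line_derivative:
  fixes x :: "real^'n" and \<Phi> :: "(real^'n) \<times> real \<Rightarrow> real" and G :: "(real^'n) \<times> real \<Rightarrow> (real^'n) \<times> real"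
  defines "P \<equiv> \<lambda>t. inverse (norm (x, t))"
  assumes x: "x \<noteq> 0" and der: "\<And>X. (\<Phi> has_derivative (\<lambda>h. G X \<bullet> h)) (at X)"
  shows "((\<lambda>t. \<Phi> (P t *\<^sub>R (x, t))) has_real_derivative
    G (P t *\<^sub>R (x, t)) \<bullet> (P t *\<^sub>R ((0, 1) - (t * P t) *\<^sub>R (P t *\<^sub>R (x, t))))) (at t within S)"
proof -
  let ?c = "(norm x)\<^sup>2"
  have c: "?c > 0" using x by simp
  have ct: "?c + t\<^sup>2 > 0" for t by (rule add_pos_nonneg[OF c]) simp
  have P: "P t = inverse (sqrt (?c + t\<^sup>2))" for t by (simp add: P_def norm_Pair)
  have sq: "sqrt (?c + t\<^sup>2) > 0" for t using ct by simp
  have "((\<lambda>t. inverse (sqrt (?c + t\<^sup>2))) has_real_derivative - (t * P t ^ 3)) (at t within S)"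
    unfolding P using ct[of t] sq[of t]
    by (auto intro!: derivative_eq_intros simp: field_simps power2_eq_square power3_eq_cube)
  then have dP: "(P has_vector_derivative - (t * P t ^ 3)) (at t within S)"
    unfolding has_real_derivative_iff_has_vector_derivative P[abs_def] by simp
  have "((\<lambda>t. P t *\<^sub>R (x, t)) has_vector_derivative P t *\<^sub>R (0, 1) + (- (t * P t ^ 3)) *\<^sub>R (x, t)) (at t within S)"
    by (intro has_vector_derivative_scaleR has_vector_derivative_Pair derivative_intros)
       (use dP in \<open>auto simp: has_real_derivative_iff_has_vector_derivative\<close>)
  moreover have "P t *\<^sub>R (0, 1) + (- (t * P t ^ 3)) *\<^sub>R (x, t) = P t *\<^sub>R ((0, 1) - (t * P t) *\<^sub>R (P t *\<^sub>R (x, t)))"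
    by (simp add: algebra_simps power3_eq_cube)
  ultimately have "((\<lambda>t. P t *\<^sub>R (x, t)) has_vector_derivative P t *\<^sub>R ((0, 1) - (t * P t) *\<^sub>R (P t *\<^sub>R (x, t)))) (at t within S)"
    by metis
  then have "((\<lambda>t. \<Phi> (P t *\<^sub>R (x, t))) has_derivative (\<lambda>h. G (P t *\<^sub>R (x, t)) \<bullet> (h *\<^sub>R (P t *\<^sub>R ((0, 1) - (t * P t) *\<^sub>R (P t *\<^sub>R (x, t))))))) (at t within S)"
    unfolding has_vector_derivative_def by (rule has_derivative_compose[OF _ der])
  then show ?thesis
    unfolding has_field_derivative_def by (simp only: inner_scaleR_right mult_commute_abs)
qed

lemma tangential_inner_le:
  fixes \<theta> v D :: "'a::real_inner"
  assumes "norm \<theta> = 1" "norm D = 1"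
  shows "\<bar>v \<bullet> (D - (\<theta> \<bullet> D) *\<^sub>R \<theta>)\<bar> \<le> 2 * norm (v - (v \<bullet> \<theta>) *\<^sub>R \<theta>)"
proof -
  have tt: "\<theta> \<bullet> \<theta> = 1" using assms by (simp add: dot_square_norm)
  have "v \<bullet> (D - (\<theta> \<bullet> D) *\<^sub>R \<theta>) = (v - (v \<bullet> \<theta>) *\<^sub>R \<theta>) \<bullet> (D - (\<theta> \<bullet> D) *\<^sub>R \<theta>)"
    by (simp add: inner_diff_left inner_diff_right tt)
  also have "\<bar>\<dots>\<bar> \<le> norm (v - (v \<bullet> \<theta>) *\<^sub>R \<theta>) * norm (D - (\<theta> \<bullet> D) *\<^sub>R \<theta>)" by (rule Cauchy_Schwarz_ineq2)
  also have "\<dots> \<le> norm (v - (v \<bullet> \<theta>) *\<^sub>R \<theta>) * 2"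
  proof (rule mult_left_mono)
    have "norm (D - (\<theta> \<bullet> D) *\<^sub>R \<theta>) \<le> norm D + norm ((\<theta> \<bullet> D) *\<^sub>R \<theta>)" by (rule norm_triangle_ineq4)
    also have "norm ((\<theta> \<bullet> D) *\<^sub>R \<theta>) \<le> norm \<theta> * norm D" using Cauchy_Schwarz_ineq2[of \<theta> D] assms by simp
    finally show "norm (D - (\<theta> \<bullet> D) *\<^sub>R \<theta>) \<le> 2" using assms by simp
  qed simp
  finally show ?thesis by simp
qed

text \<open>The ranges 1/2 <= |x| < 3/4 and 0 < t < 1/4 keep (x, t) in the half ball and the factor
  P = 1/|(x, t)| between 1 and 2. The constants 4 and 16 absorb the powers of P and the factor 2 of
  \<open>tangential_inner_le\<close>.\<close>

lemma trace_vertical_line: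
  fixes x :: "real^'n" and \<Phi> :: "(real^'n) \<times> real \<Rightarrow> real" and G :: "(real^'n) \<times> real \<Rightarrow> (real^'n) \<times> real"
  defines "T \<equiv> \<lambda>X::(real^'n) \<times> real. X /\<^sub>R norm X"
  assumes s: "0 < s" "s < 1" and \<delta>: "0 < \<delta>" "\<delta> \<le> 1/4" and x: "1/2 \<le> norm x" "norm x < 3/4"
    and der: "\<And>X. (\<Phi> has_derivative (\<lambda>h. G X \<bullet> h)) (at X)" and cont: "continuous_on UNIV G"
  shows "ennreal ((\<Phi> (x /\<^sub>R norm x, 0))\<^sup>2 * (\<delta> powr (2 - 2 * s) / (2 - 2 * s)))
    \<le> (\<integral>\<^sup>+t. indicator hball (x, t) * (ennreal 4 * ennreal (snd (T (x, t)) powr (1 - 2 * s) * (\<Phi> (T (x, t)))\<^sup>2)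
         + ennreal (16 * \<delta>\<^sup>2 / s) * ennreal (snd (T (x, t)) powr (1 - 2 * s) * (norm (G (T (x, t)) - (G (T (x, t)) \<bullet> T (x, t)) *\<^sub>R T (x, t)))\<^sup>2)) \<partial>lborel)"
proof -
  define P where "P t = inverse (norm (x, t))" for t :: real
  have x0: "x \<noteq> 0" using x by auto
  have T: "T (x, t) = P t *\<^sub>R (x, t)" for t by (simp add: T_def P_def)
  define \<psi> where "\<psi> t = \<Phi> (P t *\<^sub>R (x, t))" for t
  define \<psi>' where "\<psi>' t = G (P t *\<^sub>R (x, t)) \<bullet> (P t *\<^sub>R ((0, 1) - (t * P t) *\<^sub>R (P t *\<^sub>R (x, t))))" for t
  have d\<psi>: "(\<psi> has_real_derivative \<psi>' t) (at t within S)" for t S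
    unfolding \<psi>_def[abs_def] \<psi>'_def P_def by (rule vertical_line_derivative[OF x0 der])
  have cP: "continuous_on UNIV P" unfolding P_def[abs_def]
    using x0 by (intro continuous_intros) (auto simp: prod_eq_iff)
  have c\<theta>: "continuous_on UNIV (\<lambda>t. P t *\<^sub>R (x, t))" by (intro continuous_intros cP)
  have c\<psi>': "continuous_on UNIV \<psi>'" unfolding \<psi>'_def[abs_def]
    by (intro continuous_intros cP continuous_on_compose2[OF cont c\<theta>]) auto
  have c\<psi>: "continuous_on UNIV \<psi>" by (intro continuous_at_imp_continuous_on ballI DERIV_isCont[OF d\<psi>])
  have "ennreal ((\<psi> 0)\<^sup>2 * (\<delta> powr (2 - 2 * s) / (2 - 2 * s)))
    \<le> (\<integral>\<^sup>+t. indicator {0<..<\<delta>} t * ennreal (t powr (1 - 2 * s) * (2 * (\<psi> t)\<^sup>2 + \<delta>\<^sup>2 / (2 * s) * (\<psi>' t)\<^sup>2)) \<partial>lborel)"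
    by (intro trace_1d s \<delta> d\<psi> continuous_on_subset[OF c\<psi>'] borel_measurable_continuous_onI c\<psi> c\<psi>') auto
  also have "\<dots> \<le> (\<integral>\<^sup>+t. indicator hball (x, t) * (ennreal 4 * ennreal (snd (T (x, t)) powr (1 - 2 * s) * (\<Phi> (T (x, t)))\<^sup>2)
         + ennreal (16 * \<delta>\<^sup>2 / s) * ennreal (snd (T (x, t)) powr (1 - 2 * s) * (norm (G (T (x, t)) - (G (T (x, t)) \<bullet> T (x, t)) *\<^sub>R T (x, t)))\<^sup>2)) \<partial>lborel)"
  proof (rule nn_integral_mono)
    fix t :: real
    let ?\<theta> = "T (x, t)"
    let ?g = "norm (G ?\<theta> - (G ?\<theta> \<bullet> ?\<theta>) *\<^sub>R ?\<theta>)" and ?w = "snd ?\<theta> powr (1 - 2 * s)"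
    show "indicator {0<..<\<delta>} t * ennreal (t powr (1 - 2 * s) * (2 * (\<psi> t)\<^sup>2 + \<delta>\<^sup>2 / (2 * s) * (\<psi>' t)\<^sup>2))
      \<le> indicator hball (x, t) * (ennreal 4 * ennreal (?w * (\<Phi> ?\<theta>)\<^sup>2) + ennreal (16 * \<delta>\<^sup>2 / s) * ennreal (?w * ?g\<^sup>2))"
    proof (cases "t \<in> {0<..<\<delta>}")
      case True
      then have t: "0 < t" "t < 1/4" using \<delta> by auto
      have nle: "norm (x, t) < 1" using norm_Pair_le[of x t] t x by simp
      have nge: "1/2 \<le> norm (x, t)" using norm_fst_le[where x=x and y=t] x by simp
      then have n0: "norm (x, t) > 0" by linarith
      have P1: "1 \<le> P t" unfolding P_def using nle n0 by (intro one_le_inverse) auto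
      have P2: "P t \<le> 2" unfolding P_def using le_imp_inverse_le[OF nge] by simp
      have n\<theta>: "norm ?\<theta> = 1" unfolding T_def norm_scaleR using left_inverse[OF less_imp_neq[OF n0, symmetric]] n0 by (simp del: zero_less_norm_iff)
      have "t powr (1 - 2 * s) = ?w * P t powr (2 * s - 1)"
      proof -
        have "P t powr (1 - 2 * s) * P t powr (2 * s - 1) = 1" using P1 by (simp add: powr_add[symmetric])
        then show ?thesis using t P1 by (simp add: T powr_mult)
      qed
      also have "P t powr (2 * s - 1) \<le> P t powr 1" using P1 s by (intro powr_mono) auto
      then have "?w * P t powr (2 * s - 1) \<le> ?w * 2" using P1 P2 by (intro mult_left_mono) auto
      finally have w: "t powr (1 - 2 * s) \<le> 2 * ?w" by simp
      have D1: "norm ((0, 1) :: (real^'n) \<times> real) = 1" by (simp add: norm_Pair)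
      have in1: "?\<theta> \<bullet> (0, 1) = t * P t" by (simp add: T inner_Pair)
      have "\<psi>' t = P t * (G ?\<theta> \<bullet> ((0, 1) - (?\<theta> \<bullet> (0, 1)) *\<^sub>R ?\<theta>))" unfolding \<psi>'_def in1 by (simp only: T inner_scaleR_right)
      then have "\<bar>\<psi>' t\<bar> = P t * \<bar>G ?\<theta> \<bullet> ((0, 1) - (?\<theta> \<bullet> (0, 1)) *\<^sub>R ?\<theta>)\<bar>" using P1 by (simp add: abs_mult)
      also have "\<dots> \<le> 2 * (2 * ?g)"
        by (rule mult_mono[OF P2 tangential_inner_le[OF n\<theta> D1]]) auto
      finally have "\<bar>\<psi>' t\<bar>\<^sup>2 \<le> (2 * (2 * ?g))\<^sup>2" by (intro power_mono) auto
      then have \<psi>2: "(\<psi>' t)\<^sup>2 \<le> 16 * ?g\<^sup>2" by (simp add: power_mult_distrib)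
      have "t powr (1 - 2 * s) * (2 * (\<psi> t)\<^sup>2 + \<delta>\<^sup>2 / (2 * s) * (\<psi>' t)\<^sup>2) \<le> (2 * ?w) * (2 * (\<Phi> ?\<theta>)\<^sup>2 + \<delta>\<^sup>2 / (2 * s) * (16 * ?g\<^sup>2))"
        using s \<psi>2 by (intro mult_mono[OF w] add_mono mult_left_mono) (auto simp: \<psi>_def T)
      also have "\<dots> = 4 * (?w * (\<Phi> ?\<theta>)\<^sup>2) + 16 * \<delta>\<^sup>2 / s * (?w * ?g\<^sup>2)" using s by (simp add: field_simps)
      finally have "ennreal (t powr (1 - 2 * s) * (2 * (\<psi> t)\<^sup>2 + \<delta>\<^sup>2 / (2 * s) * (\<psi>' t)\<^sup>2)) \<le> ennreal (4 * (?w * (\<Phi> ?\<theta>)\<^sup>2) + 16 * \<delta>\<^sup>2 / s * (?w * ?g\<^sup>2))"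
        by (rule ennreal_leI)
      also have "\<dots> = ennreal 4 * ennreal (?w * (\<Phi> ?\<theta>)\<^sup>2) + ennreal (16 * \<delta>\<^sup>2 / s) * ennreal (?w * ?g\<^sup>2)"
        using s by (simp add: ennreal_mult[symmetric] ennreal_plus[symmetric] del: ennreal_plus ennreal_numeral)
      finally show ?thesis using True t nle by (simp add: hball_def)
    qed simp
  qed
  also have "\<psi> 0 = \<Phi> (x /\<^sub>R norm x, 0)" using x0 by (simp add: \<psi>_def P_def norm_Pair)
  finally show ?thesis .
qed


text \<open>For s > 1/2 the weight is singular on the equator. Since |X| < 1, normalising X only
  enlarges its height y, so the weight is at most 1 + y^(1-2s), which is integrable because 1 - 2s >
  -1.\<close>

lemma integrable_hball_weight:
  assumes s: "0 < s" "s < 1"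
  shows "integrable lborel (\<lambda>X. indicator hball (X::(real^'n) \<times> real) * snd (X /\<^sub>R norm X) powr (1 - 2 * s))"
proof (rule integrableI_bounded)
  have [measurable]: "(\<lambda>X::(real^'n) \<times> real. snd (X /\<^sub>R norm X)) \<in> borel_measurable borel"
    by (rule borel_measurable_snd_compose) measurable
  have [measurable]: "(snd :: (real^'n) \<times> real \<Rightarrow> real) \<in> borel_measurable borel" by (rule borel_measurable_snd_id)
  have [measurable]: "(fst :: (real^'n) \<times> real \<Rightarrow> real^'n) \<in> borel_measurable borel"
    by (rule borel_measurable_continuous_onI) (rule continuous_on_fst[OF continuous_on_id])
  show "(\<lambda>X. indicator hball (X::(real^'n) \<times> real) * snd (X /\<^sub>R norm X) powr (1 - 2 * s)) \<in> borel_measurable lborel"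
    by measurable
  let ?f = "\<lambda>X::(real^'n) \<times> real. indicator (ball 0 1) (fst X) * (indicator {0<..<1} (snd X) * (1 + ennreal (snd X powr (1 - 2 * s))))"
  have [measurable]: "ball (0::real^'n) 1 \<in> sets borel" by simp
  have "?f \<in> borel_measurable (borel \<Otimes>\<^sub>M borel)" by measurable
  then have mf: "?f \<in> borel_measurable borel" by (simp only: borel_prod)
  have "(\<integral>\<^sup>+X. ennreal (norm (indicator hball (X::(real^'n) \<times> real) * snd (X /\<^sub>R norm X) powr (1 - 2 * s))) \<partial>lborel) \<le> (\<integral>\<^sup>+X. ?f X \<partial>lborel)"
  proof (rule nn_integral_mono)
    fix X :: "(real^'n) \<times> real"
    show "ennreal (norm (indicator hball X * snd (X /\<^sub>R norm X) powr (1 - 2 * s))) \<le> ?f X"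
    proof (cases "X \<in> hball")
      case True
      then have X: "norm X < 1" "snd X > 0" by (auto simp: hball_def)
      have n0: "norm X > 0" by (rule snd_pos_norm[OF X(2)])
      have sX: "snd X < 1" using abs_snd_le[of X] X by linarith
      have fX: "norm (fst X) < 1" using norm_fst_le[where x="fst X" and y="snd X"] X by simp
      have y1: "snd (X /\<^sub>R norm X) \<le> 1" and y2: "snd X \<le> snd (X /\<^sub>R norm X)"
      proof -
        show "snd (X /\<^sub>R norm X) \<le> 1" using abs_snd_le[of X] n0 X by (simp add: field_simps del: zero_less_norm_iff)
        have "snd X * norm X \<le> snd X * 1" using X by (intro mult_left_mono) auto
        then show "snd X \<le> snd (X /\<^sub>R norm X)" using n0 by (simp add: field_simps del: zero_less_norm_iff)
      qed
      have "snd (X /\<^sub>R norm X) powr (1 - 2 * s) \<le> 1 + snd X powr (1 - 2 * s)"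
      proof (cases "0 \<le> 1 - 2 * s")
        case True
        have "snd (X /\<^sub>R norm X) powr (1 - 2 * s) \<le> 1" using True y1 y2 X by (intro powr_le1) auto
        then show ?thesis using powr_ge_zero[of "snd X" "1 - 2 * s"] by linarith
      next
        case False
        have "snd (X /\<^sub>R norm X) powr (1 - 2 * s) \<le> snd X powr (1 - 2 * s)" using False y2 X by (intro powr_mono2') auto
        then show ?thesis by linarith
      qed
      then have "ennreal (snd (X /\<^sub>R norm X) powr (1 - 2 * s)) \<le> ennreal (1 + snd X powr (1 - 2 * s))" by (rule ennreal_leI)
      also have "\<dots> = 1 + ennreal (snd X powr (1 - 2 * s))" by (simp add: ennreal_plus)
      finally show ?thesis using True X sX fX by simp
    qed simp
  qed
  also have "\<dots> = (\<integral>\<^sup>+X. ?f X \<partial>(lborel \<Otimes>\<^sub>M lborel))" by (simp add: lborel_prod)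
  also have "\<dots> = (\<integral>\<^sup>+x. \<integral>\<^sup>+y. ?f (x, y) \<partial>lborel \<partial>lborel)"
    using mf by (intro lborel.nn_integral_fst[symmetric]) (simp add: lborel_prod)
  also have "\<dots> = (\<integral>\<^sup>+x. indicator (ball 0 1) (x::real^'n) * (ennreal 1 + ennreal (1 powr (2 - 2 * s) / (2 - 2 * s))) \<partial>lborel)"
  proof (rule nn_integral_cong)
    fix x :: "real^'n"
    have "(\<integral>\<^sup>+y. ?f (x, y) \<partial>lborel) = indicator (ball 0 1) x * (\<integral>\<^sup>+y. indicator {0<..<1} y * (1 + ennreal (y powr (1 - 2 * s))) \<partial>lborel)"
      by (simp add: nn_integral_cmult)
    also have "(\<integral>\<^sup>+y. indicator {0<..<1} y * (1 + ennreal (y powr (1 - 2 * s))) \<partial>lborel)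
      = (\<integral>\<^sup>+y. indicator {0<..<1::real} y \<partial>lborel) + (\<integral>\<^sup>+y. indicator {0<..<1} y * ennreal (y powr (1 - 2 * s)) \<partial>lborel)"
      unfolding distrib_left mult_1_right by (rule nn_integral_add) measurable
    also have "\<dots> = ennreal 1 + ennreal (1 powr (2 - 2 * s) / (2 - 2 * s))"
      using s nn_integral_powr_Ioo[of "1 - 2 * s" 1] by simp
    finally show "(\<integral>\<^sup>+y. ?f (x, y) \<partial>lborel) = indicator (ball 0 1) x * (ennreal 1 + ennreal (1 powr (2 - 2 * s) / (2 - 2 * s)))" .
  qed
  also have "\<dots> = emeasure lborel (ball (0::real^'n) 1) * (ennreal 1 + ennreal (1 powr (2 - 2 * s) / (2 - 2 * s)))"
    by (subst nn_integral_multc) auto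
  also have "\<dots> < top" using emeasure_bounded_finite[of "ball (0::real^'n) 1"] by (simp add: ennreal_mult_less_top)
  finally show "(\<integral>\<^sup>+X. ennreal (norm (indicator hball (X::(real^'n) \<times> real) * snd (X /\<^sub>R norm X) powr (1 - 2 * s))) \<partial>lborel) < \<infinity>" by simp
qed

lemma integrable_hball_weight_mult:
  fixes h :: "(real^'n) \<times> real \<Rightarrow> real"
  assumes s: "0 < s" "s < 1" and h: "continuous_on UNIV h"
  shows "integrable lborel (\<lambda>X. indicator hball X * (snd (X /\<^sub>R norm X) powr (1 - 2 * s) * h (X /\<^sub>R norm X)))"
proof -
  have "bounded (h ` sphere 0 1)"
    by (intro compact_imp_bounded compact_continuous_image continuous_on_subset[OF h]) auto
  then obtain M where M: "\<forall>y\<in>h ` sphere 0 1. norm y \<le> M" using bounded_iff by blast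
  have [measurable]: "(\<lambda>X::(real^'n) \<times> real. snd (X /\<^sub>R norm X)) \<in> borel_measurable borel"
    by (rule borel_measurable_snd_compose) measurable
  have [measurable]: "(\<lambda>X. h (X /\<^sub>R norm X)) \<in> borel_measurable borel"
    by (rule borel_measurable_continuous_on[OF h]) measurable
  show ?thesis
  proof (rule Bochner_Integration.integrable_bound)
    show "integrable lborel (\<lambda>X. M * (indicator hball (X::(real^'n) \<times> real) * snd (X /\<^sub>R norm X) powr (1 - 2 * s)))"
      by (rule integrable_mult_right[OF integrable_hball_weight[OF s]])
    show "AE X in lborel. norm (indicator hball X * (snd (X /\<^sub>R norm X) powr (1 - 2 * s) * h (X /\<^sub>R norm X)))
      \<le> norm (M * (indicator hball (X::(real^'n) \<times> real) * snd (X /\<^sub>R norm X) powr (1 - 2 * s)))"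
    proof (rule AE_I2)
      fix X :: "(real^'n) \<times> real"
      show "norm (indicator hball X * (snd (X /\<^sub>R norm X) powr (1 - 2 * s) * h (X /\<^sub>R norm X)))
        \<le> norm (M * (indicator hball (X::(real^'n) \<times> real) * snd (X /\<^sub>R norm X) powr (1 - 2 * s)))"
      proof (cases "X \<in> hball")
        case True
        then have "norm X > 0" by (intro snd_pos_norm) (simp add: hball_def)
        then have "norm (X /\<^sub>R norm X) = 1" by simp
        then have "X /\<^sub>R norm X \<in> sphere 0 1" by simp
        then have "norm (h (X /\<^sub>R norm X)) \<le> M" using M by blast
        then have "\<bar>h (X /\<^sub>R norm X)\<bar> \<le> \<bar>M\<bar>" by simp
        then have "snd (X /\<^sub>R norm X) powr (1 - 2 * s) * \<bar>h (X /\<^sub>R norm X)\<bar> \<le> snd (X /\<^sub>R norm X) powr (1 - 2 * s) * \<bar>M\<bar>"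
          by (rule mult_left_mono) simp
        then show ?thesis using True by (simp add: abs_mult mult.commute)
      qed simp
    qed
  qed measurable
qed


text \<open>The trace is controlled by integrating along vertical lines over the annulus
  \<open>1/2 \<le> |x| < 3/4\<close>, after extending \<open>\<Phi>\<close> from the sphere by homogeneity of degree zero.\<close>

lemma trace_half_ball:
  fixes \<Phi> :: "(real^'n) \<times> real \<Rightarrow> real" and G :: "(real^'n) \<times> real \<Rightarrow> (real^'n) \<times> real"
  assumes s: "0 < s" "s < 1" and \<delta>: "0 < \<delta>" "\<delta> \<le> 1/4"
    and der: "\<And>X. (\<Phi> has_derivative (\<lambda>h. G X \<bullet> h)) (at X)" and cont: "continuous_on UNIV G"
  shows "\<delta> powr (2 - 2 * s) / (2 - 2 * s) * (((3/4) ^ CARD('n) - (1/2) ^ CARD('n)) * (\<integral>x. indicator (ball 0 1 - {0}) x * (\<Phi> (x /\<^sub>R norm x, 0))\<^sup>2 \<partial>lborel))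
    \<le> 4 * (\<integral>X. indicator hball X * (snd (X /\<^sub>R norm X) powr (1 - 2 * s) * (\<Phi> (X /\<^sub>R norm X))\<^sup>2) \<partial>lborel)
      + 16 * \<delta>\<^sup>2 / s * (\<integral>X. indicator hball X * (snd (X /\<^sub>R norm X) powr (1 - 2 * s)
         * (norm (G (X /\<^sub>R norm X) - (G (X /\<^sub>R norm X) \<bullet> (X /\<^sub>R norm X)) *\<^sub>R (X /\<^sub>R norm X)))\<^sup>2) \<partial>lborel)"
proof -
  let ?N = "CARD('n)"
  let ?c = "\<delta> powr (2 - 2 * s) / (2 - 2 * s)"
  let ?T = "\<lambda>X::(real^'n) \<times> real. X /\<^sub>R norm X"
  let ?g = "\<lambda>\<theta>. (norm (G \<theta> - (G \<theta> \<bullet> \<theta>) *\<^sub>R \<theta>))\<^sup>2"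
  let ?w = "\<lambda>X. snd (?T X) powr (1 - 2 * s)"
  let ?b = "\<lambda>x::real^'n. (\<Phi> (x /\<^sub>R norm x, 0))\<^sup>2"
  have c\<Phi>: "continuous_on UNIV \<Phi>" using der by (intro continuous_at_imp_continuous_on ballI has_derivative_continuous)
  have cg: "continuous_on UNIV ?g" by (intro continuous_intros cont)
  have c2: "continuous_on UNIV (\<lambda>\<theta>. (\<Phi> \<theta>)\<^sup>2)" by (intro continuous_intros c\<Phi>)
  have [measurable]: "(\<lambda>X. snd (?T X)) \<in> borel_measurable borel" by (rule borel_measurable_snd_compose) measurable
  have [measurable]: "(\<lambda>X. \<Phi> (?T X)) \<in> borel_measurable borel" by (rule borel_measurable_continuous_on[OF c\<Phi>]) measurable
  have [measurable]: "(\<lambda>X. ?g (?T X)) \<in> borel_measurable borel" by (rule borel_measurable_continuous_on[OF cg]) measurable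
  have mb[measurable]: "(\<lambda>x::real^'n. \<Phi> (x /\<^sub>R norm x, 0)) \<in> borel_measurable borel"
    by (rule borel_measurable_continuous_on[OF c\<Phi>]) measurable
  define F where "F X = ennreal 4 * ennreal (?w X * (\<Phi> (?T X))\<^sup>2) + ennreal (16 * \<delta>\<^sup>2 / s) * ennreal (?w X * ?g (?T X))" for X
  have mF: "(\<lambda>X. indicator hball X * F X) \<in> borel_measurable borel" unfolding F_def by measurable
  define I\<Phi> where "I\<Phi> = (\<integral>X. indicator hball X * (?w X * (\<Phi> (?T X))\<^sup>2) \<partial>lborel)"
  define IT where "IT = (\<integral>X. indicator hball X * (?w X * ?g (?T X)) \<partial>lborel)"
  define Ib where "Ib = (\<integral>x. indicator (ball 0 1 - {0}) x * ?b x \<partial>lborel)"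
  have nn\<Phi>: "(\<integral>\<^sup>+X. indicator hball X * ennreal (?w X * (\<Phi> (?T X))\<^sup>2) \<partial>lborel) = ennreal I\<Phi>"
  proof -
    have "(\<integral>\<^sup>+X. ennreal (indicator hball X * (?w X * (\<Phi> (?T X))\<^sup>2)) \<partial>lborel) = ennreal I\<Phi>"
      unfolding I\<Phi>_def by (rule nn_integral_eq_integral[OF integrable_hball_weight_mult[OF s c2]]) simp
    then show ?thesis by (simp add: ennreal_mult' ennreal_indicator)
  qed
  have nnT: "(\<integral>\<^sup>+X. indicator hball X * ennreal (?w X * ?g (?T X)) \<partial>lborel) = ennreal IT"
  proof -
    have "(\<integral>\<^sup>+X. ennreal (indicator hball X * (?w X * ?g (?T X))) \<partial>lborel) = ennreal IT"
      unfolding IT_def by (rule nn_integral_eq_integral[OF integrable_hball_weight_mult[OF s cg]]) simp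
    then show ?thesis by (simp add: ennreal_mult' ennreal_indicator)
  qed
  have nonneg: "I\<Phi> \<ge> 0" "IT \<ge> 0" "Ib \<ge> 0" unfolding I\<Phi>_def IT_def Ib_def by (intro integral_nonneg_AE; simp)+
  have "bounded ((\<lambda>x::real^'n. \<Phi> (x, 0)) ` sphere 0 1)"
    by (intro compact_imp_bounded compact_continuous_image continuous_on_compose2[OF c\<Phi>] continuous_intros) auto
  then obtain M where M: "\<forall>y\<in>(\<lambda>x::real^'n. \<Phi> (x, 0)) ` sphere 0 1. norm y \<le> M" using bounded_iff by blast
  have [measurable]: "ball 0 1 - {0::real^'n} \<in> sets borel" by (intro borel_open open_delete) auto
  have ib: "integrable lborel (\<lambda>x. indicator (ball 0 1 - {0}) x * ?b x)"
  proof (rule Bochner_Integration.integrable_bound)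
    show "integrable lborel (\<lambda>x::real^'n. indicator (ball 0 1) x * M\<^sup>2)"
      using emeasure_bounded_finite[of "ball (0::real^'n) 1"] by (intro integrable_mult_left) auto
    show "AE x::real^'n in lborel. norm (indicator (ball 0 1 - {0}) x * ?b x) \<le> norm (indicator (ball 0 1) x * M\<^sup>2)"
    proof (rule AE_I2)
      fix x :: "real^'n"
      show "norm (indicator (ball 0 1 - {0}) x * ?b x) \<le> norm (indicator (ball 0 1) x * M\<^sup>2)"
      proof (cases "x \<in> ball 0 1 - {0}")
        case True
        then have "x /\<^sub>R norm x \<in> sphere 0 1" by simp
        then have "\<bar>\<Phi> (x /\<^sub>R norm x, 0)\<bar> \<le> M" using M by auto
        then have "\<bar>\<Phi> (x /\<^sub>R norm x, 0)\<bar>\<^sup>2 \<le> M\<^sup>2" by (intro power_mono) auto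
        then show ?thesis using True by simp
      qed simp
    qed
  qed measurable
  define h where "h x = ennreal (?b x)" for x :: "real^'n"
  have mh[measurable]: "h \<in> borel_measurable borel" unfolding h_def by measurable
  have hc: "h (c *\<^sub>R x) = h x" if "c > 0" for c x
  proof -
    have "inverse c * inverse (norm x) * c = inverse (norm x)" using that by (simp add: mult.commute)
    moreover have "(c *\<^sub>R x) /\<^sub>R norm (c *\<^sub>R x) = (inverse c * inverse (norm x) * c) *\<^sub>R x"
      by (simp only: norm_scaleR abs_of_pos[OF that] scaleR_scaleR inverse_mult_distrib)
    ultimately have "(c *\<^sub>R x) /\<^sub>R norm (c *\<^sub>R x) = x /\<^sub>R norm x" by (simp only:)
    then show ?thesis unfolding h_def by (simp only:)
  qed
  have Ib: "(\<integral>\<^sup>+x. indicator (UNIV - {0}) x * h x * indicator {x. norm x < 1} x \<partial>lborel) = ennreal Ib"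
  proof -
    have "(\<integral>\<^sup>+x. ennreal (indicator (ball 0 1 - {0}) x * ?b x) \<partial>lborel) = ennreal Ib"
      unfolding Ib_def by (rule nn_integral_eq_integral[OF ib]) simp
    moreover have "(\<lambda>x. indicator (UNIV - {0}) x * h x * indicator {x. norm x < 1} x) = (\<lambda>x. ennreal (indicator (ball 0 1 - {0}) x * ?b x))"
      by (auto simp: h_def indicator_def)
    ultimately show ?thesis by simp
  qed
  have sc: "(\<integral>\<^sup>+x. indicator (UNIV - {0}) x * h x * indicator {x. norm x < c} x \<partial>lborel) = ennreal (c ^ ?N * Ib)" if "c > 0" for c
    using nn_integral_homogeneous_scale[of h c "UNIV - {0}"] that hc nonneg by (simp add: Ib ennreal_mult)
  define A where "A = {x::real^'n. 1/2 \<le> norm x \<and> norm x < 3/4}"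
  have Am[measurable]: "A \<in> sets borel" unfolding A_def by measurable
  have tq: "(0::real) < 3 / 4" by simp
  \<comment> \<open>The boundary integrand is homogeneous of degree zero, so the annulus carries the
    fraction (3/4)^N - (1/2)^N of its integral over the unit ball.\<close>
  have split: "ennreal ((1/2) ^ ?N * Ib) + (\<integral>\<^sup>+x. indicator A x * h x \<partial>lborel) = ennreal ((3/4) ^ ?N * Ib)"
  proof -
    have "(\<integral>\<^sup>+x. indicator (UNIV - {0}) x * h x * indicator {x. norm x < 1/2} x \<partial>lborel) + (\<integral>\<^sup>+x. indicator A x * h x \<partial>lborel)
      = (\<integral>\<^sup>+x. indicator (UNIV - {0}) x * h x * indicator {x. norm x < 1/2} x + indicator A x * h x \<partial>lborel)"
      by (rule nn_integral_add[symmetric]) measurable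
    also have "(\<lambda>x. indicator (UNIV - {0}) x * h x * indicator {x. norm x < 1/2} x + indicator A x * h x)
      = (\<lambda>x. indicator (UNIV - {0}) x * h x * indicator {x. norm x < 3/4} x)"
      by (auto simp: indicator_def A_def)
    finally show ?thesis using sc[OF half_gt_zero[OF zero_less_one]] sc[OF tq] by (simp only: )
  qed
  have "(\<integral>\<^sup>+x. indicator A x * h x \<partial>lborel) \<noteq> top" using split by (metis ennreal_neq_top ennreal_add_eq_top)
  then obtain J where J: "(\<integral>\<^sup>+x. indicator A x * h x \<partial>lborel) = ennreal J" "J \<ge> 0" by (cases "\<integral>\<^sup>+x. indicator A x * h x \<partial>lborel") auto
  have "ennreal ((1/2) ^ ?N * Ib + J) = ennreal ((3/4) ^ ?N * Ib)" using split J nonneg by simp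
  then have "(1/2) ^ ?N * Ib + J = (3/4) ^ ?N * Ib" using J nonneg by (subst (asm) ennreal_inj) auto
  then have J': "J = ((3/4) ^ ?N - (1/2) ^ ?N) * Ib" by (simp add: algebra_simps)
  have "ennreal (?c * J) = ennreal ?c * (\<integral>\<^sup>+x. indicator A x * h x \<partial>lborel)" using s J by (simp add: ennreal_mult[symmetric])
  also have "\<dots> = (\<integral>\<^sup>+x. ennreal ?c * (indicator A x * h x) \<partial>lborel)" by (rule nn_integral_cmult[symmetric]) measurable
  also have "\<dots> \<le> (\<integral>\<^sup>+x. \<integral>\<^sup>+t. indicator hball (x, t) * F (x, t) \<partial>lborel \<partial>lborel)"
  proof (rule nn_integral_mono)
    fix x :: "real^'n"
    show "ennreal ?c * (indicator A x * h x) \<le> (\<integral>\<^sup>+t. indicator hball (x, t) * F (x, t) \<partial>lborel)"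
    proof (cases "x \<in> A")
      case True
      then have x: "1/2 \<le> norm x" "norm x < 3/4" by (auto simp: A_def)
      have "ennreal ?c * (indicator A x * h x) = ennreal (?b x * ?c)" using True s by (simp add: h_def ennreal_mult[symmetric] mult.commute)
      also have "\<dots> \<le> (\<integral>\<^sup>+t. indicator hball (x, t) * F (x, t) \<partial>lborel)"
        unfolding F_def by (rule trace_vertical_line[OF s \<delta> x der cont])
      finally show ?thesis .
    qed simp
  qed
  also have "\<dots> = (\<integral>\<^sup>+X. indicator hball X * F X \<partial>(lborel \<Otimes>\<^sub>M lborel))"
    using mF by (intro lborel.nn_integral_fst) (simp add: lborel_prod)
  also have "\<dots> = (\<integral>\<^sup>+X. indicator hball X * F X \<partial>lborel)" by (simp add: lborel_prod)
  also have "\<dots> = (\<integral>\<^sup>+X. ennreal 4 * (indicator hball X * ennreal (?w X * (\<Phi> (?T X))\<^sup>2)) + ennreal (16 * \<delta>\<^sup>2 / s) * (indicator hball X * ennreal (?w X * ?g (?T X))) \<partial>lborel)"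
    unfolding F_def by (intro nn_integral_cong) (simp only: distrib_left mult.left_commute)
  also have "\<dots> = ennreal 4 * ennreal I\<Phi> + ennreal (16 * \<delta>\<^sup>2 / s) * ennreal IT"
  proof -
    have a: "(\<integral>\<^sup>+X. ennreal 4 * (indicator hball X * ennreal (?w X * (\<Phi> (?T X))\<^sup>2)) \<partial>lborel) = ennreal 4 * ennreal I\<Phi>"
      unfolding nn\<Phi>[symmetric] by (rule nn_integral_cmult) measurable
    have b: "(\<integral>\<^sup>+X. ennreal (16 * \<delta>\<^sup>2 / s) * (indicator hball X * ennreal (?w X * ?g (?T X))) \<partial>lborel) = ennreal (16 * \<delta>\<^sup>2 / s) * ennreal IT"
      unfolding nnT[symmetric] by (rule nn_integral_cmult) measurable
    show ?thesis unfolding a[symmetric] b[symmetric] by (rule nn_integral_add) measurable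
  qed
  also have "\<dots> = ennreal (4 * I\<Phi> + 16 * \<delta>\<^sup>2 / s * IT)"
    using s nonneg by (simp add: ennreal_mult[symmetric] ennreal_plus[symmetric] del: ennreal_plus ennreal_numeral)
  finally have "?c * J \<le> 4 * I\<Phi> + 16 * \<delta>\<^sup>2 / s * IT"
    using s nonneg by (subst (asm) ennreal_le_iff) (auto intro!: add_nonneg_nonneg)
  then show ?thesis unfolding J' I\<Phi>_def IT_def Ib_def .
qed


section \<open>Boundedness of the Rayleigh quotient and the bound on the exponent\<close>

lemma kappa_s_pos:
  assumes "0 < s" "s < 1"
  shows "kappa_s s > 0"
  using assms unfolding kappa_s_def by (intro divide_pos_pos mult_pos_pos Gamma_real_pos) auto

text \<open>Without a lower bound, the infimum in \<open>mu1\<close> would be an unspecified real number.\<close>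

lemma rayleigh_bdd_below:
  assumes s: "0 < s" "s < 1"
  shows "bdd_below {rayleigh s lam \<Phi> G | (\<Phi> :: (real^'n) \<times> real \<Rightarrow> real) G.
       continuous_on UNIV G \<and> (\<forall>x. (\<Phi> has_derivative (\<lambda>h. G x \<bullet> h)) (at x)) \<and>
       sphere_integral (half_sphere :: ((real^'n) \<times> real) set) (\<lambda>\<theta>. snd \<theta> powr (1 - 2 * s) * (\<Phi> \<theta>)^2) \<noteq> 0}"
proof -
  let ?N = "real CARD('n)"
  define k where "k = (3/4) ^ CARD('n) - (1/2 :: real) ^ CARD('n)"
  have k: "k > 0" unfolding k_def using power_strict_mono[of "1/2::real" "3/4" "CARD('n)"] by simp
  \<comment> \<open>Only a positive \<open>lam\<close> lowers the quotient, hence the maximum with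
    0.\<close>
  define B where "B = kappa_s s * max lam 0 * ?N"
  have B: "B \<ge> 0" unfolding B_def using kappa_s_pos[OF s] by simp
  \<comment> \<open>Chosen so that \<delta>^(2s) <= e yields 16 B \<delta>^2/(s c) <= N + 1, which
    lets the tangential energy absorb the gradient part of the trace estimate. The B + 1 keeps the
    denominator positive when B = 0.\<close>
  define e where "e = k * s * (?N + 1) / (16 * (2 - 2 * s) * (B + 1))"
  have e: "e > 0" unfolding e_def using k s B by (intro divide_pos_pos mult_pos_pos) auto
  define \<delta> where "\<delta> = min (1/4) (e powr (1 / (2 * s)))"
  have \<delta>: "0 < \<delta>" "\<delta> \<le> 1/4" using e by (auto simp: \<delta>_def)
  have \<delta>e: "\<delta> powr (2 * s) \<le> e"
  proof -
    have "\<delta> powr (2 * s) \<le> (e powr (1 / (2 * s))) powr (2 * s)" using \<delta> s by (intro powr_mono2) (auto simp: \<delta>_def)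
    also have "\<dots> = e" using e s by (simp add: powr_powr)
    finally show ?thesis .
  qed
  define c where "c = \<delta> powr (2 - 2 * s) / (2 - 2 * s) * k"
  have c: "c > 0" unfolding c_def using s \<delta> k by (intro mult_pos_pos divide_pos_pos) auto
  define K where "K = B * (4 / c) / (?N + 1)"
  have "?N + 1 \<noteq> 0" by (simp add: add_nonneg_eq_0_iff)
  then have "B * (4 / c) = K * (?N + 1)" unfolding K_def by (rule nonzero_divide_eq_eq[THEN iffD1, OF _ refl])
  then have K: "K * ((?N + 1) * z) = B * (4 / c) * z" for z by (metis mult.assoc)
  have main: "- K \<le> rayleigh s lam \<Phi> G"
    if cont: "continuous_on UNIV G" and der: "\<And>x. (\<Phi> has_derivative (\<lambda>h. G x \<bullet> h)) (at x)"
      and nz: "sphere_integral (half_sphere :: ((real^'n) \<times> real) set) (\<lambda>\<theta>. snd \<theta> powr (1 - 2 * s) * (\<Phi> \<theta>)^2) \<noteq> 0"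
    for \<Phi> :: "(real^'n) \<times> real \<Rightarrow> real" and G
  proof -
    define I\<Phi> where "I\<Phi> = (\<integral>X. indicator hball X * (snd (X /\<^sub>R norm X) powr (1 - 2 * s) * (\<Phi> (X /\<^sub>R norm X))\<^sup>2) \<partial>lborel)"
    define IT where "IT = (\<integral>X. indicator hball X * (snd (X /\<^sub>R norm X) powr (1 - 2 * s)
         * (norm (G (X /\<^sub>R norm X) - (G (X /\<^sub>R norm X) \<bullet> (X /\<^sub>R norm X)) *\<^sub>R (X /\<^sub>R norm X)))\<^sup>2) \<partial>lborel)"
    define Ib where "Ib = (\<integral>x. indicator (ball 0 1 - {0}) x * (\<Phi> (x /\<^sub>R norm (x::real^'n), 0))\<^sup>2 \<partial>lborel)"
    have nonneg: "I\<Phi> \<ge> 0" "IT \<ge> 0" "Ib \<ge> 0" unfolding I\<Phi>_def IT_def Ib_def by (intro integral_nonneg_AE; simp)+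
    have R: "rayleigh s lam \<Phi> G = ((?N + 1) * IT - kappa_s s * lam * (?N * Ib)) / ((?N + 1) * I\<Phi>)"
      unfolding rayleigh_def sphere_integral_half sphere_integral_bd I\<Phi>_def IT_def Ib_def by simp
    have "I\<Phi> \<noteq> 0" using nz unfolding sphere_integral_half I\<Phi>_def by auto
    then have \<Phi>p: "I\<Phi> > 0" using nonneg by simp
    have "\<delta> powr (2 - 2 * s) / (2 - 2 * s) * (k * Ib) \<le> 4 * I\<Phi> + 16 * \<delta>\<^sup>2 / s * IT"
      using trace_half_ball[OF s \<delta> der cont] unfolding I\<Phi>_def IT_def Ib_def k_def .
    then have "c * Ib \<le> 4 * I\<Phi> + 16 * \<delta>\<^sup>2 / s * IT" unfolding c_def by (simp only: mult.assoc)
    then have "Ib \<le> (4 * I\<Phi> + 16 * \<delta>\<^sup>2 / s * IT) / c" using c by (simp add: pos_le_divide_eq mult.commute)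
    then have "B * Ib \<le> B * ((4 * I\<Phi> + 16 * \<delta>\<^sup>2 / s * IT) / c)" using B by (intro mult_left_mono) auto
    also have "\<dots> = K * ((?N + 1) * I\<Phi>) + B * (16 * \<delta>\<^sup>2 / s / c) * IT" unfolding K by (simp add: add_divide_distrib algebra_simps)
    also have "B * (16 * \<delta>\<^sup>2 / s / c) \<le> ?N + 1"
    proof -
      have d2: "\<delta>\<^sup>2 = \<delta> powr (2 - 2 * s) * \<delta> powr (2 * s)" using \<delta> by (simp add: powr_add[symmetric] powr_numeral)
      have "16 * \<delta>\<^sup>2 / s / c = 16 * (2 - 2 * s) / (s * k) * \<delta> powr (2 * s)"
        using s k \<delta> unfolding c_def d2 by (simp add: field_simps)
      also have "\<dots> \<le> 16 * (2 - 2 * s) / (s * k) * e" using s k \<delta>e by (intro mult_left_mono) auto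
      also have "\<dots> = (?N + 1) / (B + 1)"
      proof -
        define q p n where "q = 2 - 2 * s" and "p = B + 1" and "n = ?N + 1"
        have "q > 0" "p > 0" using s B by (auto simp: q_def p_def)
        then show ?thesis unfolding e_def q_def[symmetric] p_def[symmetric] n_def[symmetric] using s k by (simp add: field_simps)
      qed
      finally have "B * (16 * \<delta>\<^sup>2 / s / c) \<le> B * ((?N + 1) / (B + 1))" using B by (intro mult_left_mono) auto
      also have "\<dots> = (B / (B + 1)) * (?N + 1)" by simp
      also have "\<dots> \<le> 1 * (?N + 1)" using B by (intro mult_right_mono) auto
      finally show ?thesis by simp
    qed
    then have "K * ((?N + 1) * I\<Phi>) + B * (16 * \<delta>\<^sup>2 / s / c) * IT \<le> K * ((?N + 1) * I\<Phi>) + (?N + 1) * IT"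
      using nonneg by (intro add_left_mono mult_right_mono) auto
    finally have 1: "B * Ib \<le> K * ((?N + 1) * I\<Phi>) + (?N + 1) * IT" .
    have "kappa_s s * lam * ?N * Ib \<le> B * Ib"
      unfolding B_def using kappa_s_pos[OF s] nonneg by (intro mult_right_mono mult_left_mono) auto
    then have "- K * ((?N + 1) * I\<Phi>) \<le> (?N + 1) * IT - kappa_s s * lam * (?N * Ib)" using 1 by (simp add: mult.assoc)
    then show ?thesis unfolding R using \<Phi>p by (subst pos_le_divide_eq) auto
  qed
  show ?thesis by (rule bdd_belowI[of _ "- K"]) (use main in auto)
qed

lemma mu1_le_rayleigh:
  fixes \<Phi> :: "(real^'n) \<times> real \<Rightarrow> real"
  assumes "0 < s" "s < 1" "continuous_on UNIV G" "\<And>x. (\<Phi> has_derivative (\<lambda>h. G x \<bullet> h)) (at x)"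
    "sphere_integral (half_sphere :: ((real^'n) \<times> real) set) (\<lambda>\<theta>. snd \<theta> powr (1 - 2 * s) * (\<Phi> \<theta>)^2) \<noteq> 0"
  shows "mu1 TYPE('n) s lam \<le> rayleigh s lam \<Phi> G"
  unfolding mu1_def by (rule cInf_lower[OF _ rayleigh_bdd_below]) (use assms in blast)+

text \<open>With h = (N - 2s)/2, \<gamma> < g follows from \<mu>_1 < g^2 + 2 h g, because (g + h)^2
  = h^2 + g^2 + 2 h g. The required upper bounds on \<mu>_1 are Rayleigh quotients of the two test
  functions.\<close>

lemma gamma_lam_less:
  assumes s: "0 < s" "s < real CARD('n::finite) / 2" "s < 1" and g: "2 * s < g" "lam \<le> 0 \<Longrightarrow> 2 \<le> g"
  shows "gamma_lam TYPE('n) s lam < g"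
proof -
  let ?N = "real CARD('n)" and ?\<mu> = "mu1 TYPE('n) s lam"
  define h where "h = (?N - 2 * s) / 2"
  have h: "h > 0" using s by (simp add: h_def)
  have key: "gamma_lam TYPE('n) s lam < g" if "?\<mu> < g\<^sup>2 + 2 * h * g"
  proof -
    have "h\<^sup>2 + ?\<mu> < (g + h)\<^sup>2" using that by (simp add: power2_eq_square algebra_simps)
    \<comment> \<open>\<open>sqrt\<close> is extended as an odd function and is strictly increasing
      on all reals, so an argument of either sign is covered.\<close>
    then have "sqrt (h\<^sup>2 + ?\<mu>) < sqrt ((g + h)\<^sup>2)" by (rule real_sqrt_less_mono)
    also have "\<dots> = g + h" using g s h by simp
    finally show ?thesis unfolding gamma_lam_def h_def by (simp add: field_simps)
  qed
  show ?thesis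
  proof (cases "lam \<le> 0")
    case True
    have D: "((\<lambda>X::(real^'n) \<times> real. (snd X)\<^sup>2) has_derivative (\<lambda>h. (0, 2 * snd x) \<bullet> h)) (at x)" for x
      by (auto intro!: derivative_eq_intros simp: inner_Pair_0 inner_prod_def)
    have "?\<mu> \<le> rayleigh s lam (\<lambda>X::(real^'n) \<times> real. (snd X)\<^sup>2) (\<lambda>X. (0, 2 * snd X))"
      using s rayleigh_sq(2)[OF s(1,3), where 'n='n] by (intro mu1_le_rayleigh D) (auto intro!: continuous_intros)
    also have "\<dots> = 4 * ?N / (4 - 2 * s)" by (rule rayleigh_sq(1)[OF s(1,3)])
    also have "\<dots> < 4 + 4 * h"
    proof -
      \<comment> \<open>Clearing the denominator leaves a sum of terms that are positive for s < 1
        and 2s < N.\<close>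
      have "(4 + 4 * h) * (4 - 2 * s) - 4 * ?N = (?N - 2 * s) * (4 * (1 - s)) + 8 * (1 - s) + 8 * (1 - s)"
        unfolding h_def by (simp add: field_simps)
      moreover have "\<dots> > 0" using s by (intro add_pos_pos mult_pos_pos) auto
      ultimately show ?thesis using s by (simp add: pos_divide_less_eq)
    qed
    also have "\<dots> \<le> g\<^sup>2 + 2 * h * g"
    proof -
      have "2 \<le> g" using g True by simp
      then have "4 \<le> g\<^sup>2" "2 * h * 2 \<le> 2 * h * g" using h power_mono[of 2 g 2] by (simp, intro mult_left_mono) auto
      from add_mono[OF this] show ?thesis by simp
    qed
    finally show ?thesis by (rule key)
  next
    case False
    have nz: "sphere_integral (half_sphere :: ((real^'n) \<times> real) set) (\<lambda>\<theta>. snd \<theta> powr (1 - 2 * s) * 1\<^sup>2) \<noteq> 0"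
      using hball_integral_pos[OF integrable_hball_weight[OF s(1,3)]] snd_normalized_pos
      unfolding sphere_integral_half by (fastforce simp: less_le)
    have "?\<mu> \<le> rayleigh s lam (\<lambda>X::(real^'n) \<times> real. 1) (\<lambda>X. 0)"
      using s nz by (intro mu1_le_rayleigh) (auto intro!: continuous_intros)
    also have "\<dots> \<le> 0"
      unfolding rayleigh_def sphere_integral_half sphere_integral_bd using kappa_s_pos[OF s(1,3)] False
      by (auto intro!: divide_nonpos_nonneg mult_nonneg_nonneg integral_nonneg_AE)
    also have "0 < g\<^sup>2 + 2 * h * g" using h g s by (intro add_pos_pos mult_pos_pos) auto
    finally show ?thesis by (rule key)
  qed
qed

section \<open>Positivity by dilation\<close>

lemma borel_measurable_ffun:
  fixes e :: "'a::euclidean_space"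
  assumes [measurable]: "G \<in> borel_measurable borel"
  shows "ffun s G e \<in> borel_measurable borel"
  unfolding ffun_def[abs_def] Gbr_def by measurable

context profile
begin

lemma G_eq: "0 \<le> \<sigma> \<Longrightarrow> G \<sigma> = \<sigma> powr (g / 2) - U \<sigma>"
  using U_eq[of \<sigma>] by simp

lemma uf_low: "norm x \<le> 3 \<Longrightarrow> uf x = norm x powr g"
  unfolding uf_def using U_low[of "(norm x)\<^sup>2"] power_mono[of "norm x" 3 2] by (simp add: square_powr)

lemma continuous_on_uf: "continuous_on UNIV (uf :: 'a::euclidean_space \<Rightarrow> real)"
proof -
  have "continuous_on UNIV (\<lambda>y::'a. norm y powr g - D 0 ((norm y)\<^sup>2))"
    using s g by (intro continuous_on_diff continuous_on_powr' continuous_on_compose2[OF D_cont[of UNIV 0]] continuous_intros) auto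
  moreover have "(uf :: 'a \<Rightarrow> real) = (\<lambda>y. norm y powr g - D 0 ((norm y)\<^sup>2))" by (rule ext) (simp add: uf_eq D_0)
  ultimately show ?thesis by simp
qed

text \<open>The dilation L^g u(x/L), written in terms of \<sigma> = |x|^2; it fixes the pure power
  and enlarges the region where u equals it.\<close>

definition UL :: "real \<Rightarrow> real \<Rightarrow> real" where "UL L \<sigma> = L powr g * U (\<sigma> / L\<^sup>2)"

lemma profile_UL:
  assumes L: "1 \<le> L"
  shows "profile s g (b * L\<^sup>2) (UL L)"
proof
  have L2: "1 \<le> L\<^sup>2" using L by simp
  have "9 * 1 \<le> 9 * L\<^sup>2" using L2 by simp
  also have "\<dots> < b * L\<^sup>2" using L b by simp
  finally show "9 < b * L\<^sup>2" by simp
  show "smooth_all {0<..} (UL L)"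
    unfolding smooth_all_def
  proof
    fix k
    have "smooth_n k {0<..} (\<lambda>x. U ((1 / L\<^sup>2) * x + 0))"
      by (rule smooth_n_compose_affine[where S="{0<..}"]) (use U_smooth L in \<open>auto simp: smooth_all_def\<close>)
    from smooth_n_cmult[OF this, of "L powr g"] show "smooth_n k {0<..} (UL L)"
      by (rule smooth_n_cong[rotated 2]) (auto simp: UL_def)
  qed
  show "UL L \<sigma> = \<sigma> powr (g / 2)" if "0 \<le> \<sigma>" "\<sigma> \<le> 9" for \<sigma>
  proof -
    have "\<sigma> * 1 \<le> 9 * L\<^sup>2" using that L2 by (intro mult_mono) auto
    then have "\<sigma> / L\<^sup>2 \<le> 9" using L by (simp add: pos_divide_le_eq)
    then have "U (\<sigma> / L\<^sup>2) = (\<sigma> / L\<^sup>2) powr (g / 2)" using that by (intro U_low) auto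
    also have "\<dots> = \<sigma> powr (g / 2) / L powr g" using that L by (simp add: powr_divide square_powr)
    finally show ?thesis using L by (simp add: UL_def)
  qed
  show "UL L \<sigma> = 0" if "b * L\<^sup>2 \<le> \<sigma>" for \<sigma>
    using U_high[of "\<sigma> / L\<^sup>2"] that L by (simp add: UL_def pos_le_divide_eq)
qed (use s g in auto)

lemma moment_UL:
  assumes L: "1 \<le> L" and m0: "(\<integral>y. U ((norm (y::real^'n))\<^sup>2) * norm y powr (- (real CARD('n) + 2 * s)) \<partial>lborel) = 0"
  shows "(\<integral>y. UL L ((norm (y::real^'n))\<^sup>2) * norm y powr (- (real CARD('n) + 2 * s)) \<partial>lborel) = 0"
proof -
  let ?p = "real CARD('n) + 2 * s"
  interpret PL: profile s g "b * L\<^sup>2" "UL L" by (rule profile_UL[OF L])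
  have "(\<lambda>y::real^'n. UL L ((norm (L *\<^sub>R y))\<^sup>2) * norm (L *\<^sub>R y) powr (- ?p))
    = (\<lambda>y. (L powr g * L powr (- ?p)) * (U ((norm y)\<^sup>2) * norm y powr (- ?p)))"
    using L by (intro ext) (simp add: UL_def power_mult_distrib powr_mult)
  then show ?thesis using L m0
    by (subst integral_scale[of L]) simp_all
qed

text \<open>Substitution of L z for z. For large L the interval (0, 1) sees only the values of the
  original f near 0, where its expansion decides the sign.\<close>

lemma ffun_UL:
  fixes e :: "real^'n"
  assumes L: "1 \<le> L" and e: "norm e = 1"
  shows "ffun s (profile.G g (UL L)) e r = L powr (g - 2 * s) * ffun s G e (r / L)"
proof -
  let ?p = "real CARD('n) + 2 * s"
  interpret PL: profile s g "b * L\<^sup>2" "UL L" by (rule profile_UL[OF L])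
  have GL: "PL.G (L\<^sup>2 * \<sigma>) = L powr g * G \<sigma>" if "0 \<le> \<sigma>" for \<sigma>
    using that L by (simp add: PL.G_eq G_eq UL_def powr_mult square_powr algebra_simps)
  have br: "Gbr PL.G e r (L *\<^sub>R z) = L powr g * Gbr G e (r / L) z" for z
  proof -
    have a: "(norm (L *\<^sub>R z))\<^sup>2 + 2 * r * (e \<bullet> (L *\<^sub>R z)) + r\<^sup>2 = L\<^sup>2 * ((norm z)\<^sup>2 + 2 * (r / L) * (e \<bullet> z) + (r / L)\<^sup>2)"
      "(norm (L *\<^sub>R z))\<^sup>2 - 2 * r * (e \<bullet> (L *\<^sub>R z)) + r\<^sup>2 = L\<^sup>2 * ((norm z)\<^sup>2 - 2 * (r / L) * (e \<bullet> z) + (r / L)\<^sup>2)"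
      "(norm (L *\<^sub>R z))\<^sup>2 = L\<^sup>2 * (norm z)\<^sup>2"
      using L by (auto simp: field_simps power2_eq_square)
    have n: "(norm z)\<^sup>2 + 2 * t * (e \<bullet> z) + t\<^sup>2 \<ge> 0" for t
    proof -
      have "(norm (z + t *\<^sub>R e))\<^sup>2 = (norm z)\<^sup>2 + 2 * t * (e \<bullet> z) + t\<^sup>2 * (e \<bullet> e)"
        unfolding power2_norm_eq_inner by (simp add: inner_add_left inner_add_right inner_commute power2_eq_square algebra_simps)
      moreover have "e \<bullet> e = 1" using e by (simp add: dot_square_norm)
      ultimately show ?thesis by (metis mult.right_neutral zero_le_power2)
    qed
    have n': "(norm z)\<^sup>2 - 2 * t * (e \<bullet> z) + t\<^sup>2 \<ge> 0" for t using n[of "- t"] by simp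
    show ?thesis unfolding Gbr_def a(1) a(2) unfolding a(3) GL[OF n] GL[OF n'] GL[OF zero_le_power2] by (simp add: algebra_simps add_divide_distrib)
  qed
  have L0: "L > 0" using L by simp
  have m: "(\<lambda>z::real^'n. Gbr PL.G e r z * norm z powr (- ?p)) \<in> borel_measurable borel"
    unfolding Gbr_def by measurable
  have "ffun s PL.G e r = (\<integral>z. Gbr PL.G e r z * norm z powr (- ?p) \<partial>lborel)" by (simp add: ffun_def)
  also have "\<dots> = L ^ CARD('n) * (\<integral>z. Gbr PL.G e r (L *\<^sub>R z) * norm (L *\<^sub>R z) powr (- ?p) \<partial>lborel)"
    using integral_scale[OF L0 m] by (simp only: DIM_cart DIM_real mult_1_right)
  also have "(\<lambda>z. Gbr PL.G e r (L *\<^sub>R z) * norm (L *\<^sub>R z) powr (- ?p)) = (\<lambda>z. (L powr g * L powr (- ?p)) * (Gbr G e (r / L) z * norm z powr (- ?p)))"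
    using L by (intro ext) (simp add: br powr_mult)
  also have "(\<integral>z. (L powr g * L powr (- ?p)) * (Gbr G e (r / L) z * norm z powr (- ?p)) \<partial>lborel) = L powr g * L powr (- ?p) * ffun s G e (r / L)"
    by (simp add: ffun_def)
  also have "L ^ CARD('n) * (L powr g * L powr (- ?p) * ffun s G e (r / L)) = L powr (g - 2 * s) * ffun s G e (r / L)"
  proof -
    have "L ^ CARD('n) * (L powr g * L powr (- ?p)) = L powr (real CARD('n) + (g + - ?p))"
      using L by (simp only: powr_add) (simp add: powr_realpow)
    then show ?thesis by (simp add: mult.assoc[symmetric])
  qed
  finally show ?thesis .
qed

end

theorem exists_positive_profile:
  fixes e :: "real^'n" and s g :: real
  assumes s: "0 < s" "s < 1" and g: "2 * s < g" "g < 2 * s + 2" and e: "norm e = 1"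
  obtains U L K where "L \<ge> 1" "profile s g (16 * L\<^sup>2) U"
    "(\<integral>y. U ((norm (y::real^'n))\<^sup>2) * norm y powr (- (real CARD('n) + 2 * s)) \<partial>lborel) = 0"
    "\<And>r. 0 < r \<Longrightarrow> r < 1 \<Longrightarrow> 0 < ffun s (profile.G g U) e r"
    "\<And>r. 0 \<le> r \<Longrightarrow> r \<le> 1 \<Longrightarrow> \<bar>ffun s (profile.G g U) e r\<bar> \<le> K * r^4"
    "\<And>c d. 0 \<le> c \<Longrightarrow> c < d \<Longrightarrow> d \<le> 16 * L\<^sup>2 \<Longrightarrow> \<exists>\<sigma>. c < \<sigma> \<and> \<sigma> < d \<and> U \<sigma> \<noteq> 0"
proof -
  obtain U \<theta> K where P: "profile s g 16 U"
    and m0: "(\<integral>y. U ((norm (y::real^'n))\<^sup>2) * norm y powr (- (real CARD('n) + 2 * s)) \<partial>lborel) = 0"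
    and \<theta>: "\<theta> > 0" and K: "\<And>r. 0 \<le> r \<Longrightarrow> r \<le> 1 \<Longrightarrow> \<bar>ffun s (profile.G g U) e r - \<theta> * r^4\<bar> \<le> K * r^5"
    and nv: "\<And>c d. 0 \<le> c \<Longrightarrow> c < d \<Longrightarrow> d \<le> 16 \<Longrightarrow> \<exists>\<sigma>. c < \<sigma> \<and> \<sigma> < d \<and> U \<sigma> \<noteq> 0"
    by (rule exists_profile[OF s g e]) blast
  interpret profile s g 16 U by (rule P)
  have K0: "K \<ge> 0" using K[of 1] by simp
  \<comment> \<open>Then K/L < \<theta>, so that at r/L with r < 1 the term of order four exceeds
    the remainder.\<close>
  define L where "L = 1 + K / \<theta>"
  have L: "L \<ge> 1" using K0 \<theta> by (simp add: L_def)
  show ?thesis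
  proof (rule that[of L "UL L" "L powr (g - 2 * s) * (\<theta> + K)"])
    show "L \<ge> 1" by (rule L)
    show "profile s g (16 * L\<^sup>2) (UL L)" by (rule profile_UL[OF L])
    show "(\<integral>y. UL L ((norm (y::real^'n))\<^sup>2) * norm y powr (- (real CARD('n) + 2 * s)) \<partial>lborel) = 0" by (rule moment_UL[OF L m0])
    have rL: "r / L \<le> r" if "0 \<le> r" for r using that L by (simp add: divide_le_eq mult_le_cancel_left1)
    show "0 < ffun s (profile.G g (UL L)) e r" if r: "0 < r" "r < 1" for r
    proof -
      let ?t = "r / L"
      have t: "0 < ?t" "?t \<le> 1" using r L rL[of r] by auto
      have "K * ?t < \<theta>"
      proof -
        have "K * r \<le> K * 1" using K0 r by (intro mult_left_mono) auto
        also have "\<dots> < \<theta> * L" using \<theta> by (simp add: L_def field_simps)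
        finally show ?thesis using L by (simp add: pos_divide_less_eq)
      qed
      then have "K * ?t * ?t^4 < \<theta> * ?t^4" using t by (intro mult_strict_right_mono) auto
      then have "K * ?t^5 < \<theta> * ?t^4" by (simp add: power_numeral_reduce mult.assoc)
      then have "ffun s G e ?t > 0" using K[of ?t] t by linarith
      then show ?thesis unfolding ffun_UL[OF L e] using L by simp
    qed
    show "\<bar>ffun s (profile.G g (UL L)) e r\<bar> \<le> L powr (g - 2 * s) * (\<theta> + K) * r^4" if r: "0 \<le> r" "r \<le> 1" for r
    proof -
      let ?t = "r / L"
      have t: "0 \<le> ?t" "?t \<le> 1" "?t \<le> r" using r L rL[of r] by auto
      have "?t^5 \<le> ?t^4" using t by (intro power_decreasing) auto
      then have "K * ?t^5 \<le> K * ?t^4" using K0 by (intro mult_left_mono)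
      then have "\<bar>ffun s G e ?t\<bar> \<le> \<theta> * ?t^4 + K * ?t^4" using K[of ?t] t \<theta> by (smt (verit) mult_nonneg_nonneg zero_le_power)
      also have "\<dots> = (\<theta> + K) * ?t^4" by (simp add: algebra_simps)
      also have "\<dots> \<le> (\<theta> + K) * r^4" using t \<theta> K0 by (intro mult_left_mono power_mono) auto
      finally have "L powr (g - 2 * s) * \<bar>ffun s G e ?t\<bar> \<le> L powr (g - 2 * s) * ((\<theta> + K) * r^4)" by (intro mult_left_mono) auto
      then show ?thesis unfolding ffun_UL[OF L e] by (simp add: abs_mult mult.assoc)
    qed
    show "\<exists>\<sigma>. c < \<sigma> \<and> \<sigma> < d \<and> UL L \<sigma> \<noteq> 0" if cd: "0 \<le> c" "c < d" "d \<le> 16 * L\<^sup>2" for c d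
    proof -
      have L2: "L\<^sup>2 > 0" using L by simp
      obtain \<sigma> where "c / L\<^sup>2 < \<sigma>" "\<sigma> < d / L\<^sup>2" "U \<sigma> \<noteq> 0"
        using nv[of "c / L\<^sup>2" "d / L\<^sup>2"] cd L2 by (auto simp: divide_strict_right_mono pos_divide_le_eq)
      then show ?thesis using L L2 by (intro exI[of _ "L\<^sup>2 * \<sigma>"]) (auto simp: UL_def pos_divide_less_eq pos_less_divide_eq mult.commute)
    qed
  qed
qed

text \<open>Boundedness is included because it makes the class closed under products.\<close>

definition lip_bd :: "'a::real_normed_vector set \<Rightarrow> ('a \<Rightarrow> 'b::real_normed_vector) \<Rightarrow> bool" where
  "lip_bd S f \<longleftrightarrow> (\<exists>K\<ge>0. \<forall>x\<in>S. norm (f x) \<le> K \<and> (\<forall>y\<in>S. norm (f x - f y) \<le> K * norm (x - y)))"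

lemma lip_bdI:
  assumes "\<And>x. x \<in> S \<Longrightarrow> norm (f x) \<le> A" "\<And>x y. x \<in> S \<Longrightarrow> y \<in> S \<Longrightarrow> norm (f x - f y) \<le> B * norm (x - y)"
  shows "lip_bd S f"
  unfolding lip_bd_def
proof (intro exI[of _ "\<bar>A\<bar> + \<bar>B\<bar>"] conjI ballI)
  fix x assume x: "x \<in> S"
  show "norm (f x) \<le> \<bar>A\<bar> + \<bar>B\<bar>" using assms(1)[OF x] by linarith
  fix y assume y: "y \<in> S"
  have "B * norm (x - y) \<le> (\<bar>A\<bar> + \<bar>B\<bar>) * norm (x - y)" by (intro mult_right_mono) auto
  then show "norm (f x - f y) \<le> (\<bar>A\<bar> + \<bar>B\<bar>) * norm (x - y)" using assms(2)[OF x y] by linarith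
qed auto

lemma lip_bd_scaleR:
  fixes f :: "'a::real_normed_vector \<Rightarrow> real" and h :: "'a \<Rightarrow> 'b::real_normed_vector"
  assumes "lip_bd S f" "lip_bd S h"
  shows "lip_bd S (\<lambda>x. f x *\<^sub>R h x)"
proof -
  obtain K where K: "K \<ge> 0" "\<And>x. x \<in> S \<Longrightarrow> norm (f x) \<le> K" "\<And>x y. x \<in> S \<Longrightarrow> y \<in> S \<Longrightarrow> norm (f x - f y) \<le> K * norm (x - y)"
    using assms(1) unfolding lip_bd_def by blast
  obtain M where M: "M \<ge> 0" "\<And>x. x \<in> S \<Longrightarrow> norm (h x) \<le> M" "\<And>x y. x \<in> S \<Longrightarrow> y \<in> S \<Longrightarrow> norm (h x - h y) \<le> M * norm (x - y)"
    using assms(2) unfolding lip_bd_def by blast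
  show ?thesis
  proof (rule lip_bdI[where A = "K * M" and B = "2 * K * M"])
    show "norm (f x *\<^sub>R h x) \<le> K * M" if "x \<in> S" for x
      using K(2)[OF that] M(2)[OF that] K(1) by (simp add: mult_mono)
    show "norm (f x *\<^sub>R h x - f y *\<^sub>R h y) \<le> 2 * K * M * norm (x - y)" if x: "x \<in> S" and y: "y \<in> S" for x y
    proof -
      have "f x *\<^sub>R h x - f y *\<^sub>R h y = f x *\<^sub>R (h x - h y) + (f x - f y) *\<^sub>R h y" by (simp add: algebra_simps)
      then have "norm (f x *\<^sub>R h x - f y *\<^sub>R h y) \<le> norm (f x) * norm (h x - h y) + norm (f x - f y) * norm (h y)"
        by (metis norm_triangle_ineq norm_scaleR real_norm_def)
      also have "\<dots> \<le> K * (M * norm (x - y)) + (K * norm (x - y)) * M"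
        using K(1) M(1) K(2)[OF x] M(3)[OF x y] K(3)[OF x y] M(2)[OF y] by (intro add_mono mult_mono) auto
      finally show ?thesis by (simp add: algebra_simps)
    qed
  qed
qed

lemma lip_bd_diff:
  assumes "lip_bd S f" "lip_bd S h"
  shows "lip_bd S (\<lambda>x. f x - h x)"
proof -
  obtain K where K: "K \<ge> 0" "\<And>x. x \<in> S \<Longrightarrow> norm (f x) \<le> K" "\<And>x y. x \<in> S \<Longrightarrow> y \<in> S \<Longrightarrow> norm (f x - f y) \<le> K * norm (x - y)"
    using assms(1) unfolding lip_bd_def by blast
  obtain M where M: "M \<ge> 0" "\<And>x. x \<in> S \<Longrightarrow> norm (h x) \<le> M" "\<And>x y. x \<in> S \<Longrightarrow> y \<in> S \<Longrightarrow> norm (h x - h y) \<le> M * norm (x - y)"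
    using assms(2) unfolding lip_bd_def by blast
  show ?thesis
  proof (rule lip_bdI[where A = "K + M" and B = "K + M"])
    show "norm (f x - h x) \<le> K + M" if "x \<in> S" for x
      using K(2)[OF that] M(2)[OF that] norm_triangle_ineq4[of "f x" "h x"] by linarith
    show "norm (f x - h x - (f y - h y)) \<le> (K + M) * norm (x - y)" if x: "x \<in> S" and y: "y \<in> S" for x y
      using K(3)[OF x y] M(3)[OF x y] norm_triangle_ineq4[of "f x - f y" "h x - h y"]
      by (simp add: algebra_simps)
  qed
qed

lemma lip_bd_const: "lip_bd S (\<lambda>x. c)"
  by (rule lip_bdI[where A = "norm c" and B = 0]) auto

lemma lip_bd_C1:
  fixes f :: "real \<Rightarrow> real"
  assumes "\<And>x. x \<in> {a..b} \<Longrightarrow> (f has_real_derivative f' x) (at x)" "continuous_on {a..b} f'"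
  shows "lip_bd {a..b} f"
proof -
  have "bounded (f' ` {a..b})" by (intro compact_imp_bounded compact_continuous_image assms) auto
  then obtain B where B: "\<forall>y\<in>f' ` {a..b}. norm y \<le> B" using bounded_iff by blast
  have "continuous_on {a..b} f" by (intro continuous_at_imp_continuous_on ballI DERIV_isCont[OF assms(1)])
  then have "bounded (f ` {a..b})" by (intro compact_imp_bounded compact_continuous_image) auto
  then obtain A where A: "\<forall>y\<in>f ` {a..b}. norm y \<le> A" using bounded_iff by blast
  show ?thesis
  proof (rule lip_bdI[where A = A and B = B])
    show "norm (f x - f y) \<le> B * norm (x - y)" if "x \<in> {a..b}" "y \<in> {a..b}" for x y
    proof (rule field_differentiable_bound[of "{a..b}" f f' B x y])
      show "(f has_real_derivative f' z) (at z within {a..b})" if "z \<in> {a..b}" for z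
        by (rule has_field_derivative_at_within[OF assms(1)[OF that]])
      show "norm (f' z) \<le> B" if "z \<in> {a..b}" for z using B that by blast
    qed (use that in auto)
  qed (use A in auto)
qed

lemma lip_bd_compose_norm:
  fixes f :: "real \<Rightarrow> 'b::real_normed_vector"
  assumes "lip_bd {a..b} f" "\<And>x. x \<in> S \<Longrightarrow> a \<le> norm x \<and> norm x \<le> b"
  shows "lip_bd S (\<lambda>x. f (norm x))"
proof -
  obtain K where K: "K \<ge> 0" "\<And>x. x \<in> {a..b} \<Longrightarrow> norm (f x) \<le> K" "\<And>x y. x \<in> {a..b} \<Longrightarrow> y \<in> {a..b} \<Longrightarrow> norm (f x - f y) \<le> K * norm (x - y)"
    using assms(1) unfolding lip_bd_def by blast
  show ?thesis
  proof (rule lip_bdI[where A = K and B = K])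
    show "norm (f (norm x)) \<le> K" if "x \<in> S" for x using assms(2)[OF that] by (intro K) auto
    show "norm (f (norm x) - f (norm y)) \<le> K * norm (x - y)" if x: "x \<in> S" and y: "y \<in> S" for x y
    proof -
      have "norm (f (norm x) - f (norm y)) \<le> K * norm (norm x - norm y)" using assms(2)[OF x] assms(2)[OF y] by (intro K) auto
      also have "\<dots> \<le> K * norm (x - y)" using K(1) norm_triangle_ineq3[of x y] by (intro mult_left_mono) auto
      finally show ?thesis .
    qed
  qed
qed

section \<open>The potential and the solution\<close>

lemma C_Ns_pos:
  assumes "0 < s" "s < 1"
  shows "C_Ns N s > 0"
proof -
  \<comment> \<open>At its poles \<open>Gamma\<close> is 0 by convention, which would make
    \<open>C_Ns\<close> vanish; -s lies strictly between -1 and 0.\<close>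
  have "- s \<notin> \<int>\<^sub>\<le>\<^sub>0"
  proof
    assume "- s \<in> \<int>\<^sub>\<le>\<^sub>0"
    then obtain n where "- s = - of_nat n" by (elim nonpos_Ints_cases')
    then have "s = real n" by simp
    then show False using assms by (cases n) auto
  qed
  then have "Gamma (- s) \<noteq> 0" by (simp add: Gamma_eq_zero_iff)
  moreover have "Gamma ((real N + 2 * s) / 2) > 0" using assms by (intro Gamma_real_pos) auto
  ultimately show ?thesis unfolding C_Ns_def by (intro divide_pos_pos mult_pos_pos) auto
qed

context profile
begin

text \<open>The derivative of f(r) r^(-g), divided by r. The gradient of the potential is then c
  Q(|x|) x, a product of Lipschitz factors away from the origin.\<close>

definition Q :: "'a::euclidean_space \<Rightarrow> real \<Rightarrow> real" where
  "Q e r = f1 e r * r powr (- 1 - g) - g * ffun s G e r * r powr (- 2 - g)"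

lemma lip_bd_Q:
  assumes e: "norm e = 1" and ab: "0 < a" "b' < 1"
  shows "lip_bd {a..b'} (Q (e :: 'a::euclidean_space))"
proof -
  have f: "lip_bd {a..b'} (f1 e)"
  proof (rule lip_bdI)
    fix x assume x: "x \<in> {a..b'}"
    show "norm (f1 e x) \<le> Lc TYPE('a)"
    proof -
      have "\<bar>f1 e x - f1 e 0\<bar> \<le> Lc TYPE('a) * \<bar>x - 0\<bar>" using x ab by (intro f1_lipschitz e) auto
      also have "\<dots> \<le> Lc TYPE('a) * 1" using x ab Lc_nonneg by (intro mult_left_mono) auto
      finally show ?thesis by simp
    qed
    show "norm (f1 e x - f1 e y) \<le> Lc TYPE('a) * norm (x - y)" if "y \<in> {a..b'}" for y
      unfolding real_norm_def using x that ab by (intro f1_lipschitz e) auto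
  qed
  have cf1: "continuous_on {a..b'} (f1 e)"
  proof -
    have "(Lc TYPE('a))-lipschitz_on {a..b'} (f1 e)"
      by (rule lipschitz_onI) (use ab Lc_nonneg in \<open>auto simp: dist_real_def intro!: f1_lipschitz e\<close>)
    then show ?thesis by (rule lipschitz_on_continuous_on)
  qed
  have ff: "lip_bd {a..b'} (ffun s G e)"
    by (rule lip_bd_C1[OF _ cf1], rule ffun_deriv[OF e]) (use ab in auto)
  have pw: "lip_bd {a..b'} (\<lambda>r. r powr c)" for c
  proof (rule lip_bd_C1[where f' = "\<lambda>r. c * r powr (c - 1)"])
    show "((\<lambda>r. r powr c) has_real_derivative c * x powr (c - 1)) (at x)" if "x \<in> {a..b'}" for x
      using that ab by (auto intro!: derivative_eq_intros)
    show "continuous_on {a..b'} (\<lambda>r. c * r powr (c - 1))" using ab by (intro continuous_intros) auto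
  qed
  have "lip_bd {a..b'} (\<lambda>r. f1 e r *\<^sub>R r powr (- 1 - g) - (g *\<^sub>R ffun s G e r) *\<^sub>R r powr (- 2 - g))"
    by (intro lip_bd_diff lip_bd_scaleR f ff pw lip_bd_const)
  then show ?thesis by (simp add: Q_def[abs_def])
qed

definition pot :: "real \<Rightarrow> 'a::euclidean_space \<Rightarrow> 'a \<Rightarrow> real" where
  "pot c e x = c * ffun s G e (norm x) * norm x powr (- g)"

definition dpot :: "real \<Rightarrow> 'a::euclidean_space \<Rightarrow> 'a \<Rightarrow> 'a" where
  "dpot c e x = (c * Q e (norm x)) *\<^sub>R x"

lemma pot_has_derivative:
  assumes e: "norm e = 1" and x: "x \<noteq> 0" "norm x < 1"
  shows "(pot c e has_derivative (\<lambda>h. dpot c e x \<bullet> h)) (at (x :: 'a::euclidean_space))"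
proof -
  let ?r = "norm x"
  have r: "?r > 0" using x by simp
  have "((\<lambda>r. c * ffun s G e r * r powr (- g)) has_real_derivative (c * f1 e ?r * ?r powr (- g) + c * ffun s G e ?r * (- g * ?r powr (- g - 1)))) (at ?r)"
    using r x by (auto intro!: derivative_eq_intros ffun_deriv[OF e])
  moreover have "c * f1 e ?r * ?r powr (- g) + c * ffun s G e ?r * (- g * ?r powr (- g - 1)) = c * Q e ?r * ?r"
  proof -
    have "?r powr (- g) = ?r powr (- 1 - g) * ?r" "?r powr (- 1 - g) = ?r powr (- 2 - g) * ?r"
      using r powr_add[of ?r "- 1 - g" 1] powr_add[of ?r "- 2 - g" 1] by simp_all
    moreover have ex: "- g - 1 = - 1 - g" by simp
    ultimately show ?thesis unfolding Q_def ex by (simp add: algebra_simps)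
  qed
  ultimately have "((\<lambda>r. c * ffun s G e r * r powr (- g)) has_derivative (*) (c * Q e ?r * ?r)) (at ?r)"
    by (simp add: has_field_derivative_def)
  from has_derivative_compose[OF has_derivative_norm[OF x(1)] this]
  show ?thesis unfolding pot_def[abs_def] dpot_def using r
    by (elim has_derivative_eq_rhs) (auto simp: sgn_div_norm inner_commute)
qed

text \<open>On a compact subset of the punctured ball |x| stays between two radii inside (0, 1),
  where Q is Lipschitz. A Lipschitz bound yields one with exponent 1/2 because distances in the unit
  ball are at most 2.\<close>

lemma dpot_holder:
  assumes e: "norm e = 1" and K: "compact K" "K \<subseteq> ball 0 1 - {0 :: 'a::euclidean_space}"
  shows "\<exists>C. \<forall>x\<in>K. \<forall>y\<in>K. norm (dpot c e x - dpot c e y) \<le> C * norm (x - y) powr (1 / 2)"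
proof (cases "K = {}")
  case False
  have cn: "continuous_on K (\<lambda>x. norm x)" by (intro continuous_intros)
  obtain p where p: "p \<in> K" "\<And>x. x \<in> K \<Longrightarrow> norm p \<le> norm x"
    using continuous_attains_inf[OF K(1) False cn] by blast
  obtain q where q: "q \<in> K" "\<And>x. x \<in> K \<Longrightarrow> norm x \<le> norm q"
    using continuous_attains_sup[OF K(1) False cn] by blast
  have pq: "0 < norm p" "norm q < 1" using p q K by auto
  have "lip_bd K (\<lambda>x. Q e (norm x))"
    using p q by (intro lip_bd_compose_norm[OF lip_bd_Q[OF e pq]]) auto
  moreover have "lip_bd K (\<lambda>x. x)" by (rule lip_bdI[where A = 1 and B = 1]) (use K in auto)
  ultimately have "lip_bd K (\<lambda>x. (c *\<^sub>R Q e (norm x)) *\<^sub>R x)"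
    by (intro lip_bd_scaleR lip_bd_const)
  then have "lip_bd K (dpot c e)" by (simp add: dpot_def[abs_def])
  then obtain M where M: "M \<ge> 0" "\<And>x y. x \<in> K \<Longrightarrow> y \<in> K \<Longrightarrow> norm (dpot c e x - dpot c e y) \<le> M * norm (x - y)"
    unfolding lip_bd_def by blast
  have "norm (dpot c e x - dpot c e y) \<le> (M * 2) * norm (x - y) powr (1 / 2)" if x: "x \<in> K" and y: "y \<in> K" for x y
  proof -
    let ?d = "norm (x - y)"
    have "norm x < 1" "norm y < 1" using x y K by auto
    then have "?d \<le> 2" using norm_triangle_ineq4[of x y] by linarith
    then have "sqrt ?d \<le> sqrt 4" by (intro real_sqrt_le_mono) simp
    then have s2: "sqrt ?d \<le> 2" by simp
    have "?d = sqrt ?d * sqrt ?d" by simp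
    also have "\<dots> \<le> 2 * sqrt ?d" using s2 by (intro mult_right_mono) auto
    finally have "M * ?d \<le> M * (2 * ?d powr (1 / 2))" using M(1) by (intro mult_left_mono) (auto simp: powr_half_sqrt)
    then show ?thesis using M(2)[OF x y] by simp
  qed
  then show ?thesis by blast
qed simp

text \<open>The r^4 bound and g < 4 make V bounded. For the radial derivative only f' = O(r) is
  available, so x . grad V is estimated by r^(2-g), which is still better than r^(-2s) since g < 2s
  + 2.\<close>

lemma pot_bounds:
  fixes x :: "'a::euclidean_space"
  assumes e: "norm e = 1" and c: "c \<ge> 0" and K: "\<And>r. 0 \<le> r \<Longrightarrow> r \<le> 1 \<Longrightarrow> \<bar>ffun s G e r\<bar> \<le> K * r^4" and x: "norm x < 1"
  shows "\<bar>pot c e x\<bar> \<le> c * K" "\<bar>pot c e x\<bar> + \<bar>x \<bullet> dpot c e x\<bar> \<le> c * (K + Lc TYPE('a) + g * K) * norm x powr (2 - g)"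
proof -
  let ?r = "norm x" and ?L = "Lc TYPE('a)"
  have K0: "K \<ge> 0" using K[of 1] by simp
  have g0: "g > 0" "g < 4" using s g by auto
  have f: "\<bar>ffun s G e ?r\<bar> \<le> K * ?r^4" using x by (intro K) auto
  have f': "\<bar>f1 e ?r\<bar> \<le> ?L * ?r"
    using f1_lipschitz[OF e, of ?r 0] x by simp
  have pw: "?r ^ 4 * ?r powr (- g) = ?r powr (4 - g)"
  proof (cases "x = 0")
    case False
    then show ?thesis by (simp add: powr_add[of ?r 4 "- g", symmetric, unfolded powr_numeral] flip: powr_numeral powr_add)
  qed simp
  have pw2: "?r powr (2 - g) = ?r * ?r * ?r powr (- g)" "?r powr (- g) = ?r * ?r powr (- 1 - g)" "?r powr (- 1 - g) = ?r * ?r powr (- 2 - g)" if "x \<noteq> 0"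
    using that powr_add[of ?r 2 "- g"] powr_add[of ?r 1 "- 1 - g"] powr_add[of ?r 1 "- 2 - g"]
    by (simp_all add: power2_eq_square)
  have A: "\<bar>pot c e x\<bar> \<le> c * K * ?r powr (4 - g)"
  proof -
    have "\<bar>pot c e x\<bar> = c * \<bar>ffun s G e ?r\<bar> * ?r powr (- g)" using c by (simp add: pot_def abs_mult)
    also have "\<dots> \<le> c * (K * ?r^4) * ?r powr (- g)" using f c by (intro mult_right_mono mult_left_mono) auto
    also have "\<dots> = c * K * (?r^4 * ?r powr (- g))" by simp
    finally show ?thesis by (simp only: pw)
  qed
  have "?r powr (4 - g) \<le> 1" using x g0 by (intro powr_le1) auto
  then have "c * K * ?r powr (4 - g) \<le> c * K * 1" using c K0 by (intro mult_left_mono) auto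
  then show "\<bar>pot c e x\<bar> \<le> c * K" using A by simp
  show "\<bar>pot c e x\<bar> + \<bar>x \<bullet> dpot c e x\<bar> \<le> c * (K + ?L + g * K) * ?r powr (2 - g)"
  proof (cases "x = 0")
    case True
    then show ?thesis using A by (simp add: pot_def dpot_def)
  next
    case False
    then have r: "?r > 0" by simp
    have 4: "?r powr (4 - g) \<le> ?r powr (2 - g)" using x r by (intro powr_mono') auto
    have Q: "\<bar>Q e ?r\<bar> * (?r * ?r) \<le> (?L + g * K) * ?r powr (2 - g)"
    proof -
      have "\<bar>Q e ?r\<bar> \<le> \<bar>f1 e ?r\<bar> * ?r powr (- 1 - g) + g * \<bar>ffun s G e ?r\<bar> * ?r powr (- 2 - g)"
        unfolding Q_def using abs_triangle_ineq4[of "f1 e ?r * ?r powr (- 1 - g)" "g * ffun s G e ?r * ?r powr (- 2 - g)"] g0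
        by (simp add: abs_mult)
      also have "\<dots> \<le> (?L * ?r) * ?r powr (- 1 - g) + g * (K * ?r^4) * ?r powr (- 2 - g)"
        using f f' g0 by (intro add_mono mult_right_mono mult_left_mono) auto
      finally have "\<bar>Q e ?r\<bar> * (?r * ?r) \<le> ((?L * ?r) * ?r powr (- 1 - g) + g * (K * ?r^4) * ?r powr (- 2 - g)) * (?r * ?r)"
        by (intro mult_right_mono) auto
      also have "\<dots> = ?L * ?r powr (2 - g) + g * K * (?r^4 * ?r powr (- g))"
        using False by (simp add: pw2 algebra_simps)
      also have "\<dots> \<le> ?L * ?r powr (2 - g) + g * K * ?r powr (2 - g)"
        unfolding pw using 4 g0 K0 by (intro add_left_mono mult_left_mono) auto
      finally show ?thesis by (simp add: algebra_simps)
    qed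
    have "\<bar>x \<bullet> dpot c e x\<bar> = c * (\<bar>Q e ?r\<bar> * (?r * ?r))"
      using c by (simp add: dpot_def abs_mult dot_square_norm power2_eq_square)
    also have "\<dots> \<le> c * ((?L + g * K) * ?r powr (2 - g))" using Q c by (intro mult_left_mono) auto
    finally have B: "\<bar>x \<bullet> dpot c e x\<bar> \<le> c * ((?L + g * K) * ?r powr (2 - g))" .
    have "c * K * ?r powr (4 - g) \<le> c * K * ?r powr (2 - g)" using 4 c K0 by (intro mult_left_mono) auto
    then show ?thesis using A B by (simp add: algebra_simps)
  qed
qed

lemma borel_measurable_pot: "pot c (e::'a::euclidean_space) \<in> borel_measurable borel"
proof -
  have [measurable]: "ffun s G e \<in> borel_measurable borel" by (rule borel_measurable_ffun) measurable
  show ?thesis unfolding pot_def[abs_def] by measurable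
qed

lemma set_integrable_pot_powr:
  fixes e :: "'a::euclidean_space"
  assumes e: "norm e = 1" and c: "c \<ge> 0" and K: "\<And>r. 0 \<le> r \<Longrightarrow> r \<le> 1 \<Longrightarrow> \<bar>ffun s G e r\<bar> \<le> K * r^4" and q: "q \<ge> 0"
  shows "set_integrable lborel (ball 0 1) (\<lambda>x. \<bar>pot c e x\<bar> powr q)"
  unfolding set_integrable_def
proof (rule Bochner_Integration.integrable_bound)
  note borel_measurable_pot[measurable]
  have [measurable]: "ball (0::'a) 1 \<in> sets borel" by simp
  show "(\<lambda>x. indicator (ball 0 1) x *\<^sub>R \<bar>pot c e x\<bar> powr q) \<in> borel_measurable lborel" by measurable
  show "integrable lborel (\<lambda>x::'a. indicator (ball 0 1) x * (c * K) powr q)"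
    using emeasure_bounded_finite[of "ball (0::'a) 1"] by (intro integrable_mult_left) auto
  show "AE x::'a in lborel. norm (indicator (ball 0 1) x *\<^sub>R \<bar>pot c e x\<bar> powr q) \<le> norm (indicator (ball 0 1) x * (c * K) powr q)"
  proof (rule AE_I2)
    fix x :: 'a
    show "norm (indicator (ball 0 1) x *\<^sub>R \<bar>pot c e x\<bar> powr q) \<le> norm (indicator (ball 0 1) x * (c * K) powr q)"
    proof (cases "x \<in> ball 0 1")
      case True
      then have "norm x < 1" by simp
      from pot_bounds(1)[OF e c K this] have "\<bar>pot c e x\<bar> powr q \<le> (c * K) powr q" using q by (intro powr_mono2) auto
      then show ?thesis using True by simp
    qed simp
  qed
qed

text \<open>On the unit ball u = |x|^g, so C a(g) |x|^(g-2s) is \<open>lam\<close> u / |x|^(2s),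
  while the remaining C f(|x|) is V u by the choice of \<open>pot\<close>.\<close>

lemma uf_weak_solution:
  fixes e :: "real^'n"
  assumes m0: "(\<integral>y. uf (y::real^'n) * norm y powr (- (real CARD('n) + 2 * s)) \<partial>lborel) = 0"
    and e: "norm e = 1" and K: "\<And>r. 0 \<le> r \<Longrightarrow> r \<le> 1 \<Longrightarrow> \<bar>ffun s G e r\<bar> \<le> K * r^4"
    and lam: "C_Ns CARD('n) s * acoef s g e = lam"
  shows "radial_weak_solution s lam (pot (C_Ns CARD('n) s) e) (uf :: real^'n \<Rightarrow> real)"
  unfolding radial_weak_solution_def
proof (intro conjI allI impI)
  let ?C = "C_Ns CARD('n) s"
  have "(uf :: real^'n \<Rightarrow> real) = (\<lambda>x. U ((norm x)\<^sup>2))" by (rule ext) (simp add: uf_def)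
  then show "(uf :: real^'n \<Rightarrow> real) \<in> Ds2_rad s"
    using U_in_Ds2[where 'n='n] by (simp add: Ds2_rad_def radial_def)
  fix \<phi> :: "real^'n \<Rightarrow> real" assume "test_fun (ball 0 1) \<phi>"
  then obtain M where M: "M \<ge> 0" "\<And>x. \<bar>\<phi> x\<bar> \<le> M" "\<And>x y. \<bar>\<phi> x - \<phi> y\<bar> \<le> M * norm (x - y)"
    "\<And>x. norm x \<ge> 1 \<Longrightarrow> \<phi> x = 0" and ct: "continuous_on UNIV \<phi>" by (rule test_fun_lipschitz) blast
  have [measurable]: "\<phi> \<in> borel_measurable borel" by (rule borel_measurable_continuous_onI[OF ct])
  have [measurable]: "ffun s G e \<in> borel_measurable borel" by (rule borel_measurable_ffun) measurable
  have bi: "integrable lborel (\<lambda>x. \<phi> x * h x)"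
    if "\<And>x. norm x < 1 \<Longrightarrow> \<bar>h x\<bar> \<le> B" and [measurable]: "h \<in> borel_measurable borel" for h :: "real^'n \<Rightarrow> real" and B
  proof (rule Bochner_Integration.integrable_bound)
    show "integrable lborel (\<lambda>x::real^'n. indicator (ball 0 1) x * (M * B))"
      using emeasure_bounded_finite[of "ball (0::real^'n) 1"] by (intro integrable_mult_left) auto
    show "AE x in lborel. norm (\<phi> x * h x) \<le> norm (indicator (ball 0 1) x * (M * B))"
    proof (rule AE_I2)
      fix x
      show "norm (\<phi> x * h x) \<le> norm (indicator (ball 0 1) x * (M * B))"
      proof (cases "norm x < 1")
        case True
        have "\<bar>\<phi> x\<bar> * \<bar>h x\<bar> \<le> M * B" using M that(1)[OF True] by (intro mult_mono) auto
        also have "\<dots> \<le> \<bar>M * B\<bar>" by simp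
        finally show ?thesis using True by (simp add: abs_mult)
      qed (use M in simp)
    qed
  qed measurable
  have i1: "integrable lborel (\<lambda>x. \<phi> x * norm x powr (g - 2 * s))"
    by (rule bi[of _ 1]) (use g in \<open>auto intro!: powr_le1\<close>)
  have i2: "integrable lborel (\<lambda>x. \<phi> x * ffun s G e (norm x))"
  proof (rule bi[of _ "\<bar>K\<bar>"])
    fix x :: "real^'n" assume x: "norm x < 1"
    have "\<bar>ffun s G e (norm x)\<bar> \<le> K * norm x ^ 4" using x by (intro K) auto
    also have "\<dots> \<le> \<bar>K\<bar> * 1" using x by (intro mult_mono) (auto simp: power_le_one)
    finally show "\<bar>ffun s G e (norm x)\<bar> \<le> \<bar>K\<bar>" by simp
  qed measurable
  have D: "Ds2_inner s uf \<phi> = ?C * (\<integral>x. \<phi> x * (norm x powr (g - 2 * s) * acoef s g e + ffun s G e (norm x)) \<partial>lborel)"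
    by (rule weak_identity[OF m0 e _ M(1,2,3,4)]) measurable
  have "(\<integral>x. \<phi> x * (norm x powr (g - 2 * s) * acoef s g e + ffun s G e (norm x)) \<partial>lborel)
    = (\<integral>x. acoef s g e * (\<phi> x * norm x powr (g - 2 * s)) + \<phi> x * ffun s G e (norm x) \<partial>lborel)"
    by (rule Bochner_Integration.integral_cong[OF refl]) (simp add: algebra_simps)
  also have "\<dots> = acoef s g e * (\<integral>x. \<phi> x * norm x powr (g - 2 * s) \<partial>lborel) + (\<integral>x. \<phi> x * ffun s G e (norm x) \<partial>lborel)"
    using i1 i2 by simp
  finally have "Ds2_inner s uf \<phi> = lam * (\<integral>x. \<phi> x * norm x powr (g - 2 * s) \<partial>lborel) + ?C * (\<integral>x. \<phi> x * ffun s G e (norm x) \<partial>lborel)"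
    unfolding D lam[symmetric] by (simp only: distrib_left mult.assoc)
  moreover have "(\<integral>x. uf x * \<phi> x / norm x powr (2 * s) \<partial>lborel) = (\<integral>x. \<phi> x * norm x powr (g - 2 * s) \<partial>lborel)"
  proof (rule Bochner_Integration.integral_cong[OF refl])
    fix x :: "real^'n"
    show "uf x * \<phi> x / norm x powr (2 * s) = \<phi> x * norm x powr (g - 2 * s)"
      using M(4)[of x] uf_low[of x] by (cases "norm x < 1") (auto simp: powr_diff)
  qed
  moreover have "(\<integral>x. pot ?C e x * uf x * \<phi> x \<partial>lborel) = ?C * (\<integral>x. \<phi> x * ffun s G e (norm x) \<partial>lborel)"
  proof -
    have "pot ?C e x * uf x * \<phi> x = ?C * (\<phi> x * ffun s G e (norm x))" for x
    proof (cases "norm x < 1 \<and> x \<noteq> 0")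
      case True
      then have "norm x powr (- g) * norm x powr g = 1" by (simp add: powr_add[symmetric])
      then show ?thesis using True uf_low[of x] by (simp add: pot_def)
    qed (use M(4)[of x] in \<open>auto simp: pot_def\<close>)
    then have "(\<lambda>x. pot ?C e x * uf x * \<phi> x) = (\<lambda>x. ?C * (\<phi> x * ffun s G e (norm x)))" by (intro ext)
    then show ?thesis by (simp only: integral_mult_right_zero)
  qed
  ultimately show "Ds2_inner s uf \<phi> - lam * (\<integral>x. uf x * \<phi> x / norm x powr (2 * s) \<partial>lborel) = (\<integral>x. pot ?C e x * uf x * \<phi> x \<partial>lborel)"
    by simp
qed

text \<open>By continuity, vanishing almost everywhere on \<Omega> would be vanishing everywhere.
  But \<Omega> contains a radial segment, and the profile has a nonzero value in its range of
  |x|^2.\<close>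

lemma uf_not_AE_zero:
  fixes \<Omega> :: "'a::euclidean_space set"
  assumes nv: "\<And>c d. 0 \<le> c \<Longrightarrow> c < d \<Longrightarrow> d \<le> R\<^sup>2 \<Longrightarrow> \<exists>\<sigma>. c < \<sigma> \<and> \<sigma> < d \<and> U \<sigma> \<noteq> 0"
    and \<Omega>: "open \<Omega>" "\<Omega> \<noteq> {}" "\<Omega> \<subseteq> ball 0 R" and e: "norm (e::'a) = 1"
  shows "\<not> (AE x in lborel. x \<in> \<Omega> \<longrightarrow> uf x = 0)"
proof
  assume ae: "AE x in lborel. x \<in> \<Omega> \<longrightarrow> uf x = 0"
  define W where "W = \<Omega> \<inter> {x. uf x \<noteq> 0}"
  have "open W" unfolding W_def using \<Omega>(1) continuous_on_uf by (intro open_Int open_Collect_neq continuous_on_const) auto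
  moreover have "AE x in lborel. x \<notin> W" using ae by eventually_elim (auto simp: W_def)
  ultimately have W: "W = {}" by (rule open_AE_empty)
  \<comment> \<open>\<Omega> may contain the origin, which spans no ray; a nonzero point of \<Omega>
    is used instead.\<close>
  obtain x0 where x0: "x0 \<in> \<Omega>" "x0 \<noteq> 0"
  proof -
    obtain y where y: "y \<in> \<Omega>" using \<Omega>(2) by blast
    then obtain \<epsilon> where \<epsilon>: "\<epsilon> > 0" "ball y \<epsilon> \<subseteq> \<Omega>" using \<Omega>(1) open_contains_ball by blast
    have "(\<epsilon> / 2) *\<^sub>R e \<in> ball 0 \<epsilon>" "(\<epsilon> / 2) *\<^sub>R e \<noteq> 0" using e \<epsilon>(1) by auto
    then show ?thesis using that y \<epsilon>(2) by (cases "y = 0") blast+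
  qed
  obtain \<epsilon> where \<epsilon>: "\<epsilon> > 0" "ball x0 \<epsilon> \<subseteq> \<Omega>" using x0 \<Omega>(1) open_contains_ball by blast
  let ?r = "norm x0"
  have r: "0 < ?r" "?r < R" using x0 \<Omega>(3) by auto
  define c where "c = max 0 (?r - \<epsilon>)"
  have c: "0 \<le> c" "c < ?r" using r \<epsilon> by (auto simp: c_def)
  obtain \<sigma> where \<sigma>: "c\<^sup>2 < \<sigma>" "\<sigma> < ?r\<^sup>2" "U \<sigma> \<noteq> 0"
    using nv[of "c\<^sup>2" "?r\<^sup>2"] c r power_strict_mono[of c ?r 2] power_mono[of ?r R 2] by auto
  have \<sigma>0: "\<sigma> \<ge> 0" using \<sigma>(1) zero_le_power2[of c] by linarith
  have lo: "c < sqrt \<sigma>" using \<sigma> c real_sqrt_less_mono[of "c\<^sup>2" \<sigma>] by simp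
  have hi: "sqrt \<sigma> < ?r" using \<sigma> r real_sqrt_less_mono[of \<sigma> "?r\<^sup>2"] by simp
  define x where "x = (sqrt \<sigma> / ?r) *\<^sub>R x0"
  have nx: "norm x = sqrt \<sigma>" using r \<sigma>0 by (simp add: x_def)
  have "x0 - x = (1 - sqrt \<sigma> / ?r) *\<^sub>R x0" by (simp add: x_def algebra_simps)
  then have "norm (x0 - x) = \<bar>1 - sqrt \<sigma> / ?r\<bar> * ?r" by simp
  also have "\<dots> = \<bar>(1 - sqrt \<sigma> / ?r) * ?r\<bar>" using r by (simp add: abs_mult)
  also have "(1 - sqrt \<sigma> / ?r) * ?r = ?r - sqrt \<sigma>" using r by (simp add: left_diff_distrib)
  also have "\<bar>?r - sqrt \<sigma>\<bar> < \<epsilon>" using lo hi by (auto simp: c_def)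
  finally have "x \<in> \<Omega>" using \<epsilon>(2) by (auto simp: dist_norm)
  moreover have "uf x \<noteq> 0" using \<sigma>(3) \<sigma>0 by (simp add: uf_def nx)
  ultimately show False using W by (auto simp: W_def)
qed

end

theorem theorem1p1:
  fixes s lam q :: real
  assumes "0 < s" and "s < min (real CARD('n::finite) / 2) 1"
    and "lam < Lambda_Ns CARD('n) s"
    and "1 < q"
  shows "\<exists>(V :: real^'n \<Rightarrow> real) (G :: real^'n \<Rightarrow> real^'n) \<alpha>.
     0 < \<alpha> \<and> \<alpha> < 1 \<and>
     C1alpha_loc_grad \<alpha> (ball 0 1 - {0}) V G \<and>
     radial V \<and>
     (\<lambda>x. indicator (ball 0 1) x * V x) \<in> borel_measurable lborel \<and>
     set_integrable lborel (ball 0 1) (\<lambda>x. \<bar>V x\<bar> powr q) \<and>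
     (\<exists>C \<epsilon>. C > 0 \<and> \<epsilon> > 0 \<and>
        (\<forall>\<^sub>F x in at 0. \<bar>V x\<bar> + \<bar>x \<bullet> G x\<bar> \<le> C * norm x powr (- 2 * s + \<epsilon>))) \<and>
     (\<forall>x \<in> ball 0 1 - {0}. V x > 0) \<and>
     (\<exists>u :: real^'n \<Rightarrow> real.
        radial_weak_solution s lam V u \<and>
        \<not> (AE x in lborel. u x = 0) \<and>
        ((\<lambda>x. norm x powr (- gamma_lam TYPE('n) s lam) * u x) \<longlongrightarrow> 0) (at 0) \<and>
        (\<exists>R \<ge> 1. (AE x in lborel. R \<le> norm x \<longrightarrow> u x = 0) \<and>
           (\<forall>\<Omega>. open \<Omega> \<and> \<Omega> \<noteq> {} \<and> \<Omega> \<subseteq> ball 0 R \<longrightarrow>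
               \<not> (AE x in lborel. x \<in> \<Omega> \<longrightarrow> u x = 0))))"
proof -
  let ?C = "C_Ns CARD('n) s"
  have ss: "0 < s" "s < 1" "s < real CARD('n) / 2" using assms by auto
  have C: "?C > 0" by (rule C_Ns_pos[OF ss(1,2)])
  obtain e :: "real^'n" where e: "norm e = 1" using vector_choose_size[of 1] by auto
  obtain g where gg: "2 * s < g" "g < 2 * s + 2" "?C * acoef s g e = lam" "lam \<le> 0 \<Longrightarrow> 2 \<le> g"
    by (rule exists_exponent[OF ss(1,2) e C, of lam]) blast
  obtain U L K where L: "L \<ge> 1" and P: "profile s g (16 * L\<^sup>2) U"
    and m0: "(\<integral>y. U ((norm (y::real^'n))\<^sup>2) * norm y powr (- (real CARD('n) + 2 * s)) \<partial>lborel) = 0"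
    and pos: "\<And>r. 0 < r \<Longrightarrow> r < 1 \<Longrightarrow> 0 < ffun s (profile.G g U) e r"
    and K: "\<And>r. 0 \<le> r \<Longrightarrow> r \<le> 1 \<Longrightarrow> \<bar>ffun s (profile.G g U) e r\<bar> \<le> K * r^4"
    and nv: "\<And>c d. 0 \<le> c \<Longrightarrow> c < d \<Longrightarrow> d \<le> 16 * L\<^sup>2 \<Longrightarrow> \<exists>\<sigma>. c < \<sigma> \<and> \<sigma> < d \<and> U \<sigma> \<noteq> 0"
    by (rule exists_positive_profile[OF ss(1,2) gg(1,2) e]) blast
  interpret profile s g "16 * L\<^sup>2" U by (rule P)
  let ?V = "pot ?C e" and ?G = "dpot ?C e"
  \<comment> \<open>The profile vanishes from \<sigma> = 16 L^2 on, that is, from |x| = 4 L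
    on.\<close>
  let ?R = "4 * L"
  have nv': "\<exists>\<sigma>. c < \<sigma> \<and> \<sigma> < d \<and> U \<sigma> \<noteq> 0" if "0 \<le> c" "c < d" "d \<le> ?R\<^sup>2" for c d
    using nv[of c d] that by (simp add: power_mult_distrib)
  have V1: "C1alpha_loc_grad (1/2) (ball 0 1 - {0}) ?V ?G"
    unfolding C1alpha_loc_grad_def using pot_has_derivative[OF e] dpot_holder[OF e] by auto
  have V2: "radial ?V" by (simp add: radial_def pot_def)
  have V3: "(\<lambda>x. indicator (ball 0 1) x * ?V x) \<in> borel_measurable lborel"
  proof -
    note borel_measurable_pot[measurable]
    have [measurable]: "ball (0::real^'n) 1 \<in> sets borel" by simp
    show ?thesis by measurable
  qed
  have V4: "set_integrable lborel (ball 0 1) (\<lambda>x. \<bar>?V x\<bar> powr q)"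
    using assms(4) C by (intro set_integrable_pot_powr[OF e _ K]) auto
  have V5: "\<exists>C \<epsilon>. C > 0 \<and> \<epsilon> > 0 \<and> (\<forall>\<^sub>F x in at 0. \<bar>?V x\<bar> + \<bar>x \<bullet> ?G x\<bar> \<le> C * norm x powr (- 2 * s + \<epsilon>))"
  proof (intro exI conjI)
    let ?c = "?C * (K + Lc TYPE(real^'n) + g * K) + 1"
    have "K \<ge> 0" using K[of 1] by simp
    then show "?c > 0" using C Lc_nonneg[where 'a="real^'n"] s g by (intro add_nonneg_pos mult_nonneg_nonneg add_nonneg_nonneg) auto
    \<comment> \<open>This \<epsilon> turns -2s + \<epsilon> into the exponent 2 - g of
      \<open>pot_bounds\<close>.\<close>
    show "2 + 2 * s - g > 0" using g by simp
    have "\<forall>\<^sub>F x::real^'n in at 0. x \<in> ball 0 1 - {0}" by (rule eventually_at_in_open) auto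
    then show "\<forall>\<^sub>F x in at 0. \<bar>?V x\<bar> + \<bar>x \<bullet> ?G x\<bar> \<le> ?c * norm x powr (- 2 * s + (2 + 2 * s - g))"
    proof eventually_elim
      case (elim x)
      then have "norm x < 1" by simp
      from pot_bounds(2)[OF e less_imp_le[OF C] K this]
      have "\<bar>?V x\<bar> + \<bar>x \<bullet> ?G x\<bar> \<le> ?C * (K + Lc TYPE(real^'n) + g * K) * norm x powr (2 - g)" .
      also have "\<dots> \<le> ?c * norm x powr (2 - g)" by (intro mult_right_mono) auto
      finally show ?case by simp
    qed
  qed
  have V6: "\<forall>x \<in> ball 0 1 - {0}. ?V x > 0" using C pos by (auto simp: pot_def)
  have u1: "radial_weak_solution s lam ?V (uf :: real^'n \<Rightarrow> real)"
    using m0 by (intro uf_weak_solution[OF _ e K gg(3)]) (simp_all add: uf_def)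
  have u2: "\<not> (AE x in lborel. x \<in> \<Omega> \<longrightarrow> uf x = 0)" if "open \<Omega>" "\<Omega> \<noteq> {}" "\<Omega> \<subseteq> ball 0 ?R" for \<Omega> :: "(real^'n) set"
    by (rule uf_not_AE_zero[OF nv' that e])
  have u3: "\<not> (AE x::real^'n in lborel. uf x = 0)"
  proof
    assume "AE x::real^'n in lborel. uf x = 0"
    then have "AE x::real^'n in lborel. x \<in> ball 0 ?R \<longrightarrow> uf x = 0" by eventually_elim simp
    then show False using u2[of "ball 0 ?R"] L by auto
  qed
  have u4: "((\<lambda>x::real^'n. norm x powr (- gamma_lam TYPE('n) s lam) * uf x) \<longlongrightarrow> 0) (at 0)"
  proof -
    let ?d = "g - gamma_lam TYPE('n) s lam"
    have d: "?d > 0" using gamma_lam_less[OF ss(1,3,2) gg(1,4)] by simp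
    have "((\<lambda>x::real^'n. norm x powr ?d) \<longlongrightarrow> 0 powr ?d) (at 0)"
      using d by (intro tendsto_powr' tendsto_norm_zero tendsto_ident_at tendsto_const) auto
    moreover have "\<forall>\<^sub>F x::real^'n in at 0. norm x powr ?d = norm x powr (- gamma_lam TYPE('n) s lam) * uf x"
    proof -
      have "\<forall>\<^sub>F x::real^'n in at 0. x \<in> ball 0 1 - {0}" by (rule eventually_at_in_open) auto
      then show ?thesis
        by eventually_elim (simp add: uf_low powr_add[symmetric])
    qed
    ultimately show ?thesis by (simp add: tendsto_cong)
  qed
  have u5: "AE x::real^'n in lborel. ?R \<le> norm x \<longrightarrow> uf x = 0"
  proof (rule AE_I2, rule impI)
    fix x :: "real^'n" assume "?R \<le> norm x"
    then have "?R\<^sup>2 \<le> (norm x)\<^sup>2" using L by (intro power_mono) auto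
    then show "uf x = 0" unfolding uf_def by (intro U_high) (simp add: power_mult_distrib)
  qed
  have R1: "?R \<ge> 1" using L by simp
  show ?thesis
    by (intro exI[of _ ?V] exI[of _ ?G] exI[of _ "1/2 :: real"] conjI V1 V2 V3 V4 V5 V6
        exI[of _ "uf :: real^'n \<Rightarrow> real"] u1 u3 u4 exI[of _ ?R] R1 u5 allI impI)
      (use u2 in auto)
qed

end
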